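(* The monoid decomposition problem over any set of the form $S:=P\cap\mathbb{Z}^d$, where $P\subset\mathbb{R}^d$ is any decomposable pointed (rational) polyhedron presented by a separation oracle and endowed with a decomposition oracle, is polynomial-time solvable. That is, there is an algorithm which, given such a $P$ and given $a\in\mathbb{Z}^d$, decides in polynomial time whether $a\in\mathrm{mon}(S)$ and, if yes, finds a decomposition $a=\sum_k\lambda_k x^k$ with all $\lambda_k\in\mathbb{Z}_+$ and all $x^k\in S$.
   Context: $\mathbb{Z}_+$ denotes the nonnegative integers and $\mathbb{N}$ the positive integers. All polyhedra and vectors are rational. Monoid. For $S\subseteq\mathbb{Z}^d$, $\mathrm{mon}(S)=\{\sum_{k=1}^m\lambda_k x^k : m,\lambda_1,\dots,\lambda_m\in\mathbb{Z}_+,\ x^1,\dots,x^m\in S\}$; in particular $0\in\mathrm{mon}(S)$ via the empty decomposition. The monoid decomposition problem over $S$ is: given $a\in\mathbb{Z}^d$, decide if $a\in\mathrm{mon}(S)$ and, if yes, find a decomposition $a=\sum_k\lambda_k x^k$ with $\lambda_k\in\mathbb{Z}_+$, $x^k\in S$ (output as a list of pairs $(\lambda_k,x^k)$ with binary-encoded entries). Polyhedra. A polyhedron is pointed if it has at least one vertex. For $n\in\mathbb{N}$ let $nP=\{ny:y\in P\}$. A polyhedron $P\subset\mathbb{R}^d$ is decomposable if for every $n\in\mathbb{N}$ and every $x\in nP\cap\mathbb{Z}^d$ there are $x^1,\dots,x^n\in P\cap\mathbb{Z}^d$ with $x=x^1+\cdots+x^n$. Oracles. A separation oracle for $P\subset\mathbb{R}^d$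 is one that, queried on $x\in\mathbb{R}^d$, either asserts that $x\in P$ or returns $h\in\mathbb{R}^d$ such that $hy<hx$ for all $y\in P$. A decomposition oracle for a decomposable $P$ is one that, queried on $n\in\mathbb{N}$ given in unary and on $x\in nP\cap\mathbb{Z}^d$, returns $x^1,\dots,x^n\in P\cap\mathbb{Z}^d$ with $x=x^1+\cdots+x^n$. Complexity. The description complexity of a polyhedron $P$ is the smallest positive integer $\Delta$ such that $P=\{x\in\mathbb{R}^d: Ax\le b\}$ for some integer $A,b$ with $|A_{i,j}|,|b_i|\le\Delta$ for all $i,j$ (the description itself need not be known and its number of inequalities may be exponential). An algorithm on $P$ runs in polynomial time if its running time, including queries to the oracles involved, is polynomial in $d$, in the binary-encoding length $\log\Delta$ of the description complexity of $P$, and in the binary-encoding length of the other inputs (here, $a$). As in the Grötschel–Lovász–Schrijver framework, $d$ and $\Delta$ (or an upper bound on $\Delta$, then used in place of $\Delta$ in the running time) are known to the algorithm, and oracle answers have encoding length polynomially bounded in the query and in $d,\log\Delta$. *)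

theory Defs
  imports
    "Jordan_Normal_Form.Matrix"
    "HOL-Library.Log_Nat"
    "HOL-Computational_Algebra.Polynomial"
begin

section \<open>Monoids, polyhedra, decomposability\<close>

abbreviation real_vec :: "int vec \<Rightarrow> real vec" where
  "real_vec \<equiv> map_vec real_of_int"

text \<open>The dimension is an explicit parameter because the empty sum must be the zero vector of the
  right dimension.\<close>

definition vsum :: "nat \<Rightarrow> int vec list \<Rightarrow> int vec" where
  "vsum d xs = foldr (+) xs (0\<^sub>v d)"

definition combination :: "nat \<Rightarrow> (nat \<times> int vec) list \<Rightarrow> int vec" where
  "combination d ps = vsum d (map (\<lambda>(l, x). int l \<cdot>\<^sub>v x) ps)"

definition mon :: "nat \<Rightarrow> int vec set \<Rightarrow> int vec set" where
  "mon d S = {combination d ps | ps. snd ` set ps \<subseteq> S}"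

definition lattice_points :: "nat \<Rightarrow> real vec set \<Rightarrow> int vec set" where
  "lattice_points d P = {x \<in> carrier_vec d. real_vec x \<in> P}"

definition dilate :: "nat \<Rightarrow> real vec set \<Rightarrow> real vec set" where
  "dilate n P = {real n \<cdot>\<^sub>v y | y. y \<in> P}"

definition decomposable :: "nat \<Rightarrow> real vec set \<Rightarrow> bool" where
  "decomposable d P \<longleftrightarrow>
    (\<forall>n\<ge>1. \<forall>x \<in> lattice_points d (dilate n P).
      \<exists>xs. length xs = n \<and> set xs \<subseteq> lattice_points d P \<and> x = vsum d xs)"

definition describable :: "nat \<Rightarrow> nat \<Rightarrow> real vec set \<Rightarrow> bool" where
  "describable d \<Delta> P \<longleftrightarrow>
    (\<exists>m. \<exists>A \<in> carrier_mat m d. \<exists>b \<in> carrier_vec m.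
      (\<forall>i<m. \<forall>j<d. \<bar>A $$ (i, j)\<bar> \<le> int \<Delta>) \<and> (\<forall>i<m. \<bar>b $ i\<bar> \<le> int \<Delta>) \<and>
      P = {x \<in> carrier_vec d. map_mat real_of_int A *\<^sub>v x \<le> real_vec b})"

text \<open>A rational system of inequalities can be scaled to an integer one.\<close>

definition rational_polyhedron :: "nat \<Rightarrow> real vec set \<Rightarrow> bool" where
  "rational_polyhedron d P \<longleftrightarrow> (\<exists>\<Delta>. describable d \<Delta> P)"

definition description_complexity :: "nat \<Rightarrow> real vec set \<Rightarrow> nat" where
  "description_complexity d P = (LEAST \<Delta>. 0 < \<Delta> \<and> describable d \<Delta> P)"

text \<open>A vertex is a face consisting of a single point, i.e. the unique maximizer over \<open>P\<close> of some
  linear functional.\<close>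

definition vertex :: "nat \<Rightarrow> real vec set \<Rightarrow> real vec \<Rightarrow> bool" where
  "vertex d P x \<longleftrightarrow> x \<in> P \<and> (\<exists>c \<in> carrier_vec d. \<forall>y \<in> P. y \<noteq> x \<longrightarrow> c \<bullet> y < c \<bullet> x)"

definition pointed :: "nat \<Rightarrow> real vec set \<Rightarrow> bool" where
  "pointed d P \<longleftrightarrow> (\<exists>x. vertex d P x)"


section \<open>Oracle programs\<close>

text \<open>
  Algorithms are finite programs of an imperative language with two oracles. Registers hold
  integers or nested lists. Every primitive operation can be executed by a Turing machine in time
  polynomial in its charged cost, which includes the binary lengths of all operands, and two lists
  can simulate a Turing machine tape. Polynomial time for these programs therefore coincides
  with polynomial time for oracle Turing machines.
\<close>

datatype val = IntV int | ListV "val list"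

text \<open>Encoding length: integers are written in binary; the summand 1 pays for the sign.\<close>

primrec vsize :: "val \<Rightarrow> nat" where
  "vsize (IntV z) = 1 + floorlog 2 (nat \<bar>z\<bar>)"
| "vsize (ListV vs) = 1 + sum_list (map vsize vs)"

text \<open>Operations applied to values of the wrong kind return harmless default values.\<close>

fun int_of :: "val \<Rightarrow> int" where
  "int_of (IntV z) = z"
| "int_of (ListV vs) = 0"

fun list_of :: "val \<Rightarrow> val list" where
  "list_of (IntV z) = []"
| "list_of (ListV vs) = vs"

definition bool_val :: "bool \<Rightarrow> val" where
  "bool_val c = IntV (if c then 1 else 0)"

datatype binop = Plus | Minus | Times | Quot | Rem | Less | Equal | Cons_op

datatype unop = Head | Tail | Is_int

fun apply_binop :: "binop \<Rightarrow> val \<Rightarrow> val \<Rightarrow> val" where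
  "apply_binop Plus u v = IntV (int_of u + int_of v)"
| "apply_binop Minus u v = IntV (int_of u - int_of v)"
| "apply_binop Times u v = IntV (int_of u * int_of v)"
| "apply_binop Quot u v = IntV (int_of u div int_of v)"
| "apply_binop Rem u v = IntV (int_of u mod int_of v)"
| "apply_binop Less u v = bool_val (int_of u < int_of v)"
| "apply_binop Equal u v = bool_val (u = v)"
| "apply_binop Cons_op u v = ListV (u # list_of v)"

fun apply_unop :: "unop \<Rightarrow> val \<Rightarrow> val" where
  "apply_unop Head v = (case list_of v of [] \<Rightarrow> ListV [] | u # us \<Rightarrow> u)"
| "apply_unop Tail v = ListV (tl (list_of v))"
| "apply_unop Is_int v = bool_val (case v of IntV z \<Rightarrow> True | ListV vs \<Rightarrow> False)"

datatype expr =
    Reg nat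
  | Const int
  | Empty_list
  | Unop unop expr
  | Binop binop expr expr

type_synonym state = "nat \<Rightarrow> val"

primrec eval_expr :: "expr \<Rightarrow> state \<Rightarrow> val" where
  "eval_expr (Reg r) s = s r"
| "eval_expr (Const z) s = IntV z"
| "eval_expr Empty_list s = ListV []"
| "eval_expr (Unop f e) s = apply_unop f (eval_expr e s)"
| "eval_expr (Binop f e e') s = apply_binop f (eval_expr e s) (eval_expr e' s)"

primrec cost :: "expr \<Rightarrow> state \<Rightarrow> nat" where
  "cost (Reg r) s = vsize (s r)"
| "cost (Const z) s = vsize (IntV z)"
| "cost Empty_list s = 1"
| "cost (Unop f e) s = 1 + cost e s + vsize (eval_expr e s)"
| "cost (Binop f e e') s =
    1 + cost e s + cost e' s + vsize (eval_expr e s) + vsize (eval_expr e' s)"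

datatype oracle_name = Separation | Decomposition

datatype com =
    Skip
  | Assign nat expr
  | Ask nat oracle_name expr
  | Seq com com
  | If expr com com
  | While expr com

text \<open>\<open>exec orc c s s' t\<close>: program \<open>c\<close>, started in \<open>s\<close>, halts in \<open>s'\<close> after time \<open>t\<close>. An oracle
  call is charged the lengths of the query and of the answer. Everything except \<open>IntV 0\<close> counts
  as true in tests.\<close>

inductive exec ::
  "(oracle_name \<Rightarrow> val \<Rightarrow> val) \<Rightarrow> com \<Rightarrow> state \<Rightarrow> state \<Rightarrow> nat \<Rightarrow> bool"
  for orc :: "oracle_name \<Rightarrow> val \<Rightarrow> val" where
  skip: "exec orc Skip s s 1"
| assign: "exec orc (Assign r e) s (s(r := eval_expr e s)) (1 + cost e s + vsize (eval_expr e s))"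
| ask: "v = eval_expr e s \<Longrightarrow> w = orc k v \<Longrightarrow>
    exec orc (Ask r k e) s (s(r := w)) (1 + cost e s + vsize v + vsize w)"
| seq: "exec orc c s s' t \<Longrightarrow> exec orc c' s' s'' t' \<Longrightarrow> exec orc (Seq c c') s s'' (t + t')"
| if_true: "eval_expr e s \<noteq> IntV 0 \<Longrightarrow> exec orc c s s' t \<Longrightarrow>
    exec orc (If e c c') s s' (1 + cost e s + t)"
| if_false: "eval_expr e s = IntV 0 \<Longrightarrow> exec orc c' s s' t \<Longrightarrow>
    exec orc (If e c c') s s' (1 + cost e s + t)"
| while_true: "eval_expr e s \<noteq> IntV 0 \<Longrightarrow> exec orc c s s' t \<Longrightarrow> exec orc (While e c) s' s'' t' \<Longrightarrow>
    exec orc (While e c) s s'' (1 + cost e s + t + t')"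
| while_false: "eval_expr e s = IntV 0 \<Longrightarrow> exec orc (While e c) s s (1 + cost e s)"

inductive_cases exec_cases:
  "exec orc Skip s s' t"
  "exec orc (Assign r e) s s' t"
  "exec orc (Ask r k e) s s' t"
  "exec orc (Seq c c') s s' t"
  "exec orc (If e c c') s s' t"
inductive_cases exec_While: "exec orc (While e c) s s' t"

lemma exec_deterministic:
  "exec orc c s s1 t1 \<Longrightarrow> exec orc c s s2 t2 \<Longrightarrow> s1 = s2 \<and> t1 = t2"
proof (induction arbitrary: s2 t2 rule: exec.induct)
  case (skip s)
  then show ?case by (rule exec_cases(1)) simp
next
  case (assign r e s)
  then show ?case by (rule exec_cases(2)) simp
next
  case (ask v e s w k r)
  from ask.prems ask.hyps show ?case by (elim exec_cases(3)) simp
next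
  case (seq c s s' t c' s'' t')
  from seq.prems obtain u t1 t2' where
    "exec orc c s u t1" "exec orc c' u s2 t2'" "t2 = t1 + t2'"
    by (rule exec_cases(4))
  with seq.IH show ?case by metis
next
  case (if_true e s c s' t c')
  from if_true.prems if_true.hyps(1) obtain t1 where
    "exec orc c s s2 t1" "t2 = 1 + cost e s + t1"
    by (elim exec_cases(5)) simp_all
  with if_true.IH show ?case by metis
next
  case (if_false e s c' s' t c)
  from if_false.prems if_false.hyps(1) obtain t1 where
    "exec orc c' s s2 t1" "t2 = 1 + cost e s + t1"
    by (elim exec_cases(5)) simp_all
  with if_false.IH show ?case by metis
next
  case (while_true e s c s' t s'' t')
  from while_true.prems obtain u t1 t2' where
    "exec orc c s u t1" "exec orc (While e c) u s2 t2'" "t2 = 1 + cost e s + t1 + t2'"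
    by (rule exec_While) (use while_true.hyps(1) in simp_all)
  with while_true.IH show ?case by metis
next
  case (while_false e s c)
  from while_false.prems show ?case
    by (rule exec_While) (use while_false.hyps in simp_all)
qed


section \<open>Encodings and oracles\<close>

definition int_vec_val :: "int vec \<Rightarrow> val" where
  "int_vec_val x = ListV (map IntV (list_of_vec x))"

text \<open>A rational number is given by any numerator and positive denominator, not necessarily
  coprime.\<close>

definition encodes_rat :: "val \<Rightarrow> real \<Rightarrow> bool" where
  "encodes_rat v r \<longleftrightarrow>
    (\<exists>p q. 0 < q \<and> v = ListV [IntV p, IntV q] \<and> r = real_of_int p / real_of_int q)"

definition encodes_vec :: "val \<Rightarrow> real vec \<Rightarrow> bool" where
  "encodes_vec v x \<longleftrightarrow> (\<exists>vs. v = ListV vs \<and> list_all2 encodes_rat vs (list_of_vec x))"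

definition separation_oracle :: "nat \<Rightarrow> real vec set \<Rightarrow> (val \<Rightarrow> val) \<Rightarrow> bool" where
  "separation_oracle d P f \<longleftrightarrow>
    (\<forall>v. \<forall>x \<in> carrier_vec d. encodes_vec v x \<longrightarrow>
      (f v = IntV 1 \<and> x \<in> P) \<or>
      (\<exists>h \<in> carrier_vec d. encodes_vec (f v) h \<and> (\<forall>y \<in> P. h \<bullet> y < h \<bullet> x)))"

text \<open>The number \<open>n\<close> is given in unary.\<close>

definition decomposition_query :: "nat \<Rightarrow> int vec \<Rightarrow> val" where
  "decomposition_query n x = ListV [ListV (replicate n (IntV 1)), int_vec_val x]"

definition decomposition_oracle :: "nat \<Rightarrow> real vec set \<Rightarrow> (val \<Rightarrow> val) \<Rightarrow> bool" where
  "decomposition_oracle d P f \<longleftrightarrow>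
    (\<forall>n\<ge>1. \<forall>x \<in> lattice_points d (dilate n P).
      \<exists>xs. f (decomposition_query n x) = ListV (map int_vec_val xs) \<and>
        length xs = n \<and> set xs \<subseteq> lattice_points d P \<and> x = vsum d xs)"

text \<open>Only answers to admissible queries are constrained, here as in the two oracle
  specifications.\<close>

definition bounded_answers ::
  "nat poly \<Rightarrow> nat \<Rightarrow> nat \<Rightarrow> real vec set \<Rightarrow> (oracle_name \<Rightarrow> val \<Rightarrow> val) \<Rightarrow> bool" where
  "bounded_answers q d \<Delta> P orc \<longleftrightarrow>
    (\<forall>v. \<forall>x \<in> carrier_vec d. encodes_vec v x \<longrightarrow>
      vsize (orc Separation v) \<le> poly q (vsize v + d + floorlog 2 \<Delta>)) \<and>
    (\<forall>n\<ge>1. \<forall>x \<in> lattice_points d (dilate n P).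
      vsize (orc Decomposition (decomposition_query n x))
        \<le> poly q (vsize (decomposition_query n x) + d + floorlog 2 \<Delta>))"

text \<open>The input is placed in register 0, and the output is expected there as well.\<close>

definition initial_state :: "nat \<Rightarrow> nat \<Rightarrow> int vec \<Rightarrow> state" where
  "initial_state d \<Delta> a =
    (\<lambda>_. ListV [])(0 := ListV [IntV (int d), IntV (int \<Delta>), int_vec_val a])"

definition decomposition_val :: "(nat \<times> int vec) list \<Rightarrow> val" where
  "decomposition_val ps = ListV (map (\<lambda>(l, x). ListV [IntV (int l), int_vec_val x]) ps)"

text \<open>The output \<open>IntV 0\<close> means that \<open>a\<close> is not in the monoid; it differs from the code of the
  empty decomposition.\<close>

definition solves_monoid_decomposition :: "nat \<Rightarrow> int vec set \<Rightarrow> int vec \<Rightarrow> val \<Rightarrow> bool" where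
  "solves_monoid_decomposition d S a out \<longleftrightarrow>
    (if a \<in> mon d S
     then \<exists>ps. out = decomposition_val ps \<and> snd ` set ps \<subseteq> S \<and> a = combination d ps
     else out = IntV 0)"

end

theory Submission
  imports Defs "Jordan_Normal_Form.Determinant"
begin

text \<open>
  The point \<open>y / D\<close> is represented by the integral vector \<open>D # y\<close>, which turns \<open>P\<close> into a cone. By
  convexity and decomposability, \<open>a \<noteq> 0\<close> lies in the monoid iff \<open>k # a\<close> lies in the cone for some
  \<open>k \<ge> 1\<close>. If there is such a \<open>k\<close>, then there is one of polynomial length, and it is found by bisection,
  guided by the separating functionals.

  To decompose \<open>k # a\<close>, vertices of \<open>P\<close>, which are integral by decomposability, are peeled off one by one.
  Only the integral parts of their coefficients are used; the fractional parts add up to an integral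
  vector whose first entry is at most linear in \<open>d\<close>, so that the decomposition oracle applies to it.

  A vertex is reached from a point by moving repeatedly along a direction of its minimal face until a
  new inequality becomes tight. The equations of the face are not known, but functionals that separate
  points close to the face are almost such equations, and lattice reduction rounds them to exact ones.
  In the same way the rational step lengths are recovered from the results of a bisection.
\<close>

section \<open>Polynomially computable functions\<close>

text \<open>The inequalities describing \<open>P\<close> are unknown and may be exponentially many.
  They occur in the analysis only; a face is accessible solely through answers to queries near it.
  This dictates the chain of constants. \<open>kernel_bound\<close> bounds short vectors of a face,
  \<open>quality\<close> is the precision at which an approximate equation becomes exact on them,
  \<open>grid\<close> is the scale that lattice reduction needs for this precision,
  \<open>direction_bound\<close> bounds solutions of equations with coefficients up to
  \<open>grid\<close>, and \<open>zoom\<close> places the query so close to the face that all these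
  losses are outweighed. Steps are counted by triangular systems of rows and directions: each move
  along a face, and each peeled vertex, makes a row tight that extends such a system. Hence at most
  \<open>n = d + 1\<close> such moves are possible, and at most \<open>n + 1\<close> fractional
  parts are left over. Many of the functions have short values only on meaningful inputs, for
  instance bases or points of the cone. Polynomial time is therefore treated relative to a semantic
  promise. One program has to serve every bound on the answer lengths, so programs are fixed first
  and only the bounding polynomial depends on the bound.\<close>

lemma poly_nat_mono:
  fixes p :: "nat poly"
  assumes "m \<le> n"
  shows "poly p m \<le> poly p n"
  using assms by (induction p) (auto intro!: add_mono mult_mono)

section \<open>Programs with time bounds\<close>

definition runs :: "(oracle_name \<Rightarrow> val \<Rightarrow> val) \<Rightarrow> com \<Rightarrow> state \<Rightarrow> state \<Rightarrow> nat \<Rightarrow> bool" where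
  "runs orc c s s' T \<longleftrightarrow> (\<exists>t\<le>T. exec orc c s s' t)"

lemma runs_assign:
  assumes "eval_expr e s = v" "1 + cost e s + vsize v \<le> T"
  shows "runs orc (Assign r e) s (s(r := v)) T"
  using exec.assign[of orc r e s] assms unfolding runs_def by auto

lemma runs_ask:
  assumes "eval_expr e s = v" "1 + cost e s + vsize v + vsize (orc k v) \<le> T"
  shows "runs orc (Ask r k e) s (s(r := orc k v)) T"
  using exec.ask[of v e s "orc k v" orc k r] assms unfolding runs_def by auto

lemma runs_skip: "runs orc Skip s s 1"
  unfolding runs_def using exec.skip by blast

lemma runs_seq:
  assumes "runs orc c s s' T" "runs orc c' s' s'' T'"
  shows "runs orc (Seq c c') s s'' (T + T')"
  using assms unfolding runs_def by (meson add_mono exec.seq)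

lemma runs_mono: "runs orc c s s' T \<Longrightarrow> T \<le> T' \<Longrightarrow> runs orc c s s' T'"
  unfolding runs_def by (meson le_trans)

lemma runs_if:
  assumes "1 + cost e s + T \<le> T'"
    and "eval_expr e s \<noteq> IntV 0 \<Longrightarrow> runs orc c s s' T"
    and "eval_expr e s = IntV 0 \<Longrightarrow> runs orc c' s s' T"
  shows "runs orc (If e c c') s s' T'"
proof (cases "eval_expr e s = IntV 0")
  case True
  then obtain t where "t \<le> T" "exec orc c' s s' t" using assms(3) unfolding runs_def by blast
  then show ?thesis using exec.if_false[OF True, of orc c' s' t c] assms(1) unfolding runs_def
    by (meson add_le_cancel_left le_trans)
next
  case False
  then obtain t where "t \<le> T" "exec orc c s s' t" using assms(2) unfolding runs_def by blast
  then show ?thesis using exec.if_true[OF False, of orc c s' t c'] assms(1) unfolding runs_def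
    by (meson add_le_cancel_left le_trans)
qed

lemma runs_while_true:
  assumes "eval_expr e s \<noteq> IntV 0" "runs orc c s s' T" "runs orc (While e c) s' s'' T'"
    "1 + cost e s + T + T' \<le> T''"
  shows "runs orc (While e c) s s'' T''"
proof -
  obtain t t' where "t \<le> T" "exec orc c s s' t" "t' \<le> T'" "exec orc (While e c) s' s'' t'"
    using assms(2,3) unfolding runs_def by blast
  with exec.while_true[OF assms(1) this(2,4)] show ?thesis
    using assms(4) unfolding runs_def
    by (intro exI[of _ "1 + cost e s + t + t'"]) auto
qed

lemma runs_while_false:
  assumes "eval_expr e s = IntV 0" "1 + cost e s \<le> T"
  shows "runs orc (While e c) s s T"
  using exec.while_false[OF assms(1), of orc c] assms(2) unfolding runs_def by blast

text \<open>Every new value is paid for when it is created, so a time bound is also a bound on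
  lengths.\<close>

lemma exec_vsize: "exec orc c s s' t \<Longrightarrow> vsize (s' r) \<le> vsize (s r) + t"
  by (induction rule: exec.induct) auto

lemma runs_vsize: "runs orc c s s' T \<Longrightarrow> vsize (s' r) \<le> vsize (s r) + T"
  unfolding runs_def using exec_vsize by (meson add_le_cancel_left le_trans)

primrec writes :: "com \<Rightarrow> nat set" where
  "writes Skip = {}"
| "writes (Assign r e) = {r}"
| "writes (Ask r k e) = {r}"
| "writes (Seq c c') = writes c \<union> writes c'"
| "writes (If e c c') = writes c \<union> writes c'"
| "writes (While e c) = writes c"

lemma finite_writes: "finite (writes c)"
  by (induction c) auto

text \<open>Composite programs keep intermediate values in registers outside \<open>writes\<close>;
  such registers exist because \<open>writes\<close> is finite. This takes the place of a
  stack.\<close>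

lemma exec_frame: "exec orc c s s' t \<Longrightarrow> r \<notin> writes c \<Longrightarrow> s' r = s r"
  by (induction rule: exec.induct) auto

lemma runs_frame: "runs orc c s s' T \<Longrightarrow> r \<notin> writes c \<Longrightarrow> s' r = s r"
  unfolding runs_def using exec_frame by blast

lemma fresh_register:
  assumes "finite (A :: nat set)"
  obtains k where "k \<notin> A" "k \<noteq> 0"
  using ex_new_if_finite[of "insert 0 A"] assms by auto

text \<open>The environment is not stored in memory: it is the data that the oracles depend on. The first
  component is the polynomial bounding the lengths of the oracle answers.\<close>

datatype env = Env (answer_bound: "nat poly") (env_dim: nat) (env_complexity: nat)
  (env_polyhedron: "real vec set") (env_oracle: "oracle_name \<Rightarrow> val \<Rightarrow> val")

section \<open>Encodings and polynomial bounds\<close>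

definition env_size :: "env \<Rightarrow> nat" where
  "env_size e = env_dim e + floorlog 2 (env_complexity e)"

class enc =
  fixes enc :: "'a \<Rightarrow> val"

instantiation int :: enc begin
definition "enc_int = IntV"
instance ..
end

instantiation nat :: enc begin
definition "enc_nat n = IntV (int n)"
instance ..
end

instantiation bool :: enc begin
definition "enc_bool = bool_val"
instance ..
end

instantiation val :: enc begin
definition "enc_val v = (v :: val)"
instance ..
end

instantiation list :: (enc) enc begin
definition "enc_list xs = ListV (map enc xs)"
instance ..
end

instantiation prod :: (enc, enc) enc begin
definition "enc_prod x = ListV [enc (fst x), enc (snd x)]"
instance ..
end

lemmas enc_defs = enc_int_def enc_nat_def enc_bool_def enc_val_def enc_list_def enc_prod_def

abbreviation esz :: "'a :: enc \<Rightarrow> nat" where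
  "esz x \<equiv> vsize (enc x)"

lemma esz_prod: "esz (x, y) = 1 + esz x + esz y"
  by (simp add: enc_prod_def)

lemma esz_list: "esz xs = 1 + sum_list (map esz xs)"
  by (simp add: enc_list_def comp_def)

lemma vsize_pos: "1 \<le> vsize v"
  by (cases v) auto

lemma length_le_esz: "length xs \<le> esz xs"
proof (induction xs)
  case (Cons x xs)
  then show ?case using vsize_pos[of "enc x"] by (simp add: esz_list)
qed simp

definition isz :: "env \<Rightarrow> 'a :: enc \<Rightarrow> nat" where
  "isz e x = env_size e + esz x"

text \<open>The polynomial may depend on the answer bound \<open>q\<close> but on nothing else in
  the environment, which mirrors the order of quantifiers in the theorem.\<close>

definition pbd :: "(env \<Rightarrow> 'a :: enc \<Rightarrow> bool) \<Rightarrow> (env \<Rightarrow> 'a \<Rightarrow> nat) \<Rightarrow> bool" where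
  "pbd D g \<longleftrightarrow>
    (\<forall>q. \<exists>p. \<forall>e x. answer_bound e = q \<longrightarrow> D e x \<longrightarrow> g e x \<le> poly p (isz e x))"

lemma pbd_mono:
  assumes "pbd D g" "\<And>e x. D' e x \<Longrightarrow> D e x" "\<And>e x. D' e x \<Longrightarrow> f e x \<le> g e x"
  shows "pbd D' f"
  using assms unfolding pbd_def by (meson le_trans)

lemma pbd_const: "pbd D (\<lambda>e x. n)"
  unfolding pbd_def by (intro allI exI[of _ "[:n:]"]) simp

lemma pbd_isz: "pbd D (\<lambda>e x. isz e x)"
  unfolding pbd_def by (intro allI exI[of _ "[:0, 1:]"]) simp

lemma pbd_esz_id: "pbd D (\<lambda>e x. esz x)"
  by (rule pbd_mono[OF pbd_isz[of D]]) (auto simp: isz_def)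

lemma pbd_env_size: "pbd D (\<lambda>e x. env_size e)"
  by (rule pbd_mono[OF pbd_isz[of D]]) (auto simp: isz_def)

lemma pbd_add:
  assumes "pbd D f" "pbd D g"
  shows "pbd D (\<lambda>e x. f e x + g e x)"
  unfolding pbd_def
proof
  fix q
  obtain p1 p2 where
    "\<forall>e x. answer_bound e = q \<longrightarrow> D e x \<longrightarrow> f e x \<le> poly p1 (isz e x)"
    "\<forall>e x. answer_bound e = q \<longrightarrow> D e x \<longrightarrow> g e x \<le> poly p2 (isz e x)"
    using assms unfolding pbd_def by metis
  then show "\<exists>p. \<forall>e x. answer_bound e = q \<longrightarrow> D e x \<longrightarrow> f e x + g e x \<le> poly p (isz e x)"
    by (intro exI[of _ "p1 + p2"]) (simp add: add_mono)
qed

lemma pbd_mult: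
  assumes "pbd D f" "pbd D g"
  shows "pbd D (\<lambda>e x. f e x * g e x)"
  unfolding pbd_def
proof
  fix q
  obtain p1 p2 where
    "\<forall>e x. answer_bound e = q \<longrightarrow> D e x \<longrightarrow> f e x \<le> poly p1 (isz e x)"
    "\<forall>e x. answer_bound e = q \<longrightarrow> D e x \<longrightarrow> g e x \<le> poly p2 (isz e x)"
    using assms unfolding pbd_def by metis
  then show "\<exists>p. \<forall>e x. answer_bound e = q \<longrightarrow> D e x \<longrightarrow> f e x * g e x \<le> poly p (isz e x)"
    by (intro exI[of _ "p1 * p2"]) (simp add: mult_mono)
qed

text \<open>A loop runs its body on many inputs \<open>z\<close>, none of which is a fixed function
  of \<open>x\<close>. What is needed is one bound for all \<open>z\<close> of bounded length;
  composing the two polynomials provides it.\<close>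

lemma pbd_sup:
  assumes h: "pbd D' h" and B: "pbd D B"
  obtains H where "pbd D H"
    "\<And>e x z. D e x \<Longrightarrow> D' e z \<Longrightarrow> esz z \<le> B e x \<Longrightarrow> h e z \<le> H e x"
proof -
  obtain p where p: "\<And>e x. D' e x \<Longrightarrow> h e x \<le> poly (p (answer_bound e)) (isz e x)"
    using h unfolding pbd_def by metis
  obtain r where r: "\<And>e x. D e x \<Longrightarrow> B e x \<le> poly (r (answer_bound e)) (isz e x)"
    using B unfolding pbd_def by metis
  define H where "H e x = poly (p (answer_bound e)) (env_size e + B e x)" for e x
  show ?thesis
  proof (rule that[of H])
    show "pbd D H"
      unfolding pbd_def
    proof
      fix q
      have "H e x \<le> poly (pcompose (p q) ([:0, 1:] + r q)) (isz e x)"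
        if "answer_bound e = q" "D e x" for e x
        using r[OF that(2)] that(1) unfolding H_def poly_pcompose
        by (auto intro!: poly_nat_mono add_mono simp: isz_def)
      then show "\<exists>p. \<forall>e x. answer_bound e = q \<longrightarrow> D e x \<longrightarrow> H e x \<le> poly p (isz e x)"
        by blast
    qed
    show "h e z \<le> H e x" if "D e x" "D' e z" "esz z \<le> B e x" for e x z
    proof -
      have "h e z \<le> poly (p (answer_bound e)) (isz e z)" by (rule p[OF that(2)])
      also have "\<dots> \<le> H e x" unfolding H_def isz_def using that(3) by (intro poly_nat_mono) simp
      finally show ?thesis .
    qed
  qed
qed

lemma pbd_comp:
  assumes "pbd D' h" "pbd D (\<lambda>e x. esz (g e x))" "\<And>e x. D e x \<Longrightarrow> D' e (g e x)"
  shows "pbd D (\<lambda>e x. h e (g e x))"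
proof -
  obtain H where H: "pbd D H"
    "\<And>e x z. D e x \<Longrightarrow> D' e z \<Longrightarrow> esz z \<le> esz (g e x) \<Longrightarrow> h e z \<le> H e x"
    using pbd_sup[OF assms(1,2)] by metis
  show ?thesis by (rule pbd_mono[OF H(1)]) (auto intro: H(2) assms(3))
qed

section \<open>Polynomial time under a promise\<close>

definition computes ::
  "com \<Rightarrow> (env \<Rightarrow> 'a :: enc \<Rightarrow> bool) \<Rightarrow> (env \<Rightarrow> 'a \<Rightarrow> 'b :: enc) \<Rightarrow> (env \<Rightarrow> 'a \<Rightarrow> nat) \<Rightarrow> bool" where
  "computes c D f T \<longleftrightarrow>
    (\<forall>e x s. D e x \<longrightarrow> s 0 = enc x \<longrightarrow>
      (\<exists>s'. runs (env_oracle e) c s s' (T e x) \<and> s' 0 = enc (f e x)))"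

text \<open>The program is chosen before the environment and sees it only through oracle calls.
  Registers other than 0 are arbitrary before and after the run, and outside \<open>D\<close>
  nothing is promised.\<close>

definition FP :: "(env \<Rightarrow> 'a :: enc \<Rightarrow> bool) \<Rightarrow> (env \<Rightarrow> 'a \<Rightarrow> 'b :: enc) \<Rightarrow> bool" where
  "FP D f \<longleftrightarrow> (\<exists>c T. pbd D T \<and> computes c D f T)"

lemma FP_I:
  assumes "pbd D T"
    and "\<And>e x s. D e x \<Longrightarrow> s 0 = enc x \<Longrightarrow>
      \<exists>s'. runs (env_oracle e) c s s' (T e x) \<and> s' 0 = enc (f e x)"
  shows "FP D f"
  using assms unfolding FP_def computes_def by blast

lemma computesD:
  assumes "computes c D f T" "D e x" "s 0 = enc x"
  shows "\<exists>s'. runs (env_oracle e) c s s' (T e x) \<and> s' 0 = enc (f e x)"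
  using assms unfolding computes_def by blast

text \<open>Only codes count, so \<open>f\<close> and \<open>g\<close> may have different types.
  Decoding a value, such as an oracle answer, is then a change of type that costs nothing.\<close>

lemma FP_cong_enc:
  assumes "FP D f" "\<And>e x. D' e x \<Longrightarrow> D e x" "\<And>e x. D' e x \<Longrightarrow> enc (g e x) = enc (f e x)"
  shows "FP D' g"
proof -
  obtain c T where c: "pbd D T" "computes c D f T"
    using assms(1) by (auto simp: FP_def)
  note c = c(1) computesD[OF c(2)]
  have "pbd D' T" by (rule pbd_mono[OF c(1)]) (auto intro: assms)
  then show ?thesis by (rule FP_I[of _ _ c]) (use c assms in auto)
qed

lemma FP_weaken: "FP D f \<Longrightarrow> (\<And>e x. D' e x \<Longrightarrow> D e x) \<Longrightarrow> FP D' f"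
  using FP_cong_enc[of D f D' f] by simp

lemma FP_cong: "FP D f \<Longrightarrow> (\<And>e x. D e x \<Longrightarrow> g e x = f e x) \<Longrightarrow> FP D g"
  using FP_cong_enc[of D f D g] by simp

lemma pbd_FP:
  assumes "FP D f"
  shows "pbd D (\<lambda>e x. esz (f e x))"
proof -
  obtain c T where c: "pbd D T" "computes c D f T"
    using assms(1) by (auto simp: FP_def)
  note c = c(1) computesD[OF c(2)]
  have "esz (f e x) \<le> isz e x + T e x" if D: "D e x" for e x
  proof -
    obtain s' where "runs (env_oracle e) c (\<lambda>_. enc x) s' (T e x)" "s' 0 = enc (f e x)"
      using c(2)[of e x "\<lambda>_. enc x"] D by auto
    then show ?thesis using runs_vsize[of "env_oracle e" c "\<lambda>_. enc x" s' "T e x" 0] by (simp add: isz_def)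
  qed
  then show ?thesis by (intro pbd_mono[OF pbd_add[OF pbd_isz[of D] c(1)]]) auto
qed

lemma FP_id: "FP D (\<lambda>e x. x)"
  by (rule FP_I[OF pbd_const, of _ Skip 1]) (use runs_skip in blast)

lemma FP_comp:
  assumes f: "FP D' f" and g: "FP D g" and D: "\<And>e x. D e x \<Longrightarrow> D' e (g e x)"
  shows "FP D (\<lambda>e x. f e (g e x))"
proof -
  obtain c T where c: "pbd D' T" "computes c D' f T"
    using f by (auto simp: FP_def)
  note c = c(1) computesD[OF c(2)]
  obtain c' T' where c': "pbd D T'" "computes c' D g T'"
    using g by (auto simp: FP_def)
  note c' = c'(1) computesD[OF c'(2)]
  have "pbd D (\<lambda>e x. T' e x + T e (g e x))"
    by (intro pbd_add c'(1) pbd_comp[OF c(1)] pbd_FP[OF g] D)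
  then show ?thesis
  proof (rule FP_I[of _ _ "Seq c' c"])
    fix e x and s :: state assume "D e x" "s 0 = enc x"
    then obtain s' where s': "runs (env_oracle e) c' s s' (T' e x)" "s' 0 = enc (g e x)"
      using c'(2) by blast
    obtain s'' where "runs (env_oracle e) c s' s'' (T e (g e x))" "s'' 0 = enc (f e (g e x))"
      using c(2)[of e "g e x" s'] D[OF \<open>D e x\<close>] s'(2) by blast
    with s' show "\<exists>s'. runs (env_oracle e) (Seq c' c) s s' (T' e x + T e (g e x)) \<and> s' 0 = enc (f e (g e x))"
      using runs_seq by blast
  qed
qed

lemma FP_Pair:
  assumes f: "FP D f" and g: "FP D g"
  shows "FP D (\<lambda>e x. (f e x, g e x))"
proof -
  obtain c T where c: "pbd D T" "computes c D f T"
    using f by (auto simp: FP_def)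
  note c = c(1) computesD[OF c(2)]
  obtain c' T' where c': "pbd D T'" "computes c' D g T'"
    using g by (auto simp: FP_def)
  note c' = c'(1) computesD[OF c'(2)]
  obtain k where k: "k \<notin> writes c \<union> writes c'" "k \<noteq> 0"
    using fresh_register finite_writes by (metis finite_Un)
  obtain l where l: "l \<notin> insert k (writes c \<union> writes c')" "l \<noteq> 0"
    using fresh_register finite_writes by (metis finite_Un finite_insert)
  let ?S = "\<lambda>e x. 20 * (1 + esz x + esz (f e x) + esz (g e x))"
  let ?T = "\<lambda>e x. ?S e x + (T e x + (?S e x + (?S e x + (T' e x + ?S e x))))"
  let ?prog = "Seq (Assign k (Reg 0)) (Seq c (Seq (Assign l (Reg 0)) (Seq (Assign 0 (Reg k))
    (Seq c' (Assign 0 (Binop Cons_op (Reg l) (Binop Cons_op (Reg 0) Empty_list)))))))"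
  have "pbd D ?T"
    by (intro pbd_add pbd_mult pbd_const pbd_esz_id pbd_FP[OF f] pbd_FP[OF g] c c')
  then show ?thesis
  proof (rule FP_I[of _ _ ?prog])
    fix e x and s :: state assume D: "D e x" and s: "s 0 = enc x"
    let ?s1 = "s(k := enc x)"
    have 1: "runs (env_oracle e) (Assign k (Reg 0)) s ?s1 (?S e x)"
      by (rule runs_assign) (use s in auto)
    have "?s1 0 = enc x" using s k by simp
    then obtain s2 where s2: "runs (env_oracle e) c ?s1 s2 (T e x)" "s2 0 = enc (f e x)"
      using c(2) D by blast
    have s2k: "s2 k = enc x" using runs_frame[OF s2(1), of k] k by simp
    let ?s3 = "s2(l := enc (f e x))"
    have 3: "runs (env_oracle e) (Assign l (Reg 0)) s2 ?s3 (?S e x)"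
      by (rule runs_assign) (use s2 in auto)
    let ?s4 = "?s3(0 := enc x)"
    have 4: "runs (env_oracle e) (Assign 0 (Reg k)) ?s3 ?s4 (?S e x)"
      by (rule runs_assign) (use s2k l in auto)
    obtain s5 where s5: "runs (env_oracle e) c' ?s4 s5 (T' e x)" "s5 0 = enc (g e x)"
      using c'(2)[of e x ?s4] D by auto
    have s5l: "s5 l = enc (f e x)" using runs_frame[OF s5(1), of l] l by simp
    let ?s6 = "s5(0 := enc (f e x, g e x))"
    have 6: "runs (env_oracle e) (Assign 0 (Binop Cons_op (Reg l) (Binop Cons_op (Reg 0) Empty_list))) s5 ?s6 (?S e x)"
      by (rule runs_assign) (use s5 s5l in \<open>auto simp: enc_prod_def\<close>)
    have "runs (env_oracle e) ?prog s ?s6 (?T e x)"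
      by (intro runs_seq) (rule 1 s2(1) 3 4 s5(1) 6)+
    then show "\<exists>s'. runs (env_oracle e) ?prog s s' (?T e x) \<and> s' 0 = enc (f e x, g e x)"
      by (intro exI[of _ ?s6]) simp
  qed
qed

text \<open>Each branch is required only on its own part of the domain. This is essential where a
  branch is well-defined or short only if the test came out its way.\<close>

lemma FP_If:
  assumes b: "FP D b" and f: "FP (\<lambda>e x. D e x \<and> b e x) f" and g: "FP (\<lambda>e x. D e x \<and> \<not> b e x) g"
  shows "FP D (\<lambda>e x. if b e x then f e x else g e x)"
proof -
  obtain c0 T0 where c0: "pbd D T0" "computes c0 D b T0"
    using b by (auto simp: FP_def)
  note c0 = c0(1) computesD[OF c0(2)]
  obtain c T where c: "pbd (\<lambda>e x. D e x \<and> b e x) T" "computes c (\<lambda>e x. D e x \<and> b e x) f T"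
    using f by (auto simp: FP_def)
  note c = c(1) computesD[OF c(2)]
  obtain c' T' where c': "pbd (\<lambda>e x. D e x \<and> \<not> b e x) T'" "computes c' (\<lambda>e x. D e x \<and> \<not> b e x) g T'"
    using g by (auto simp: FP_def)
  note c' = c'(1) computesD[OF c'(2)]
  obtain k where k: "k \<notin> writes c0" "k \<noteq> 0"
    using fresh_register finite_writes by metis
  define S where "S e x = (if b e x then T e x else T' e x)" for e x
  have S: "pbd D S"
  proof -
    have "\<exists>p. \<forall>e x. answer_bound e = q \<longrightarrow> D e x \<longrightarrow> S e x \<le> poly p (isz e x)" for q
    proof -
      obtain p p' where "\<forall>e x. answer_bound e = q \<longrightarrow> D e x \<and> b e x \<longrightarrow> T e x \<le> poly p (isz e x)"
       "\<forall>e x. answer_bound e = q \<longrightarrow> D e x \<and> \<not> b e x \<longrightarrow> T' e x \<le> poly p' (isz e x)"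
        using c(1) c'(1) unfolding pbd_def by metis
      then show ?thesis by (intro exI[of _ "p + p'"]) (auto simp: S_def trans_le_add1 trans_le_add2)
    qed
    then show ?thesis unfolding pbd_def by blast
  qed
  let ?R = "\<lambda>e x. 3 + 3 * esz x"
  let ?T = "\<lambda>e x. ?R e x + (T0 e x + (1 + (esz x + T0 e x) + (?R e x + S e x)))"
  let ?prog = "Seq (Assign k (Reg 0)) (Seq c0 (If (Reg 0) (Seq (Assign 0 (Reg k)) c) (Seq (Assign 0 (Reg k)) c')))"
  have "pbd D ?T"
    by (intro pbd_add pbd_mult pbd_const pbd_esz_id S c0)
  then show ?thesis
  proof (rule FP_I[of _ _ ?prog])
    fix e x and s :: state assume D: "D e x" and s: "s 0 = enc x"
    let ?s1 = "s(k := enc x)"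
    have 1: "runs (env_oracle e) (Assign k (Reg 0)) s ?s1 (?R e x)"
      by (rule runs_assign) (use s in auto)
    have s1: "?s1 0 = enc x" using s k by simp
    then obtain s2 where s2: "runs (env_oracle e) c0 ?s1 s2 (T0 e x)" "s2 0 = enc (b e x)"
      using c0(2) D by blast
    have s2k: "s2 k = enc x" using runs_frame[OF s2(1), of k] k by simp
    have sz: "vsize (s2 0) \<le> esz x + T0 e x" using runs_vsize[OF s2(1), of 0] s1 by simp
    let ?s3 = "s2(0 := enc x)"
    have 3: "runs (env_oracle e) (Assign 0 (Reg k)) s2 ?s3 (?R e x)"
      by (rule runs_assign) (use s2k in auto)
    obtain s4 where s4: "b e x \<Longrightarrow> runs (env_oracle e) c ?s3 s4 (S e x)"
      "\<not> b e x \<Longrightarrow> runs (env_oracle e) c' ?s3 s4 (S e x)"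
      "s4 0 = enc (if b e x then f e x else g e x)"
      using c(2)[of e x ?s3] c'(2)[of e x ?s3] D unfolding S_def by (cases "b e x") auto
    have "runs (env_oracle e) ?prog s s4 (?T e x)"
    proof (intro runs_seq, rule 1, rule s2(1), rule runs_if[OF order.refl[THEN le_trans]])
      show "1 + cost (Reg 0) s2 + (?R e x + S e x) \<le> 1 + (esz x + T0 e x) + (?R e x + S e x)"
        using sz by simp
      show "runs (env_oracle e) (Seq (Assign 0 (Reg k)) c) s2 s4 (?R e x + S e x)"
        if "eval_expr (Reg 0) s2 \<noteq> IntV 0"
        using that s2(2) by (intro runs_seq[OF 3] s4) (auto simp: enc_bool_def bool_val_def split: if_splits)
      show "runs (env_oracle e) (Seq (Assign 0 (Reg k)) c') s2 s4 (?R e x + S e x)"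
        if "eval_expr (Reg 0) s2 = IntV 0"
        using that s2(2) by (intro runs_seq[OF 3] s4) (auto simp: enc_bool_def bool_val_def split: if_splits)
    qed
    then show "\<exists>s'. runs (env_oracle e) ?prog s s' (?T e x) \<and> s' 0 = enc (if b e x then f e x else g e x)"
      using s4(3) by blast
  qed
qed

text \<open>The invariant \<open>I\<close> serves to bound the length of the accumulator.\<close>

lemma FP_fold:
  fixes xs :: "env \<Rightarrow> 'a :: enc \<Rightarrow> 'b :: enc list" and a :: "env \<Rightarrow> 'a \<Rightarrow> 'c :: enc"
  assumes xs: "FP D xs" and a: "FP D a" and F: "FP D' (\<lambda>e z. F e (fst z) (fst (snd z)) (snd (snd z)))"
    and I0: "\<And>e x. D e x \<Longrightarrow> I e x 0 (a e x)"
    and IS: "\<And>e x k s. D e x \<Longrightarrow> k < length (xs e x) \<Longrightarrow> I e x k s \<Longrightarrow>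
      I e x (Suc k) (F e x (xs e x ! k) s)"
    and D': "\<And>e x k s. D e x \<Longrightarrow> k < length (xs e x) \<Longrightarrow> I e x k s \<Longrightarrow> D' e (x, (xs e x ! k, s))"
    and B: "pbd D B"
    and size: "\<And>e x k s. D e x \<Longrightarrow> k \<le> length (xs e x) \<Longrightarrow> I e x k s \<Longrightarrow> esz s \<le> B e x"
  shows "FP D (\<lambda>e x. fold (F e x) (xs e x) (a e x))"
proof -
  obtain c0 T0 where c0: "pbd D T0" "computes c0 D xs T0"
    using xs by (auto simp: FP_def)
  note c0 = c0(1) computesD[OF c0(2)]
  obtain c1 T1 where c1: "pbd D T1" "computes c1 D a T1"
    using a by (auto simp: FP_def)
  note c1 = c1(1) computesD[OF c1(2)]
  obtain c T where c: "pbd D' T" "computes c D' (\<lambda>e z. F e (fst z) (fst (snd z)) (snd (snd z))) T"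
    using F by (auto simp: FP_def)
  note c = c(1) computesD[OF c(2)]
  let ?A = "writes c0 \<union> writes c1 \<union> writes c"
  have fA: "finite ?A" using finite_writes by simp
  obtain k where k: "k \<notin> ?A" "k \<noteq> 0" using fresh_register[OF fA] by metis
  obtain l where l: "l \<notin> insert k ?A" "l \<noteq> 0" using fresh_register fA by (metis finite_insert)
  obtain m where m: "m \<notin> insert l (insert k ?A)" "m \<noteq> 0" using fresh_register fA by (metis finite_insert)
  let ?Z = "\<lambda>e x. 2 + esz x + esz (xs e x) + B e x"
  have Z: "pbd D ?Z"
    by (intro pbd_add pbd_const pbd_esz_id pbd_FP[OF xs] B)
  obtain H where H: "pbd D H" "\<And>e x z. D e x \<Longrightarrow> D' e z \<Longrightarrow> esz z \<le> ?Z e x \<Longrightarrow> T e z \<le> H e x"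
    using pbd_sup[OF c(1) Z] by metis
  \<comment> \<open>The loop stops exactly at \<open>IntV 0\<close>, while \<open>Equal\<close>
    yields 1 on the empty list; hence the subtraction from 1.\<close>
  let ?test = "Binop Minus (Const 1) (Binop Equal (Reg l) Empty_list)"
  let ?body = "Seq (Assign 0 (Binop Cons_op (Reg k)
      (Binop Cons_op (Binop Cons_op (Unop Head (Reg l)) (Binop Cons_op (Reg m) Empty_list)) Empty_list)))
    (Seq c (Seq (Assign m (Reg 0)) (Assign l (Unop Tail (Reg l)))))"
  let ?prog = "Seq (Assign k (Reg 0)) (Seq c0 (Seq (Assign l (Reg 0)) (Seq (Assign 0 (Reg k))
    (Seq c1 (Seq (Assign m (Reg 0)) (Seq (While ?test ?body) (Assign 0 (Reg m))))))))"
  let ?W = "\<lambda>e x. 40 * ?Z e x"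
  let ?L = "\<lambda>e x. ?W e x + ((?W e x + (H e x + (?W e x + ?W e x))))"
  let ?T = "\<lambda>e x. ?W e x + (T0 e x + (?W e x + (?W e x + (T1 e x + (?W e x +
    ((esz (xs e x) + 1) * ?L e x + ?W e x))))))"
  \<comment> \<open>Induction on the unprocessed part \<open>ys\<close>; the processed part
    \<open>zs\<close> records at which index the invariant \<open>I\<close> applies.\<close>
  have loop: "\<exists>s'. runs (env_oracle e) (While ?test ?body) s s' ((length ys + 1) * ?L e x) \<and>
      s' m = enc (fold (F e x) ys b)"
    if D: "D e x" and "xs e x = zs @ ys" "I e x (length zs) b" "s k = enc x" "s l = enc ys" "s m = enc b"
    for e x s ys zs b
    using that(2-)
  proof (induction ys arbitrary: zs b s)
    case Nil
    have "runs (env_oracle e) (While ?test ?body) s s ((length [] + 1) * ?L e x)"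
      by (rule runs_while_false) (use Nil in \<open>auto simp: enc_list_def bool_val_def floorlog_def\<close>)
    then show ?case using Nil by auto
  next
    case (Cons y ys)
    let ?F = "F e x y b"
    have len: "length zs < length (xs e x)" using Cons.prems by simp
    have nth: "xs e x ! length zs = y" using Cons.prems by simp
    have D'z: "D' e (x, (y, b))" using D'[OF D len Cons.prems(2)] nth by simp
    have sb: "esz b \<le> B e x" using size[OF D _ Cons.prems(2)] len by simp
    have szy: "1 + esz y \<le> esz (xs e x)" "esz (y # ys) \<le> esz (xs e x)"
      using Cons.prems(1) by (auto simp: esz_list)
    have I': "I e x (length (zs @ [y])) ?F" using IS[OF D len Cons.prems(2)] nth by simp
    have sF: "esz ?F \<le> B e x" using size[OF D _ I'] len by simp
    have "0 < esz (x, (y, b))" by (simp add: esz_prod)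
    let ?s1 = "s(0 := enc (x, (y, b)))"
    have 1: "runs (env_oracle e) (Assign 0 (Binop Cons_op (Reg k)
      (Binop Cons_op (Binop Cons_op (Unop Head (Reg l)) (Binop Cons_op (Reg m) Empty_list)) Empty_list))) s ?s1 (?W e x)"
      by (rule runs_assign) (use Cons.prems sb szy in \<open>auto simp: enc_prod_def enc_list_def\<close>)
    obtain s2 where s2: "runs (env_oracle e) c ?s1 s2 (T e (x, (y, b)))" "s2 0 = enc ?F"
      using c(2)[OF D'z, of ?s1] by auto
    have s2k: "s2 k = enc x" "s2 l = enc (y # ys)"
      using runs_frame[OF s2(1)] k l m Cons.prems by auto
    have TH: "T e (x, (y, b)) \<le> H e x"
      by (rule H(2)[OF D D'z]) (use sb szy in \<open>auto simp: esz_prod\<close>)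
    let ?s3 = "s2(m := enc ?F)"
    have 3: "runs (env_oracle e) (Assign m (Reg 0)) s2 ?s3 (?W e x)"
      by (rule runs_assign) (use s2 sF in auto)
    let ?s4 = "?s3(l := enc ys)"
    have 4: "runs (env_oracle e) (Assign l (Unop Tail (Reg l))) ?s3 ?s4 (?W e x)"
      by (rule runs_assign) (use s2k szy l m in \<open>auto simp: enc_list_def\<close>)
    have body: "runs (env_oracle e) ?body s ?s4 (?W e x + (H e x + (?W e x + ?W e x)))"
      by (intro runs_seq) (rule 1 runs_mono[OF s2(1) TH] 3 4)+
    have "xs e x = (zs @ [y]) @ ys" using Cons.prems by simp
    moreover have "?s4 k = enc x" "?s4 l = enc ys" "?s4 m = enc ?F" using s2k k l m by auto
    ultimately obtain s5 where
      s5: "runs (env_oracle e) (While ?test ?body) ?s4 s5 ((length ys + 1) * ?L e x)"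
      "s5 m = enc (fold (F e x) ys ?F)"
      using Cons.IH[OF _ I', of ?s4] by blast
    have "runs (env_oracle e) (While ?test ?body) s s5 ((length (y # ys) + 1) * ?L e x)"
    proof (rule runs_while_true[OF _ body s5(1)])
      show "eval_expr ?test s \<noteq> IntV 0"
        using Cons.prems by (auto simp: enc_list_def bool_val_def)
      have "1 + cost ?test s \<le> ?W e x"
        using Cons.prems szy by (auto simp: enc_list_def bool_val_def floorlog_def)
      then show "1 + cost ?test s + (?W e x + (H e x + (?W e x + ?W e x))) + (length ys + 1) * ?L e x
        \<le> (length (y # ys) + 1) * ?L e x"
        by simp
    qed
    then show ?case using s5(2) by auto
  qed
  have "pbd D ?T"
    by (intro pbd_add pbd_mult pbd_const pbd_esz_id pbd_FP[OF xs] B c0 c1 H)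
  then show ?thesis
  proof (rule FP_I[of _ _ ?prog])
    fix e x and s :: state assume D: "D e x" and s: "s 0 = enc x"
    let ?s1 = "s(k := enc x)"
    have 1: "runs (env_oracle e) (Assign k (Reg 0)) s ?s1 (?W e x)"
      by (rule runs_assign) (use s in auto)
    have "?s1 0 = enc x" using s k by simp
    then obtain s2 where s2: "runs (env_oracle e) c0 ?s1 s2 (T0 e x)" "s2 0 = enc (xs e x)"
      using c0(2) D by blast
    have s2k: "s2 k = enc x" using runs_frame[OF s2(1), of k] k by simp
    let ?s3 = "s2(l := enc (xs e x))"
    have 3: "runs (env_oracle e) (Assign l (Reg 0)) s2 ?s3 (?W e x)"
      by (rule runs_assign) (use s2 in auto)
    let ?s4 = "?s3(0 := enc x)"
    have 4: "runs (env_oracle e) (Assign 0 (Reg k)) ?s3 ?s4 (?W e x)"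
      by (rule runs_assign) (use s2k l in auto)
    obtain s5 where s5: "runs (env_oracle e) c1 ?s4 s5 (T1 e x)" "s5 0 = enc (a e x)"
      using c1(2)[of e x ?s4] D by auto
    have s5k: "s5 l = enc (xs e x)" "s5 k = enc x"
      using runs_frame[OF s5(1)] k l s2k by auto
    have sa: "esz (a e x) \<le> B e x" using size[OF D _ I0[OF D]] by simp
    let ?s6 = "s5(m := enc (a e x))"
    have 6: "runs (env_oracle e) (Assign m (Reg 0)) s5 ?s6 (?W e x)"
      by (rule runs_assign) (use s5 sa in auto)
    have s6: "?s6 k = enc x" "?s6 l = enc (xs e x)" "?s6 m = enc (a e x)"
      using s5k m by auto
    obtain s7 where s7: "runs (env_oracle e) (While ?test ?body) ?s6 s7 ((length (xs e x) + 1) * ?L e x)"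
       "s7 m = enc (fold (F e x) (xs e x) (a e x))"
      using loop[OF D, of "[]" "xs e x" "a e x" ?s6] I0[OF D] s6 by auto
    have len: "length (xs e x) \<le> esz (xs e x)" by (rule length_le_esz)
    have s7': "runs (env_oracle e) (While ?test ?body) ?s6 s7 ((esz (xs e x) + 1) * ?L e x)"
      by (rule runs_mono[OF s7(1)]) (rule mult_right_mono, use len in auto)
    have inv: "\<exists>b. I e x n b \<and> b = fold (F e x) (take n (xs e x)) (a e x)" if "n \<le> length (xs e x)" for n
      using that
    proof (induction n)
      case 0
      then show ?case using I0[OF D] by simp
    next
      case (Suc n)
      then show ?case using IS[OF D, of n] by (auto simp: take_Suc_conv_app_nth)
    qed
    have fin: "esz (fold (F e x) (xs e x) (a e x)) \<le> B e x"
      using inv[of "length (xs e x)"] size[OF D, of "length (xs e x)"] by auto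
    let ?s8 = "s7(0 := enc (fold (F e x) (xs e x) (a e x)))"
    have 8: "runs (env_oracle e) (Assign 0 (Reg m)) s7 ?s8 (?W e x)"
      by (rule runs_assign) (use s7 fin in auto)
    have "runs (env_oracle e) ?prog s ?s8 (?T e x)"
      by (intro runs_seq) (rule 1 s2(1) 3 4 s5(1) 6 s7' 8)+
    then show "\<exists>s'. runs (env_oracle e) ?prog s s' (?T e x) \<and> s' 0 = enc (fold (F e x) (xs e x) (a e x))"
      by (intro exI[of _ ?s8]) simp
  qed
qed

section \<open>Binary lengths of numbers and expressions\<close>

lemma floorlog_small: "floorlog 2 0 = 0" "floorlog 2 1 = 1" "floorlog 2 (Suc 0) = 1" "floorlog 2 2 = 2"
proof -
  show "floorlog 2 0 = 0" by (simp add: floorlog_eq_zero_iff)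
  then show one: "floorlog 2 1 = 1" using compute_floorlog[of 2 1] by simp
  then show "floorlog 2 (Suc 0) = 1" by simp
  show "floorlog 2 2 = 2" using compute_floorlog[of 2 2] one by simp
qed

lemma floorlog_le: "x < 2 ^ w \<Longrightarrow> floorlog 2 x \<le> w"
  by (rule floorlog_leI) auto

lemma less_floorlog: "x < 2 ^ floorlog 2 x"
  using floorlog_leD[of 2 x "floorlog 2 x"] by simp

lemma vsize_IntV_le: "\<bar>z\<bar> < 2 ^ w \<Longrightarrow> vsize (IntV z) \<le> 1 + w"
proof -
  assume "\<bar>z\<bar> < 2 ^ w"
  then have "nat \<bar>z\<bar> < 2 ^ w" by (simp add: nat_less_iff)
  then show ?thesis using floorlog_le by simp
qed

lemma abs_less_vsize: "\<bar>z\<bar> < 2 ^ (vsize (IntV z) - 1)"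
  using less_floorlog[of "nat \<bar>z\<bar>"] by (simp add: nat_less_iff)

lemma vsize_IntV_mono: "\<bar>z\<bar> \<le> \<bar>z'\<bar> \<Longrightarrow> vsize (IntV z) \<le> vsize (IntV z')"
  by (simp add: floorlog_mono)

lemma vsize_plus_le: "vsize (IntV (a + b)) \<le> vsize (IntV a) + vsize (IntV b)"
proof -
  let ?u = "vsize (IntV a) - 1" and ?v = "vsize (IntV b) - 1"
  have "\<bar>a + b\<bar> < 2 ^ ?u + 2 ^ ?v" using abs_less_vsize[of a] abs_less_vsize[of b] by linarith
  also have "\<dots> \<le> 2 ^ (?u + ?v) + (2 ^ (?u + ?v) :: int)"
    by (intro add_mono power_increasing) auto
  finally have "\<bar>a + b\<bar> < 2 ^ Suc (?u + ?v)" by simp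
  from vsize_IntV_le[OF this] show ?thesis by simp
qed

lemma vsize_times_le: "vsize (IntV (a * b)) \<le> vsize (IntV a) + vsize (IntV b)"
proof -
  let ?u = "vsize (IntV a) - 1" and ?v = "vsize (IntV b) - 1"
  have "\<bar>a * b\<bar> < 2 ^ ?u * 2 ^ ?v"
    unfolding abs_mult by (intro mult_strict_mono abs_less_vsize) auto
  then have "\<bar>a * b\<bar> < 2 ^ (?u + ?v)" by (simp add: power_add)
  from vsize_IntV_le[OF this] show ?thesis by simp
qed

lemma abs_div_le: "\<bar>a div b\<bar> \<le> \<bar>a :: int\<bar>"
proof -
  have pos: "\<bar>c div b\<bar> \<le> \<bar>c\<bar>" if "0 < b" for b c :: int
  proof -
    have "c div b \<le> \<bar>c\<bar> div b" using that by (intro zdiv_mono1) auto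
    also have "\<dots> \<le> \<bar>c\<bar> div 1" using that by (intro zdiv_mono2) auto
    finally have 1: "c div b \<le> \<bar>c\<bar>" by simp
    have "- \<bar>c\<bar> \<le> c div b"
    proof (cases "c < 0")
      case True
      then show ?thesis using zdiv_mono2_neg[of c 1 b] that by simp
    next
      case False
      then show ?thesis using that pos_imp_zdiv_nonneg_iff[of b c] by linarith
    qed
    with 1 show ?thesis by linarith
  qed
  show ?thesis
  proof (cases "b = 0")
    case False
    then show ?thesis using pos[of b a] pos[of "- b" "- a"] by (cases "0 < b") auto
  qed simp
qed

lemma abs_mod_le: "\<bar>a mod b\<bar> \<le> \<bar>a\<bar> + \<bar>b :: int\<bar>"
proof (cases "b = 0")
  case False
  then show ?thesis using abs_mod_less[of b a] by linarith
qed simp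

lemma vsize_binop: "vsize (apply_binop b u v) \<le> vsize u + vsize v + 2"
proof -
  have i: "vsize (IntV (int_of w)) \<le> vsize w" for w by (cases w) (auto simp: floorlog_small)
  have l: "vsize (ListV (list_of w)) \<le> vsize w" for w by (cases w) auto
  note I = i[of u] i[of v]
  show ?thesis
  proof (cases b)
    case Plus
    then show ?thesis using vsize_plus_le[of "int_of u" "int_of v"] I by simp
  next
    case Minus
    then show ?thesis using vsize_plus_le[of "int_of u" "- int_of v"] I by simp
  next
    case Times
    then show ?thesis using vsize_times_le[of "int_of u" "int_of v"] I by simp
  next
    case Quot
    then show ?thesis using vsize_IntV_mono[OF abs_div_le[of "int_of u" "int_of v"]] I by simp
  next
    case Rem
    have "vsize (IntV (int_of u mod int_of v)) \<le> vsize (IntV (\<bar>int_of u\<bar> + \<bar>int_of v\<bar>))"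
      by (rule vsize_IntV_mono) (use abs_mod_le[of "int_of u" "int_of v"] in simp)
    also have "\<dots> \<le> vsize (IntV (int_of u)) + vsize (IntV (int_of v))"
      using vsize_plus_le[of "\<bar>int_of u\<bar>" "\<bar>int_of v\<bar>"] by simp
    finally show ?thesis using I Rem by simp
  next
    case Cons_op
    then show ?thesis using l[of v] by simp
  qed (auto simp: bool_val_def floorlog_small)
qed

lemma vsize_unop: "vsize (apply_unop f v) \<le> vsize v + 2"
proof (cases f)
  case Head
  then show ?thesis by (cases v) (auto split: list.splits)
next
  case Tail
  have "sum_list (map vsize (tl vs)) \<le> sum_list (map vsize vs)" for vs
    by (cases vs) auto
  with Tail show ?thesis by (cases v) (auto simp: le_SucI)
qed (auto simp: bool_val_def floorlog_small)

primrec regs :: "expr \<Rightarrow> nat set" where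
  "regs (Reg r) = {r}"
| "regs (Const z) = {}"
| "regs Empty_list = {}"
| "regs (Unop f e) = regs e"
| "regs (Binop f e e') = regs e \<union> regs e'"

text \<open>Every operation returns at most the sum of the operand lengths plus a constant, so the
  factor \<open>k\<close> depends only on the shape of the expression. Additive constants are
  absorbed because lengths are at least 1.\<close>

lemma expr_bound:
  assumes "regs ex \<subseteq> {0}"
  shows "\<exists>k. \<forall>s. cost ex s \<le> k * vsize (s 0) \<and> vsize (eval_expr ex s) \<le> k * vsize (s 0)"
  using assms
proof (induction ex)
  case (Const z)
  have "vsize (IntV z) \<le> vsize (IntV z) * vsize v" for v
    using mult_le_mono2[OF vsize_pos[of v], of "vsize (IntV z)"] by (simp del: vsize.simps)
  then show ?case by (intro exI[of _ "vsize (IntV z)"]) (simp del: vsize.simps)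
next
  case Empty_list
  then show ?case by (intro exI[of _ 1]) (use vsize_pos in auto)
next
  case (Unop f e)
  then obtain k where k: "\<And>s. cost e s \<le> k * vsize (s 0) \<and> vsize (eval_expr e s) \<le> k * vsize (s 0)"
    by auto
  have "cost (Unop f e) s \<le> (2 * k + 3) * vsize (s 0)" "vsize (eval_expr (Unop f e) s) \<le> (2 * k + 3) * vsize (s 0)" for s
    using k[of s] vsize_unop[of f "eval_expr e s"] vsize_pos[of "s 0"] by (auto simp: algebra_simps)
  then show ?case by blast
next
  case (Binop f e e')
  then obtain k k' where k: "\<And>s. cost e s \<le> k * vsize (s 0) \<and> vsize (eval_expr e s) \<le> k * vsize (s 0)"
     "\<And>s. cost e' s \<le> k' * vsize (s 0) \<and> vsize (eval_expr e' s) \<le> k' * vsize (s 0)"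
    by auto
  have "cost (Binop f e e') s \<le> (2 * k + 2 * k' + 3) * vsize (s 0)"
     "vsize (eval_expr (Binop f e e') s) \<le> (2 * k + 2 * k' + 3) * vsize (s 0)" for s
    using k(1)[of s] k(2)[of s] vsize_binop[of f "eval_expr e s" "eval_expr e' s"] vsize_pos[of "s 0"]
    by (auto simp: algebra_simps)
  then show ?case by blast
qed (auto intro: exI[of _ 1])

lemma FP_expr:
  assumes "regs ex \<subseteq> {0}" "\<And>e x s. D e x \<Longrightarrow> s 0 = enc x \<Longrightarrow> eval_expr ex s = enc (f e x)"
  shows "FP D f"
proof -
  obtain k where k: "\<And>s. cost ex s \<le> k * vsize (s 0) \<and> vsize (eval_expr ex s) \<le> k * vsize (s 0)"
    using expr_bound[OF assms(1)] by metis
  have "pbd D (\<lambda>e x. 1 + 2 * k * esz x)"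
    by (intro pbd_add pbd_mult pbd_const pbd_esz_id)
  then show ?thesis
  proof (rule FP_I[of _ _ "Assign 0 ex"])
    fix e x and s :: state assume D: "D e x" and s: "s 0 = enc x"
    have "runs (env_oracle e) (Assign 0 ex) s (s(0 := enc (f e x))) (1 + 2 * k * esz x)"
      by (rule runs_assign) (use k[of s] s assms(2)[of e x s] D in auto)
    then show "\<exists>s'. runs (env_oracle e) (Assign 0 ex) s s' (1 + 2 * k * esz x) \<and> s' 0 = enc (f e x)"
      by (intro exI[of _ "s(0 := enc (f e x))"]) simp
  qed
qed

lemma val_expr: "\<exists>ex. regs ex = {} \<and> (\<forall>s. eval_expr ex s = v)"
proof (induction v)
  case (IntV z)
  then show ?case by (intro exI[of _ "Const z"]) simp
next
  case (ListV vs)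
  then show ?case
  proof (induction vs)
    case Nil
    then show ?case by (intro exI[of _ Empty_list]) simp
  next
    case (Cons v vs)
    obtain ex where "regs ex = {}" "\<forall>s. eval_expr ex s = v"
      using Cons.prems[of v] by auto
    moreover obtain ex' where "regs ex' = {}" "\<forall>s. eval_expr ex' s = ListV vs"
      using Cons.IH Cons.prems by auto
    ultimately show ?case by (intro exI[of _ "Binop Cons_op ex ex'"]) auto
  qed
qed

lemma FP_const: "FP D (\<lambda>e x. c)"
proof -
  obtain ex where "regs ex = {}" "\<forall>s. eval_expr ex s = enc c" using val_expr by blast
  then show ?thesis by (intro FP_expr[of ex]) auto
qed

lemma FP_expr1:
  assumes "FP D f" "regs ex \<subseteq> {0}" "\<And>e x s. D e x \<Longrightarrow> s 0 = enc (f e x) \<Longrightarrow> eval_expr ex s = enc (g e (f e x))"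
  shows "FP D (\<lambda>e x. g e (f e x))"
proof -
  have "FP (\<lambda>e y. \<exists>x. D e x \<and> y = f e x) g"
    by (rule FP_expr[OF assms(2)]) (use assms(3) in auto)
  from FP_comp[OF this assms(1)] show ?thesis by auto
qed

lemma FP_op:
  fixes f :: "env \<Rightarrow> 'a :: enc \<Rightarrow> 'b :: enc" and h :: "'b \<Rightarrow> 'c :: enc"
  assumes "FP D f" "regs ex \<subseteq> {0}" "\<And>e x s. D e x \<Longrightarrow> s 0 = enc (f e x) \<Longrightarrow> eval_expr ex s = enc (h (f e x))"
  shows "FP D (\<lambda>e x. h (f e x))"
  using FP_expr1[of D f ex "\<lambda>e. h"] assms by blast

abbreviation "arg1 \<equiv> Unop Head (Reg 0)"
abbreviation "arg2 \<equiv> Unop Head (Unop Tail (Reg 0))"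

lemma FP_op2:
  fixes f :: "env \<Rightarrow> 'a :: enc \<Rightarrow> 'b :: enc" and h :: "'b \<Rightarrow> 'd :: enc \<Rightarrow> 'c :: enc"
  assumes "FP D f" "FP D g"
    and "\<And>e x. D e x \<Longrightarrow> apply_binop b (enc (f e x)) (enc (g e x)) = enc (h (f e x) (g e x))"
  shows "FP D (\<lambda>e x. h (f e x) (g e x))"
  using FP_op[OF FP_Pair[OF assms(1,2)], of "Binop b arg1 arg2" "\<lambda>(u, v). h u v"] assms(3)
  by (auto simp: enc_prod_def)

lemma FP_comp2:
  assumes "FP D' (\<lambda>e z. h e (fst z) (snd z))" "FP D f" "FP D g" "\<And>e x. D e x \<Longrightarrow> D' e (f e x, g e x)"
  shows "FP D (\<lambda>e x. h e (f e x) (g e x))"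
  using FP_comp[OF assms(1) FP_Pair[OF assms(2,3)]] assms(4) by simp

lemma FP_comp3:
  assumes "FP D' (\<lambda>e z. h e (fst z) (fst (snd z)) (snd (snd z)))" "FP D f1" "FP D f2" "FP D f3"
    "\<And>e x. D e x \<Longrightarrow> D' e (f1 e x, f2 e x, f3 e x)"
  shows "FP D (\<lambda>e x. h e (f1 e x) (f2 e x) (f3 e x))"
  using FP_comp[OF assms(1) FP_Pair[OF assms(2) FP_Pair[OF assms(3,4)]]] assms(5) by simp

lemma FP_comp4:
  assumes "FP D' (\<lambda>e z. h e (fst z) (fst (snd z)) (fst (snd (snd z))) (snd (snd (snd z))))"
    "FP D f1" "FP D f2" "FP D f3" "FP D f4"
    "\<And>e x. D e x \<Longrightarrow> D' e (f1 e x, f2 e x, f3 e x, f4 e x)"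
  shows "FP D (\<lambda>e x. h e (f1 e x) (f2 e x) (f3 e x) (f4 e x))"
  using FP_comp[OF assms(1) FP_Pair[OF assms(2) FP_Pair[OF assms(3) FP_Pair[OF assms(4,5)]]]] assms(6) by simp

text \<open>The value of \<open>v\<close> becomes a second input, and the new domain remembers where
  it comes from, so facts about it stay available in the body.\<close>

lemma FP_Let:
  assumes "FP D g" "FP (\<lambda>e z. D e (fst z) \<and> snd z = g e (fst z)) (\<lambda>e z. F e (fst z) (snd z))"
  shows "FP D (\<lambda>e x. let v = g e x in F e x v)"
  unfolding Let_def by (rule FP_comp2[OF assms(2) FP_id assms(1)]) simp

section \<open>Arithmetic and lists in polynomial time\<close>

named_theorems fp

lemmas [fp] = FP_id FP_const FP_Pair pbd_const pbd_add pbd_mult pbd_FP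

lemma FP_fst [fp]: "FP D f \<Longrightarrow> FP D (\<lambda>e x. fst (f e x))"
  by (rule FP_op[of D f arg1]) (auto simp: enc_prod_def)

lemma FP_snd [fp]: "FP D f \<Longrightarrow> FP D (\<lambda>e x. snd (f e x))"
  by (rule FP_op[of D f arg2]) (auto simp: enc_prod_def)

lemma FP_plus [fp]: "FP D f \<Longrightarrow> FP D g \<Longrightarrow> FP D (\<lambda>e x. f e x + g e x :: int)"
  by (rule FP_op2[of _ _ _ Plus]) (auto simp: enc_defs)

lemma FP_minus [fp]: "FP D f \<Longrightarrow> FP D g \<Longrightarrow> FP D (\<lambda>e x. f e x - g e x :: int)"
  by (rule FP_op2[of _ _ _ Minus]) (auto simp: enc_defs)

lemma FP_times [fp]: "FP D f \<Longrightarrow> FP D g \<Longrightarrow> FP D (\<lambda>e x. f e x * g e x :: int)"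
  by (rule FP_op2[of _ _ _ Times]) (auto simp: enc_defs)

lemma FP_div [fp]: "FP D f \<Longrightarrow> FP D g \<Longrightarrow> FP D (\<lambda>e x. f e x div g e x :: int)"
  by (rule FP_op2[of _ _ _ Quot]) (auto simp: enc_defs)

lemma FP_less [fp]: "FP D f \<Longrightarrow> FP D g \<Longrightarrow> FP D (\<lambda>e x. (f e x :: int) < g e x)"
  by (rule FP_op2[of _ _ _ Less]) (auto simp: enc_defs)

lemma FP_eq [fp]: "FP D f \<Longrightarrow> FP D g \<Longrightarrow> FP D (\<lambda>e x. (f e x :: int) = g e x)"
  by (rule FP_op2[of _ _ _ Equal]) (auto simp: enc_defs)

lemma FP_plus_nat [fp]: "FP D f \<Longrightarrow> FP D g \<Longrightarrow> FP D (\<lambda>e x. f e x + g e x :: nat)"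
  by (rule FP_op2[of _ _ _ Plus]) (auto simp: enc_defs)

lemma FP_Suc [fp]: "FP D f \<Longrightarrow> FP D (\<lambda>e x. Suc (f e x))"
  using FP_plus_nat[OF _ FP_const[of _ 1]] by auto

lemma FP_less_nat [fp]: "FP D f \<Longrightarrow> FP D g \<Longrightarrow> FP D (\<lambda>e x. (f e x :: nat) < g e x)"
  by (rule FP_op2[of _ _ _ Less]) (auto simp: enc_defs)

lemma FP_eq_nat [fp]: "FP D f \<Longrightarrow> FP D g \<Longrightarrow> FP D (\<lambda>e x. (f e x :: nat) = g e x)"
  by (rule FP_op2[of _ _ _ Equal]) (auto simp: enc_defs)

lemma FP_int [fp]: "FP D f \<Longrightarrow> FP D (\<lambda>e x. int (f e x))"
  by (rule FP_op[of D f "Reg 0"]) (auto simp: enc_defs)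

lemma FP_not [fp]: "FP D f \<Longrightarrow> FP D (\<lambda>e x. \<not> f e x)"
  by (rule FP_op[of D f "Binop Minus (Const 1) (Reg 0)"]) (auto simp: enc_defs bool_val_def)

lemma FP_conj [fp]: "FP D f \<Longrightarrow> FP D g \<Longrightarrow> FP D (\<lambda>e x. f e x \<and> g e x)"
  by (rule FP_op2[of _ _ _ Times]) (auto simp: enc_defs bool_val_def)

lemma FP_disj [fp]:
  assumes "FP D f" "FP D g"
  shows "FP D (\<lambda>e x. f e x \<or> g e x)"
proof -
  have "FP D (\<lambda>e x. \<not> (\<not> f e x \<and> \<not> g e x))" by (intro fp assms)
  then show ?thesis by simp
qed

lemma FP_le [fp]:
  assumes "FP D f" "FP D g"
  shows "FP D (\<lambda>e x. (f e x :: int) \<le> g e x)"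
proof -
  have "FP D (\<lambda>e x. \<not> (g e x < f e x))" by (intro fp assms)
  then show ?thesis by (simp add: not_less)
qed

lemma FP_if [fp]:
  assumes "FP D b" "FP D f" "FP D g"
  shows "FP D (\<lambda>e x. if b e x then f e x else g e x)"
  by (rule FP_If[OF assms(1) FP_weaken[OF assms(2)] FP_weaken[OF assms(3)]]) auto

lemma FP_uminus [fp]:
  assumes "FP D f"
  shows "FP D (\<lambda>e x. - (f e x :: int))"
proof -
  have "FP D (\<lambda>e x. 0 - f e x)" by (intro fp assms)
  then show ?thesis by simp
qed

lemma FP_abs [fp]:
  assumes "FP D f"
  shows "FP D (\<lambda>e x. \<bar>f e x :: int\<bar>)"
proof -
  have "FP D (\<lambda>e x. if f e x < 0 then - f e x else f e x)" by (intro fp assms)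
  then show ?thesis by (simp add: abs_if)
qed

lemma FP_Cons [fp]: "FP D f \<Longrightarrow> FP D g \<Longrightarrow> FP D (\<lambda>e x. f e x # g e x)"
  by (rule FP_op2[of _ _ _ Cons_op]) (auto simp: enc_defs)

lemma FP_null [fp]: "FP D f \<Longrightarrow> FP D (\<lambda>e x. f e x = [])"
  by (rule FP_op[of D f "Binop Equal (Reg 0) Empty_list"]) (auto simp: enc_defs bool_val_def)

lemma FP_tl [fp]: "FP D f \<Longrightarrow> FP D (\<lambda>e x. tl (f e x))"
  by (rule FP_op[of D f "Unop Tail (Reg 0)"]) (auto simp: enc_defs map_tl)

text \<open>The promise matters: \<open>Head\<close> maps the empty list to an empty list, which
  need not be the code of \<open>hd []\<close>.\<close>

lemma FP_hd: "FP D f \<Longrightarrow> (\<And>e x. D e x \<Longrightarrow> f e x \<noteq> []) \<Longrightarrow> FP D (\<lambda>e x. hd (f e x))"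
  by (rule FP_op[of D f arg1]) (auto simp: enc_defs split: list.splits)

lemma FP_enc [fp]: "FP D f \<Longrightarrow> FP D (\<lambda>e x. enc (f e x))"
  by (rule FP_op[of D f "Reg 0"]) (auto simp: enc_val_def)

lemma sum_list_take_le: "sum_list (take k (xs :: nat list)) \<le> sum_list xs"
  by (metis append_take_drop_id le_add1 sum_list_append)

lemma esz_take: "esz (take k xs) \<le> esz xs"
  by (simp add: esz_list take_map[symmetric] sum_list_take_le)

lemma esz_rev [simp]: "esz (rev xs) = esz xs"
  by (simp add: esz_list rev_map[symmetric] sum_list_rev)

lemma esz_Cons: "esz (x # xs) = esz x + esz xs"
  by (simp add: esz_list)

lemma esz_append: "esz (xs @ ys) + 1 = esz xs + esz ys"
  by (simp add: esz_list)

lemma esz_nth: "i < length xs \<Longrightarrow> esz (xs ! i) < esz xs"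
  using member_le_sum_list[of "esz (xs ! i)" "map esz xs"] by (simp add: esz_list)

lemma esz_mem: "y \<in> set xs \<Longrightarrow> esz y < esz xs"
  using esz_nth by (metis in_set_conv_nth)

lemma FP_rev [fp]:
  assumes "FP D f"
  shows "FP D (\<lambda>e x. rev (f e x))"
proof -
  have "FP D (\<lambda>e x. fold (\<lambda>y s. y # s) (f e x) [])"
    by (rule FP_fold[where D' = "\<lambda>_ _. True" and I = "\<lambda>e x k s. s = rev (take k (f e x))" and B = "\<lambda>e x. esz (f e x)"])
      (intro assms fp | auto simp: take_Suc_conv_app_nth esz_take)+
  moreover have "fold (\<lambda>y s. y # s) xs [] = rev xs" for xs :: "'b list"
    by (simp add: fold_Cons_rev)
  ultimately show ?thesis by simp
qed

lemma FP_append [fp]: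
  assumes "FP D f" "FP D g"
  shows "FP D (\<lambda>e x. f e x @ g e x)"
proof -
  have le: "esz (rev (take k xs) @ ys) \<le> esz xs + esz ys" for k and xs ys :: "'b list"
    using esz_append[of "rev (take k xs)" ys] esz_take[of k xs] by simp
  have "FP D (\<lambda>e x. fold (\<lambda>y s. y # s) (rev (f e x)) (g e x))"
    by (rule FP_fold[where D' = "\<lambda>_ _. True" and I = "\<lambda>e x k s. s = rev (take k (rev (f e x))) @ g e x"
          and B = "\<lambda>e x. esz (f e x) + esz (g e x)"])
      (intro assms fp | auto simp: take_Suc_conv_app_nth intro: le[THEN le_trans])+
  moreover have "fold (\<lambda>y s. y # s) (rev xs) ys = xs @ ys" for xs ys :: "'b list"
    by (simp add: fold_Cons_rev)
  ultimately show ?thesis by simp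
qed

lemma esz_map_le: "(\<And>y. y \<in> set xs \<Longrightarrow> esz (f y) \<le> n) \<Longrightarrow> esz (map f xs) \<le> 1 + length xs * n"
proof (induction xs)
  case (Cons x xs)
  have "esz (f x) \<le> n" "esz (map f xs) \<le> 1 + length xs * n"
    using Cons by auto
  then show ?case by (simp add: esz_Cons)
qed (simp add: esz_list)

lemma FP_map:
  assumes xs: "FP D xs" and F: "FP D' (\<lambda>e z. F e (fst z) (snd z))"
    and D': "\<And>e x y. D e x \<Longrightarrow> y \<in> set (xs e x) \<Longrightarrow> D' e (x, y)"
  shows "FP D (\<lambda>e x. map (F e x) (xs e x))"
proof -
  have "pbd D (\<lambda>e x. 1 + esz x + esz (xs e x))" by (intro pbd_add pbd_const pbd_esz_id pbd_FP xs)
  from pbd_sup[OF pbd_FP[OF F] this] obtain H where H: "pbd D H"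
    "\<And>e x z. D e x \<Longrightarrow> D' e z \<Longrightarrow> esz z \<le> 1 + esz x + esz (xs e x) \<Longrightarrow> esz (F e (fst z) (snd z)) \<le> H e x"
    by metis
  have le: "esz (map (F e x) (take k (xs e x))) \<le> 1 + esz (xs e x) * H e x" if "D e x" for e x k
  proof -
    have "esz (F e x y) \<le> H e x" if "y \<in> set (take k (xs e x))" for y
    proof -
      have "y \<in> set (xs e x)" using that by (rule in_set_takeD)
      then show ?thesis using H(2)[OF \<open>D e x\<close> D'[OF \<open>D e x\<close>], of y] esz_mem[of y "xs e x"] by (simp add: esz_prod)
    qed
    then have "esz (map (F e x) (take k (xs e x))) \<le> 1 + length (take k (xs e x)) * H e x"
      by (rule esz_map_le)
    also have "\<dots> \<le> 1 + esz (xs e x) * H e x"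
      using length_le_esz[of "xs e x"] by (intro add_left_mono mult_right_mono) auto
    finally show ?thesis .
  qed
  have "FP D (\<lambda>e x. rev (fold (\<lambda>y s. F e x y # s) (xs e x) []))"
  proof (intro FP_rev, rule FP_fold[where I = "\<lambda>e x k s. s = rev (map (F e x) (take k (xs e x)))"
      and B = "\<lambda>e x. 1 + esz (xs e x) * H e x" and D' = "\<lambda>e z. D' e (fst z, fst (snd z))"])
    have "FP (\<lambda>e z. D' e (fst z, fst (snd z))) (\<lambda>e (z :: 'a \<times> 'b \<times> 'c list). F e (fst z) (fst (snd z)))"
      by (rule FP_comp2[OF F]) (intro fp | simp)+
    then show "FP (\<lambda>e z. D' e (fst z, fst (snd z))) (\<lambda>e (z :: 'a \<times> 'b \<times> 'c list). F e (fst z) (fst (snd z)) # snd (snd z))"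
      by (intro fp)
    show "pbd D (\<lambda>e x. 1 + esz (xs e x) * H e x)"
      by (intro pbd_add pbd_mult pbd_const pbd_FP xs H)
  qed (auto simp: take_Suc_conv_app_nth intro!: le[simplified] D' xs FP_const)
  moreover have "rev (fold (\<lambda>y s. G y # s) ys zs) = rev zs @ map G ys" for G :: "'b \<Rightarrow> 'c" and ys zs
    by (induction ys arbitrary: zs) auto
  ultimately show ?thesis by simp
qed

lemma esz_concat_le: "esz (concat xss) \<le> esz xss"
proof (induction xss)
  case (Cons xs xss)
  then show ?case using esz_append[of xs "concat xss"] by (simp add: esz_Cons)
qed (simp add: esz_list)

lemma FP_concat [fp]:
  assumes "FP D f"
  shows "FP D (\<lambda>e x. concat (f e x))"
proof -
  have "FP D (\<lambda>e x. fold (\<lambda>y s. s @ y) (f e x) [])"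
    by (rule FP_fold[where D' = "\<lambda>_ _. True" and I = "\<lambda>e x k s. s = concat (take k (f e x))" and B = "\<lambda>e x. esz (f e x)"])
      (intro assms fp |
       auto simp: take_Suc_conv_app_nth intro: le_trans[OF esz_concat_le esz_take])+
  moreover have "fold (\<lambda>y s. s @ y) xs ys = ys @ concat xs" for xs and ys :: "'b list"
    by (induction xs arbitrary: ys) auto
  ultimately show ?thesis by simp
qed

lemma FP_filter:
  assumes xs: "FP D xs" and F: "FP D' (\<lambda>e z. F e (fst z) (snd z))"
    and D': "\<And>e x y. D e x \<Longrightarrow> y \<in> set (xs e x) \<Longrightarrow> D' e (x, y)"
  shows "FP D (\<lambda>e x. filter (F e x) (xs e x))"
proof -
  have "FP D (\<lambda>e x. concat (map (\<lambda>y. if F e x y then [y] else []) (xs e x)))"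
    by (intro FP_concat FP_map[where D' = D' and F = "\<lambda>e x y. if F e x y then [y] else []"] xs fp F D')
  moreover have "concat (map (\<lambda>y. if G y then [y] else []) ys) = filter G ys" for G and ys :: "'b list"
    by (induction ys) auto
  ultimately show ?thesis by simp
qed

lemma esz_zip_le: "esz (zip xs ys) \<le> 2 * (esz xs + esz ys)"
proof (induction xs ys rule: list_induct2')
  case (4 x xs y ys)
  then show ?case using vsize_pos[of "enc x"] by (simp add: esz_Cons esz_prod)
qed (simp_all add: esz_list)

lemma FP_zip [fp]:
  assumes f: "FP D f" and g: "FP D g"
  shows "FP D (\<lambda>e x. zip (f e x) (g e x))"
proof -
  let ?F = "\<lambda>y s. if fst s = [] then s else (tl (fst s), (y, hd (fst s)) # snd s)"
  have fold: "fold ?F us (vs, ws) = (drop (length us) vs, rev (zip us vs) @ ws)"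
    for us :: "'b list" and vs :: "'c list" and ws
  proof (induction us arbitrary: vs ws)
    case (Cons u us)
    show ?case
    proof (cases vs)
      case Nil
      then show ?thesis using Cons[of Nil ws] by simp
    qed (simp add: Cons)
  qed simp
  let ?I = "\<lambda>e x k s. s = fold ?F (take k (f e x)) (g e x, [])"
  have "FP D (\<lambda>e x. rev (snd (fold ?F (f e x) (g e x, []))))"
  proof (intro FP_rev FP_snd, rule FP_fold[where I = ?I and D' = "\<lambda>_ _. True"
      and B = "\<lambda>e x. 1 + 3 * (esz (f e x) + esz (g e x))"])
    show "FP (\<lambda>_ _. True) (\<lambda>e (z :: 'a \<times> 'b \<times> 'c list \<times> ('b \<times> 'c) list). ?F (fst (snd z)) (snd (snd z)))"
    proof (rule FP_If)
      show "FP (\<lambda>e x. True \<and> fst (snd (snd x)) \<noteq> [])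
         (\<lambda>e (x :: 'a \<times> 'b \<times> 'c list \<times> ('b \<times> 'c) list).
            (tl (fst (snd (snd x))), (fst (snd x), hd (fst (snd (snd x)))) # snd (snd (snd x))))"
        by (intro fp FP_hd) auto
    qed (intro fp)+
    show "pbd D (\<lambda>e x. 1 + 3 * (esz (f e x) + esz (g e x)))"
      by (intro pbd_add pbd_mult pbd_const pbd_FP f g)
    show "esz s \<le> 1 + 3 * (esz (f e x) + esz (g e x))" if "?I e x k s" for e x k s
    proof -
      have "esz (drop n ys) \<le> esz ys" for n and ys :: "'c list"
        using esz_append[of "take n ys" "drop n ys"] vsize_pos[of "enc (take n ys)"] by simp
      note 1 = this[of "length (take k (f e x))" "g e x"]
      have 2: "esz (zip (take k (f e x)) (g e x)) \<le> 2 * (esz (f e x) + esz (g e x))"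
        by (rule order.trans[OF esz_zip_le]) (simp add: esz_take)
      have "s = (drop (length (take k (f e x))) (g e x), rev (zip (take k (f e x)) (g e x)))"
        using that unfolding fold by simp
      then show ?thesis using 1 2 by (simp add: esz_prod del: length_take)
    qed
  qed (auto simp: take_Suc_conv_app_nth intro!: f g FP_Pair FP_const)
  then show ?thesis unfolding fold by simp
qed

text \<open>There is no random access: a fold counts the index down and catches the entry met at 0.
  The default makes the function total, which is why programs index with \<open>nth_default\<close>
  throughout.\<close>

lemma FP_nth_default [fp]:
  assumes xs: "FP D xs" and i: "FP D i"
  shows "FP D (\<lambda>e x. nth_default d (xs e x) (i e x))"
proof -
  let ?F = "\<lambda>y (s :: int \<times> 'b). (fst s - 1, if fst s = 0 then y else snd s)"
  have fold: "fold ?F ys (n, v) = (n - int (length ys), if 0 \<le> n \<and> n < int (length ys) then ys ! nat n else v)" for ys n v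
    by (induction ys arbitrary: n v) (auto simp: nth_Cons' nat_diff_distrib)
  let ?I = "\<lambda>e x k s. s = fold ?F (take k (xs e x)) (int (i e x), d)"
  let ?B = "\<lambda>e x. 2 + esz (i e x) + 2 * esz (xs e x) + esz d"
  have "FP D (\<lambda>e x. snd (fold ?F (xs e x) (int (i e x), d)))"
  proof (intro FP_snd, rule FP_fold[where I = ?I and D' = "\<lambda>_ _. True"
      and B = ?B])
    show "FP (\<lambda>_ _. True) (\<lambda>e z. ?F (fst (snd z)) (snd (snd z)))"
      by (intro fp)
    show "pbd D ?B"
      by (intro pbd_add pbd_mult pbd_const pbd_FP xs i)
    show "esz s \<le> ?B e x" if "?I e x k s" "k \<le> length (xs e x)" for e x k s
    proof -
      have "\<bar>int (i e x) - int k\<bar> \<le> int (i e x) + int k" by linarith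
      then have "vsize (IntV (int (i e x) - int k)) \<le> vsize (IntV (int (i e x) + int k))"
        by (intro vsize_IntV_mono) simp
      also have "\<dots> \<le> vsize (IntV (int (i e x))) + vsize (IntV (int k))"
        by (rule vsize_plus_le)
      also have "vsize (IntV (int k)) \<le> 1 + k"
        by (rule vsize_IntV_le) (simp add: of_nat_less_two_power)
      finally have 1: "esz (int (i e x) - int k) \<le> esz (i e x) + 1 + esz (xs e x)"
        using that(2) length_le_esz[of "xs e x"] by (simp add: enc_defs)
      have "snd s = d \<or> snd s \<in> set (xs e x)"
        using that(1) unfolding fold by (auto simp: min_def nat_less_iff split: if_splits)
      then have "esz (snd s) \<le> esz (xs e x) + esz d"
        using esz_mem[of "snd s" "xs e x"] by auto
      moreover have "fst s = int (i e x) - int k"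
        using that unfolding fold by simp
      ultimately show ?thesis
        using 1 by (cases s) (simp add: esz_prod)
    qed
  qed (auto simp: take_Suc_conv_app_nth intro!: xs i fp)
  then show ?thesis unfolding fold by (simp add: nth_default_def cong: if_cong)
qed

text \<open>Only the length matters: the list is the fuel of a fold with as many rounds as
  \<open>z\<close> has binary digits.\<close>

definition bits :: "int \<Rightarrow> int list" where
  "bits z = replicate (floorlog 2 (nat z)) 0"

lemma esz_replicate_0: "esz (replicate n (0 :: int)) = 1 + n"
  by (simp add: esz_list enc_int_def floorlog_small sum_list_replicate)

text \<open>A halving loop has to be written directly, because a fold presupposes a list to run over
  and this is the function that produces such lists from numbers.\<close>

lemma FP_bits [fp]:
  assumes "FP D f"
  shows "FP D (\<lambda>e x. bits (f e x))"
proof -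
  let ?test = "Binop Less (Const 0) (Reg 0)"
  let ?body = "Seq (Assign 1 (Binop Cons_op (Const 0) (Reg 1))) (Assign 0 (Binop Quot (Reg 0) (Const 2)))"
  let ?prog = "Seq (Assign 1 Empty_list) (Seq (While ?test ?body) (Assign 0 (Reg 1)))"
  define W where "W z = 40 * vsize (IntV z)" for z
  have step: "\<exists>s'. runs orc (While ?test ?body) s s' ((floorlog 2 (nat z) + 1) * (3 * W y)) \<and>
      s' 1 = enc (replicate (floorlog 2 (nat z) + k) (0 :: int))"
    if "s 0 = IntV z" "s 1 = enc (replicate k (0 :: int))"
      "vsize (IntV z) \<le> vsize (IntV y)" "floorlog 2 (nat z) + k \<le> vsize (IntV y)" for orc s z k y
    using that
  proof (induction "floorlog 2 (nat z)" arbitrary: s z k)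
    case 0
    then have "z \<le> 0" by (auto simp: floorlog_eq_zero_iff)
    have "runs orc (While ?test ?body) s s ((floorlog 2 (nat z) + 1) * (3 * W y))"
      by (rule runs_while_false) (use 0 \<open>z \<le> 0\<close> in \<open>auto simp: bool_val_def W_def floorlog_small\<close>)
    then show ?case using 0 by auto
  next
    case (Suc n)
    then have "0 < z" by (cases "0 < z") (auto simp: floorlog_small)
    then have fl: "floorlog 2 (nat z) = floorlog 2 (nat (z div 2)) + 1"
      using compute_floorlog[of 2 "nat z"] by (simp add: nat_div_distrib)
    let ?s1 = "s(1 := enc (replicate (Suc k) (0 :: int)))"
    have k: "vsize (s 1) \<le> 1 + vsize (IntV y)" using Suc.prems esz_replicate_0[of k] by simp
    have 1: "runs orc (Assign 1 (Binop Cons_op (Const 0) (Reg 1))) s ?s1 (W y)"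
      by (rule runs_assign) (use Suc.prems k in \<open>auto simp: enc_defs W_def floorlog_small esz_replicate_0\<close>)
    let ?s2 = "?s1(0 := IntV (z div 2))"
    have d: "vsize (IntV (z div 2)) \<le> vsize (IntV z)" by (rule vsize_IntV_mono[OF abs_div_le])
    have 2: "runs orc (Assign 0 (Binop Quot (Reg 0) (Const 2))) ?s1 ?s2 (W y)"
      by (rule runs_assign) (use Suc.prems d in \<open>auto simp: W_def floorlog_small\<close>)
    have "n = floorlog 2 (nat (z div 2))" using Suc.hyps fl by simp
    moreover have "?s2 0 = IntV (z div 2)" "?s2 1 = enc (replicate (Suc k) (0 :: int))" by simp_all
    moreover have "vsize (IntV (z div 2)) \<le> vsize (IntV y)" using d Suc.prems(3) by linarith
    moreover have "floorlog 2 (nat (z div 2)) + Suc k \<le> vsize (IntV y)" using fl Suc.prems(4) by simp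
    ultimately obtain s' where
      s': "runs orc (While ?test ?body) ?s2 s' ((floorlog 2 (nat (z div 2)) + 1) * (3 * W y))"
      "s' 1 = enc (replicate (floorlog 2 (nat (z div 2)) + Suc k) (0 :: int))"
      using Suc.hyps(1)[of "z div 2" ?s2 "Suc k"] by blast
    have "runs orc (While ?test ?body) s s' ((floorlog 2 (nat z) + 1) * (3 * W y))"
    proof (rule runs_while_true[OF _ runs_seq[OF 1 2] s'(1)])
      show "eval_expr ?test s \<noteq> IntV 0" using Suc.prems \<open>0 < z\<close> by (simp add: bool_val_def)
      have "1 + cost ?test s \<le> W y" using Suc.prems by (auto simp: W_def floorlog_small)
      then show "1 + cost ?test s + (W y + W y) + (floorlog 2 (nat (z div 2)) + 1) * (3 * W y)
        \<le> (floorlog 2 (nat z) + 1) * (3 * W y)" unfolding fl by simp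
    qed
    then show ?case using s'(2) fl by auto
  qed
  let ?T = "\<lambda>(e :: env) (z :: int). 5 + ((esz z + 1) * (3 * (40 * esz z)) + 5 * (1 + esz z))"
  have "FP (\<lambda>_ _. True) (\<lambda>e z. bits z)"
  proof (rule FP_I[of _ ?T ?prog])
    show "pbd (\<lambda>_ _. True) ?T" by (intro pbd_add pbd_mult pbd_const pbd_esz_id)
    fix e :: env and z :: int and s :: state assume s: "s 0 = enc z"
    have fl: "floorlog 2 (nat z) \<le> vsize (IntV z)" by (auto simp: floorlog_mono intro!: le_SucI)
    let ?s1 = "s(1 := ListV [])"
    have 1: "runs (env_oracle e) (Assign 1 Empty_list) s ?s1 5"
      by (rule runs_assign) auto
    obtain s2 where s2: "runs (env_oracle e) (While ?test ?body) ?s1 s2 ((floorlog 2 (nat z) + 1) * (3 * W z))"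
      "s2 1 = enc (replicate (floorlog 2 (nat z)) (0 :: int))"
      using step[of ?s1 z 0 z "env_oracle e"] s fl by (auto simp: enc_defs)
    have s2': "runs (env_oracle e) (While ?test ?body) ?s1 s2 ((esz z + 1) * (3 * (40 * esz z)))"
      by (rule runs_mono[OF s2(1)]) (use fl in \<open>auto simp: W_def enc_int_def simp del: vsize.simps intro!: mult_mono\<close>)
    have 3: "runs (env_oracle e) (Assign 0 (Reg 1)) s2 (s2(0 := enc (bits z))) (5 * (1 + esz z))"
      by (rule runs_assign) (use s2 fl esz_replicate_0[of "floorlog 2 (nat z)"] in \<open>auto simp: bits_def enc_int_def\<close>)
    have "runs (env_oracle e) ?prog s (s2(0 := enc (bits z))) (?T e z)"
      by (intro runs_seq) (rule 1 s2' 3)+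
    then show "\<exists>s'. runs (env_oracle e) ?prog s s' (?T e z) \<and> s' 0 = enc (bits z)"
      by (intro exI[of _ "s2(0 := enc (bits z))"]) simp
  qed
  from FP_comp[OF this assms] show ?thesis by simp
qed

lemma esz_sum_list_le: "esz (sum_list xs) \<le> 2 + esz (xs :: int list)"
proof (induction xs)
  case (Cons x xs)
  then show ?case using vsize_plus_le[of x "sum_list xs"] vsize_pos[of "enc x"]
    by (simp add: esz_Cons enc_int_def del: vsize.simps)
qed (simp add: enc_defs floorlog_small)

lemma esz_prod_list_le: "esz (prod_list xs) \<le> 2 + esz (xs :: int list)"
proof (induction xs)
  case (Cons x xs)
  then show ?case using vsize_times_le[of x "prod_list xs"] vsize_pos[of "enc x"]
    by (simp add: esz_Cons enc_int_def del: vsize.simps)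
qed (simp add: enc_defs floorlog_small)

lemma FP_sum_list [fp]:
  assumes "FP D f"
  shows "FP D (\<lambda>e x. sum_list (f e x) :: int)"
proof -
  have B: "pbd D (\<lambda>e x. 2 + esz (f e x))" by (intro pbd_add pbd_const pbd_FP assms)
  have "FP D (\<lambda>e x. fold (\<lambda>y s. s + y) (f e x) 0)"
    by (rule FP_fold[OF _ _ _ _ _ _ B, where D' = "\<lambda>_ _. True" and I = "\<lambda>e x k s. s = sum_list (take k (f e x))"])
      (intro assms fp |
       auto simp: take_Suc_conv_app_nth simp del: add_2_eq_Suc add_2_eq_Suc' intro!: le_trans[OF esz_sum_list_le] esz_take)+
  moreover have "fold (\<lambda>y s. s + y) xs y = y + sum_list xs" for xs and y :: int
    by (induction xs arbitrary: y) auto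
  ultimately show ?thesis by simp
qed

text \<open>Lengths add up under multiplication, so partial products are no longer than the list.
  Powers with a unary exponent are therefore expressed as products of constant lists.\<close>

lemma FP_prod_list [fp]:
  assumes "FP D f"
  shows "FP D (\<lambda>e x. prod_list (f e x) :: int)"
proof -
  have B: "pbd D (\<lambda>e x. 2 + esz (f e x))" by (intro pbd_add pbd_const pbd_FP assms)
  have "FP D (\<lambda>e x. fold (\<lambda>y s. s * y) (f e x) 1)"
    by (rule FP_fold[OF _ _ _ _ _ _ B, where D' = "\<lambda>_ _. True" and I = "\<lambda>e x k s. s = prod_list (take k (f e x))"])
      (intro assms fp |
       auto simp: take_Suc_conv_app_nth simp del: add_2_eq_Suc add_2_eq_Suc' intro!: le_trans[OF esz_prod_list_le] esz_take)+
  moreover have "fold (\<lambda>y s. s * y) xs y = y * prod_list xs" for xs and y :: int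
    by (induction xs arbitrary: y) auto
  ultimately show ?thesis by simp
qed

lemma FP_Ask:
  assumes f: "FP D f" and B: "pbd D B"
    and le: "\<And>e x. D e x \<Longrightarrow> vsize (env_oracle e k (enc (f e x))) \<le> B e x"
  shows "FP D (\<lambda>e x. env_oracle e k (enc (f e x)))"
proof -
  obtain c T where c: "pbd D T" "computes c D f T"
    using assms(1) by (auto simp: FP_def)
  note c = c(1) computesD[OF c(2)]
  let ?T = "\<lambda>e x. T e x + (1 + 2 * esz (f e x) + B e x)"
  have "pbd D ?T" by (intro pbd_add pbd_mult pbd_const pbd_FP c B f)
  then show ?thesis
  proof (rule FP_I[of _ _ "Seq c (Ask 0 k (Reg 0))"])
    fix e x and s :: state assume D: "D e x" and s: "s 0 = enc x"
    obtain s' where s': "runs (env_oracle e) c s s' (T e x)" "s' 0 = enc (f e x)"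
      using c(2)[of e x s] D s by blast
    have "runs (env_oracle e) (Ask 0 k (Reg 0)) s' (s'(0 := env_oracle e k (enc (f e x)))) (1 + 2 * esz (f e x) + B e x)"
      by (rule runs_ask) (use s'(2) le[OF D] in auto)
    from runs_seq[OF s'(1) this]
    show "\<exists>s'. runs (env_oracle e) (Seq c (Ask 0 k (Reg 0))) s s' (?T e x) \<and>
        s' 0 = enc (env_oracle e k (enc (f e x)))"
      by (intro exI[of _ "s'(0 := env_oracle e k (enc (f e x)))"]) (simp add: enc_val_def)
  qed
qed

lemma FP_Is_int [fp]:
  assumes "FP D f"
  shows "FP D (\<lambda>e x. case f e x of IntV z \<Rightarrow> True | ListV vs \<Rightarrow> False)"
  by (rule FP_op[OF assms, of "Unop Is_int (Reg 0)"]) (auto simp: enc_defs)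

lemma FP_iteration_list:
  assumes "FP D f" "FP D g"
  shows "FP D (\<lambda>e x. concat (map (\<lambda>_. g e x) (f e x)))"
  by (intro FP_concat FP_map[where D' = "\<lambda>e z. D e (fst z)" and F = "\<lambda>e x _. g e x"] assms
      FP_comp[OF assms(2)] fp) auto

section \<open>Schur complements of Gram matrices\<close>

text \<open>\<open>schur g k i j\<close> is the inner product of the \<open>i\<close>-th and the \<open>j\<close>-th basis vector after projection
  onto the orthogonal complement of the first \<open>k\<close> basis vectors, where \<open>g\<close> is the Gram matrix; thus
  \<open>pivot g k\<close> is the squared length of the \<open>k\<close>-th Gram-Schmidt vector.\<close>

fun schur :: "(nat \<Rightarrow> nat \<Rightarrow> real) \<Rightarrow> nat \<Rightarrow> nat \<Rightarrow> nat \<Rightarrow> real" where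
  "schur g 0 i j = g i j"
| "schur g (Suc k) i j = schur g k i j - schur g k i k * schur g k j k / schur g k k k"

definition pivot :: "(nat \<Rightarrow> nat \<Rightarrow> real) \<Rightarrow> nat \<Rightarrow> real" where
  "pivot g k = schur g k k k"

definition gram_minor :: "(nat \<Rightarrow> nat \<Rightarrow> real) \<Rightarrow> nat \<Rightarrow> real" where
  "gram_minor g k = (\<Prod>l<k. pivot g l)"

lemma schur_0: "schur g 0 = g"
  by (intro ext) simp

lemma gram_minor_Suc: "gram_minor g (Suc k) = gram_minor g k * pivot g k"
  by (simp add: gram_minor_def)

text \<open>Positive pivots express that the first \<open>N\<close> vectors are linearly
  independent.\<close>

locale gram_matrix =
  fixes g :: "nat \<Rightarrow> nat \<Rightarrow> real" and N :: nat
  assumes sym: "g i j = g j i"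
    and pivot_pos: "k < N \<Longrightarrow> 0 < pivot g k"
begin

lemma schur_sym: "schur g k i j = schur g k j i"
proof (induction k arbitrary: i j)
  case 0
  then show ?case using sym by simp
next
  case (Suc k)
  then show ?case using Suc.IH[of i j] by (simp add: mult.commute)
qed

lemma schur_pos: "k < N \<Longrightarrow> 0 < schur g k k k"
  using pivot_pos by (simp add: pivot_def)

lemma schur_zero:
  assumes "k \<le> N" "j < k"
  shows "schur g k i j = 0"
  using assms
proof (induction k arbitrary: i)
  case (Suc k)
  have p: "schur g k k k \<noteq> 0" using schur_pos[of k] Suc.prems by simp
  show ?case
  proof (cases "j = k")
    case False
    then have j: "j < k" using Suc.prems by simp
    have z: "schur g k i' j = 0" for i' using Suc.IH[of i'] Suc.prems j by simp
    show ?thesis by (simp add: z schur_sym[of k j k])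
  qed (use p in simp)
qed simp

lemma schur_zero':
  assumes "k \<le> N" "j < k"
  shows "schur g k j i = 0"
  using schur_zero[OF assms] schur_sym by simp

lemma schur_sum: "schur g k i j = schur g m i j - (\<Sum>l=m..<k. schur g l i l * schur g l j l / pivot g l)"
  if "m \<le> k"
  using that by (induction k rule: dec_induct) (auto simp: pivot_def)

text \<open>After \<open>k\<close> projections nothing is left of vector \<open>j < k\<close>, so
  the unrolled recursion has no remainder. This is the triangular factorization of the Gram
  matrix.\<close>

lemma gram_sum:
  assumes "k \<le> N" "j < k"
  shows "g i j = (\<Sum>l<k. schur g l i l * schur g l j l / pivot g l)"
  using schur_sum[of 0 k i j] schur_zero[OF assms] by (simp add: atLeast0LessThan)

text \<open>For \<open>i \<ge> k\<close> the entry is the pivot at \<open>i\<close> plus the squares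
  removed between steps \<open>k\<close> and \<open>i\<close>.\<close>

lemma schur_diag_nonneg:
  assumes "k \<le> N" "i < N"
  shows "0 \<le> schur g k i i"
proof (cases "i < k")
  case True
  then show ?thesis using schur_zero[OF assms(1)] by simp
next
  case False
  have "0 \<le> (\<Sum>l=k..<i. schur g l i l * schur g l i l / pivot g l)"
    using assms pivot_pos by (intro sum_nonneg) (auto simp: less_imp_le)
  then show ?thesis using schur_sum[of k i i i] False schur_pos[of i] assms by simp
qed

lemma sum_squares_le:
  assumes "k \<le> N" "i < N"
  shows "(\<Sum>l<k. (schur g l i l)\<^sup>2 / pivot g l) \<le> g i i"
  using schur_diag_nonneg[OF assms] schur_sum[of 0 k i i]
  by (simp add: atLeast0LessThan power2_eq_square)

lemma pivot_le:
  assumes "k < N"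
  shows "pivot g k \<le> g k k"
proof -
  have "0 \<le> (\<Sum>l<k. schur g l k l * schur g l k l / pivot g l)"
    using pivot_pos assms by (intro sum_nonneg) (auto simp: less_imp_le)
  then show ?thesis using schur_sum[of 0 k k k] by (simp add: pivot_def[of g k] atLeast0LessThan)
qed

text \<open>Each subtracted product is split by the arithmetic-geometric mean inequality, and both
  sums are bounded by Bessel's inequality \<open>sum_squares_le\<close>; no square roots occur. The
  lemma limits the numbers that arise in the elimination.\<close>

lemma abs_schur_le:
  assumes "k \<le> N" "i < N" "j < N"
  shows "\<bar>schur g k i j\<bar> \<le> \<bar>g i j\<bar> + (g i i + g j j) / 2"
proof -
  have "\<bar>schur g l i l * schur g l j l / pivot g l\<bar>
      \<le> ((schur g l i l)\<^sup>2 / pivot g l + (schur g l j l)\<^sup>2 / pivot g l) / 2" if "l < k" for l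
  proof -
    have p: "0 < pivot g l" using that assms pivot_pos by simp
    have "\<bar>schur g l i l * schur g l j l\<bar> \<le> ((schur g l i l)\<^sup>2 + (schur g l j l)\<^sup>2) / 2"
      using sum_squares_bound[of "\<bar>schur g l i l\<bar>" "\<bar>schur g l j l\<bar>"] by (simp add: abs_mult)
    from divide_right_mono[OF this less_imp_le[OF p]]
    have "\<bar>schur g l i l * schur g l j l\<bar> / pivot g l
        \<le> ((schur g l i l)\<^sup>2 + (schur g l j l)\<^sup>2) / 2 / pivot g l" .
    moreover have "\<bar>schur g l i l * schur g l j l / pivot g l\<bar> = \<bar>schur g l i l * schur g l j l\<bar> / pivot g l"
      using p by (simp only: abs_divide abs_of_pos)
    moreover have "((schur g l i l)\<^sup>2 + (schur g l j l)\<^sup>2) / 2 / pivot g l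
        = ((schur g l i l)\<^sup>2 / pivot g l + (schur g l j l)\<^sup>2 / pivot g l) / 2"
      by (simp only: add_divide_distrib divide_divide_eq_left mult.commute)
    ultimately show ?thesis by (simp only:)
  qed
  then have "\<bar>\<Sum>l<k. schur g l i l * schur g l j l / pivot g l\<bar>
      \<le> (\<Sum>l<k. ((schur g l i l)\<^sup>2 / pivot g l + (schur g l j l)\<^sup>2 / pivot g l) / 2)"
    by (intro order.trans[OF sum_abs] sum_mono) simp
  also have "\<dots> \<le> (g i i + g j j) / 2"
    using sum_squares_le[OF assms(1,2)] sum_squares_le[OF assms(1,3)]
    by (simp add: sum_divide_distrib[symmetric] sum.distrib)
  finally have "\<bar>\<Sum>l<k. schur g l i l * schur g l j l / pivot g l\<bar> \<le> (g i i + g j j) / 2" .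
  moreover have "schur g k i j = g i j - (\<Sum>l<k. schur g l i l * schur g l j l / pivot g l)"
    using schur_sum[of 0 k i j] by (simp add: atLeast0LessThan)
  ultimately show ?thesis by linarith
qed

lemma gram_minor_pos: "k \<le> N \<Longrightarrow> 0 < gram_minor g k"
  unfolding gram_minor_def using pivot_pos by (intro prod_pos) auto

text \<open>The projection subtracts a combination of the first \<open>k\<close> vectors. What
  matters is that its coefficients are the same for all \<open>j\<close>.\<close>

lemma schur_coefficients: "\<exists>c. \<forall>j. schur g k i j = g i j - (\<Sum>l<k. c l * g l j)"
proof (induction k arbitrary: i)
  case (Suc k)
  obtain c where c: "\<And>j. schur g k i j = g i j - (\<Sum>l<k. c l * g l j)" using Suc by blast
  obtain c' where c': "\<And>j. schur g k k j = g k j - (\<Sum>l<k. c' l * g l j)" using Suc by blast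
  define t where "t = schur g k i k / schur g k k k"
  have "schur g (Suc k) i j = g i j - (\<Sum>l<Suc k. (if l = k then t else c l - t * c' l) * g l j)" for j
  proof -
    have "schur g (Suc k) i j = schur g k i j - t * schur g k k j"
      by (simp add: t_def schur_sym[of k j k])
    also have "\<dots> = g i j - ((\<Sum>l<k. (c l - t * c' l) * g l j) + t * g k j)"
      by (simp add: c c' algebra_simps sum_subtractf sum_distrib_left)
    finally show ?thesis by simp
  qed
  then show ?case by (intro exI[of _ "\<lambda>l. if l = k then t else c l - t * c' l"]) blast
qed simp

lemma det_gram:
  assumes "k \<le> N"
  shows "det (mat k k (\<lambda>(i, j). g i j)) = gram_minor g k"
proof -
  let ?M = "mat k k (\<lambda>(i, l). schur g l i l / pivot g l)"
  let ?U = "mat k k (\<lambda>(l, j). schur g l j l)"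
  have "mat k k (\<lambda>(i, j). g i j) = ?M * ?U"
    using gram_sum[OF assms]
    by (intro eq_matI) (auto simp: scalar_prod_def atLeast0LessThan)
  then have "det (mat k k (\<lambda>(i, j). g i j)) = det ?M * det ?U"
    by (simp add: det_mult[of ?M k ?U])
  also have "det ?M = prod_list (diag_mat ?M)"
    by (rule det_lower_triangular[of k]) (use schur_zero' assms in auto)
  also have "\<dots> = (\<Prod>l<k. 1)"
  proof -
    have 1: "?M $$ (l, l) = 1" if "l < k" for l
      using that schur_pos[of l] assms by (simp add: pivot_def)
    have "prod_list (diag_mat ?M) = (\<Prod>l<k. ?M $$ (l, l))"
      by (simp add: prod_list_diag_prod atLeast0LessThan)
    also have "\<dots> = (\<Prod>l<k. 1)" by (intro prod.cong refl) (rule 1, simp)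
    finally show ?thesis .
  qed
  also have "det ?U = prod_list (diag_mat ?U)"
    by (rule det_upper_triangular[of _ k]) (use schur_zero' assms in \<open>auto intro!: upper_triangularI\<close>)
  also have "\<dots> = gram_minor g k"
    unfolding prod_list_diag_prod gram_minor_def by (auto simp: pivot_def atLeast0LessThan)
  finally show ?thesis by simp
qed

text \<open>Cramer's rule expresses both numbers as determinants.\<close>

lemma gram_minor_schur_int:
  assumes int: "\<And>i j. g i j \<in> \<int>" and k: "k \<le> N"
  shows "gram_minor g k \<in> \<int>" "gram_minor g k * schur g k i j \<in> \<int>"
proof -
  define G where "G = mat k k (\<lambda>(i, j). \<lfloor>g i j\<rfloor>)"
  have G: "G \<in> carrier_mat k k" by (simp add: G_def)
  have "map_mat real_of_int G = mat k k (\<lambda>(i, j). g i j)"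
    using int by (auto simp: G_def)
  then have det: "real_of_int (det G) = gram_minor g k"
    using det_gram[OF k] by (metis of_int_hom.hom_det)
  then show "gram_minor g k \<in> \<int>" by (metis Ints_of_int)
  obtain c where c: "\<And>j. schur g k i j = g i j - (\<Sum>l<k. c l * g l j)"
    using schur_coefficients by blast
  have "gram_minor g k * c m \<in> \<int>" if m: "m < k" for m
  proof -
    have adj: "(\<Sum>j<k. G $$ (l, j) * adj_mat G $$ (j, m)) = (if l = m then det G else 0)" if "l < k" for l
    proof -
      have "(G * adj_mat G) $$ (l, m) = (\<Sum>j<k. G $$ (l, j) * adj_mat G $$ (j, m))"
        using that m G adj_mat(1)[OF G] by (simp add: scalar_prod_def atLeast0LessThan)
      then show ?thesis using that m adj_mat(2)[OF G] by (cases "l = m") simp_all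
    qed
    have adj': "(\<Sum>j<k. g l j * real_of_int (adj_mat G $$ (j, m))) = (if l = m then gram_minor g k else 0)" if "l < k" for l
    proof -
      have "(\<Sum>j<k. g l j * real_of_int (adj_mat G $$ (j, m))) = real_of_int (\<Sum>j<k. G $$ (l, j) * adj_mat G $$ (j, m))"
        using that int by (auto simp: G_def intro!: sum.cong)
      then show ?thesis unfolding adj[OF that] using det by simp
    qed
    \<comment> \<open>For \<open>j < k\<close> the complement vanishes, so the coefficients
      \<open>c\<close> solve a linear system with matrix \<open>G\<close>; multiplying by the
      adjugate leaves the determinant as the only denominator.\<close>
    have "(\<Sum>j<k. g i j * real_of_int (adj_mat G $$ (j, m)))
        = (\<Sum>j<k. (\<Sum>l<k. c l * g l j) * real_of_int (adj_mat G $$ (j, m)))"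
      using c schur_zero[OF k, of _ i] by (intro sum.cong) auto
    also have "\<dots> = (\<Sum>l<k. c l * (\<Sum>j<k. g l j * real_of_int (adj_mat G $$ (j, m))))"
      unfolding sum_distrib_left sum_distrib_right by (subst sum.swap) (simp add: mult.assoc)
    also have "\<dots> = c m * gram_minor g k"
      using m by (simp add: adj' if_distrib sum.delta cong: if_cong)
    finally have "gram_minor g k * c m = (\<Sum>j<k. g i j * real_of_int (adj_mat G $$ (j, m)))"
      by (simp add: mult.commute)
    also have "\<dots> \<in> \<int>" using int by (intro Ints_sum Ints_mult) auto
    finally show ?thesis .
  qed
  then have "(\<Sum>l<k. (gram_minor g k * c l) * g l j) \<in> \<int>"
    by (intro Ints_sum) (rule Ints_mult[OF _ int], simp)
  moreover have "gram_minor g k * schur g k i j = gram_minor g k * g i j - (\<Sum>l<k. (gram_minor g k * c l) * g l j)"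
    by (simp add: c right_diff_distrib sum_distrib_left mult.assoc)
  ultimately show "gram_minor g k * schur g k i j \<in> \<int>"
    using \<open>gram_minor g k \<in> \<int>\<close> int by (auto intro!: Ints_diff Ints_mult)
qed

lemma gram_minor_ge_1:
  assumes "\<And>i j. g i j \<in> \<int>" "k \<le> N"
  shows "1 \<le> gram_minor g k"
proof -
  obtain n where "gram_minor g k = real_of_int n"
    using gram_minor_schur_int(1)[OF assms] by (auto elim: Ints_cases)
  then show ?thesis using gram_minor_pos[OF assms(2)] by simp
qed

text \<open>The hypothesis is Siegel's condition for reduced bases.\<close>

lemma reduced_first:
  assumes red: "\<And>i. Suc i < N \<Longrightarrow> pivot g i \<le> 2 * pivot g (Suc i)"
  shows "g 0 0 ^ N \<le> 2 ^ (N * N) * gram_minor g N"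
proof (cases "N = 0")
  case False
  have le: "pivot g 0 \<le> 2 ^ i * pivot g i" if "i < N" for i
    using that
  proof (induction i)
    case (Suc i)
    then have "pivot g 0 \<le> 2 ^ i * pivot g i" by simp
    also have "\<dots> \<le> 2 ^ i * (2 * pivot g (Suc i))" by (intro mult_left_mono red Suc) auto
    finally show ?case by (simp add: ac_simps)
  qed simp
  have "g 0 0 ^ N = (\<Prod>i<N. pivot g 0)" by (simp add: pivot_def)
  also have "\<dots> \<le> (\<Prod>i<N. 2 ^ N * pivot g i)"
  proof (intro prod_mono conjI)
    fix i assume i: "i \<in> {..<N}"
    show "0 \<le> pivot g 0" using pivot_pos[of 0] False by simp
    have "pivot g 0 \<le> 2 ^ i * pivot g i" using le i by simp
    also have "\<dots> \<le> 2 ^ N * pivot g i"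
      using i pivot_pos[of i] by (intro mult_right_mono power_increasing) auto
    finally show "pivot g 0 \<le> 2 ^ N * pivot g i" .
  qed
  also have "\<dots> = 2 ^ (N * N) * gram_minor g N"
    by (simp add: prod.distrib gram_minor_def power_mult)
  finally show ?thesis .
qed (simp add: gram_minor_def)

end

text \<open>The right-hand side is unchanged when \<open>A, P, P'\<close> trade places with
  \<open>C, Q, Q'\<close>: two elimination steps may be carried out in either order.\<close>

lemma two_pivots:
  fixes A B C :: real
  assumes "A \<noteq> 0" "A * C - B * B \<noteq> 0"
  shows "P * P' / A + (Q - P * B / A) * (Q' - P' * B / A) / (C - B * B / A) =
    (C * (P * P') - B * (P * Q' + Q * P') + A * (Q * Q')) / (A * C - B * B)"
proof -
  have 1: "C - B * B / A = (A * C - B * B) / A" "Q - P * B / A = (A * Q - P * B) / A"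
    "Q' - P' * B / A = (A * Q' - P' * B) / A"
    using assms by (auto simp: field_simps)
  have "P * P' / A + (A * Q - P * B) / A * ((A * Q' - P' * B) / A) / ((A * C - B * B) / A)
      = P * P' * (A * C - B * B) / (A * (A * C - B * B))
        + (A * Q - P * B) * (A * Q' - P' * B) / (A * (A * C - B * B))"
    using assms by simp
  also have "\<dots> = (P * P' * (A * C - B * B) + (A * Q - P * B) * (A * Q' - P' * B)) / (A * (A * C - B * B))"
    by (rule add_divide_distrib[symmetric])
  also have "P * P' * (A * C - B * B) + (A * Q - P * B) * (A * Q' - P' * B)
      = A * (C * (P * P') - B * (P * Q' + Q * P') + A * (Q * Q'))"
    by (simp add: algebra_simps)
  finally show ?thesis
    unfolding 1 using assms by simp
qed

definition swap_gram :: "nat \<Rightarrow> (nat \<Rightarrow> nat \<Rightarrow> real) \<Rightarrow> nat \<Rightarrow> nat \<Rightarrow> real" where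
  "swap_gram i g x y = g (transpose i (Suc i) x) (transpose i (Suc i) y)"

context gram_matrix
begin

lemma schur_swap_low:
  assumes "k \<le> i"
  shows "schur (swap_gram i g) k x y = schur g k (transpose i (Suc i) x) (transpose i (Suc i) y)"
  using assms
proof (induction k arbitrary: x y)
  case (Suc k)
  then show ?case by simp
qed (simp add: swap_gram_def)

text \<open>\<open>A'\<close> is the squared length of vector \<open>i + 1\<close> after projection
  away from the first \<open>i\<close> vectors only, hence the new pivot in place \<open>i\<close>.
  The product of the two pivots is preserved, and all later complements depend only on the common
  span.\<close>

lemma pivot_swap:
  assumes i: "Suc i < N"
  defines "A' \<equiv> pivot g (Suc i) + (schur g i (Suc i) i)\<^sup>2 / pivot g i"
  shows "pivot (swap_gram i g) k =
    (if k = i then A' else if k = Suc i then pivot g i * pivot g (Suc i) / A' else pivot g k)"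
proof -
  let ?s = "transpose i (Suc i)"
  let ?h = "swap_gram i g"
  define A B C where "A = schur g i i i" and "B = schur g i (Suc i) i" and "C = schur g i (Suc i) (Suc i)"
  have A: "0 < A" using schur_pos[of i] i by (simp add: A_def)
  have p: "pivot g (Suc i) = C - B\<^sup>2 / A"
    by (simp add: pivot_def A_def B_def C_def power2_eq_square)
  have D: "0 < C - B\<^sup>2 / A" using pivot_pos[of "Suc i"] i p by simp
  have A': "A' = C" unfolding A'_def p by (simp add: pivot_def A_def B_def)
  have C: "0 < C"
    using D A by (smt (verit) divide_nonneg_pos zero_le_power2)
  have B': "schur g i i (Suc i) = B" using schur_sym by (simp add: B_def)
  have D': "0 < A * C - B\<^sup>2" using D A by (simp add: field_simps)
  have high: "schur ?h k x y = schur g k (?s x) (?s y)" if "Suc (Suc i) \<le> k" for k x y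
    using that
  proof (induction k arbitrary: x y rule: dec_induct)
    case base
    define P P' Q Q' R where "P = schur g i (?s x) i" and "P' = schur g i (?s y) i"
      and "Q = schur g i (?s x) (Suc i)" and "Q' = schur g i (?s y) (Suc i)" and "R = schur g i (?s x) (?s y)"
    have "schur g (Suc (Suc i)) (?s x) (?s y) =
        R - P * P' / A - (Q - P * B / A) * (Q' - P' * B / A) / (C - B * B / A)"
      by (simp add: P_def P'_def Q_def Q'_def R_def A_def B_def C_def)
    also have "\<dots> = R - Q * Q' / C - (P - Q * B / C) * (P' - Q' * B / C) / (A - B * B / C)"
    proof -
      have "P * P' / A + (Q - P * B / A) * (Q' - P' * B / A) / (C - B * B / A)
          = (C * (P * P') - B * (P * Q' + Q * P') + A * (Q * Q')) / (A * C - B * B)"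
        using A D' by (intro two_pivots) (auto simp: power2_eq_square)
      moreover have "Q * Q' / C + (P - Q * B / C) * (P' - Q' * B / C) / (A - B * B / C)
          = (A * (Q * Q') - B * (Q * P' + P * Q') + C * (P * P')) / (C * A - B * B)"
        using C D' by (intro two_pivots) (auto simp: power2_eq_square mult.commute)
      moreover have "A * (Q * Q') - B * (Q * P' + P * Q') + C * (P * P')
          = C * (P * P') - B * (P * Q' + Q * P') + A * (Q * Q')" "C * A - B * B = A * C - B * B"
        by (simp_all add: algebra_simps)
      ultimately show ?thesis by (simp only: diff_diff_eq)
    qed
    also have "\<dots> = schur ?h (Suc (Suc i)) x y"
      by (simp add: schur_swap_low P_def P'_def Q_def Q'_def R_def A_def B' C_def)
    finally show ?case by simp
  next
    case (step k)
    then have "?s k = k" by (auto simp: transpose_def)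
    with step show ?case by simp
  qed
  consider "k < i" | "k = i" | "k = Suc i" | "Suc (Suc i) \<le> k" by linarith
  then show ?thesis
  proof cases
    case 1
    then have "?s k = k" by (auto simp: transpose_def)
    then show ?thesis using 1 by (simp add: pivot_def schur_swap_low)
  next
    case 2
    then show ?thesis using A' by (simp add: pivot_def schur_swap_low C_def)
  next
    case 3
    have "pivot ?h (Suc i) = A - B * B / C"
      by (simp add: pivot_def schur_swap_low A_def C_def B')
    also have "\<dots> = A * (C - B\<^sup>2 / A) / C"
      using A C by (simp add: field_simps power2_eq_square)
    finally show ?thesis using 3 p A' by (simp add: pivot_def A_def)
  next
    case 4
    then have "?s k = k" by (auto simp: transpose_def)
    then show ?thesis using 4 by (simp add: pivot_def high)
  qed
qed

end

text \<open>The Gram matrix changes in this way when \<open>r\<close> times the \<open>j\<close>-th vector is subtracted from the \<open>i\<close>-th one.\<close>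

definition reduce_gram :: "nat \<Rightarrow> nat \<Rightarrow> real \<Rightarrow> (nat \<Rightarrow> nat \<Rightarrow> real) \<Rightarrow> nat \<Rightarrow> nat \<Rightarrow> real" where
  "reduce_gram i j r g x y = g x y - (if x = i then r * g j y else 0) - (if y = i then r * g x j else 0)
    + (if x = i \<and> y = i then r * r * g j j else 0)"

context gram_matrix
begin

text \<open>Case distinctions become factors \<open>h x\<close>, so that the bilinear identities
  below can be verified by plain algebra.\<close>

lemma reduce_gram_alt:
  assumes "h = (\<lambda>x. if x = i then r else 0)"
  shows "reduce_gram i j r f x y = f x y - h x * f j y - h y * f x j + h x * h y * f j j"
  using assms by (simp add: reduce_gram_def)

text \<open>Subtracting a multiple of vector \<open>j\<close> commutes with the projections up to
  step \<open>j\<close>; the next projection annihilates vector \<open>j\<close>, and from then on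
  the subtraction leaves no trace.\<close>

lemma schur_reduce:
  assumes "j < i" "i < N"
  shows "k \<le> j \<Longrightarrow> schur (reduce_gram i j r g) k x y = reduce_gram i j r (schur g k) x y"
    and "j < k \<Longrightarrow> schur (reduce_gram i j r g) k x y = schur g k x y"
proof -
  let ?h = "reduce_gram i j r g"
  define h where "h x = (if x = i then r else 0)" for x
  have alt: "reduce_gram i j r f x y = f x y - h x * f j y - h y * f x j + h x * h y * f j j" for f x y
    by (rule reduce_gram_alt) (simp add: h_def fun_eq_iff)
  have h0: "h k = 0" if "k \<le> j" for k using that assms by (simp add: h_def)
  have low: "schur ?h k x y = reduce_gram i j r (schur g k) x y" if "k \<le> j" for k x y
    using that
  proof (induction k arbitrary: x y)
    case (Suc k)
    then have *: "schur ?h k x y = reduce_gram i j r (schur g k) x y" for x y by simp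
    define p where "p x = schur g k x k" for x
    have kk: "schur ?h k k k = schur g k k k" "schur ?h k x k = p x - h x * p j" for x
      using Suc.prems by (simp_all add: * alt h0 p_def)
    have e: "(p x - h x * p j) * (p y - h y * p j) / schur g k k k
        = p x * p y / schur g k k k - h x * (p j * p y / schur g k k k)
          - h y * (p x * p j / schur g k k k) + h x * h y * (p j * p j / schur g k k k)"
      by (simp add: algebra_simps add_divide_distrib diff_divide_distrib)
    have "schur ?h (Suc k) x y = schur ?h k x y - (p x - h x * p j) * (p y - h y * p j) / schur g k k k"
      by (simp only: schur.simps kk(1)) (simp only: kk(2))
    also have "\<dots> = reduce_gram i j r (schur g (Suc k)) x y"
      unfolding e * alt by (simp add: p_def algebra_simps)
    finally show ?case .
  qed (simp add: schur_0)
  then show "k \<le> j \<Longrightarrow> schur ?h k x y = reduce_gram i j r (schur g k) x y" .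
  have "schur ?h k x y = schur g k x y" if "Suc j \<le> k" for k x y
    using that
  proof (induction k arbitrary: x y rule: dec_induct)
    case base
    define p where "p x = schur g j x j" for x
    have p: "p j \<noteq> 0" using schur_pos[of j] assms by (simp add: p_def)
    have kk: "schur ?h j j j = p j" "schur ?h j x j = p x - h x * p j" for x
      by (simp_all add: low alt h0 p_def)
    have e: "(p x - h x * p j) * (p y - h y * p j) / p j
        = p x * p y / p j - h x * p y - h y * p x + h x * h y * p j"
      using p by (simp add: algebra_simps add_divide_distrib diff_divide_distrib)
    have pj: "schur g j j y = p y" for y using schur_sym by (simp add: p_def)
    have "schur ?h (Suc j) x y = schur ?h j x y - (p x - h x * p j) * (p y - h y * p j) / p j"
      by (simp only: schur.simps kk(1)) (simp only: kk(2))
    also have "\<dots> = schur g j x y - p x * p y / p j"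
      unfolding e low[OF order.refl] alt pj by (simp add: p_def[symmetric] algebra_simps)
    also have "\<dots> = schur g (Suc j) x y" by (simp add: p_def)
    finally show ?case .
  qed simp
  then show "j < k \<Longrightarrow> schur ?h k x y = schur g k x y" by simp
qed

lemma pivot_reduce:
  assumes "j < i" "i < N"
  shows "pivot (reduce_gram i j r g) k = pivot g k"
  using schur_reduce[OF assms, where k = k and x = k and y = k] assms
  by (cases "k \<le> j") (auto simp: pivot_def reduce_gram_def)

end

section \<open>Lattice reduction\<close>

definition dot :: "int list \<Rightarrow> int list \<Rightarrow> int" where
  "dot u v = sum_list (map2 (*) u v)"

definition lin :: "int \<Rightarrow> int list \<Rightarrow> int \<Rightarrow> int list \<Rightarrow> int list" where
  "lin a u b v = map2 (\<lambda>x y. a * x + b * y) u v"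

lemma dot_simps [simp]: "dot [] v = 0" "dot u [] = 0" "dot (x # u) (y # v) = x * y + dot u v"
  by (simp_all add: dot_def)

lemma lin_simps [simp]: "lin a [] b v = []" "lin a u b [] = []"
  "lin a (x # u) b (y # v) = (a * x + b * y) # lin a u b v"
  by (simp_all add: lin_def)

lemma length_lin [simp]: "length (lin a u b v) = min (length u) (length v)"
  by (simp add: lin_def)

lemma nth_lin [simp]: "i < length u \<Longrightarrow> i < length v \<Longrightarrow> lin a u b v ! i = a * u ! i + b * v ! i"
  by (simp add: lin_def)

declare nth_default_nth [simp]

lemma dot_commute: "dot u v = dot v u"
  by (induction u v rule: list_induct2') auto

lemma dot_lin: "length u = length v \<Longrightarrow> dot (lin a u b v) w = a * dot u w + b * dot v w"
proof (induction u v arbitrary: w rule: list_induct2)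
  case (Cons x xs y ys)
  then show ?case by (cases w) (auto simp: algebra_simps)
qed simp

lemma dot_lin': "length u = length v \<Longrightarrow> dot w (lin a u b v) = a * dot w u + b * dot w v"
  using dot_lin[of u v a b w] by (simp add: dot_commute)

lemma dot_sum: "length u = length v \<Longrightarrow> dot u v = (\<Sum>i<length u. u ! i * v ! i)"
  by (induction u v rule: list_induct2) (simp_all add: sum.lessThan_Suc_shift del: sum.lessThan_Suc)

lemma dot_self_nonneg: "0 \<le> dot u u"
  by (induction u) auto

lemma abs_nth_le_dot: "i < length u \<Longrightarrow> \<bar>u ! i\<bar> \<le> dot u u"
proof -
  assume "i < length u"
  then have "u ! i * u ! i \<le> dot u u"
    by (induction u arbitrary: i) (auto simp: nth_Cons' dot_self_nonneg intro: add_increasing)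
  moreover have "\<bar>x\<bar> \<le> x * x" for x :: int
  proof (cases "x = 0")
    case False
    then have "1 * \<bar>x\<bar> \<le> \<bar>x\<bar> * \<bar>x\<bar>" by (intro mult_right_mono) auto
    then show ?thesis by simp
  qed simp
  ultimately show ?thesis using order.trans by blast
qed

section \<open>Fraction-free elimination and the reduction algorithm\<close>

definition gram_list :: "int list list \<Rightarrow> int list list" where
  "gram_list B = map (\<lambda>u. map (\<lambda>v. dot u v) B) B"

text \<open>Fraction-free elimination on the Gram matrix; the \<open>k\<close>-th row of the result is the pivot row of
  the \<open>k\<close>-th step.\<close>

definition bareiss_step :: "nat \<Rightarrow> int list list \<times> int \<times> int list list \<Rightarrow> int list list \<times> int \<times> int list list" where
  "bareiss_step k s = (let row = nth_default [] (fst s) k; p = nth_default 0 row k in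
    (map (\<lambda>r. map2 (\<lambda>x y. (p * x - nth_default 0 r k * y) div fst (snd s)) r row) (fst s),
     p, row # snd (snd s)))"

definition bareiss :: "nat list \<Rightarrow> int list list \<Rightarrow> int list list" where
  "bareiss I B = rev (snd (snd (fold bareiss_step I (gram_list B, 1, []))))"

text \<open>\<open>r\<close> is the integer nearest to the Gram-Schmidt coefficient, computed from
  integers alone. The elimination is repeated for every pair, so that the basis is the whole state
  of the algorithm.\<close>

definition reduce_pair :: "nat list \<Rightarrow> nat \<Rightarrow> nat \<Rightarrow> int list list \<Rightarrow> int list list" where
  "reduce_pair I i j B = (let row = nth_default [] (bareiss I B) j; p = nth_default 0 row j;
      r = (2 * nth_default 0 row i + p) div (2 * p) in
    map (\<lambda>x. if fst x = i then lin 1 (snd x) (- r) (nth_default [] B j) else snd x) (zip I B))"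

text \<open>The indices \<open>j\<close> decrease, because a step at \<open>j\<close> changes only
  the coefficients at indices up to \<open>j\<close>.\<close>

definition reduce_row :: "nat list \<Rightarrow> nat \<Rightarrow> int list list \<Rightarrow> int list list" where
  "reduce_row I i B = fold (\<lambda>j B. reduce_pair I i j B) (rev (filter (\<lambda>j. j < i) I)) B"

definition reduce_all :: "nat list \<Rightarrow> int list list \<Rightarrow> int list list" where
  "reduce_all I B = fold (\<lambda>i B. reduce_row I i B) I B"

definition minors :: "nat list \<Rightarrow> int list list \<Rightarrow> int list" where
  "minors I B = 1 # map (\<lambda>x. nth_default 0 (snd x) (fst x)) (zip I (bareiss I B))"

text \<open>Quotients of consecutive minors are pivots, so the comparison says that pivot
  \<open>i\<close> exceeds twice pivot \<open>i + 1\<close>. Minors of a basis are positive; the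
  test against 0 thus detects the default value and keeps \<open>i + 1\<close> in range.\<close>

definition violation :: "nat list \<Rightarrow> int list \<Rightarrow> bool \<times> nat" where
  "violation I ds = fold (\<lambda>i acc. if nth_default 0 ds (Suc (Suc i)) \<noteq> 0 \<and>
      2 * (nth_default 0 ds i * nth_default 0 ds (Suc (Suc i))) < nth_default 0 ds (Suc i) * nth_default 0 ds (Suc i)
    then (True, i) else acc) I (False, 0)"

definition swap_rows :: "nat list \<Rightarrow> nat \<Rightarrow> int list list \<Rightarrow> int list list" where
  "swap_rows I i B = map (\<lambda>x. if fst x = i then nth_default [] B (Suc i) else
    if fst x = Suc i then nth_default [] B i else snd x) (zip I B)"

text \<open>A complete size reduction before each exchange keeps the basis short at the end of every
  round.\<close>

definition lll_step :: "nat list \<Rightarrow> int list list \<Rightarrow> int list list" where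
  "lll_step I B = (let B' = reduce_all I B; v = violation I (minors I B') in
    if fst v then swap_rows I (snd v) B' else B')"

text \<open>The number of rounds is fixed in advance by the length of \<open>fuel\<close>; rounds
  after the goal has been reached do no harm.\<close>

definition lll :: "nat list \<Rightarrow> int list \<Rightarrow> int list list \<Rightarrow> int list list" where
  "lll I fuel B = fold (\<lambda>_ B. lll_step I B) fuel B"

definition gr :: "int list list \<Rightarrow> nat \<Rightarrow> nat \<Rightarrow> real" where
  "gr B i j = real_of_int (dot (nth_default [] B i) (nth_default [] B j))"

definition square :: "nat \<Rightarrow> int list list \<Rightarrow> bool" where
  "square N B \<longleftrightarrow> length B = N \<and> (\<forall>u \<in> set B. length u = N)"

section \<open>Correctness of elimination and rounding\<close>

locale basis =
  fixes N :: nat and B :: "int list list"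
  assumes square: "square N B" and positive: "\<And>k. k < N \<Longrightarrow> 0 < pivot (gr B) k"
begin

sublocale gram_matrix "gr B" N
  by standard (auto simp: gr_def dot_commute positive)

lemma gr_int: "gr B i j \<in> \<int>"
  by (simp add: gr_def)

lemma len [simp]: "length B = N" "i < N \<Longrightarrow> length (B ! i) = N"
  using square by (auto simp: square_def)

lemma minor_int:
  assumes "k \<le> N"
  shows "real_of_int \<lfloor>gram_minor (gr B) k\<rfloor> = gram_minor (gr B) k"
    "real_of_int \<lfloor>gram_minor (gr B) k * schur (gr B) k i j\<rfloor> = gram_minor (gr B) k * schur (gr B) k i j"
  using gram_minor_schur_int[OF gr_int assms] by auto

text \<open>The entries that the elimination holds after \<open>k\<close> steps. They are integers
  by Cramer's rule, so the floor only changes the type.\<close>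

definition bm :: "nat \<Rightarrow> nat \<Rightarrow> nat \<Rightarrow> int" where
  "bm k i j = \<lfloor>gram_minor (gr B) k * schur (gr B) k i j\<rfloor>"

definition bd :: "nat \<Rightarrow> int" where
  "bd k = \<lfloor>gram_minor (gr B) k\<rfloor>"

lemma bm_real: "k \<le> N \<Longrightarrow> real_of_int (bm k i j) = gram_minor (gr B) k * schur (gr B) k i j"
  using minor_int by (simp add: bm_def)

lemma bd_real: "k \<le> N \<Longrightarrow> real_of_int (bd k) = gram_minor (gr B) k"
  using minor_int by (simp add: bd_def)

lemma bm_diag: "k < N \<Longrightarrow> bm k k k = bd (Suc k)"
  using bm_real[of k k k] bd_real[of "Suc k"] by (simp add: gram_minor_Suc pivot_def flip: of_int_eq_iff[where 'a = real])

lemma bd_pos: "k \<le> N \<Longrightarrow> 0 < bd k"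
  using bd_real[of k] gram_minor_pos[of k] by (simp flip: of_int_less_iff[where 'a = real])

text \<open>Bareiss's identity: the numerator is the previous minor times the next entry, and the
  next entry is already known to be an integer, so the division is exact.\<close>

lemma bm_step:
  assumes "k < N"
  shows "(bm k k k * bm k i j - bm k i k * bm k k j) div bd k = bm (Suc k) i j"
proof -
  let ?d = "gram_minor (gr B) k" and ?s = "schur (gr B) k"
  have p: "?s k k \<noteq> 0" using schur_pos[of k] assms by simp
  have "real_of_int (bm k k k * bm k i j - bm k i k * bm k k j)
      = (?d * ?s k k) * (?d * ?s i j) - (?d * ?s i k) * (?d * ?s k j)"
    using assms by (simp add: bm_real)
  also have "\<dots> = ?d * ((?d * ?s k k) * (?s i j - ?s i k * ?s j k / ?s k k))"
    using p schur_sym[of k k j] by (simp add: field_simps)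
  also have "\<dots> = real_of_int (bd k * bm (Suc k) i j)"
    using assms by (simp add: bm_real bd_real gram_minor_Suc pivot_def)
  finally have "bm k k k * bm k i j - bm k i k * bm k k j = bd k * bm (Suc k) i j"
    by (simp only: of_int_eq_iff)
  then show ?thesis using bd_pos[of k] assms by simp
qed

lemma bareiss_state:
  assumes "k \<le> N"
  shows "fold bareiss_step [0..<k] (gram_list B, 1, []) =
    (map (\<lambda>i. map (\<lambda>j. bm k i j) [0..<N]) [0..<N], bd k, rev (map (\<lambda>l. map (\<lambda>j. bm l l j) [0..<N]) [0..<k]))"
  using assms
proof (induction k)
  case 0
  have "gram_list B = map (\<lambda>i. map (\<lambda>j. bm 0 i j) [0..<N]) [0..<N]"
    by (rule nth_equalityI) (auto simp: gram_list_def bm_def gram_minor_def gr_def intro!: nth_equalityI)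
  then show ?case by (simp add: bd_def gram_minor_def)
next
  case (Suc k)
  have z: "map2 f (map g [0..<N]) (map h [0..<N]) = map (\<lambda>j. f (g j) (h j)) [0..<N]" for f g and h :: "nat \<Rightarrow> int"
    by (rule nth_equalityI) auto
  have "(bd (Suc k) * bm k i j - bm k i k * bm k k j) div bd k = bm (Suc k) i j" for i j
    using bm_step[of k i j] bm_diag[of k] Suc.prems by simp
  then show ?case
    using Suc by (simp add: bareiss_step_def Let_def z bm_diag comp_def)
qed

lemma bareiss_eq: "bareiss [0..<N] B = map (\<lambda>l. map (\<lambda>j. bm l l j) [0..<N]) [0..<N]"
  unfolding bareiss_def by (simp add: bareiss_state)

lemma minors_eq: "minors [0..<N] B = map bd [0..<Suc N]"
proof -
  have "minors [0..<N] B = bd 0 # map (\<lambda>k. bd (Suc k)) [0..<N]"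
    unfolding minors_def bareiss_eq
    by (auto simp: bd_def[of 0] gram_minor_def bm_diag intro!: nth_equalityI)
  also have "\<dots> = map bd [0..<Suc N]"
    by (simp add: map_upt_Suc del: upt_Suc)
  finally show ?thesis .
qed

text \<open>The Gram-Schmidt coefficient of vector \<open>i\<close> along the \<open>j\<close>-th
  orthogonalized vector.\<close>

definition mu :: "nat \<Rightarrow> nat \<Rightarrow> real" where
  "mu i j = schur (gr B) j i j / pivot (gr B) j"

lemma gr_diag: "i < N \<Longrightarrow> gr B i i = (\<Sum>l<i. (mu i l)\<^sup>2 * pivot (gr B) l) + pivot (gr B) i"
proof -
  assume i: "i < N"
  have "(mu i l)\<^sup>2 * pivot (gr B) l = schur (gr B) l i l * schur (gr B) l i l / pivot (gr B) l" if "l < i" for l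
    using pivot_pos[of l] that i by (simp add: mu_def power2_eq_square)
  then have "(\<Sum>l<i. (mu i l)\<^sup>2 * pivot (gr B) l) = (\<Sum>l<i. schur (gr B) l i l * schur (gr B) l i l / pivot (gr B) l)"
    by (intro sum.cong) auto
  then show ?thesis using schur_sum[of 0 i i i] by (simp add: pivot_def[of _ i] atLeast0LessThan)
qed

definition rounded :: "nat \<Rightarrow> nat \<Rightarrow> int" where
  "rounded i j = (2 * bm j j i + bm j j j) div (2 * bm j j j)"

lemma rounded: "j < i \<Longrightarrow> i < N \<Longrightarrow> \<bar>mu i j - real_of_int (rounded i j)\<bar> \<le> 1 / 2"
proof -
  assume ij: "j < i" "i < N"
  define p where "p = bm j j j"
  have p: "0 < p" using bm_diag[of j] bd_pos[of "Suc j"] ij by (simp add: p_def)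
  have half: "\<bar>2 * x\<bar> \<le> y \<Longrightarrow> \<bar>x\<bar> \<le> 1 / 2 * y" for x y :: real by (simp add: abs_mult)
  define r where "r = rounded i j"
  define c where "c = bm j j i"
  have "gram_minor (gr B) j \<noteq> 0" "pivot (gr B) j \<noteq> 0"
    using gram_minor_pos[of j] pivot_pos[of j] ij by auto
  then have mu: "mu i j = c / p"
    using bm_real[of j] ij schur_sym[of j i j] by (simp add: c_def p_def mu_def pivot_def)
  have "2 * c + p = 2 * p * r + (2 * c + p) mod (2 * p)"
    by (simp add: r_def rounded_def c_def p_def)
  moreover have "0 \<le> (2 * c + p) mod (2 * p)" "(2 * c + p) mod (2 * p) < 2 * p" using p by simp_all
  ultimately have "- p \<le> 2 * (c - p * r)" "2 * (c - p * r) \<le> p" by (simp_all add: algebra_simps)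
  then have "\<bar>2 * (c - p * r)\<bar> \<le> p" by linarith
  then have "real_of_int \<bar>2 * (c - p * r)\<bar> \<le> p" by (simp only: of_int_le_iff)
  then have "\<bar>c - p * real_of_int r\<bar> \<le> 1 / 2 * real_of_int p"
    using half[of "c - p * real_of_int r" "real_of_int p"] by (simp only: of_int_abs of_int_mult of_int_diff of_int_numeral)
  moreover have "mu i j - r = (c - p * real_of_int r) / p" using p mu by (simp add: field_simps)
  then have "\<bar>mu i j - r\<bar> = \<bar>c - p * real_of_int r\<bar> / p" using p by (simp only: abs_divide abs_of_pos of_int_0_less_iff)
  ultimately show ?thesis using p by (simp only: r_def pos_divide_le_eq of_int_0_less_iff)
qed

lemma reduce_pair_eq:
  assumes "j < i" "i < N"
  shows "reduce_pair [0..<N] i j B = B[i := lin 1 (B ! i) (- rounded i j) (B ! j)]"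
  unfolding reduce_pair_def bareiss_eq using assms
  by (intro nth_equalityI) (auto simp: nth_list_update Let_def rounded_def)

lemma gr_reduce_pair:
  assumes "j < i" "i < N"
  shows "gr (reduce_pair [0..<N] i j B) = reduce_gram i j (real_of_int (rounded i j)) (gr B)"
proof (intro ext)
  fix x y
  show "gr (reduce_pair [0..<N] i j B) x y = reduce_gram i j (real_of_int (rounded i j)) (gr B) x y"
    using assms unfolding reduce_pair_eq[OF assms] gr_def reduce_gram_def
    by (auto simp: nth_default_def nth_list_update dot_lin dot_lin' algebra_simps)
qed

lemma basis_reduce_pair:
  assumes "j < i" "i < N"
  shows "basis N (reduce_pair [0..<N] i j B)"
proof
  show "square N (reduce_pair [0..<N] i j B)"
    unfolding reduce_pair_eq[OF assms] square_def using assms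
    by (auto simp: set_conv_nth nth_list_update split: if_splits)
  show "0 < pivot (gr (reduce_pair [0..<N] i j B)) k" if "k < N" for k
    unfolding gr_reduce_pair[OF assms] pivot_reduce[OF assms] using that by (rule pivot_pos)
qed

lemma pivot_reduce_pair:
  assumes "j < i" "i < N"
  shows "pivot (gr (reduce_pair [0..<N] i j B)) = pivot (gr B)"
  using gr_reduce_pair[OF assms] pivot_reduce[OF assms] by auto

end

text \<open>A multiple of row \<open>j\<close> of the unitriangular coefficient matrix is subtracted
  from row \<open>i\<close>; its diagonal 1 appears as a separate case.\<close>

lemma mu_reduce_pair:
  assumes "basis N B" "j < i" "i < N" "l < N"
  shows "basis.mu (reduce_pair [0..<N] i j B) x l =
    basis.mu B x l - (if x = i \<and> l \<le> j then real_of_int (basis.rounded B i j) * (if l = j then 1 else basis.mu B j l) else 0)"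
proof -
  interpret basis N B by fact
  interpret R: basis N "reduce_pair [0..<N] i j B" by (rule basis_reduce_pair[OF assms(2,3)])
  have p: "pivot (gr B) l \<noteq> 0" using pivot_pos[OF assms(4)] by simp
  show ?thesis
    unfolding R.mu_def mu_def pivot_reduce_pair[OF assms(2,3)] unfolding gr_reduce_pair[OF assms(2,3)]
    using schur_reduce[OF assms(2,3), of l "real_of_int (rounded i j)" x l] p assms
    by (cases "l \<le> j") (auto simp: reduce_gram_def pivot_def diff_divide_distrib)
qed

definition reduced_below :: "nat \<Rightarrow> int list list \<Rightarrow> bool" where
  "reduced_below m B \<longleftrightarrow> (\<forall>j<m. \<forall>l<j. \<bar>basis.mu B j l\<bar> \<le> 1 / 2)"

text \<open>Exactly the closure that row operations require. Invariants are stated for every such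
  set, and the set is instantiated later by congruences.\<close>

definition closed_lattice :: "int list set \<Rightarrow> bool" where
  "closed_lattice L \<longleftrightarrow> (\<forall>u\<in>L. \<forall>v\<in>L. \<forall>c. lin 1 u c v \<in> L)"

text \<open>While a row is being reduced its coefficients at most double in each step.\<close>

lemma reduce_row_partial:
  assumes "basis N B" "i < N" "reduced_below i B" "k \<le> i"
    and Y: "\<And>l. l < i \<Longrightarrow> \<bar>basis.mu B i l\<bar> \<le> Y"
  defines "B' \<equiv> fold (\<lambda>j B. reduce_pair [0..<N] i j B) (rev [i - k..<i]) B"
  shows "basis N B' \<and> pivot (gr B') = pivot (gr B) \<and>
    (\<forall>x<N. x \<noteq> i \<longrightarrow> B' ! x = B ! x \<and> (\<forall>l<N. basis.mu B' x l = basis.mu B x l)) \<and>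
    (\<forall>l<i. i - k \<le> l \<longrightarrow> \<bar>basis.mu B' i l\<bar> \<le> 1 / 2) \<and>
    (\<forall>l<i. \<bar>basis.mu B' i l\<bar> + 1 \<le> 2 ^ k * (Y + 1)) \<and>
    (\<forall>L. closed_lattice L \<longrightarrow> set B \<subseteq> L \<longrightarrow> set B' \<subseteq> L)"
  using assms(4) unfolding B'_def
proof (induction k)
  case 0
  then show ?case using assms by auto
next
  case (Suc k)
  let ?f = "\<lambda>j B. reduce_pair [0..<N] i j B"
  define C where "C = fold ?f (rev [i - k..<i]) B"
  define j where "j = i - Suc k"
  have "[i - Suc k..<i] = j # [i - k..<i]"
    using Suc.prems by (simp add: j_def upt_conv_Cons Suc_diff_Suc)
  then have eq: "fold ?f (rev [i - Suc k..<i]) B = reduce_pair [0..<N] i j C"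
    by (simp add: C_def)
  have C: "basis N C" "pivot (gr C) = pivot (gr B)"
    "\<And>x. x < N \<Longrightarrow> x \<noteq> i \<Longrightarrow> C ! x = B ! x"
    "\<And>x l. x < N \<Longrightarrow> x \<noteq> i \<Longrightarrow> l < N \<Longrightarrow> basis.mu C x l = basis.mu B x l"
    "\<And>l. l < i \<Longrightarrow> i - k \<le> l \<Longrightarrow> \<bar>basis.mu C i l\<bar> \<le> 1 / 2"
    "\<And>l. l < i \<Longrightarrow> \<bar>basis.mu C i l\<bar> + 1 \<le> 2 ^ k * (Y + 1)"
    "\<And>L. closed_lattice L \<Longrightarrow> set B \<subseteq> L \<Longrightarrow> set C \<subseteq> L"
    using Suc.IH Suc.prems unfolding C_def by auto
  interpret basis N C by fact
  have j: "j < i" "j < N" using Suc.prems assms(2) by (auto simp: j_def)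
  note mu' = mu_reduce_pair[OF C(1) j(1) assms(2)]
  let ?r = "real_of_int (rounded i j)"
  have r: "\<bar>mu i j - ?r\<bar> \<le> 1 / 2" by (rule rounded[OF j(1) assms(2)])
  have mj: "\<bar>mu j l\<bar> \<le> 1 / 2" if "l < j" for l
    using assms(3) that j C(4)[of j l] by (auto simp: reduced_below_def)
  have mi: "basis.mu (?f j C) i l = mu i l - (if l \<le> j then ?r * (if l = j then 1 else mu j l) else 0)"
    if "l < i" for l
    using mu'[of l i] that assms(2) by simp
  have small: "\<bar>basis.mu (?f j C) i l\<bar> \<le> 1 / 2" if "l < i" "j \<le> l" for l
  proof (cases "l = j")
    case True
    then show ?thesis using r mi[OF that(1)] by simp
  next
    case False
    then have "i - k \<le> l" using that(2) Suc.prems by (simp add: j_def)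
    then show ?thesis using C(5)[OF that(1)] mi[OF that(1)] False that(2) by simp
  qed
  \<comment> \<open>\<open>?r\<close> differs from the coefficient at \<open>j\<close> by at most
    1/2, and row \<open>j\<close> contributes at most half of \<open>?r\<close>. The summand 1 in
    the bound absorbs the rounding.\<close>
  have large: "\<bar>basis.mu (?f j C) i l\<bar> + 1 \<le> 2 ^ Suc k * (Y + 1)" if "l < i" for l
  proof -
    have p: "1 \<le> 2 ^ k * (Y + 1)" using C(6)[of l] that by linarith
    show ?thesis
    proof (cases "l < j")
      case True
      have "\<bar>?r * mu j l\<bar> \<le> \<bar>?r\<bar> * (1 / 2)"
        unfolding abs_mult using mj[OF True] by (intro mult_left_mono) auto
      moreover have "\<bar>?r\<bar> + 1 / 2 \<le> 2 ^ k * (Y + 1)" using r C(6)[of j] j by linarith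
      moreover have "basis.mu (?f j C) i l = mu i l - ?r * mu j l"
        using True mi[OF that] by simp
      ultimately show ?thesis using C(6)[OF that] by simp
    next
      case False
      then show ?thesis using small[of l] that p by simp
    qed
  qed
  have L: "set (?f j C) \<subseteq> L" if "closed_lattice L" "set B \<subseteq> L" for L
  proof -
    have "C ! i \<in> L" "C ! j \<in> L" using C(7)[OF that] j assms(2) by (auto intro: subsetD[OF _ nth_mem])
    then have "lin 1 (C ! i) (- rounded i j) (C ! j) \<in> L"
      using that(1) by (auto simp: closed_lattice_def)
    then show ?thesis
      unfolding reduce_pair_eq[OF j(1) assms(2)] using C(7)[OF that] set_update_subset_insert by fast
  qed
  have other: "?f j C ! x = B ! x" "l < N \<Longrightarrow> basis.mu (?f j C) x l = basis.mu B x l"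
    if "x < N" "x \<noteq> i" for x l
  proof -
    show "?f j C ! x = B ! x"
      unfolding reduce_pair_eq[OF j(1) assms(2)] using that C(3) by simp
    show "l < N \<Longrightarrow> basis.mu (?f j C) x l = basis.mu B x l"
      using mu'[of l x] that C(4) by simp
  qed
  have "i - Suc k = j" by (simp add: j_def)
  then show ?case
    unfolding eq using basis_reduce_pair[OF j(1) assms(2)] pivot_reduce_pair[OF j(1) assms(2)] C(2) small large L other
    by simp
qed

lemma reduce_row_fold: "i \<le> N \<Longrightarrow> reduce_row [0..<N] i B = fold (\<lambda>j B. reduce_pair [0..<N] i j B) (rev [0..<i]) B"
proof -
  assume "i \<le> N"
  then have "filter (\<lambda>j. j < i) [0..<N] = [0..<i]"
    using upt_add_eq_append[of 0 i "N - i"] by simp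
  then show ?thesis by (simp add: reduce_row_def)
qed

text \<open>The next minor is at least 1 and minor \<open>l\<close> is at most \<open>Z\<close>, so
  pivot \<open>l\<close> is at least \<open>1 / Z\<close>. Since \<open>(mu i l)^2\<close> times
  this pivot is at most \<open>X\<close>, the coefficient cannot be large.\<close>

lemma mu_bound:
  assumes "basis N B" "l < i" "i < N" "1 \<le> X" "gr B i i \<le> X" "gram_minor (gr B) l \<le> Z"
  shows "\<bar>basis.mu B i l\<bar> \<le> X * Z"
proof -
  interpret basis N B by fact
  let ?p = "pivot (gr B) l"
  have p: "0 < ?p" using pivot_pos assms by simp
  have Z: "1 \<le> Z" using gram_minor_ge_1[OF gr_int, of l] assms by simp
  have "1 \<le> gram_minor (gr B) l * ?p"
    using gram_minor_ge_1[OF gr_int, of "Suc l"] assms by (simp add: gram_minor_Suc)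
  also have "\<dots> \<le> Z * ?p" using assms p by (intro mult_right_mono) auto
  finally have 1: "1 \<le> Z * ?p" .
  have "(mu i l)\<^sup>2 * ?p \<le> (\<Sum>l<i. (mu i l)\<^sup>2 * pivot (gr B) l)"
    using assms pivot_pos by (intro member_le_sum) (auto simp: less_imp_le)
  also have "\<dots> \<le> X" using gr_diag[OF assms(3)] pivot_pos[OF assms(3)] assms(5) by simp
  finally have "(mu i l)\<^sup>2 * ?p * Z \<le> X * Z" using Z by (intro mult_right_mono) auto
  moreover have "(mu i l)\<^sup>2 * 1 \<le> (mu i l)\<^sup>2 * (Z * ?p)" using 1 by (intro mult_left_mono) auto
  ultimately have 2: "(mu i l)\<^sup>2 \<le> X * Z" by (simp add: ac_simps)
  have XZ: "1 \<le> X * Z" using mult_mono[of 1 X 1 Z] assms Z by simp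
  then have "X * Z * 1 \<le> (X * Z) * (X * Z)" by (intro mult_left_mono) auto
  then have "\<bar>mu i l\<bar>\<^sup>2 \<le> (X * Z)\<^sup>2" using 2 by (simp add: power2_eq_square)
  then show ?thesis by (rule power2_le_imp_le) (use XZ in linarith)
qed

lemma diag_bound:
  assumes "basis N B" "i < N" "\<And>l. l < i \<Longrightarrow> \<bar>basis.mu B i l\<bar> \<le> Y" "1 \<le> Y" "\<And>l. l < N \<Longrightarrow> pivot (gr B) l \<le> M"
  shows "gr B i i \<le> N * (Y\<^sup>2 * M)"
proof -
  interpret basis N B by fact
  have M: "0 \<le> M" using assms(2) assms(5)[of i] pivot_pos[of i] by simp
  have Y2: "1 \<le> Y\<^sup>2" using assms(4) by simp
  have "(\<Sum>l<i. (mu i l)\<^sup>2 * pivot (gr B) l) \<le> (\<Sum>l<i. Y\<^sup>2 * M)"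
  proof (intro sum_mono mult_mono)
    fix l assume l: "l \<in> {..<i}"
    show "(mu i l)\<^sup>2 \<le> Y\<^sup>2" using assms(3)[of l] l assms(4) by (simp add: abs_le_square_iff[symmetric])
    show "pivot (gr B) l \<le> M" "0 \<le> pivot (gr B) l" using assms(2,5) l pivot_pos[of l] by auto
  qed auto
  moreover have "pivot (gr B) i \<le> Y\<^sup>2 * M"
    using assms(2) assms(5)[of i] mult_right_mono[OF Y2 M] by simp
  moreover have "real i * (Y\<^sup>2 * M) + Y\<^sup>2 * M \<le> N * (Y\<^sup>2 * M)"
  proof -
    have "real (Suc i) * (Y\<^sup>2 * M) \<le> real N * (Y\<^sup>2 * M)" using assms(2) M by (intro mult_right_mono) auto
    then show ?thesis by (simp add: algebra_simps)
  qed
  ultimately show ?thesis using gr_diag[OF assms(2)] by simp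
qed

lemma reduce_all_partial:
  assumes "basis N B" "m \<le> N"
  defines "B' \<equiv> fold (\<lambda>i B. reduce_row [0..<N] i B) [0..<m] B"
  shows "basis N B' \<and> pivot (gr B') = pivot (gr B) \<and> reduced_below m B' \<and>
    (\<forall>x<N. m \<le> x \<longrightarrow> B' ! x = B ! x) \<and>
    (\<forall>L. closed_lattice L \<longrightarrow> set B \<subseteq> L \<longrightarrow> set B' \<subseteq> L)"
  using assms(2) unfolding B'_def
proof (induction m)
  case 0
  then show ?case using assms by (simp add: reduced_below_def)
next
  case (Suc m)
  define C where "C = fold (\<lambda>i B. reduce_row [0..<N] i B) [0..<m] B"
  have C: "basis N C" "pivot (gr C) = pivot (gr B)" "reduced_below m C" "\<forall>x<N. m \<le> x \<longrightarrow> C ! x = B ! x"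
    "\<And>L. closed_lattice L \<Longrightarrow> set B \<subseteq> L \<Longrightarrow> set C \<subseteq> L"
    using Suc unfolding C_def by auto
  \<comment> \<open>Any bound serves here, because the conclusions drawn from
    \<open>reduce_row_partial\<close> in this proof do not mention it.\<close>
  have Y: "\<bar>basis.mu C m l\<bar> \<le> Max ((\<lambda>l. \<bar>basis.mu C m l\<bar>) ` {..<m})" if "l < m" for l
    using that by (intro Max_ge) auto
  have m: "m < N" using Suc by simp
  note * = reduce_row_partial[OF C(1) m C(3) order.refl Y]
  let ?D = "reduce_row [0..<N] m C"
  have D: "?D = fold (\<lambda>j B. reduce_pair [0..<N] m j B) (rev [m - m..<m]) C"
    using reduce_row_fold[of m N C] m by simp
  have "fold (\<lambda>i B. reduce_row [0..<N] i B) [0..<Suc m] B = ?D" by (simp add: C_def)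
  moreover have "basis N ?D" "pivot (gr ?D) = pivot (gr B)" "\<forall>x<N. Suc m \<le> x \<longrightarrow> ?D ! x = B ! x"
    "\<forall>L. closed_lattice L \<longrightarrow> set B \<subseteq> L \<longrightarrow> set ?D \<subseteq> L"
    using * C unfolding D by auto
  moreover have "reduced_below (Suc m) ?D"
    using * C(3) m unfolding D reduced_below_def by (auto simp: less_Suc_eq)
  ultimately show ?case by simp
qed

lemma reduce_all:
  assumes "basis N B"
  defines "B' \<equiv> reduce_all [0..<N] B"
  shows "basis N B'" "pivot (gr B') = pivot (gr B)" "reduced_below N B'"
    "closed_lattice L \<Longrightarrow> set B \<subseteq> L \<Longrightarrow> set B' \<subseteq> L"
  using reduce_all_partial[OF assms(1) order.refl] unfolding B'_def reduce_all_def by auto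

lemma fold_last:
  fixes P :: "nat \<Rightarrow> bool"
  defines "F \<equiv> \<lambda>i acc. if P i then (True, i) else acc"
  shows "fold F I a = a \<and> (\<forall>i\<in>set I. \<not> P i) \<or> (\<exists>i\<in>set I. P i \<and> fold F I a = (True, i))"
proof (induction I arbitrary: a)
  case (Cons x I)
  then show ?case using Cons[of "F x a"] by (cases "P x") (auto simp: F_def)
qed simp

lemma violation_cases:
  assumes "v = violation I ds"
  shows "fst v \<Longrightarrow> snd v \<in> set I \<and> nth_default 0 ds (Suc (Suc (snd v))) \<noteq> 0 \<and>
      2 * (nth_default 0 ds (snd v) * nth_default 0 ds (Suc (Suc (snd v)))) < nth_default 0 ds (Suc (snd v)) * nth_default 0 ds (Suc (snd v))"
    and "\<not> fst v \<Longrightarrow> i \<in> set I \<Longrightarrow> nth_default 0 ds (Suc (Suc i)) \<noteq> 0 \<Longrightarrow>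
      nth_default 0 ds (Suc i) * nth_default 0 ds (Suc i) \<le> 2 * (nth_default 0 ds i * nth_default 0 ds (Suc (Suc i)))"
proof -
  let ?P = "\<lambda>i. nth_default 0 ds (Suc (Suc i)) \<noteq> 0 \<and>
      2 * (nth_default 0 ds i * nth_default 0 ds (Suc (Suc i))) < nth_default 0 ds (Suc i) * nth_default 0 ds (Suc i)"
  note g = fold_last[of ?P I "(False, 0)", folded violation_def assms]
  show "fst v \<Longrightarrow> snd v \<in> set I \<and> ?P (snd v)"
    using g by fastforce
  show "\<not> fst v \<Longrightarrow> i \<in> set I \<Longrightarrow> nth_default 0 ds (Suc (Suc i)) \<noteq> 0 \<Longrightarrow>
      nth_default 0 ds (Suc i) * nth_default 0 ds (Suc i) \<le> 2 * (nth_default 0 ds i * nth_default 0 ds (Suc (Suc i)))"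
    using g by fastforce
qed

section \<open>Exchange steps and termination\<close>

definition siegel :: "nat \<Rightarrow> (nat \<Rightarrow> nat \<Rightarrow> real) \<Rightarrow> bool" where
  "siegel N g \<longleftrightarrow> (\<forall>i. Suc i < N \<longrightarrow> pivot g i \<le> 2 * pivot g (Suc i))"

text \<open>For integral bases every minor is at least 1, hence so is the product, whereas an
  exchange changes just one minor and shrinks it by a factor of at most 3/4.\<close>

definition potential :: "nat \<Rightarrow> (nat \<Rightarrow> nat \<Rightarrow> real) \<Rightarrow> real" where
  "potential N g = (\<Prod>k<N. gram_minor g (Suc k))"

lemma minor_violation:
  assumes "basis N B" "i < N"
  shows "nth_default 0 (minors [0..<N] B) (Suc (Suc i)) \<noteq> 0 \<longleftrightarrow> Suc i < N"
    "Suc i < N \<Longrightarrow> 2 * (nth_default 0 (minors [0..<N] B) i * nth_default 0 (minors [0..<N] B) (Suc (Suc i)))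
      < nth_default 0 (minors [0..<N] B) (Suc i) * nth_default 0 (minors [0..<N] B) (Suc i) \<longleftrightarrow>
     2 * pivot (gr B) (Suc i) < pivot (gr B) i"
proof -
  interpret basis N B by fact
  have nth: "nth_default 0 (minors [0..<N] B) k = (if k \<le> N then bd k else 0)" for k
    unfolding minors_eq by (auto simp: nth_default_def simp del: upt_Suc)
  show "nth_default 0 (minors [0..<N] B) (Suc (Suc i)) \<noteq> 0 \<longleftrightarrow> Suc i < N"
    unfolding nth using bd_pos[of "Suc (Suc i)"] by auto
  assume i: "Suc i < N"
  let ?d = "gram_minor (gr B) i" and ?p = "pivot (gr B) i" and ?q = "pivot (gr B) (Suc i)"
  have pos: "0 < ?d" "0 < ?p" using gram_minor_pos[of i] pivot_pos[of i] i by auto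
  have "2 * (bd i * bd (Suc (Suc i))) < bd (Suc i) * bd (Suc i) \<longleftrightarrow>
    real_of_int (2 * (bd i * bd (Suc (Suc i)))) < real_of_int (bd (Suc i) * bd (Suc i))"
    by (simp only: of_int_less_iff)
  also have "\<dots> \<longleftrightarrow> (?d * ?d * ?p) * (2 * ?q) < (?d * ?d * ?p) * ?p"
    using i by (simp add: bd_real gram_minor_Suc algebra_simps)
  also have "\<dots> \<longleftrightarrow> 2 * ?q < ?p"
    using pos by (intro mult_less_cancel_left_pos) simp
  finally show "2 * (nth_default 0 (minors [0..<N] B) i * nth_default 0 (minors [0..<N] B) (Suc (Suc i)))
      < nth_default 0 (minors [0..<N] B) (Suc i) * nth_default 0 (minors [0..<N] B) (Suc i) \<longleftrightarrow> 2 * ?q < ?p"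
    unfolding nth using i by simp
qed

lemma gr_swap_rows:
  assumes "length B = N" "Suc i < N"
  shows "gr (swap_rows [0..<N] i B) = swap_gram i (gr B)"
proof -
  have "nth_default [] (swap_rows [0..<N] i B) x = nth_default [] B (transpose i (Suc i) x)" for x
    using assms by (auto simp: swap_rows_def nth_default_def transpose_def)
  then show ?thesis by (simp add: fun_eq_iff gr_def swap_gram_def)
qed

lemma lll_step_all:
  assumes B: "basis N B"
  defines "B' \<equiv> lll_step [0..<N] B"
  shows "basis N B' \<and> gram_minor (gr B') N = gram_minor (gr B) N \<and>
    (\<forall>L. closed_lattice L \<longrightarrow> set B \<subseteq> L \<longrightarrow> set B' \<subseteq> L) \<and>
    (\<forall>M k. (\<forall>l < N. pivot (gr B) l \<le> M) \<longrightarrow> k < N \<longrightarrow> pivot (gr B') k \<le> M) \<and>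
    (\<forall>M k. (\<forall>l < N. pivot (gr B) l \<le> M) \<longrightarrow> k < N \<longrightarrow> gr B' k k \<le> N * M) \<and>
    (siegel N (gr B) \<longrightarrow> siegel N (gr B')) \<and>
    (siegel N (gr B') \<or> potential N (gr B') \<le> 3 / 4 * potential N (gr B))"
proof -
  define C where "C = reduce_all [0..<N] B"
  define v where "v = violation [0..<N] (minors [0..<N] C)"
  have C: "basis N C" "pivot (gr C) = pivot (gr B)" "reduced_below N C"
    using reduce_all[OF B] by (simp_all add: C_def)
  interpret basis N C by fact
  have minor: "gram_minor (gr C) = gram_minor (gr B)"
    by (simp add: gram_minor_def[abs_def] C(2))
  have LC: "set C \<subseteq> L" if "closed_lattice L" "set B \<subseteq> L" for L
    using reduce_all(4)[OF B that] by (simp add: C_def)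
  have diag: "gr C k k \<le> N * M" if "\<And>l. l < N \<Longrightarrow> pivot (gr B) l \<le> M" "k < N" for M :: real and k
    using diag_bound[OF C(1) that(2), of 1 M] C(2,3) that unfolding reduced_below_def by fastforce
  have B': "B' = (if fst v then swap_rows [0..<N] (snd v) C else C)"
    by (simp add: B'_def lll_step_def Let_def C_def v_def)
  show ?thesis
  proof (cases "fst v")
    case False
    have "pivot (gr C) i \<le> 2 * pivot (gr C) (Suc i)" if "Suc i < N" for i
      using violation_cases(2)[OF v_def False, of i] minor_violation[OF C(1), of i] that by force
    then have "siegel N (gr C)" by (simp add: siegel_def)
    then show ?thesis using False B' C minor LC diag by auto
  next
    case True
    define i where "i = snd v"
    have i: "Suc i < N" "2 * pivot (gr C) (Suc i) < pivot (gr C) i"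
      using violation_cases(1)[OF v_def True] minor_violation[OF C(1), of i] by (auto simp: i_def)
    have B'i: "B' = swap_rows [0..<N] i C" using B' True by (simp add: i_def)
    have g: "gr B' = swap_gram i (gr C)" unfolding B'i by (rule gr_swap_rows) (use i in auto)
    let ?p = "pivot (gr C) i" and ?q = "pivot (gr C) (Suc i)"
    define A where "A = ?q + (schur (gr C) i (Suc i) i)\<^sup>2 / ?p"
    have p: "0 < ?p" "0 < ?q" using pivot_pos i by auto
    have piv: "pivot (gr B') k = (if k = i then A else if k = Suc i then ?p * ?q / A else pivot (gr C) k)" for k
      unfolding g A_def by (rule pivot_swap[OF i(1)])
    have "\<bar>mu (Suc i) i\<bar> \<le> 1 / 2" using C(3) i by (auto simp: reduced_below_def)
    then have "(mu (Suc i) i)\<^sup>2 \<le> (1 / 2)\<^sup>2" by (simp add: abs_le_square_iff[symmetric])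
    then have "(mu (Suc i) i)\<^sup>2 * ?p \<le> 1 / 4 * ?p" using p by (intro mult_right_mono) (auto simp: power2_eq_square)
    moreover have "(mu (Suc i) i)\<^sup>2 * ?p = (schur (gr C) i (Suc i) i)\<^sup>2 / ?p"
      using p by (simp add: mu_def power2_eq_square)
    \<comment> \<open>One half comes from the violated condition of Siegel, one quarter from size
      reduction.\<close>
    ultimately have A: "A \<le> 3 / 4 * ?p" using i(2) by (simp add: A_def)
    have qA: "?q \<le> A" using p by (simp add: A_def)
    have Apos: "0 < A" using p qA by linarith
    have sq: "square N B'"
      unfolding B'i square_def swap_rows_def using i by (auto simp: set_zip)
    have bas: "basis N B'"
    proof
      show "square N B'" by fact
      show "0 < pivot (gr B') k" if "k < N" for k
        unfolding piv using that pivot_pos p Apos by auto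
    qed
    have minor': "gram_minor (gr B') k = (if k = Suc i then gram_minor (gr C) i * A else gram_minor (gr C) k)" for k
    proof -
      have low: "gram_minor (gr B') k = gram_minor (gr C) k" if "k \<le> i" for k
        unfolding gram_minor_def using that by (intro prod.cong) (auto simp: piv)
      have high: "gram_minor (gr B') k = gram_minor (gr C) k" if "Suc (Suc i) \<le> k" for k
        using that
      proof (induction k rule: dec_induct)
        case base
        then show ?case using low[of i] Apos by (simp add: gram_minor_Suc piv)
      next
        case (step k)
        then show ?case by (simp add: gram_minor_Suc piv)
      qed
      consider "k \<le> i" | "k = Suc i" | "Suc (Suc i) \<le> k" by linarith
      then show ?thesis
      proof cases
        case 2
        then show ?thesis using low[of i] by (simp add: gram_minor_Suc piv)
      qed (use low high in auto)
    qed
    have pot: "potential N (gr B') \<le> 3 / 4 * potential N (gr C)"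
    proof -
      have split: "potential N h = gram_minor h (Suc i) * (\<Prod>k\<in>{..<N} - {i}. gram_minor h (Suc k))" for h
        unfolding potential_def using i by (subst prod.remove[of _ i]) auto
      have "gram_minor (gr B') (Suc i) = gram_minor (gr C) i * A" by (simp add: minor')
      also have "\<dots> \<le> gram_minor (gr C) i * (3 / 4 * ?p)"
        using A gram_minor_pos[of i] i by (intro mult_left_mono) auto
      also have "\<dots> = 3 / 4 * gram_minor (gr C) (Suc i)" by (simp add: gram_minor_Suc)
      finally have 1: "gram_minor (gr B') (Suc i) \<le> 3 / 4 * gram_minor (gr C) (Suc i)" .
      have 2: "(\<Prod>k\<in>{..<N} - {i}. gram_minor (gr B') (Suc k)) = (\<Prod>k\<in>{..<N} - {i}. gram_minor (gr C) (Suc k))"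
        by (intro prod.cong) (auto simp: minor')
      have "0 \<le> (\<Prod>k\<in>{..<N} - {i}. gram_minor (gr C) (Suc k))"
        using gram_minor_pos by (intro prod_nonneg) (auto simp: less_imp_le Suc_leI)
      from mult_right_mono[OF 1 this] show ?thesis unfolding split[of "gr B'"] split[of "gr C"] 2 by simp
    qed
    have L: "set B' \<subseteq> L" if "closed_lattice L" "set B \<subseteq> L" for L
    proof -
      have "set B' \<subseteq> set C" unfolding B'i swap_rows_def using i by (auto simp: set_zip)
      then show ?thesis using LC[OF that] by blast
    qed
    \<comment> \<open>Both exchanged pivots are at most the old \<open>?p\<close>, the second
      because \<open>?q \<le> A\<close>. The largest pivot never grows, which keeps lengths
      independent of the number of rounds.\<close>
    have M: "pivot (gr B') k \<le> M" if "\<forall>l<N. pivot (gr B) l \<le> M" "k < N" for M :: real and k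
    proof -
      have "?p \<le> M" using that i C(2) by (metis Suc_lessD)
      moreover have "A \<le> ?p" using A p by linarith
      moreover have "?p * ?q / A \<le> ?p" using p qA Apos by (simp add: pos_divide_le_eq)
      ultimately show ?thesis using that C(2) by (auto simp: piv)
    qed
    have D: "gr B' k k \<le> N * M" if "\<forall>l<N. pivot (gr B) l \<le> M" "k < N" for M :: real and k
    proof -
      have "transpose i (Suc i) k < N" using that(2) i by (auto simp: transpose_def)
      then show ?thesis using diag[of M "transpose i (Suc i) k"] that unfolding g swap_gram_def by auto
    qed
    have "\<not> siegel N (gr B)" using i C(2) by (auto simp: siegel_def not_le)
    moreover have "potential N (gr C) = potential N (gr B)" by (simp add: potential_def minor)
    ultimately show ?thesis using bas minor'[of N] minor i L M D pot by auto
  qed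
qed

lemma lll_step:
  assumes B: "basis N B"
  defines "B' \<equiv> lll_step [0..<N] B"
  shows "basis N B'" "gram_minor (gr B') N = gram_minor (gr B) N"
    "closed_lattice L \<Longrightarrow> set B \<subseteq> L \<Longrightarrow> set B' \<subseteq> L"
    "(\<And>l. l < N \<Longrightarrow> pivot (gr B) l \<le> M) \<Longrightarrow> k < N \<Longrightarrow> pivot (gr B') k \<le> M"
    "(\<And>l. l < N \<Longrightarrow> pivot (gr B) l \<le> M) \<Longrightarrow> k < N \<Longrightarrow> gr B' k k \<le> N * M"
    "siegel N (gr B) \<Longrightarrow> siegel N (gr B')"
    "siegel N (gr B') \<or> potential N (gr B') \<le> 3 / 4 * potential N (gr B)"
  using lll_step_all[OF B] unfolding B'_def by blast+

text \<open>The bound on the rows relies on size reduction and hence holds from the first round on,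
  which explains the exception for empty fuel.\<close>

lemma lll_inv:
  fixes fuel :: "int list"
  assumes "basis N B" "\<And>l. l < N \<Longrightarrow> pivot (gr B) l \<le> M"
  defines "B' \<equiv> lll [0..<N] fuel B"
  shows "basis N B' \<and> gram_minor (gr B') N = gram_minor (gr B) N \<and>
    (\<forall>L. closed_lattice L \<longrightarrow> set B \<subseteq> L \<longrightarrow> set B' \<subseteq> L) \<and> (\<forall>l<N. pivot (gr B') l \<le> M) \<and>
    (fuel = [] \<or> (\<forall>k<N. gr B' k k \<le> N * M)) \<and>
    (siegel N (gr B') \<or> potential N (gr B') \<le> (3 / 4) ^ length fuel * potential N (gr B))"
  unfolding B'_def
proof (induction fuel rule: rev_induct)
  case Nil
  then show ?case using assms by (simp add: lll_def)
next
  case (snoc x fuel)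
  let ?C = "lll [0..<N] fuel B"
  have eq: "lll [0..<N] (fuel @ [x]) B = lll_step [0..<N] ?C" by (simp add: lll_def)
  have C: "basis N ?C" using snoc by blast
  note * = lll_step[OF C]
  have "siegel N (gr (lll_step [0..<N] ?C)) \<or>
    potential N (gr (lll_step [0..<N] ?C)) \<le> (3 / 4) ^ length (fuel @ [x]) * potential N (gr B)"
  proof (cases "siegel N (gr ?C)")
    case False
    then have "potential N (gr ?C) \<le> (3 / 4) ^ length fuel * potential N (gr B)" using snoc by blast
    then show ?thesis using *(7) by auto
  qed (use *(6) in blast)
  then show ?case unfolding eq using *(1-5) snoc by auto
qed

theorem lll_short:
  fixes fuel :: "int list"
  assumes B: "basis N B" and N: "0 < N" and L: "closed_lattice L" "set B \<subseteq> L"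
    and fuel: "(3 / 4) ^ length fuel * potential N (gr B) < 1"
  defines "B' \<equiv> lll [0..<N] fuel B"
  shows "B' ! 0 \<in> L" "length (B' ! 0) = N" "0 < dot (B' ! 0) (B' ! 0)"
    "real_of_int (dot (B' ! 0) (B' ! 0)) ^ N \<le> 2 ^ (N * N) * gram_minor (gr B) N"
proof -
  define M where "M = Max (pivot (gr B) ` {..<N})"
  have "pivot (gr B) l \<le> M" if "l < N" for l using that by (simp add: M_def)
  from lll_inv[OF B this, of fuel] have inv: "basis N B'" "gram_minor (gr B') N = gram_minor (gr B) N"
    "set B' \<subseteq> L" "siegel N (gr B') \<or> potential N (gr B') \<le> (3 / 4) ^ length fuel * potential N (gr B)"
    using L by (auto simp: B'_def)
  interpret basis N B' by fact
  show "B' ! 0 \<in> L" "length (B' ! 0) = N" using N inv(3) nth_mem[of 0 B'] by auto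
  have g: "gr B' 0 0 = real_of_int (dot (B' ! 0) (B' ! 0))" using N by (simp add: gr_def)
  show "0 < dot (B' ! 0) (B' ! 0)" using pivot_pos[OF N] g by (simp add: pivot_def)
  have "1 \<le> potential N (gr B')"
    unfolding potential_def using gram_minor_ge_1[OF gr_int] by (intro prod_ge_1) auto
  then have "siegel N (gr B')" using inv(4) fuel by linarith
  then show "real_of_int (dot (B' ! 0) (B' ! 0)) ^ N \<le> 2 ^ (N * N) * gram_minor (gr B) N"
    using reduced_first inv(2) g by (simp add: siegel_def)
qed

section \<open>Simultaneous Diophantine approximation\<close>

text \<open>A lattice vector has the form \<open>q # (q b - G p)\<close>, so a short one makes every
  \<open>b ! i / G\<close> close to a fraction with denominator \<open>q\<close>. With the row
  \<open>1 # b\<close> in last place all pivots are explicit: \<open>G^2\<close> each, and finally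
  1.\<close>

definition dioph_basis :: "nat list \<Rightarrow> int \<Rightarrow> int list \<Rightarrow> int list list" where
  "dioph_basis I G b = map (\<lambda>i. 0 # map (\<lambda>j. if i = j then G else 0) I) I @ [1 # b]"

definition dioph :: "nat list \<Rightarrow> nat list \<Rightarrow> int list \<Rightarrow> int \<Rightarrow> int list \<Rightarrow> int \<times> int list" where
  "dioph I I' fuel G b = (let v = nth_default [] (lll I' fuel (dioph_basis I G b)) 0; q = nth_default 0 v 0 in
    (q, map2 (\<lambda>x y. (q * x - y) div G) b (tl v)))"

locale dioph_lattice =
  fixes n :: nat and G :: int and b :: "int list"
  assumes n: "0 < n" and G: "0 < G" and b: "length b = n"
begin

abbreviation "B \<equiv> dioph_basis [0..<n] G b"

lemma square_B: "square (Suc n) B"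
  using b by (auto simp: square_def dioph_basis_def)

lemma dot_zeros: "dot (map (\<lambda>j. if i = j then c else 0) [m..<m + length v]) v =
    (if m \<le> i \<and> i < m + length v then c * v ! (i - m) else 0)"
proof (induction v arbitrary: m)
  case (Cons x v)
  have "[m..<m + length (x # v)] = m # [Suc m..<Suc m + length v]"
    using upt_conv_Cons[of m "m + length (x # v)"] by simp
  then show ?case using Cons[of "Suc m"] by (auto simp: nth_Cons' Suc_diff_le)
qed simp

lemma gr_B:
  "i < n \<Longrightarrow> j < n \<Longrightarrow> gr B i j = (if i = j then (real_of_int G)\<^sup>2 else 0)"
  "i < n \<Longrightarrow> gr B i n = G * b ! i"
  "i < n \<Longrightarrow> gr B n i = G * b ! i"
  "gr B n n = 1 + (\<Sum>l=0..<n. (real_of_int (b ! l))\<^sup>2)"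
proof -
  have nth: "nth_default [] B i = (if i < n then 0 # map (\<lambda>j. if i = j then G else 0) [0..<n] else 1 # b)" if "i \<le> n" for i
    using that by (auto simp: dioph_basis_def nth_default_def nth_append)
  note d = dot_zeros[of i G 0] 
  show "gr B i j = (if i = j then (real_of_int G)\<^sup>2 else 0)" if "i < n" "j < n"
    using that dot_zeros[of i G 0 "map (\<lambda>k. if j = k then G else 0) [0..<n]"]
    by (auto simp: gr_def nth power2_eq_square)
  show "gr B i n = G * b ! i" if "i < n"
    using that dot_zeros[of i G 0 b] b by (simp add: gr_def nth)
  then show "gr B n i = G * b ! i" if "i < n"
    using that by (simp add: gr_def dot_commute)
  show "gr B n n = 1 + (\<Sum>l=0..<n. (real_of_int (b ! l))\<^sup>2)"
    using b by (simp add: gr_def nth dot_sum power2_eq_square atLeast0LessThan)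
qed

lemma schur_B:
  assumes "k \<le> n"
  shows "i < n \<Longrightarrow> j < n \<Longrightarrow> schur (gr B) k i j = (if i = j \<and> k \<le> i then (real_of_int G)\<^sup>2 else 0)"
    "i < n \<Longrightarrow> schur (gr B) k i n = (if k \<le> i then G * b ! i else 0)"
    "i < n \<Longrightarrow> schur (gr B) k n i = (if k \<le> i then G * b ! i else 0)"
    "schur (gr B) k n n = 1 + (\<Sum>l=k..<n. (real_of_int (b ! l))\<^sup>2)"
  using assms
proof (induction k arbitrary: i j)
  case 0
  { case 1 then show ?case by (simp add: gr_B) }
  { case 2 then show ?case by (simp add: gr_B) }
  { case 3 then show ?case by (simp add: gr_B) }
  { case 4 then show ?case by (simp add: gr_B) }
next
  case (Suc k)
  have G': "(real_of_int G)\<^sup>2 \<noteq> 0" using G by simp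
  { case 1 then show ?case using Suc.IH(1) G' by (cases "i = k") (auto simp: power2_eq_square) }
  { case 2 then show ?case using Suc.IH(1-3) G' by (cases "i = k") (auto simp: power2_eq_square) }
  { case 3 then show ?case using Suc.IH(1-3) G' by (cases "i = k") (auto simp: power2_eq_square) }
  { case 4
    then have "(\<Sum>l=k..<n. (real_of_int (b ! l))\<^sup>2) = (real_of_int (b ! k))\<^sup>2 + (\<Sum>l=Suc k..<n. (real_of_int (b ! l))\<^sup>2)"
      by (simp add: sum.atLeast_Suc_lessThan)
    then show ?case using Suc.IH 4 G' by (auto simp: power2_eq_square) }
qed

lemma pivot_B: "k < n \<Longrightarrow> pivot (gr B) k = (real_of_int G)\<^sup>2" "pivot (gr B) n = 1"
  using schur_B(1)[of k k k] schur_B(4)[of n] by (auto simp: pivot_def)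

lemma basis_B: "basis (Suc n) B"
proof
  show "square (Suc n) B" by (rule square_B)
  show "0 < pivot (gr B) k" if "k < Suc n" for k
    using pivot_B(1)[of k] pivot_B(2) G that by (cases "k = n") auto
qed

lemma minor_B: "gram_minor (gr B) k = (if k \<le> n then (real_of_int G ^ 2) ^ k else (real_of_int G ^ 2) ^ n)"
  if "k \<le> Suc n"
proof (cases "k \<le> n")
  case True
  then have "gram_minor (gr B) k = (\<Prod>l<k. (real_of_int G)\<^sup>2)"
    unfolding gram_minor_def by (intro prod.cong) (auto simp: pivot_B)
  then show ?thesis using True by simp
next
  case False
  then have "k = Suc n" using that by simp
  moreover have "gram_minor (gr B) n = (\<Prod>l<n. (real_of_int G)\<^sup>2)"
    unfolding gram_minor_def by (intro prod.cong) (auto simp: pivot_B)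
  ultimately show ?thesis by (simp add: gram_minor_Suc pivot_B)
qed

lemma potential_B: "potential (Suc n) (gr B) \<le> real_of_int G ^ (2 * n * Suc n)"
proof -
  have G1: "1 \<le> real_of_int G ^ 2" using G by (simp add: one_le_power)
  have "potential (Suc n) (gr B) \<le> (\<Prod>k<Suc n. (real_of_int G ^ 2) ^ n)"
    unfolding potential_def
  proof (intro prod_mono conjI)
    fix k assume k: "k \<in> {..<Suc n}"
    show "0 \<le> gram_minor (gr B) (Suc k)" using k G by (simp add: minor_B)
    show "gram_minor (gr B) (Suc k) \<le> (real_of_int G ^ 2) ^ n"
      using k G1 power_increasing[of "Suc k" n "real_of_int G ^ 2"] by (auto simp: minor_B simp del: power_Suc)
  qed
  also have "\<dots> = real_of_int G ^ (2 * n * Suc n)" by (simp add: power_mult[symmetric] mult.assoc power_add[symmetric])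
  finally show ?thesis .
qed

text \<open>The potential is less than \<open>2^m\<close> for \<open>m = 2 n (n + 1) log G\<close>,
  and three rounds gain a factor of 2 because \<open>(3 / 4)^3 < 1 / 2\<close>.\<close>

lemma fuel_B:
  assumes "3 * (2 * n * Suc n * floorlog 2 (nat G)) \<le> F"
  shows "(3 / 4) ^ F * potential (Suc n) (gr B) < 1"
proof -
  define m where "m = 2 * n * Suc n * floorlog 2 (nat G)"
  have "nat G < 2 ^ floorlog 2 (nat G)" by (rule less_floorlog)
  then have "G < 2 ^ floorlog 2 (nat G)" using G by (simp add: nat_less_iff)
  then have "real_of_int G < 2 ^ floorlog 2 (nat G)"
    by (metis of_int_less_iff of_int_numeral of_int_power)
  then have "real_of_int G ^ (2 * n * Suc n) < (2 ^ floorlog 2 (nat G)) ^ (2 * n * Suc n)"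
    using G n by (intro power_strict_mono) auto
  also have "\<dots> = 2 ^ m" by (simp add: m_def power_mult[symmetric] ac_simps)
  finally have 1: "potential (Suc n) (gr B) < 2 ^ m" using potential_B by linarith
  have pos: "0 < potential (Suc n) (gr B)"
    unfolding potential_def using G by (intro prod_pos) (auto simp: minor_B)
  have "(3 / 4 :: real) ^ F \<le> (3 / 4) ^ (3 * m)" using assms by (intro power_decreasing) (auto simp: m_def)
  also have "\<dots> = (27 / 64) ^ m" by (simp add: power_mult power3_eq_cube)
  also have "\<dots> \<le> (1 / 2) ^ m" by (intro power_mono) auto
  finally have "(3 / 4) ^ F * potential (Suc n) (gr B) \<le> (1 / 2) ^ m * potential (Suc n) (gr B)"
    using pos by (intro mult_right_mono) auto
  also have "\<dots> < (1 / 2) ^ m * 2 ^ m" using 1 by (intro mult_strict_left_mono) auto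
  also have "\<dots> = 1" by (simp add: power_mult_distrib[symmetric])
  finally show ?thesis .
qed

text \<open>Described by congruences, from which the numerators can be recovered by division without
  tracking the coefficients of a lattice vector.\<close>

definition lattice :: "int list set" where
  "lattice = {u. length u = Suc n \<and> (\<forall>i<n. G dvd (u ! 0 * b ! i - u ! Suc i))}"

lemma closed_lattice: "closed_lattice lattice"
  unfolding closed_lattice_def
proof (intro ballI allI)
  fix u v c assume u: "u \<in> lattice" and v: "v \<in> lattice"
  have "G dvd (u ! 0 + c * v ! 0) * b ! i - (u ! Suc i + c * v ! Suc i)" if "i < n" for i
  proof -
    have "G dvd (u ! 0 * b ! i - u ! Suc i) + c * (v ! 0 * b ! i - v ! Suc i)"
      using u v that by (auto simp: lattice_def)
    then show ?thesis by (simp add: algebra_simps)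
  qed
  then show "lin 1 u c v \<in> lattice" using u v by (simp add: lattice_def)
qed

lemma B_lattice: "set B \<subseteq> lattice"
  using b by (auto simp: lattice_def dioph_basis_def)

theorem dioph_approximation:
  fixes E :: int
  assumes E: "0 < E" and GE: "2 ^ (Suc n * Suc n) * E ^ Suc n \<le> G"
    and fuel: "3 * (2 * n * Suc n * floorlog 2 (nat G)) \<le> length fuel"
    and r: "dioph [0..<n] [0..<Suc n] fuel G b = (q, p)"
  shows "q \<noteq> 0" "length p = n" "\<bar>q\<bar> * E < G" "\<And>i. i < n \<Longrightarrow> \<bar>q * b ! i - G * p ! i\<bar> * E < G"
proof -
  define C where "C = lll [0..<Suc n] fuel B"
  define v where "v = C ! 0"
  interpret C: basis "Suc n" B by (rule basis_B)
  note s = lll_short[OF basis_B _ closed_lattice B_lattice fuel_B[OF fuel], folded C_def v_def]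
  have v: "v \<in> lattice" "length v = Suc n" "0 < dot v v"
    "real_of_int (dot v v) ^ Suc n \<le> 2 ^ (Suc n * Suc n) * gram_minor (gr B) (Suc n)"
    using s by auto
  have lenC: "length C = Suc n"
  proof -
    have "pivot (gr B) l \<le> Max (pivot (gr B) ` {..<Suc n})" if "l < Suc n" for l using that by (intro Max_ge) auto
    then have "basis (Suc n) C" using lll_inv[OF basis_B, of _ fuel] unfolding C_def by blast
    then show ?thesis by (simp add: basis_def square_def)
  qed
  have q: "q = v ! 0" and p: "p = map2 (\<lambda>x y. (q * x - y) div G) b (tl v)"
    using r lenC v(2) by (simp_all add: dioph_def Let_def C_def[symmetric] nth_default_def v_def del: upt_Suc) auto
  show lp: "length p = n" using p b v(2) by simp
  define D where "D = dot v v"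
  \<comment> \<open>\<open>lll_short\<close> gives \<open>D^(n+1) \<le> 2^((n+1)^2) G^(2n)\<close>.
    If \<open>D E^2\<close> reached \<open>G^2\<close>, then \<open>G^2\<close> would be at most
    \<open>2^((n+1)^2) E^(2n+2)\<close>, while the choice of \<open>G\<close> makes it larger by
    another factor \<open>2^((n+1)^2)\<close>.\<close>
  have small: "D * E\<^sup>2 < G\<^sup>2"
  proof (rule ccontr)
    assume "\<not> D * E\<^sup>2 < G\<^sup>2"
    then have "G\<^sup>2 \<le> D * E\<^sup>2" by simp
    then have "(G\<^sup>2) ^ Suc n \<le> (D * E\<^sup>2) ^ Suc n" by (intro power_mono) auto
    also have "\<dots> = D ^ Suc n * (E\<^sup>2) ^ Suc n" by (rule power_mult_distrib)
    also have "\<dots> \<le> (2 ^ (Suc n * Suc n) * (G\<^sup>2) ^ n) * (E\<^sup>2) ^ Suc n"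
    proof (intro mult_right_mono)
      have "real_of_int (D ^ Suc n) \<le> real_of_int (2 ^ (Suc n * Suc n) * (G\<^sup>2) ^ n)"
        using v(4) by (simp add: D_def minor_B)
      then show "D ^ Suc n \<le> 2 ^ (Suc n * Suc n) * (G\<^sup>2) ^ n" by (simp only: of_int_le_iff)
    qed (use E in simp)
    finally have "G\<^sup>2 * (G\<^sup>2) ^ n \<le> (2 ^ (Suc n * Suc n) * (E\<^sup>2) ^ Suc n) * (G\<^sup>2) ^ n"
      by (simp add: ac_simps)
    then have 1: "G\<^sup>2 \<le> 2 ^ (Suc n * Suc n) * (E\<^sup>2) ^ Suc n"
      using G by (simp add: mult_le_cancel_right)
    have "(2 ^ (Suc n * Suc n) * E ^ Suc n)\<^sup>2 \<le> G\<^sup>2"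
      using GE E by (intro power_mono) auto
    then have 2: "2 ^ (Suc n * Suc n) * (2 ^ (Suc n * Suc n) * (E\<^sup>2) ^ Suc n) \<le> G\<^sup>2"
      by (simp add: power2_eq_square power_mult_distrib ac_simps)
    have "0 < 2 ^ (Suc n * Suc n) * (E\<^sup>2) ^ Suc n" using E by simp
    moreover have "(2 :: int) * 1 \<le> 2 ^ (Suc n * Suc n)"
      using one_le_power[of "2 :: int" "n + n * Suc n"] by simp
    ultimately have "2 * (2 ^ (Suc n * Suc n) * (E\<^sup>2) ^ Suc n) \<le> 2 ^ (Suc n * Suc n) * (2 ^ (Suc n * Suc n) * (E\<^sup>2) ^ Suc n)"
      by (intro mult_right_mono) auto
    then show False using 1 2 \<open>0 < 2 ^ (Suc n * Suc n) * (E\<^sup>2) ^ Suc n\<close> by linarith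
  qed
  have coord: "\<bar>v ! i\<bar> * E < G" if "i < Suc n" for i
  proof -
    have "(v ! i)\<^sup>2 \<le> D"
    proof -
      have "v ! i * v ! i \<le> (\<Sum>i<length v. v ! i * v ! i)"
        using that v(2) by (intro member_le_sum) auto
      then show ?thesis by (simp add: D_def dot_sum power2_eq_square)
    qed
    then have "(v ! i)\<^sup>2 * E\<^sup>2 \<le> D * E\<^sup>2" by (intro mult_right_mono) auto
    then have "(\<bar>v ! i\<bar> * E)\<^sup>2 < G\<^sup>2" using small by (simp add: power_mult_distrib)
    then show ?thesis using G by (intro power_less_imp_less_base[of _ 2 G]) auto
  qed
  show "\<bar>q\<bar> * E < G" using coord[of 0] q by simp
  have rest: "q * b ! i - G * p ! i = v ! Suc i" if "i < n" for i
  proof -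
    have "G dvd q * b ! i - v ! Suc i" using v(1) that q by (simp add: lattice_def)
    moreover have "p ! i = (q * b ! i - v ! Suc i) div G"
      using p that b v(2) by (simp add: nth_tl)
    ultimately have "G * p ! i = q * b ! i - v ! Suc i" by simp
    then show ?thesis by simp
  qed
  show "\<bar>q * b ! i - G * p ! i\<bar> * E < G" if "i < n" for i
    using coord[of "Suc i"] rest[OF that] that by simp
  \<comment> \<open>With \<open>q = 0\<close> all entries are multiples of \<open>G\<close> of
    absolute value less than \<open>G\<close>, so the vector would vanish.\<close>
  show "q \<noteq> 0"
  proof
    assume q0: "q = 0"
    have "v ! i = 0" if i: "i < Suc n" for i
    proof (cases i)
      case (Suc j)
      then have "G * (- p ! j) = v ! i" using rest[of j] q0 i by simp
      moreover have "\<bar>v ! i\<bar> < G"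
      proof -
        have "\<bar>v ! i\<bar> * 1 \<le> \<bar>v ! i\<bar> * E" using E by (intro mult_left_mono) auto
        then show ?thesis using coord[OF i] by simp
      qed
      ultimately show ?thesis by (metis dvd_imp_le_int dvd_triv_left linorder_not_less abs_of_pos[OF G])
    qed (use q q0 in simp)
    then have "D = 0" using v(2) by (simp add: D_def dot_sum)
    then show False using v(3) by (simp add: D_def)
  qed
qed

end

subsection \<open>Lattice reduction in polynomial time\<close>

lemma FP_map_in [fp]:
  assumes "FP D xs" "FP (\<lambda>e z. D e (fst z) \<and> snd z \<in> set (xs e (fst z))) (\<lambda>e z. F e (fst z) (snd z))"
  shows "FP D (\<lambda>e x. map (F e x) (xs e x))"
  by (rule FP_map[OF assms]) auto

lemma FP_dot [fp]:
  assumes "FP D f" "FP D g"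
  shows "FP D (\<lambda>e x. dot (f e x) (g e x))"
  unfolding dot_def case_prod_beta
  by (intro FP_sum_list fp assms)

lemma FP_lin [fp]:
  assumes "FP D a" "FP D u" "FP D b" "FP D v"
  shows "FP D (\<lambda>e x. lin (a e x) (u e x) (b e x) (v e x))"
proof -
  have "FP (\<lambda>_ _. True) (\<lambda>e z. lin (fst z) (fst (snd z)) (fst (snd (snd z))) (snd (snd (snd z))))"
    unfolding lin_def case_prod_beta
    by (intro fp)
  from FP_comp4[OF this assms] show ?thesis by simp
qed

lemma FP_gram_list [fp]:
  assumes "FP D f"
  shows "FP D (\<lambda>e x. gram_list (f e x))"
proof -
  have "FP (\<lambda>_ _. True) (\<lambda>e B. gram_list B)"
    unfolding gram_list_def
    by (intro fp)
  from FP_comp[OF this assms] show ?thesis by simp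
qed

lemma esz_int_le: "\<bar>z\<bar> < 2 ^ w \<Longrightarrow> esz (z :: int) \<le> 1 + w"
  using vsize_IntV_le by (simp add: enc_int_def del: vsize.simps)

lemma abs_less_esz: "\<bar>z\<bar> < 2 ^ esz (z :: int)"
proof -
  have "\<bar>z\<bar> < 2 ^ (vsize (IntV z) - 1)" by (rule abs_less_vsize)
  also have "\<dots> \<le> (2 :: int) ^ vsize (IntV z)" by (intro power_increasing) auto
  finally show ?thesis by (simp add: enc_int_def del: vsize.simps)
qed

lemma abs_less_mem: "z \<in> set us \<Longrightarrow> \<bar>z\<bar> < 2 ^ esz (us :: int list)"
proof -
  assume "z \<in> set us"
  then have "esz z \<le> esz us" using esz_mem less_imp_le by blast
  then have "(2 :: int) ^ esz z \<le> 2 ^ esz us" by (intro power_increasing) auto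
  then show ?thesis using abs_less_esz[of z] by linarith
qed

lemma esz_list_le: "(\<And>x. x \<in> set xs \<Longrightarrow> esz x \<le> w) \<Longrightarrow> esz xs \<le> 1 + length xs * w"
  using esz_map_le[of xs "\<lambda>x. x" w] by simp

lemma esz_ints_le: "(\<And>x. x \<in> set xs \<Longrightarrow> \<bar>x\<bar> < 2 ^ w) \<Longrightarrow> esz (xs :: int list) \<le> 1 + length xs * (1 + w)"
  by (intro esz_list_le esz_int_le)

text \<open>Bounds the code length of a matrix of order \<open>N\<close> whose entries have at most
  \<open>w\<close> binary digits.\<close>

definition msize :: "nat \<Rightarrow> nat \<Rightarrow> nat" where
  "msize N w = 1 + N * (1 + N * (1 + w))"

lemma esz_rows_le:
  assumes "length C \<le> N" "\<And>u. u \<in> set C \<Longrightarrow> length u \<le> N \<and> (\<forall>x \<in> set u. \<bar>x\<bar> < 2 ^ w)"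
  shows "esz (C :: int list list) \<le> msize N w"
proof -
  have "esz u \<le> 1 + N * (1 + w)" if "u \<in> set C" for u
    using esz_ints_le[of u w] assms(2)[OF that] mult_right_mono[of "length u" N "1 + w"] by fastforce
  then have "esz C \<le> 1 + length C * (1 + N * (1 + w))" by (rule esz_list_le)
  also have "\<dots> \<le> msize N w" using assms(1) unfolding msize_def by (intro add_left_mono mult_right_mono) auto
  finally show ?thesis .
qed

lemma pbd_msize [fp]: "pbd D f \<Longrightarrow> pbd D g \<Longrightarrow> pbd D (\<lambda>e x. msize (f e x) (g e x))"
  unfolding msize_def by (intro pbd_add pbd_mult pbd_const)

lemma esz_square_le:
  assumes "square N C" "\<And>k. k < N \<Longrightarrow> gr C k k \<le> 2 ^ w"
  shows "esz C \<le> msize N (Suc w)"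
proof (rule esz_rows_le)
  show "length C \<le> N" using assms(1) by (simp add: square_def)
  fix u assume u: "u \<in> set C"
  then obtain k where k: "k < N" "u = C ! k" using assms(1) by (auto simp: square_def in_set_conv_nth)
  have "real_of_int (dot u u) \<le> real_of_int (2 ^ w)" using assms(2)[OF k(1)] k assms(1) by (simp add: gr_def square_def)
  then have d: "dot u u \<le> 2 ^ w" by (simp only: of_int_le_iff)
  have "\<bar>x\<bar> < 2 ^ Suc w" if "x \<in> set u" for x
  proof -
    obtain i where "i < length u" "x = u ! i" using \<open>x \<in> set u\<close> by (metis in_set_conv_nth)
    then have "\<bar>x\<bar> \<le> 2 ^ w" using abs_nth_le_dot[of i u] d by simp
    also have "\<dots> < (2 :: int) ^ Suc w" by simp
    finally show ?thesis .
  qed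
  then show "length u \<le> N \<and> (\<forall>x \<in> set u. \<bar>x\<bar> < 2 ^ Suc w)"
    using u assms(1) by (auto simp: square_def)
qed

definition valid_basis :: "nat list \<Rightarrow> int list list \<Rightarrow> bool" where
  "valid_basis I B \<longleftrightarrow> I = [0..<length B] \<and> basis (length B) B"

lemma gr_le:
  assumes "i < length B" "j < length B"
  shows "\<bar>gr B i j\<bar> \<le> 2 ^ esz (gram_list B)"
proof -
  have "dot (B ! i) (B ! j) = gram_list B ! i ! j" using assms by (simp add: gram_list_def)
  moreover have "gram_list B ! i ! j \<in> set (gram_list B ! i)" "gram_list B ! i \<in> set (gram_list B)"
    using assms by (auto simp: gram_list_def)
  ultimately have "\<bar>dot (B ! i) (B ! j)\<bar> < 2 ^ esz (gram_list B ! i)" "esz (gram_list B ! i) \<le> esz (gram_list B)"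
    using abs_less_mem esz_mem less_imp_le by metis+
  then have "\<bar>dot (B ! i) (B ! j)\<bar> < 2 ^ esz (gram_list B)"
    by (meson one_le_numeral order_less_le_trans power_increasing)
  then have "real_of_int \<bar>dot (B ! i) (B ! j)\<bar> < real_of_int (2 ^ esz (gram_list B))" by (simp only: of_int_less_iff)
  then show ?thesis using assms by (simp add: gr_def)
qed

context basis
begin

abbreviation "W \<equiv> esz (gram_list B)"

lemma pivot_le_W: "k < N \<Longrightarrow> pivot (gr B) k \<le> 2 ^ W"
  using pivot_le[of k] gr_le[of k B k] by simp

lemma minor_le_W: "k \<le> N \<Longrightarrow> gram_minor (gr B) k \<le> 2 ^ (W * N)"
proof -
  assume k: "k \<le> N"
  have "gram_minor (gr B) k \<le> (\<Prod>l<k. 2 ^ W)"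
    unfolding gram_minor_def using pivot_le_W pivot_pos k by (intro prod_mono) (auto simp: less_imp_le)
  also have "\<dots> = 2 ^ (W * k)" by (simp add: power_mult)
  also have "\<dots> \<le> 2 ^ (W * N)" using k by (intro power_increasing) auto
  finally show ?thesis .
qed

lemma bd_le_W: "k \<le> N \<Longrightarrow> \<bar>bd k\<bar> < 2 ^ Suc (W * N + W + 1)"
proof -
  assume k: "k \<le> N"
  have "real_of_int (bd k) \<le> real_of_int (2 ^ (W * N))" using minor_le_W[OF k] k by (simp add: bd_real)
  then have "bd k \<le> 2 ^ (W * N)" by (simp only: of_int_le_iff)
  also have "\<dots> < (2 :: int) ^ Suc (W * N + W + 1)" by (intro power_strict_increasing) auto
  finally show ?thesis using bd_pos[OF k] by simp
qed

text \<open>Every intermediate number of the elimination is a minor times a complement. Both are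
  controlled by the initial Gram matrix, so the numbers do not explode.\<close>

lemma bm_le_W:
  assumes "k \<le> N" "i < N" "j < N"
  shows "\<bar>bm k i j\<bar> < 2 ^ Suc (W * N + W + 1)"
proof -
  define X :: real where "X = 2 ^ W"
  have "\<bar>gr B i j\<bar> \<le> X" "gr B i i \<le> X" "gr B j j \<le> X"
    using assms gr_le[of i B j] gr_le[of i B i] gr_le[of j B j] by (auto simp: X_def dest: abs_le_D1)
  then have "\<bar>schur (gr B) k i j\<bar> \<le> 2 * X"
    using abs_schur_le[OF assms] by (simp only: field_simps)
  then have s: "\<bar>schur (gr B) k i j\<bar> \<le> 2 ^ (W + 1)" by (simp add: X_def)
  have "real_of_int \<bar>bm k i j\<bar> = gram_minor (gr B) k * \<bar>schur (gr B) k i j\<bar>"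
    using assms gram_minor_pos[of k] by (simp add: bm_real abs_mult)
  also have "\<dots> \<le> 2 ^ (W * N) * 2 ^ (W + 1)"
    using s minor_le_W[OF assms(1)] gram_minor_pos[OF assms(1)] by (intro mult_mono) auto
  also have "\<dots> = real_of_int (2 ^ (W * N + W + 1))" by (simp add: power_add)
  finally have "\<bar>bm k i j\<bar> \<le> 2 ^ (W * N + W + 1)" by (simp only: of_int_le_iff)
  then show ?thesis by (rule order.strict_trans1) (intro power_strict_increasing, auto)
qed

end

lemma FP_bareiss_step [fp]:
  assumes "FP D k" "FP D s"
  shows "FP D (\<lambda>e x. bareiss_step (k e x) (s e x))"
proof -
  have "FP (\<lambda>_ _. True) (\<lambda>e z. bareiss_step (fst z) (snd z))"
    unfolding bareiss_step_def Let_def case_prod_beta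
    by (intro fp)
  from FP_comp2[OF this assms] show ?thesis by simp
qed

lemma FP_bareiss:
  assumes "FP D I" "FP D B" "\<And>e x. D e x \<Longrightarrow> valid_basis (I e x) (B e x)"
  shows "FP D (\<lambda>e x. bareiss (I e x) (B e x))"
proof -
  let ?D = "\<lambda>(e :: env) x. valid_basis (fst x) (snd x)"
  let ?a = "\<lambda>B. (gram_list B, 1 :: int, [] :: int list list)"
  let ?W = "\<lambda>x. esz (gram_list (snd x)) * esz (snd x) + esz (gram_list (snd x)) + 2"
  let ?B = "\<lambda>(e :: env) x. 3 + 2 * msize (esz (snd x)) (?W x) + ?W x"
  have "FP ?D (\<lambda>e x. fold (\<lambda>k s. bareiss_step k s) (fst x) (?a (snd x)))"
  proof (rule FP_fold[where D' = "\<lambda>_ _. True" and B = ?B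
      and I = "\<lambda>e x k s. s = fold bareiss_step [0..<k] (?a (snd x))"])
    show "pbd ?D ?B"
      by (intro fp)
    fix e k s and x :: "nat list \<times> int list list"
    assume D: "?D e x" and k: "k \<le> length (fst x)" and s: "s = fold bareiss_step [0..<k] (?a (snd x))"
    let ?N = "length (snd x)"
    interpret basis ?N "snd x" using D unfolding valid_basis_def by blast
    note len [simp del]
    have "length (fst x) = ?N" using D unfolding valid_basis_def by (metis length_upt diff_zero)
    then have k': "k \<le> ?N" using k by simp
    let ?w = "Suc (W * ?N + W + 1)"
    have N: "?N \<le> esz (snd x)" by (rule length_le_esz)
    have w: "?w \<le> ?W x" using N by (simp add: mult_le_mono)
    have pw: "(2 :: int) ^ ?w \<le> 2 ^ ?W x" by (rule power_increasing[OF w]) simp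
    have bmW: "\<bar>bm k' i j\<bar> < 2 ^ ?W x" if "k' \<le> ?N" "i < ?N" "j < ?N" for k' i j
      using bm_le_W[OF that] pw by (rule order.strict_trans2)
    have s': "s = (map (\<lambda>i. map (\<lambda>j. bm k i j) [0..<?N]) [0..<?N], bd k, rev (map (\<lambda>l. map (\<lambda>j. bm l l j) [0..<?N]) [0..<k]))"
      unfolding s by (rule bareiss_state[OF k'])
    have "esz (fst s) \<le> msize (esz (snd x)) (?W x)"
      using N bmW[OF k'] by (intro esz_rows_le) (auto simp: s')
    moreover have "esz (snd (snd s)) \<le> msize (esz (snd x)) (?W x)"
      using N bmW k' by (intro esz_rows_le) (auto simp: s')
    moreover have "esz (fst (snd s)) \<le> 1 + ?W x"
      unfolding s' fst_conv snd_conv by (intro esz_int_le order.strict_trans2[OF bd_le_W[OF k'] pw])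
    ultimately show "esz s \<le> ?B e x" using esz_prod[of "fst s" "snd s"] esz_prod[of "fst (snd s)" "snd (snd s)"] by simp
  qed (auto simp: valid_basis_def intro!: fp)
  then have "FP ?D (\<lambda>e x. bareiss (fst x) (snd x))"
    unfolding bareiss_def by (intro fp)
  from FP_comp2[OF this assms(1,2)] show ?thesis using assms(3) by simp
qed

lemma FP_reduce_pair:
  assumes I: "FP D I" and i: "FP D i" and j: "FP D j" and B: "FP D B" and D: "\<And>e x. D e x \<Longrightarrow> valid_basis (I e x) (B e x)"
  shows "FP D (\<lambda>e x. reduce_pair (I e x) (i e x) (j e x) (B e x))"
proof -
  let ?D = "\<lambda>(e :: env) z. valid_basis (fst z) (snd (snd (snd z)))"
  have bar: "FP ?D (\<lambda>e z. bareiss (fst z) (snd (snd (snd z))))"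
    by (rule FP_bareiss) (auto intro!: fp)
  have row: "FP ?D (\<lambda>e z. nth_default [] (bareiss (fst z) (snd (snd (snd z)))) (fst (snd (snd z))))"
    by (intro fp bar)
  have r: "FP ?D (\<lambda>e z. let row = nth_default [] (bareiss (fst z) (snd (snd (snd z)))) (fst (snd (snd z))) in
      - ((2 * nth_default 0 row (fst (snd z)) + nth_default 0 row (fst (snd (snd z)))) div (2 * nth_default 0 row (fst (snd (snd z))))))"
    by (intro FP_Let row fp)
  have "FP (\<lambda>_ _. True) (\<lambda>e (z :: (nat \<times> nat list \<times> int list list) \<times> int \<times> int list). map (\<lambda>y. if fst y = fst (fst z) then lin 1 (snd y) (fst (snd z)) (snd (snd z)) else snd y)
      (zip (fst (snd (fst z))) (snd (snd (fst z)))))"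
    by (intro fp)
  note m = FP_comp[OF this, where g = "\<lambda>e z. ((fst (snd z), fst z, snd (snd (snd z))),
     (let row = nth_default [] (bareiss (fst z) (snd (snd (snd z)))) (fst (snd (snd z))) in
      - ((2 * nth_default 0 row (fst (snd z)) + nth_default 0 row (fst (snd (snd z)))) div (2 * nth_default 0 row (fst (snd (snd z)))))),
     nth_default [] (snd (snd (snd z))) (fst (snd (snd z))))" and D = ?D]
  have "FP ?D (\<lambda>e z. reduce_pair (fst z) (fst (snd z)) (fst (snd (snd z))) (snd (snd (snd z))))"
    by (rule FP_cong[OF m]) (auto simp: reduce_pair_def Let_def intro!: fp r[unfolded Let_def])
  from FP_comp4[OF this I i j B] show ?thesis using D by simp
qed

text \<open>Only row \<open>i\<close> is unfinished. Its coefficients start below the bound of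
  \<open>mu_bound\<close> and have doubled at most \<open>k\<close> times, which costs
  \<open>k\<close> further bits; the other rows are unchanged.\<close>

lemma valid_reduce_below:
  assumes "valid_basis I B" "i < length B" "reduced_below i B" "k \<le> i"
  defines "C \<equiv> fold (\<lambda>j B. reduce_pair I i j B) (take k (rev (filter (\<lambda>j. j < i) I))) B"
  shows "valid_basis I C" "esz C \<le> msize (length B) (3 * length B + 3 * esz (gram_list B) + 2 * (esz (gram_list B) * length B) + 4)"
proof -
  let ?N = "length B"
  interpret basis ?N B using assms unfolding valid_basis_def by blast
  note len [simp del]
  have I: "I = [0..<?N]" using assms by (simp add: valid_basis_def)
  have "filter (\<lambda>j. j < i) [0..<?N] = [0..<i]"
    using upt_add_eq_append[of 0 i "?N - i"] assms(2) by simp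
  then have C: "C = fold (\<lambda>j B. reduce_pair [0..<?N] i j B) (rev [i - k..<i]) B"
    by (simp add: C_def I take_rev)
  have mu: "\<bar>mu i l\<bar> \<le> 2 ^ W * 2 ^ (W * ?N)" if "l < i" for l
    using mu_bound[OF basis_axioms that assms(2), of "2 ^ W"] gr_le[of i B i] minor_le_W[of l] assms(2) that by simp
  note * = reduce_row_partial[OF basis_axioms assms(2,3,4) mu, folded C]
  have bC: "basis ?N C" using * by blast
  then have lC: "length C = ?N" by (simp add: basis_def square_def)
  show "valid_basis I C" using bC lC I by (simp add: valid_basis_def)
  let ?w = "3 * ?N + 3 * W + 2 * (W * ?N) + 3"
  have gi: "gr C i i \<le> 2 ^ ?w"
  proof -
    define Y where "Y = (2 :: real) ^ (?N + (W + W * ?N + 1))"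
    have "\<bar>basis.mu C i l\<bar> \<le> Y" if "l < i" for l
    proof -
      have "\<bar>basis.mu C i l\<bar> \<le> 2 ^ k * (2 ^ W * 2 ^ (W * ?N) + 1)" using * that by fastforce
      also have "\<dots> \<le> 2 ^ ?N * (2 ^ W * 2 ^ (W * ?N) + 2 ^ W * 2 ^ (W * ?N))"
        using assms(2,4) mult_mono[of "1 :: real" "2 ^ W" 1 "2 ^ (W * ?N)"]
        by (intro mult_mono add_left_mono power_increasing) auto
      also have "\<dots> = Y" by (simp add: Y_def power_add)
      finally show ?thesis .
    qed
    moreover have "1 \<le> Y" unfolding Y_def by (rule one_le_power) simp
    moreover have "pivot (gr C) l \<le> 2 ^ W" if "l < ?N" for l using * pivot_le_W[OF that] by simp
    ultimately have "gr C i i \<le> ?N * (Y\<^sup>2 * 2 ^ W)" by (intro diag_bound[OF bC assms(2)])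
    also have "\<dots> \<le> 2 ^ ?N * (Y\<^sup>2 * 2 ^ W)" by (intro mult_right_mono) (auto simp: less_imp_le)
    also have "\<dots> = 2 ^ (?N + 2 * (?N + (W + W * ?N + 1)) + W)"
    proof -
      have "Y\<^sup>2 = 2 ^ (2 * (?N + (W + W * ?N + 1)))" by (simp only: Y_def power_mult[symmetric] mult.commute)
      then show ?thesis by (simp only: power_add mult.assoc)
    qed
    also have "\<dots> \<le> 2 ^ ?w" by (intro power_increasing) auto
    finally show ?thesis .
  qed
  have "gr C x x \<le> 2 ^ ?w" if "x < ?N" for x
  proof (cases "x = i")
    case False
    then have "gr C x x = gr B x x" using * that lC by (simp add: gr_def)
    also have "\<dots> \<le> 2 ^ W" using gr_le[of x B x] that by simp
    also have "\<dots> \<le> 2 ^ ?w" by (intro power_increasing) auto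
    finally show ?thesis .
  qed (use gi in simp)
  then show "esz C \<le> msize ?N (3 * ?N + 3 * W + 2 * (W * ?N) + 4)"
    using esz_square_le[of ?N C ?w] bC by (simp add: basis_def ac_simps)
qed

lemma msize_mono: "N \<le> N' \<Longrightarrow> w \<le> w' \<Longrightarrow> msize N w \<le> msize N' w'"
  unfolding msize_def by (intro add_mono mult_mono) auto

lemma FP_reduce_row:
  assumes I: "FP D I" and i: "FP D i" and B: "FP D B"
    and D: "\<And>e x. D e x \<Longrightarrow> valid_basis (I e x) (B e x) \<and> i e x < length (B e x) \<and> reduced_below (i e x) (B e x)"
  shows "FP D (\<lambda>e x. reduce_row (I e x) (i e x) (B e x))"
proof -
  let ?D = "\<lambda>(e :: env) z. valid_basis (fst z) (snd (snd z)) \<and> fst (snd z) < length (snd (snd z)) \<and> reduced_below (fst (snd z)) (snd (snd z))"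
  let ?js = "\<lambda>z. rev (filter (\<lambda>j. j < fst (snd z)) (fst z))"
  let ?W = "\<lambda>z. esz (gram_list (snd (snd z)))" and ?N = "\<lambda>z. esz (snd (snd z))"
  let ?B = "\<lambda>(e :: env) z. msize (?N z) (3 * ?N z + 3 * ?W z + 2 * (?W z * ?N z) + 4)"
  have len: "length (?js z) = fst (snd z)" if "?D e z" for e z
  proof -
    have "filter (\<lambda>j. j < fst (snd z)) [0..<length (snd (snd z))] = [0..<fst (snd z)]"
      using upt_add_eq_append[of 0 "fst (snd z)" "length (snd (snd z)) - fst (snd z)"] that by simp
    then show ?thesis using that by (simp add: valid_basis_def)
  qed
  have "FP ?D (\<lambda>e z. fold (\<lambda>j B. reduce_pair (fst z) (fst (snd z)) j B) (?js z) (snd (snd z)))"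
  proof (rule FP_fold[where D' = "\<lambda>e z. valid_basis (fst (fst z)) (snd (snd z))" and B = ?B
      and I = "\<lambda>e z k C. C = fold (\<lambda>j B. reduce_pair (fst z) (fst (snd z)) j B) (take k (?js z)) (snd (snd z))"])
    show "FP ?D (\<lambda>e z. ?js z)"
      by (intro FP_rev FP_filter[where F = "\<lambda>e z j. j < fst (snd z)" and D' = "\<lambda>_ _. True"] fp) simp
    show "FP (\<lambda>e z. valid_basis (fst (fst z)) (snd (snd z)))
       (\<lambda>e (z :: (nat list \<times> nat \<times> int list list) \<times> nat \<times> int list list). reduce_pair (fst (fst z)) (fst (snd (fst z))) (fst (snd z)) (snd (snd z)))"
      by (intro FP_reduce_pair fp) simp
    show "pbd ?D ?B"
      by (intro fp)
    fix e k C and z :: "nat list \<times> nat \<times> int list list"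
    assume Dz: "?D e z" and C: "C = fold (\<lambda>j B. reduce_pair (fst z) (fst (snd z)) j B) (take k (?js z)) (snd (snd z))"
    { assume k: "k < length (?js z)"
      show "reduce_pair (fst z) (fst (snd z)) (?js z ! k) C =
        fold (\<lambda>j B. reduce_pair (fst z) (fst (snd z)) j B) (take (Suc k) (?js z)) (snd (snd z))"
        using k C by (simp add: take_Suc_conv_app_nth)
      show "valid_basis (fst (fst (z, ?js z ! k, C))) (snd (snd (z, ?js z ! k, C)))"
        using valid_reduce_below(1)[of "fst z" "snd (snd z)" "fst (snd z)" k] Dz k len[OF Dz] C by simp }
    assume k: "k \<le> length (?js z)"
    have "esz C \<le> msize (length (snd (snd z))) (3 * length (snd (snd z)) + 3 * ?W z + 2 * (?W z * length (snd (snd z))) + 4)"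
      using valid_reduce_below(2)[of "fst z" "snd (snd z)" "fst (snd z)" k] Dz k len[OF Dz] C by simp
    also have "\<dots> \<le> ?B e z"
      using length_le_esz[of "snd (snd z)"] by (intro msize_mono add_mono mult_mono) auto
    finally show "esz C \<le> ?B e z" .
  qed (auto intro!: fp)
  then have "FP ?D (\<lambda>e z. reduce_row (fst z) (fst (snd z)) (snd (snd z)))"
    unfolding reduce_row_def .
  from FP_comp3[OF this I i B] show ?thesis using D by simp
qed

text \<open>The finished rows are bounded through the pivots, which do not change, and the remaining
  rows are those of \<open>B\<close>.\<close>

lemma valid_reduce_all_partial:
  assumes "valid_basis I B" "m \<le> length B"
  defines "C \<equiv> fold (\<lambda>i B. reduce_row I i B) (take m I) B"
  shows "valid_basis I C" "reduced_below m C" "length C = length B"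
    "esz C \<le> msize (length B) (length B + esz (gram_list B) + 1)"
proof -
  let ?N = "length B"
  interpret basis ?N B using assms unfolding valid_basis_def by blast
  note len [simp del]
  have I: "I = [0..<?N]" using assms by (simp add: valid_basis_def)
  have C: "C = fold (\<lambda>i B. reduce_row [0..<?N] i B) [0..<m] B"
    using assms(2) by (simp add: C_def I take_upt)
  note * = reduce_all_partial[OF basis_axioms assms(2), folded C]
  have bC: "basis ?N C" using * by blast
  then show lC: "length C = ?N" by (simp add: basis_def square_def)
  show "valid_basis I C" using bC lC I by (simp add: valid_basis_def)
  show red: "reduced_below m C" using * by blast
  have "gr C x x \<le> 2 ^ (?N + W)" if "x < ?N" for x
  proof (cases "x < m")
    case False
    then have "gr C x x = gr B x x" using * that lC by (simp add: gr_def)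
    also have "\<dots> \<le> 2 ^ W" using gr_le[of x B x] that by simp
    also have "\<dots> \<le> 2 ^ (?N + W)" by (intro power_increasing) auto
    finally show ?thesis .
  next
    case True
    have "gr C x x \<le> real ?N * (1\<^sup>2 * 2 ^ W)"
      using red True * pivot_le_W by (intro diag_bound[OF bC that]) (fastforce simp: reduced_below_def)+
    also have "\<dots> \<le> 2 ^ ?N * 2 ^ W" by (simp add: less_imp_le)
    finally show ?thesis by (simp add: power_add)
  qed
  then show "esz C \<le> msize ?N (?N + W + 1)"
    using esz_square_le[of ?N C "?N + W"] bC by (simp add: basis_def)
qed

lemma FP_reduce_all:
  assumes I: "FP D I" and B: "FP D B" and D: "\<And>e x. D e x \<Longrightarrow> valid_basis (I e x) (B e x)"
  shows "FP D (\<lambda>e x. reduce_all (I e x) (B e x))"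
proof -
  let ?D = "\<lambda>(e :: env) z. valid_basis (fst z) (snd z)"
  let ?B = "\<lambda>(e :: env) z. msize (esz (snd z)) (esz (snd z) + esz (gram_list (snd z)) + 1)"
  have len: "length (fst z) = length (snd z)" "k < length (fst z) \<Longrightarrow> fst z ! k = k" if "?D e z" for e z k
    using that unfolding valid_basis_def by (metis length_upt diff_zero, metis length_upt diff_zero nth_upt plus_nat.add_0)
  have "FP ?D (\<lambda>e z. fold (\<lambda>i B. reduce_row (fst z) i B) (fst z) (snd z))"
  proof (rule FP_fold[where D' = "\<lambda>e z. valid_basis (fst (fst z)) (snd (snd z)) \<and> fst (snd z) < length (snd (snd z)) \<and> reduced_below (fst (snd z)) (snd (snd z))"
      and B = ?B and I = "\<lambda>e z k C. C = fold (\<lambda>i B. reduce_row (fst z) i B) (take k (fst z)) (snd z)"])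
    show "FP (\<lambda>e z. valid_basis (fst (fst z)) (snd (snd z)) \<and> fst (snd z) < length (snd (snd z)) \<and> reduced_below (fst (snd z)) (snd (snd z)))
        (\<lambda>e (z :: (nat list \<times> int list list) \<times> nat \<times> int list list). reduce_row (fst (fst z)) (fst (snd z)) (snd (snd z)))"
      by (intro FP_reduce_row fp) simp
    show "pbd ?D ?B"
      by (intro fp)
    fix e k C and z :: "nat list \<times> int list list"
    assume Dz: "?D e z" and C: "C = fold (\<lambda>i B. reduce_row (fst z) i B) (take k (fst z)) (snd z)"
    { assume k: "k < length (fst z)"
      show "reduce_row (fst z) (fst z ! k) C = fold (\<lambda>i B. reduce_row (fst z) i B) (take (Suc k) (fst z)) (snd z)"
        using k C by (simp add: take_Suc_conv_app_nth)
      show "valid_basis (fst (fst (z, fst z ! k, C))) (snd (snd (z, fst z ! k, C))) \<and>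
        fst (snd (z, fst z ! k, C)) < length (snd (snd (z, fst z ! k, C))) \<and>
        reduced_below (fst (snd (z, fst z ! k, C))) (snd (snd (z, fst z ! k, C)))"
        using valid_reduce_all_partial[OF Dz, of k] k len[OF Dz] C by simp }
    assume k: "k \<le> length (fst z)"
    have "esz C \<le> msize (length (snd z)) (length (snd z) + esz (gram_list (snd z)) + 1)"
      using valid_reduce_all_partial(4)[OF Dz, of k] k len[OF Dz] C by simp
    also have "\<dots> \<le> ?B e z" using length_le_esz[of "snd z"] by (intro msize_mono) auto
    finally show "esz C \<le> ?B e z" .
  qed (auto intro!: fp)
  then have "FP ?D (\<lambda>e z. reduce_all (fst z) (snd z))"
    unfolding reduce_all_def .
  from FP_comp2[OF this I B] show ?thesis using D by simp
qed

lemma FP_violation [fp]: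
  assumes "FP D I" "FP D ds"
  shows "FP D (\<lambda>e x. violation (I e x) (ds e x))"
proof -
  let ?P = "\<lambda>(ds :: int list) i. nth_default 0 ds (Suc (Suc i)) \<noteq> 0 \<and>
      2 * (nth_default 0 ds i * nth_default 0 ds (Suc (Suc i))) < nth_default 0 ds (Suc i) * nth_default 0 ds (Suc i)"
  have "FP (\<lambda>_ _. True) (\<lambda>e z. fold (\<lambda>i acc. if ?P (snd z) i then (True, i) else acc) (fst z) (False, 0))"
  proof (rule FP_fold[where D' = "\<lambda>_ _. True"
      and I = "\<lambda>e z k s. snd s = 0 \<or> snd s \<in> set (fst z)" and B = "\<lambda>e z. 10 + esz (fst z)"])
    show "pbd (\<lambda>_ _. True) (\<lambda>(e :: env) (z :: nat list \<times> int list). 10 + esz (fst z))"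
      by (intro fp)
    show "esz s \<le> 10 + esz (fst z)" if "snd s = 0 \<or> snd s \<in> set (fst z)" for s :: "bool \<times> nat" and z :: "nat list \<times> int list"
      using that esz_prod[of "fst s" "snd s"] esz_mem[of "snd s" "fst z"]
      by (auto simp: enc_bool_def bool_val_def enc_nat_def floorlog_small split: if_splits)
  qed (auto intro!: fp)
  then have "FP (\<lambda>_ _. True) (\<lambda>e z. violation (fst z) (snd z))"
    unfolding violation_def .
  from FP_comp2[OF this assms] show ?thesis by simp
qed

lemma FP_swap_rows [fp]:
  assumes "FP D I" "FP D i" "FP D B"
  shows "FP D (\<lambda>e x. swap_rows (I e x) (i e x) (B e x))"
proof -
  have "FP (\<lambda>_ _. True) (\<lambda>e z. swap_rows (fst z) (fst (snd z)) (snd (snd z)))"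
    unfolding swap_rows_def
    by (intro fp)
  from FP_comp3[OF this assms] show ?thesis by simp
qed

lemma FP_minors:
  assumes I: "FP D I" and B: "FP D B" and D: "\<And>e x. D e x \<Longrightarrow> valid_basis (I e x) (B e x)"
  shows "FP D (\<lambda>e x. minors (I e x) (B e x))"
  unfolding minors_def
  by (intro FP_bareiss[OF I B D] I fp)

lemma valid_reduce_all: "valid_basis I B \<Longrightarrow> valid_basis I (reduce_all I B)"
  using valid_reduce_all_partial(1)[of I B "length B"] by (simp add: reduce_all_def valid_basis_def)

lemma FP_lll_step:
  assumes I: "FP D I" and B: "FP D B" and D: "\<And>e x. D e x \<Longrightarrow> valid_basis (I e x) (B e x)"
  shows "FP D (\<lambda>e x. lll_step (I e x) (B e x))"
proof -
  let ?D = "\<lambda>(e :: env) z. valid_basis (fst z) (snd z)"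
  have m: "FP ?D (\<lambda>e z. minors (fst z) (snd z))"
    by (intro FP_minors fp)
  have "FP ?D (\<lambda>e z. let v = violation (fst z) (minors (fst z) (snd z)) in if fst v then swap_rows (fst z) (snd v) (snd z) else snd z)"
    by (intro FP_Let fp m)
  from FP_comp2[OF this I FP_reduce_all[OF I B D]] show ?thesis
    unfolding lll_step_def Let_def using valid_reduce_all[OF D] by simp
qed

lemma lll_simps: "lll I [] B = B" "lll I (fuel @ [x]) B = lll_step I (lll I fuel B)"
  by (simp_all add: lll_def)

text \<open>The bound is independent of \<open>fuel\<close>: pivots stay below their initial bound,
  and after a round the rows are bounded by \<open>N\<close> times this bound. Short intermediate
  results are what makes the whole reduction polynomial.\<close>

lemma valid_lll:
  assumes "valid_basis I B"
  shows "valid_basis I (lll I fuel B)" "esz (lll I fuel B) \<le> msize (esz B) (esz B + esz (gram_list B) + 1)"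
proof -
  let ?N = "length B"
  interpret basis ?N B using assms unfolding valid_basis_def by blast
  note len [simp del]
  have I: "I = [0..<?N]" using assms by (simp add: valid_basis_def)
  note * = lll_inv[OF basis_axioms pivot_le_W, of fuel, folded I]
  let ?C = "lll I fuel B"
  have bC: "basis ?N ?C" using * by blast
  then have lC: "length ?C = ?N" by (simp add: basis_def square_def)
  show "valid_basis I ?C" using bC lC I by (simp add: valid_basis_def)
  show "esz ?C \<le> msize (esz B) (esz B + W + 1)"
  proof (cases "fuel = []")
    case True
    have "esz B \<le> msize ?N (Suc W)"
      using esz_square_le[of ?N B W] gr_le[of _ B] square by fastforce
    also have "\<dots> \<le> msize (esz B) (esz B + W + 1)" using length_le_esz[of B] by (intro msize_mono) auto
    finally show ?thesis using True by (simp add: lll_def)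
  next
    case False
    have "gr ?C k k \<le> 2 ^ (?N + W)" if "k < ?N" for k
    proof -
      have "gr ?C k k \<le> real ?N * 2 ^ W" using * that False by blast
      also have "\<dots> \<le> 2 ^ ?N * 2 ^ W" by (simp add: less_imp_le)
      finally show ?thesis by (simp add: power_add)
    qed
    then have "esz ?C \<le> msize ?N (Suc (?N + W))"
      using bC by (intro esz_square_le) (auto simp: basis_def)
    also have "\<dots> \<le> msize (esz B) (esz B + W + 1)" using length_le_esz[of B] by (intro msize_mono) auto
    finally show ?thesis .
  qed
qed

lemma FP_lll:
  assumes I: "FP D I" and fuel: "FP D fuel" and B: "FP D B" and D: "\<And>e x. D e x \<Longrightarrow> valid_basis (I e x) (B e x)"
  shows "FP D (\<lambda>e x. lll (I e x) (fuel e x) (B e x))"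
proof -
  let ?D = "\<lambda>(e :: env) z. valid_basis (fst z) (snd (snd z))"
  let ?B = "\<lambda>(e :: env) z. msize (esz (snd (snd z))) (esz (snd (snd z)) + esz (gram_list (snd (snd z))) + 1)"
  have "FP ?D (\<lambda>e (z :: nat list \<times> int list \<times> int list list). fold (\<lambda>_ B. lll_step (fst z) B) (fst (snd z)) (snd (snd z)))"
  proof (rule FP_fold[where D' = "\<lambda>e z. valid_basis (fst (fst z)) (snd (snd z))"
      and B = ?B and I = "\<lambda>e z k C. C = lll (fst z) (take k (fst (snd z))) (snd (snd z))"])
    show "FP (\<lambda>e z. valid_basis (fst (fst z)) (snd (snd z)))
       (\<lambda>e (z :: (nat list \<times> int list \<times> int list list) \<times> int \<times> int list list). lll_step (fst (fst z)) (snd (snd z)))"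
      by (intro FP_lll_step fp)
    show "pbd ?D ?B"
      by (intro fp)
  qed (auto intro!: fp valid_lll[simplified] simp: take_Suc_conv_app_nth lll_simps)
  then have "FP ?D (\<lambda>e z. lll (fst z) (fst (snd z)) (snd (snd z)))"
    by (rule FP_cong) (simp add: lll_def)
  from FP_comp3[OF this I fuel B] show ?thesis using D by simp
qed

lemma FP_dioph:
  assumes I: "FP D I" and I': "FP D I'" and fuel: "FP D fuel" and G: "FP D G" and b: "FP D b"
    and D: "\<And>e x. D e x \<Longrightarrow> \<exists>n>0. I e x = [0..<n] \<and> I' e x = [0..<Suc n] \<and> 0 < G e x \<and> length (b e x) = n"
  shows "FP D (\<lambda>e x. dioph (I e x) (I' e x) (fuel e x) (G e x) (b e x))"
proof -
  have "FP (\<lambda>_ _. True) (\<lambda>e z. dioph_basis (fst z) (fst (snd z)) (snd (snd z)))"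
    unfolding dioph_basis_def
    by (intro fp)
  from FP_comp3[OF this I G b] have B: "FP D (\<lambda>e x. dioph_basis (I e x) (G e x) (b e x))" by simp
  have valid: "valid_basis (I' e x) (dioph_basis (I e x) (G e x) (b e x))" if "D e x" for e x
  proof -
    obtain n where nn: "0 < n" "I e x = [0..<n]" "I' e x = [0..<Suc n]" "0 < G e x" "length (b e x) = n"
      using D[OF \<open>D e x\<close>] by auto
    interpret dioph_lattice n "G e x" "b e x" by standard (use nn in auto)
    have "length (dioph_basis [0..<n] (G e x) (b e x)) = Suc n" using square_B by (simp add: square_def)
    then show ?thesis using basis_B nn by (simp add: valid_basis_def del: upt_Suc)
  qed
  have l: "FP D (\<lambda>e x. lll (I' e x) (fuel e x) (dioph_basis (I e x) (G e x) (b e x)))"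
    by (intro FP_lll I' fuel B valid)
  have "FP (\<lambda>_ _. True) (\<lambda>e (z :: int list list \<times> int \<times> int list). let v = nth_default [] (fst z) 0; q = nth_default 0 v 0 in
    (q, map (\<lambda>y. (q * fst y - snd y) div fst (snd z)) (zip (snd (snd z)) (tl v))))"
    unfolding Let_def
    by (intro fp)
  from FP_comp3[OF this l G b] show ?thesis
    unfolding dioph_def Let_def case_prod_beta by simp
qed

section \<open>Small integer solutions of homogeneous equations\<close>

lemma abs_det_le:
  fixes A :: "int mat"
  assumes A: "A \<in> carrier_mat k k" and le: "\<And>i j. i < k \<Longrightarrow> j < k \<Longrightarrow> \<bar>A $$ (i, j)\<bar> \<le> m"
  shows "\<bar>det A\<bar> \<le> fact k * m ^ k"
proof -
  have "\<bar>signof p * (\<Prod>i = 0..<k. A $$ (i, p i))\<bar> \<le> m ^ k" if "p permutes {0..<k}" for p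
  proof -
    have "\<bar>signof p * (\<Prod>i = 0..<k. A $$ (i, p i))\<bar> = (\<Prod>i = 0..<k. \<bar>A $$ (i, p i)\<bar>)"
      by (simp add: abs_mult abs_prod sign_def)
    also have "\<dots> \<le> (\<Prod>i = 0..<k. m)"
      using le permutes_in_image[OF that] by (intro prod_mono) auto
    finally show ?thesis by simp
  qed
  then have "\<bar>det A\<bar> \<le> (\<Sum>p | p permutes {0..<k}. m ^ k)"
    unfolding det_def'[OF A] by (intro order.trans[OF sum_abs] sum_mono) auto
  also have "\<dots> = fact k * m ^ k"
    using card_permutations[of "{0..<k}" k] by simp
  finally show ?thesis .
qed

text \<open>Take a nonsingular minor of largest order \<open>k\<close>; the vector \<open>z\<close>
  forces \<open>k < n\<close>. Border it by one more column and an arbitrary row of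
  \<open>R\<close>: the determinant vanishes by maximality. Its cofactors along that row do not
  depend on the row and are the entries of the solution.\<close>

lemma small_kernel_vector:
  fixes R :: "int list set" and m :: int
  assumes R: "\<And>r. r \<in> R \<Longrightarrow> length r = n \<and> (\<forall>i<n. \<bar>r ! i\<bar> \<le> m)" and m: "1 \<le> m"
    and z: "length z = n" "\<exists>i<n. z ! i \<noteq> 0" "\<And>r. r \<in> R \<Longrightarrow> dot r z = 0"
  shows "\<exists>w. length w = n \<and> (\<exists>i<n. w ! i \<noteq> 0) \<and> (\<forall>r\<in>R. dot r w = 0) \<and> (\<forall>i<n. \<bar>w ! i\<bar> \<le> fact n * m ^ n)"
proof -
  define minor where "minor k f c = mat k k (\<lambda>(i, j). f i ! c j)" for k and f :: "nat \<Rightarrow> int list" and c :: "nat \<Rightarrow> nat"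
  define P where "P k \<longleftrightarrow> (\<exists>f c. (\<forall>i<k. f i \<in> R) \<and> (\<forall>j<k. c j < n) \<and> det (minor k f c) \<noteq> 0)" for k
  have carrier: "minor k f c \<in> carrier_mat k k" for k f c by (simp add: minor_def)
  have inj: "inj_on c {..<k}" if "det (minor k f c) \<noteq> 0" for k f c
  proof (rule inj_onI, rule ccontr)
    fix i j assume ij: "i \<in> {..<k}" "j \<in> {..<k}" "c i = c j" "i \<noteq> j"
    have "col (minor k f c) i = col (minor k f c) j"
      using ij by (intro eq_vecI) (auto simp: minor_def)
    then have "det (minor k f c) = 0"
      using ij by (intro det_identical_columns[OF carrier, of i j]) auto
    then show False using that by simp
  qed
  have le_n: "k \<le> n" if "P k" for k
  proof -
    obtain f c where fc: "\<forall>j<k. c j < n" "det (minor k f c) \<noteq> 0" using \<open>P k\<close> unfolding P_def by blast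
    have "card (c ` {..<k}) \<le> card {..<n}" using fc(1) by (intro card_mono) auto
    then show ?thesis using card_image[OF inj[OF fc(2)]] by simp
  qed
  have "P 0" unfolding P_def by (simp add: minor_def)
  then obtain k where k: "P k" "\<And>l. P l \<Longrightarrow> l \<le> k"
    using le_n Nat.ex_has_greatest_nat[of P 0 n] by auto
  obtain f c where fR: "\<And>i. i < k \<Longrightarrow> f i \<in> R" and cn: "\<And>j. j < k \<Longrightarrow> c j < n" and det: "det (minor k f c) \<noteq> 0"
    using k(1) by (auto simp: P_def)
  \<comment> \<open>For \<open>k = n\<close> the columns are permuted by \<open>c\<close>, and
    \<open>z\<close>, permuted accordingly, would be a nonzero kernel vector of a nonsingular
    matrix.\<close>
  have "k < n"
  proof (rule ccontr)
    assume "\<not> k < n"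
    then have kn: "k = n" using le_n[OF k(1)] by simp
    have "c ` {..<n} = {..<n}"
      using inj[OF det] cn kn by (intro endo_inj_surj) auto
    then have bij: "bij_betw c {..<n} {..<n}"
      using inj[OF det] kn by (simp add: bij_betw_def)
    let ?A = "minor k f c"
    have 0: "(\<Sum>j<k. ?A $$ (i, j) * z ! c j) = 0" if "i < k" for i
    proof -
      have "(\<Sum>j<k. ?A $$ (i, j) * z ! c j) = (\<Sum>j<n. f i ! c j * z ! c j)"
        using that kn by (simp add: minor_def)
      also have "\<dots> = (\<Sum>j<n. f i ! j * z ! j)"
        by (rule sum.reindex_bij_betw[OF bij])
      also have "\<dots> = dot (f i) z" using R[OF fR[OF that]] z(1) by (simp add: dot_sum)
      finally show ?thesis using z(3) fR[OF that] by simp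
    qed
    have "vec k (\<lambda>j. z ! c j) = 0\<^sub>v k"
    proof (rule ccontr)
      assume "vec k (\<lambda>j. z ! c j) \<noteq> 0\<^sub>v k"
      moreover have "?A *\<^sub>v vec k (\<lambda>j. z ! c j) = 0\<^sub>v k"
        using 0 by (intro eq_vecI) (auto simp: minor_def scalar_prod_def lessThan_atLeast0)
      ultimately show False using det det_0_iff_vec_prod_zero[OF carrier[of k f c]] vec_carrier by blast
    qed
    then have "z ! c l = 0" if "l < k" for l using that by (metis index_vec index_zero_vec(1))
    moreover have "\<exists>l<k. c l = i" if "i < n" for i
      using bij that kn unfolding bij_betw_def by (metis imageE lessThan_iff)
    ultimately show False using z(2) by metis
  qed
  have "\<exists>l<n. l \<notin> c ` {..<k}"
  proof (rule ccontr)
    assume "\<not> ?thesis"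
    then have "{..<n} \<subseteq> c ` {..<k}" by auto
    then have "card {..<n} \<le> card (c ` {..<k})" by (intro card_mono) auto
    also have "\<dots> \<le> k" using card_image_le[of "{..<k}" c] by simp
    finally show False using \<open>k < n\<close> by simp
  qed
  then obtain l where l: "l < n" "l \<notin> c ` {..<k}" by blast
  let ?c = "c(k := l)"
  let ?M = "\<lambda>x. minor (Suc k) (f(k := x)) ?c"
  \<comment> \<open>The list \<open>[]\<close> is a placeholder: cofactors along the last row ignore
    its entries.\<close>
  define C where "C j = cofactor (?M []) k j" for j
  have cof: "cofactor (?M x) k j = C j" for x j
  proof -
    have "mat_delete (?M x) k j = mat_delete (?M []) k j"
      by (rule eq_matI) (auto simp: mat_delete_def minor_def)
    then show ?thesis by (simp add: C_def cofactor_def)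
  qed
  have zero: "(\<Sum>j<Suc k. x ! ?c j * C j) = 0" if "x \<in> R" for x
  proof -
    have "\<not> P (Suc k)" using k(2)[of "Suc k"] by auto
    then have "det (?M x) = 0"
      unfolding P_def using fR cn l that by (metis (no_types, lifting) fun_upd_apply less_antisym)
    moreover have "det (?M x) = (\<Sum>j<Suc k. ?M x $$ (k, j) * cofactor (?M x) k j)"
      by (rule laplace_expansion_row[OF carrier]) simp
    moreover have "\<dots> = (\<Sum>j<Suc k. x ! ?c j * C j)"
      unfolding cof by (intro sum.cong) (auto simp: minor_def)
    ultimately show ?thesis by simp
  qed
  have Ck: "C k \<noteq> 0"
  proof -
    have "mat_delete (?M []) k k = minor k f c"
      by (rule eq_matI) (auto simp: mat_delete_def minor_def)
    then show ?thesis using det by (simp add: C_def cofactor_def)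
  qed
  have Cle: "\<bar>C j\<bar> \<le> fact k * m ^ k" if j: "j < Suc k" for j
  proof -
    have "\<bar>det (mat_delete (?M []) k j)\<bar> \<le> fact k * m ^ k"
    proof (rule abs_det_le)
      show "mat_delete (?M []) k j \<in> carrier_mat k k"
        using mat_delete_carrier[OF carrier, of "Suc k"] by simp
      fix a b assume ab: "a < k" "b < k"
      then have "mat_delete (?M []) k j $$ (a, b) = f a ! ?c (if b < j then b else Suc b)"
        by (simp add: mat_delete_def minor_def)
      moreover have "?c (if b < j then b else Suc b) < n" using ab j cn l by auto
      ultimately show "\<bar>mat_delete (?M []) k j $$ (a, b)\<bar> \<le> m" using R[OF fR[OF ab(1)]] by simp
    qed
    then show ?thesis by (simp add: C_def cofactor_def abs_mult power_abs)
  qed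
  define w where "w = map (\<lambda>i. \<Sum>j<Suc k. if ?c j = i then C j else 0) [0..<n]"
  have "dot r w = 0" if "r \<in> R" for r
  proof -
    have "dot r w = (\<Sum>i<n. \<Sum>j<Suc k. r ! i * (if ?c j = i then C j else 0))"
      using R[OF that] by (simp add: dot_sum w_def sum_distrib_left del: sum.lessThan_Suc)
    also have "\<dots> = (\<Sum>j<Suc k. \<Sum>i<n. r ! i * (if ?c j = i then C j else 0))" by (rule sum.swap)
    also have "\<dots> = (\<Sum>j<Suc k. r ! ?c j * C j)"
    proof (rule sum.cong[OF refl])
      fix j assume "j \<in> {..<Suc k}"
      then have "?c j < n" using cn l by (auto simp: less_Suc_eq)
      then show "(\<Sum>i<n. r ! i * (if ?c j = i then C j else 0)) = r ! ?c j * C j"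
        by (simp add: if_distrib[of "\<lambda>x. _ * x"] cong: if_cong)
    qed
    finally show ?thesis using zero[OF that] by simp
  qed
  moreover have "w ! l \<noteq> 0"
  proof -
    have "w ! l = C k + (\<Sum>j<k. if c j = l then C j else 0)" using l by (simp add: w_def)
    also have "(\<Sum>j<k. if c j = l then C j else 0) = 0" using l(2) by (intro sum.neutral) auto
    finally show ?thesis using Ck by simp
  qed
  moreover have "\<bar>w ! i\<bar> \<le> fact n * m ^ n" if "i < n" for i
  proof -
    have "\<bar>w ! i\<bar> \<le> (\<Sum>j<Suc k. \<bar>if ?c j = i then C j else 0\<bar>)"
      using that unfolding w_def by (simp del: sum.lessThan_Suc fun_upd_apply add: sum_abs)
    also have "\<dots> \<le> (\<Sum>j<Suc k. fact k * m ^ k)"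
      using Cle m by (intro sum_mono) (auto simp del: fun_upd_apply)
    also have "\<dots> = fact (Suc k) * m ^ k" by (simp add: algebra_simps)
    also have "\<dots> \<le> fact n * m ^ n"
      using \<open>k < n\<close> m by (intro mult_mono fact_mono power_increasing) auto
    finally show ?thesis .
  qed
  ultimately show ?thesis using l(1) by (intro exI[of _ w]) (auto simp: w_def)
qed

text \<open>The matrix of all products is triangular with nonzero diagonal. For \<open>k > n\<close>
  it factors through a matrix that is padded by a zero column and hence singular. This bound counts
  steps without any notion of dimension.\<close>

lemma triangular_length_le:
  fixes a u :: "nat \<Rightarrow> int list"
  assumes len: "\<And>t. t < k \<Longrightarrow> length (a t) = n \<and> length (u t) = n"
    and diag: "\<And>t. t < k \<Longrightarrow> dot (a t) (u t) \<noteq> 0"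
    and upper: "\<And>s t. t < s \<Longrightarrow> s < k \<Longrightarrow> dot (a t) (u s) = 0"
  shows "k \<le> n"
proof (rule ccontr)
  assume "\<not> k \<le> n"
  then have kn: "n < k" by simp
  let ?A = "mat k k (\<lambda>(t, j). if j < n then a t ! j else 0)"
  let ?U = "mat k k (\<lambda>(j, s). if j < n then u s ! j else 0)"
  have AU: "(?A * ?U) $$ (t, s) = dot (a t) (u s)" if "t < k" "s < k" for t s
  proof -
    have "(?A * ?U) $$ (t, s) = (\<Sum>j<k. if j < n then a t ! j * u s ! j else 0)"
      using that by (auto simp: scalar_prod_def atLeast0LessThan intro!: sum.cong)
    also have "\<dots> = (\<Sum>j<n. a t ! j * u s ! j)"
      using kn by (intro sum.mono_neutral_cong_right) auto
    finally show ?thesis using len that by (simp add: dot_sum)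
  qed
  have "det (?A * ?U) = prod_list (diag_mat (?A * ?U))"
    by (rule det_lower_triangular[of k]) (use AU upper in auto)
  also have "\<dots> \<noteq> 0"
    using AU diag by (auto simp: prod_list_zero_iff diag_mat_def)
  finally have "det ?A \<noteq> 0" using det_mult[of ?A k ?U] by auto
  moreover have "det ?A = (\<Sum>i<k. ?A $$ (i, n) * cofactor ?A i n)"
    by (rule laplace_expansion_column) (use kn in auto)
  moreover have "\<dots> = 0" using kn by (intro sum.neutral) auto
  ultimately show False by simp
qed

section \<open>The algorithm\<close>

text \<open>A point \<open>y / D\<close> is represented by the homogeneous vector \<open>D # y\<close>, and \<open>mem\<close> and \<open>sep\<close> answer
  queries for homogeneous vectors. The list \<open>I\<close> of all indices serves as a unary representation of
  the dimension.\<close>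

definition unit_list :: "nat list \<Rightarrow> nat \<Rightarrow> int list" where
  "unit_list I k = map (\<lambda>i. if i = k then 1 else 0) I"

definition asum :: "int list \<Rightarrow> int" where
  "asum v = sum_list (map abs v)"

definition next_list :: "nat list \<Rightarrow> nat list" where
  "next_list I = 0 # map Suc I"

definition size_of :: "nat list \<Rightarrow> int" where
  "size_of I = sum_list (map (\<lambda>_. 1) I)"

text \<open>\<open>(n m)^n\<close>, which dominates the \<open>n! m^n\<close> of
  \<open>small_kernel_vector\<close>. The power is a product over the index list because that is how
  it is computed.\<close>

definition kernel_bound :: "nat list \<Rightarrow> int \<Rightarrow> int" where
  "kernel_bound I m = prod_list (map (\<lambda>_. size_of I * m) I)"

text \<open>Exceeds \<open>1 + 2 n W\<close>, where \<open>W\<close> is the kernel bound, so that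
  rounding errors summed over a short vector stay below 1; and it is at least \<open>2 n\<close>, so
  that the largest coefficient is not rounded to 0.\<close>

definition quality :: "nat list \<Rightarrow> int \<Rightarrow> int" where
  "quality I m = 2 * size_of I * kernel_bound I m + 2 * size_of I"

text \<open>\<open>2^((n+1)^2) E^(n+1)\<close>, the least value that
  \<open>dioph_approximation\<close> admits for the precision \<open>E\<close> given by
  \<open>quality\<close>.\<close>

definition grid :: "nat list \<Rightarrow> int \<Rightarrow> int" where
  "grid I m = prod_list (map (\<lambda>_. prod_list (map (\<lambda>_. 2) (next_list I))) (next_list I)) *
    prod_list (map (\<lambda>_. quality I m) (next_list I))"

text \<open>\<open>(n G)^n\<close> for the grid \<open>G\<close>: with coefficients up to
  \<open>G\<close>, each step of back substitution enlarges entries by a factor of at most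
  \<open>n G\<close>, and there are at most \<open>n\<close> steps.\<close>

definition direction_bound :: "nat list \<Rightarrow> int \<Rightarrow> int" where
  "direction_bound I m = prod_list (map (\<lambda>_. size_of I * grid I m) I)"

text \<open>At scale \<open>n m W\<close> every short vector of the face can be added without
  leaving the cone (\<open>shift_in_K\<close>); the direction bound compensates for the size of the
  tested direction, and the grid is the precision wanted.\<close>

definition zoom :: "nat list \<Rightarrow> int \<Rightarrow> int" where
  "zoom I m = size_of I * m * kernel_bound I m * direction_bound I m * grid I m"

text \<open>Six rounds per bit of the grid for each of \<open>(n+1)^2\<close> pairs, enough for
  \<open>fuel_B\<close>.\<close>

definition grid_fuel :: "nat list \<Rightarrow> int \<Rightarrow> int list" where
  "grid_fuel I m = concat (map (\<lambda>_. concat (map (\<lambda>_. concat (map (\<lambda>_. [0, 0, 0, 0, 0, 0]) (bits (grid I m))))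
    (next_list I))) (next_list I))"

text \<open>Twice the largest possible value of \<open>\<bar>dot r u\<bar>\<close>, and these values
  are the denominators of step lengths.\<close>

definition line_quality :: "nat list \<Rightarrow> int \<Rightarrow> int" where
  "line_quality I m = 2 * size_of I * m * direction_bound I m"

text \<open>The grid of \<open>dioph_approximation\<close> for a single number: the exponents are 4
  and 2.\<close>

definition line_grid :: "nat list \<Rightarrow> int \<Rightarrow> int" where
  "line_grid I m = 16 * line_quality I m * line_quality I m"

definition line_fuel :: "nat list \<Rightarrow> int \<Rightarrow> int list" where
  "line_fuel I m = concat (map (\<lambda>_. [0, 0, 0, 0, 0, 0, 0, 0, 0, 0, 0, 0]) (bits (line_grid I m)))"

text \<open>Equations \<open>p \<bullet> w = 0\<close> are collected in triangular form, most recent first: the entry \<open>(j, p)\<close>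
  has \<open>p ! j \<noteq> 0\<close>, and \<open>p\<close> vanishes at the pivots \<open>j\<close> of all older entries.\<close>

definition back_step :: "nat list \<Rightarrow> nat \<times> int list \<Rightarrow> int list \<Rightarrow> int list" where
  "back_step I e u = lin (nth_default 0 (snd e) (fst e)) u (- dot (snd e) u) (unit_list I (fst e))"

text \<open>Starts from a free coordinate and treats recent equations first. Correcting the pivot
  coordinate of an older equation does not disturb recent ones, which vanish there. Scaling by the
  pivot entry avoids fractions.\<close>

definition back_substitution :: "nat list \<Rightarrow> (nat \<times> int list) list \<Rightarrow> nat \<Rightarrow> int list" where
  "back_substitution I ps k = fold (\<lambda>e u. back_step I e u) ps (unit_list I k)"

text \<open>Runs from the oldest equation on, so that zeros at older pivots survive. On solutions of
  the equations the functional changes only by a nonzero factor.\<close>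

definition eliminate :: "(nat \<times> int list) list \<Rightarrow> int list \<Rightarrow> int list" where
  "eliminate ps h = fold (\<lambda>e g. lin (nth_default 0 (snd e) (fst e)) g (- nth_default 0 g (fst e)) (snd e)) (rev ps) h"

definition free_index :: "nat list \<Rightarrow> (nat \<times> int list) list \<Rightarrow> bool \<times> nat" where
  "free_index I ps = fold (\<lambda>i acc. if filter (\<lambda>e. fst e = i) ps = [] then (True, i) else acc) I (False, 0)"

definition nonzero_index :: "nat list \<Rightarrow> int list \<Rightarrow> bool \<times> nat" where
  "nonzero_index I p = fold (\<lambda>i acc. if nth_default 0 p i \<noteq> 0 then (True, i) else acc) I (False, 0)"

text \<open>Division by \<open>asum g\<close> normalizes the functional before it is rounded to the
  grid. Of the simultaneous approximation only the numerators \<open>p\<close> are kept, since the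
  equation is homogeneous.\<close>

definition new_equation :: "nat list \<Rightarrow> int \<Rightarrow> (nat \<times> int list) list \<Rightarrow> int list \<Rightarrow> nat \<times> int list" where
  "new_equation I m ps h = (let g = eliminate ps h; c = asum g;
      p = snd (dioph I (next_list I) (grid_fuel I m) (grid I m) (map (\<lambda>x. (grid I m * x) div c) g)) in
    (snd (nonzero_index I p), p))"

text \<open>An empty second component means that no direction has been found yet. If both signs stay
  in the cone, the rows tight at \<open>z\<close> must vanish on \<open>u\<close>; otherwise the
  separating functional supplies another equation.\<close>

definition face_step :: "(int list \<Rightarrow> bool) \<Rightarrow> (int list \<Rightarrow> int list) \<Rightarrow> nat list \<Rightarrow> int \<Rightarrow> int list \<Rightarrow>
    (nat \<times> int list) list \<times> int list \<Rightarrow> (nat \<times> int list) list \<times> int list" where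
  "face_step mem sep I m z s =
    (if snd s \<noteq> [] \<or> \<not> fst (free_index I (fst s)) then s else
      let u = back_substitution I (fst s) (snd (free_index I (fst s))) in
      if \<not> mem (lin (zoom I m) z 1 u) then (new_equation I m (fst s) (sep (lin (zoom I m) z 1 u)) # fst s, [])
      else if \<not> mem (lin (zoom I m) z (- 1) u) then (new_equation I m (fst s) (sep (lin (zoom I m) z (- 1) u)) # fst s, [])
      else (fst s, u))"

text \<open>The initial equation confines the search to directions of height 0. At most
  \<open>n\<close> triangular equations exist, so \<open>n\<close> rounds either find a direction or
  use up all indices.\<close>

definition face :: "(int list \<Rightarrow> bool) \<Rightarrow> (int list \<Rightarrow> int list) \<Rightarrow> nat list \<Rightarrow> int \<Rightarrow> int list \<Rightarrow> int list" where
  "face mem sep I m z = snd (fold (\<lambda>_ s. face_step mem sep I m z s) I ([(0, unit_list I 0)], []))"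

definition bisect_step :: "(int list \<Rightarrow> bool) \<Rightarrow> int \<Rightarrow> int list \<Rightarrow> int list \<Rightarrow> int \<times> int \<Rightarrow> int \<times> int" where
  "bisect_step mem c z u s =
    (if snd s - fst s \<le> 1 then s
     else if mem (lin c z ((fst s + snd s) div 2) u) then ((fst s + snd s) div 2, snd s)
     else (fst s, (fst s + snd s) div 2))"

text \<open>Bisection locates the step length between neighbouring multiples of
  \<open>1 / line_grid\<close>, and one-dimensional Diophantine approximation turns this into the
  exact fraction. The denominator may come out negative, hence the change of signs.\<close>

definition line_search :: "(int list \<Rightarrow> bool) \<Rightarrow> nat list \<Rightarrow> int \<Rightarrow> int list \<Rightarrow> int list \<Rightarrow> int \<Rightarrow> int \<times> int" where
  "line_search mem I m z u T =
    (let j = fst (fold (\<lambda>_ s. bisect_step mem (line_grid I m) z u s) (bits (T * line_grid I m)) (0, T * line_grid I m));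
      r = dioph [0] [0, 1] (line_fuel I m) (line_grid I m) [j] in
    if fst r < 0 then (- fst r, - nth_default 0 (snd r) 0) else (fst r, nth_default 0 (snd r) 0))"

text \<open>A row negative on \<open>u\<close> is at most \<open>-1\<close> there and at most
  \<open>m * asum z\<close> at \<open>z\<close>, so a step of length \<open>m * asum z + 1\<close>
  certainly leaves the cone.\<close>

definition advance :: "(int list \<Rightarrow> bool) \<Rightarrow> nat list \<Rightarrow> int \<Rightarrow> int list \<Rightarrow> int list \<Rightarrow> int list" where
  "advance mem I m z u = (let r = line_search mem I m z u (m * asum z + 1) in lin (fst r) z (snd r) u)"

text \<open>If even the far point along \<open>u\<close> lies in the cone, then no row is negative
  on \<open>u\<close>. Since the cone contains no line of height 0, the walk must then leave it in
  direction \<open>-u\<close>.\<close>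

definition walk_step :: "(int list \<Rightarrow> bool) \<Rightarrow> (int list \<Rightarrow> int list) \<Rightarrow> nat list \<Rightarrow> int \<Rightarrow> int list \<Rightarrow> int list" where
  "walk_step mem sep I m z = (let u = face mem sep I m z in
    if u = [] then z
    else if mem (lin 1 z (m * asum z + 1) u) then advance mem I m z (map uminus u)
    else advance mem I m z u)"

text \<open>The walk ends at a multiple of a vertex; the division is exact because vertices are
  integral.\<close>

definition vertex_near :: "(int list \<Rightarrow> bool) \<Rightarrow> (int list \<Rightarrow> int list) \<Rightarrow> nat list \<Rightarrow> int \<Rightarrow> int list \<Rightarrow> int list" where
  "vertex_near mem sep I m z =
    (let y = fold (\<lambda>_ y. walk_step mem sep I m y) (next_list I) z in map (\<lambda>x. x div nth_default 0 y 0) y)"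

text \<open>The components of the state: finished, the scale \<open>M\<close>, the remaining point \<open>z\<close> (weighted by \<open>1 / M\<close>),
  the integral remainder, and the part of the decomposition found so far.\<close>

type_synonym peel_state = "bool \<times> int \<times> int list \<times> int list \<times> (int \<times> int list) list"

text \<open>The test decides whether \<open>z - z_0 v\<close>, which has height 0, is a recession
  direction of the cone. If so, all the weight of \<open>z\<close> can be put on \<open>v\<close>
  and the process ends. Otherwise as much of \<open>v\<close> as possible is removed from
  \<open>z\<close>, the scale is multiplied by the denominator of the step, and the integral part of
  the coefficient is split off.\<close>

definition peel :: "(int list \<Rightarrow> bool) \<Rightarrow> nat list \<Rightarrow> int \<Rightarrow> int list \<Rightarrow> int \<Rightarrow> int list \<Rightarrow> int list \<Rightarrow> (int \<times> int list) list \<Rightarrow> peel_state" where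
  "peel mem I m v M z r ps =
    (if mem (lin 1 v (m * asum v + 1) (lin 1 z (- nth_default 0 z 0) v))
     then let k = (nth_default 0 z 0 - 1) div M in (True, M, z, lin 1 r (- k) v, (k, tl v) # ps)
     else let l = line_search mem I m z (map uminus v) (nth_default 0 z 0); k = snd l div (fst l * M) in
       (False, fst l * M, lin (fst l) z (snd l) (map uminus v), lin 1 r (- k) v, (k, tl v) # ps))"

definition peel_step :: "(int list \<Rightarrow> bool) \<Rightarrow> (int list \<Rightarrow> int list) \<Rightarrow> nat list \<Rightarrow> int \<Rightarrow> peel_state \<Rightarrow> peel_state" where
  "peel_step mem sep I m s = (if fst s then s else
    peel mem I m (vertex_near mem sep I m (fst (snd (snd s)))) (fst (snd s)) (fst (snd (snd s)))
      (fst (snd (snd (snd s)))) (snd (snd (snd (snd s)))))"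

definition peel_all :: "(int list \<Rightarrow> bool) \<Rightarrow> (int list \<Rightarrow> int list) \<Rightarrow> nat list \<Rightarrow> int \<Rightarrow> int list \<Rightarrow> peel_state" where
  "peel_all mem sep I m a = fold (\<lambda>_ s. peel_step mem sep I m s) (next_list I) (False, 1, a, a, [])"

text \<open>The third component is the multiple found, or 0. The first coefficient of the separating
  functional tells on which side of \<open>k\<close> the solutions lie. If it is 0, the functional
  is constant in \<open>k\<close> and excludes all of them, so the interval is made empty.\<close>

definition find_step :: "(int list \<Rightarrow> bool) \<Rightarrow> (int list \<Rightarrow> int list) \<Rightarrow> int list \<Rightarrow> int \<times> int \<times> int \<Rightarrow> int \<times> int \<times> int" where
  "find_step mem sep a s =
    (if snd (snd s) \<noteq> 0 \<or> fst (snd s) < fst s then s else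
      let k = (fst s + fst (snd s)) div 2 in
      if mem (k # a) then (fst s, fst (snd s), k) else
      let c = nth_default 0 (sep (k # a)) 0 in
      if 0 < c then (k + 1, fst (snd s), 0) else if c < 0 then (fst s, k - 1, 0) else (fst s, fst s - 1, 0))"

definition find_multiple :: "(int list \<Rightarrow> bool) \<Rightarrow> (int list \<Rightarrow> int list) \<Rightarrow> int \<Rightarrow> int list \<Rightarrow> int" where
  "find_multiple mem sep m a = snd (snd (fold (\<lambda>_ s. find_step mem sep a s) (0 # bits (m * asum a + 1)) (1, m * asum a + 1, 0)))"

section \<open>Faces and vertices\<close>

lemma length_unit_list [simp]: "length (unit_list I k) = length I"
  by (simp add: unit_list_def)

lemma nth_unit_list [simp]: "i < n \<Longrightarrow> unit_list [0..<n] k ! i = (if i = k then 1 else 0)"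
  by (simp add: unit_list_def)

lemma dot_unit_list: "length v = n \<Longrightarrow> k < n \<Longrightarrow> dot v (unit_list [0..<n] k) = v ! k"
  by (simp add: dot_sum if_distrib[of "\<lambda>x. _ * x"] cong: if_cong)

lemma asum_sum: "asum v = (\<Sum>i<length v. \<bar>v ! i\<bar>)"
  by (simp add: asum_def sum_list_sum_nth atLeast0LessThan)

lemma asum_nonneg: "0 \<le> asum v"
  by (simp add: asum_sum sum_nonneg)

lemma abs_nth_le_asum: "i < length v \<Longrightarrow> \<bar>v ! i\<bar> \<le> asum v"
  unfolding asum_sum by (intro member_le_sum) auto

lemma abs_dot_le:
  assumes "length r = n" "length u = n" "\<And>i. i < n \<Longrightarrow> \<bar>r ! i\<bar> \<le> m"
  shows "\<bar>dot r u\<bar> \<le> m * asum u"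
proof -
  have "\<bar>dot r u\<bar> \<le> (\<Sum>i<n. \<bar>r ! i * u ! i\<bar>)"
    unfolding dot_sum[OF assms(1)[folded assms(2)]] assms(1) by (rule sum_abs)
  also have "\<dots> \<le> (\<Sum>i<n. m * \<bar>u ! i\<bar>)"
    using assms(3) by (intro sum_mono) (simp add: abs_mult mult_right_mono)
  also have "\<dots> = m * asum u" by (simp add: asum_sum sum_distrib_left assms(2))
  finally show ?thesis .
qed

lemma asum_le: "length u = n \<Longrightarrow> (\<And>i. i < n \<Longrightarrow> \<bar>u ! i\<bar> \<le> c) \<Longrightarrow> asum u \<le> int n * c"
  unfolding asum_sum using sum_mono[of "{..<n}" "\<lambda>i. \<bar>u ! i\<bar>" "\<lambda>_. c"] by simp

lemma dot_uminus: "dot r (map uminus u) = - dot r u"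
proof (induction r arbitrary: u)
  case (Cons x r)
  then show ?case by (cases u) auto
qed simp

text \<open>\<open>H\<close> contains the row \<open>b # - a\<close> for each inequality \<open>a \<bullet> x \<le> b\<close>.\<close>

locale cone =
  fixes n :: nat and m :: int and H :: "int list set"
    and mem :: "int list \<Rightarrow> bool" and sep :: "int list \<Rightarrow> int list"
  assumes n: "1 \<le> n" and m: "1 \<le> m"
    and H: "r \<in> H \<Longrightarrow> length r = n" "r \<in> H \<Longrightarrow> i < n \<Longrightarrow> \<bar>r ! i\<bar> \<le> m"
begin

text \<open>Homogenization restricted to positive height, so that every element represents a
  point.\<close>

definition K :: "int list set" where
  "K = {z. length z = n \<and> 0 < z ! 0 \<and> (\<forall>r\<in>H. 0 \<le> dot r z)}"

definition tight :: "int list \<Rightarrow> int list set" where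
  "tight z = {r \<in> H. dot r z = 0}"

text \<open>The direction space of the minimal face containing the point represented by
  \<open>z\<close>.\<close>

definition L :: "int list \<Rightarrow> int list set" where
  "L z = {u. length u = n \<and> u ! 0 = 0 \<and> (\<forall>r\<in>tight z. dot r u = 0)}"

text \<open>The minimal face is a single point, so \<open>z\<close> represents a vertex.\<close>

definition trivial :: "int list \<Rightarrow> bool" where
  "trivial z \<longleftrightarrow> (\<forall>u\<in>L z. \<forall>i<n. u ! i = 0)"

abbreviation "I \<equiv> [0..<n]"
abbreviation "nn \<equiv> int n"
abbreviation "W \<equiv> kernel_bound I m"
abbreviation "E \<equiv> quality I m"
abbreviation "G \<equiv> grid I m"
abbreviation "U \<equiv> direction_bound I m"
abbreviation "T \<equiv> zoom I m"
abbreviation "E1 \<equiv> line_quality I m"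
abbreviation "G1 \<equiv> line_grid I m"

lemma size_of: "size_of I = nn"
  unfolding size_of_def by (simp only: sum_list_triv) simp

lemma length_concat_const: "length (concat (map (\<lambda>_. ys) xs)) = length xs * length ys"
  by (induction xs) auto

lemma prod_list_const: "prod_list (map (\<lambda>_. c) xs) = (c :: int) ^ length xs"
  by (induction xs) auto

lemma W: "W = (nn * m) ^ n"
  by (simp add: kernel_bound_def prod_list_const size_of)

lemma nm: "1 \<le> nn * m"
  using n m mult_mono[of 1 nn 1 m] by simp

lemma W_ge_1: "1 \<le> W"
  unfolding W using nm by (rule one_le_power)

lemma fact_le_W: "fact n * m ^ n \<le> W"
proof -
  have "(fact n :: int) \<le> nn ^ n" using fact_le_power[of n, where 'a = int] by simp
  then show ?thesis unfolding W power_mult_distrib using m by (intro mult_right_mono) auto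
qed

lemma E: "1 + 2 * nn * W \<le> E" "2 * nn \<le> E" "2 \<le> E" "W \<le> E"
proof -
  have nW: "W \<le> nn * W" using mult_right_mono[of 1 nn W] n W_ge_1 by simp
  have "1 \<le> nn" using n by simp
  with nW W_ge_1 show "1 + 2 * nn * W \<le> E" "2 * nn \<le> E" "2 \<le> E" "W \<le> E"
    unfolding quality_def size_of mult.assoc by linarith+
qed

lemma next_list: "next_list I = [0..<Suc n]"
  by (simp add: next_list_def map_Suc_upt upt_conv_Cons del: upt_Suc)

lemma G: "G = 2 ^ (Suc n * Suc n) * E ^ Suc n"
  unfolding grid_def next_list prod_list_const
  by (simp add: power_mult[symmetric] del: upt_Suc mult_Suc mult_Suc_right power_Suc)

lemma E_le_G: "E \<le> G"
proof -
  have "1 * E ^ 1 \<le> 2 ^ (Suc n * Suc n) * E ^ Suc n"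
    using E(3) by (intro mult_mono power_increasing one_le_power) auto
  then show ?thesis by (simp add: G)
qed

lemma G_ge_1: "1 \<le> G"
  using E_le_G E(3) by linarith

lemma U: "U = (nn * G) ^ n"
  by (simp add: direction_bound_def prod_list_const size_of)

lemma nG: "1 \<le> nn * G"
  using n G_ge_1 mult_mono[of 1 nn 1 G] by simp

lemma G_le_U: "G \<le> U"
proof -
  have "G \<le> nn * G" using mult_right_mono[of 1 nn G] n G_ge_1 by simp
  also have "\<dots> = (nn * G) ^ 1" by simp
  also have "\<dots> \<le> U" unfolding U using n nG by (intro power_increasing) auto
  finally show ?thesis .
qed

lemma U_ge: "1 \<le> U" "W \<le> U"
  using G_le_U E_le_G E(4) G_ge_1 by linarith+

lemma T: "T = nn * m * W * U * G"
  by (simp add: zoom_def size_of)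

lemma E1: "E1 = 2 * nn * m * U"
  by (simp add: line_quality_def size_of)

lemma E1_ge: "2 \<le> E1"
  unfolding E1 using mult_mono[OF nm U_ge(1)] nm by simp

lemma G1: "G1 = 16 * E1 * E1"
  by (simp add: line_grid_def)

lemma G1_ge: "1 \<le> G1"
  unfolding G1 using E1_ge mult_mono[of 1 E1 1 E1] by simp

lemma finite_H: "finite H"
proof (rule finite_subset)
  show "H \<subseteq> {xs. set xs \<subseteq> {- m..m} \<and> length xs = n}"
    using H by (fastforce simp: in_set_conv_nth abs_le_iff)
qed (rule finite_lists_length_eq, simp)

lemma K_dest: "z \<in> K \<Longrightarrow> length z = n" "z \<in> K \<Longrightarrow> 0 < z ! 0" "z \<in> K \<Longrightarrow> r \<in> H \<Longrightarrow> 0 \<le> dot r z"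
  by (auto simp: K_def)

lemma L_dest: "u \<in> L z \<Longrightarrow> length u = n" "u \<in> L z \<Longrightarrow> u ! 0 = 0" "u \<in> L z \<Longrightarrow> r \<in> tight z \<Longrightarrow> dot r u = 0"
  by (auto simp: L_def)

lemma row_le: "r \<in> H \<Longrightarrow> length u = n \<Longrightarrow> (\<And>i. i < n \<Longrightarrow> \<bar>u ! i\<bar> \<le> c) \<Longrightarrow> \<bar>dot r u\<bar> \<le> nn * m * c"
proof -
  assume r: "r \<in> H" and u: "length u = n" "\<And>i. i < n \<Longrightarrow> \<bar>u ! i\<bar> \<le> c"
  have "\<bar>dot r u\<bar> \<le> m * asum u" using abs_dot_le[OF H(1)[OF r] u(1) H(2)[OF r]] .
  also have "\<dots> \<le> m * (nn * c)" using m asum_le[OF u] by (intro mult_left_mono) auto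
  finally show ?thesis by (simp add: ac_simps)
qed

text \<open>The unit vector is added to the tight rows so that the short solution has height 0 as
  well.\<close>

lemma small_L:
  assumes "\<not> trivial z"
  shows "\<exists>w\<in>L z. (\<exists>i<n. w ! i \<noteq> 0) \<and> (\<forall>i<n. \<bar>w ! i\<bar> \<le> W)"
proof -
  obtain u where u: "u \<in> L z" "\<exists>i<n. u ! i \<noteq> 0" using assms by (auto simp: trivial_def)
  let ?e = "unit_list I 0"
  have R: "length r = n \<and> (\<forall>i<n. \<bar>r ! i\<bar> \<le> m)" if "r \<in> insert ?e (tight z)" for r
    using that H m by (auto simp: tight_def)
  have "dot ?e u = 0"
    using dot_unit_list[of u n 0] dot_commute[of ?e u] L_dest[OF u(1)] n by simp
  then have "dot r u = 0" if "r \<in> insert ?e (tight z)" for r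
    using that L_dest(3)[OF u(1)] by auto
  then have "\<exists>w. length w = n \<and> (\<exists>i<n. w ! i \<noteq> 0) \<and> (\<forall>r\<in>insert ?e (tight z). dot r w = 0) \<and>
      (\<forall>i<n. \<bar>w ! i\<bar> \<le> fact n * m ^ n)"
    by (intro small_kernel_vector[OF R m L_dest(1)[OF u(1)] u(2)])
  then obtain w where w: "length w = n" "\<exists>i<n. w ! i \<noteq> 0" "\<And>r. r \<in> insert ?e (tight z) \<Longrightarrow> dot r w = 0"
    "\<And>i. i < n \<Longrightarrow> \<bar>w ! i\<bar> \<le> fact n * m ^ n" by blast
  have "w ! 0 = 0" using w(3)[of ?e] w(1) dot_unit_list[of w n 0] n by (simp add: dot_commute)
  then have "w \<in> L z" using w by (auto simp: L_def)
  then show ?thesis using w fact_le_W by (meson order.trans)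
qed

text \<open>At a vertex the tight rows determine \<open>z\<close> up to a factor, so the short
  kernel vector \<open>w\<close> equals \<open>w ! 0\<close> times \<open>v\<close>. As
  \<open>v\<close> is integral, its entries are no larger than those of \<open>w\<close>.\<close>

lemma vertex_small:
  assumes z: "z \<in> K" and triv: "trivial z" and v: "length v = n" "\<And>i. i < n \<Longrightarrow> z ! i = z ! 0 * v ! i"
  shows "i < n \<Longrightarrow> \<bar>v ! i\<bar> \<le> W"
proof -
  assume i: "i < n"
  have z0: "0 < z ! 0" "length z = n" using z K_dest by auto
  have "length r = n \<and> (\<forall>i<n. \<bar>r ! i\<bar> \<le> m)" if "r \<in> tight z" for r
    using that H by (auto simp: tight_def)
  moreover have "\<exists>i<n. z ! i \<noteq> 0" using z0 n by (intro exI[of _ 0]) auto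
  moreover have "dot r z = 0" if "r \<in> tight z" for r using that by (simp add: tight_def)
  ultimately obtain w where w: "length w = n" "\<exists>i<n. w ! i \<noteq> 0" "\<And>r. r \<in> tight z \<Longrightarrow> dot r w = 0"
    "\<And>i. i < n \<Longrightarrow> \<bar>w ! i\<bar> \<le> fact n * m ^ n"
    using small_kernel_vector[of "tight z" n m z] m z0 by metis
  let ?u = "lin (z ! 0) w (- w ! 0) z"
  have "?u \<in> L z" using w z0 n by (auto simp: L_def dot_lin' tight_def)
  then have "\<And>i. i < n \<Longrightarrow> ?u ! i = 0" using triv by (auto simp: trivial_def)
  then have eq: "z ! 0 * w ! i = w ! 0 * z ! i" if "i < n" for i using that w z0 by force
  have w0: "w ! 0 \<noteq> 0"
  proof
    assume "w ! 0 = 0"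
    then have "w ! i = 0" if "i < n" for i using eq[OF that] z0 by simp
    then show False using w(2) by blast
  qed
  have "z ! 0 * w ! i = z ! 0 * (w ! 0 * v ! i)" using eq[OF i] v(2)[OF i] by (metis mult.left_commute)
  then have "w ! i = w ! 0 * v ! i" using z0 by simp
  then have "\<bar>v ! i\<bar> \<le> \<bar>w ! i\<bar>" using w0 mult_right_mono[of 1 "\<bar>w ! 0\<bar>" "\<bar>v ! i\<bar>"] by (simp add: abs_mult)
  then show ?thesis using w(4)[OF i] fact_le_W by linarith
qed

text \<open>Tight rows vanish on \<open>w\<close>; every other row is at least 1 at
  \<open>z\<close>, and the factor \<open>n m W\<close> outweighs its value on
  \<open>w\<close>.\<close>

lemma shift_in_K:
  assumes z: "z \<in> K" and w: "w \<in> L z" "\<And>i. i < n \<Longrightarrow> \<bar>w ! i\<bar> \<le> W" and s: "\<bar>s\<bar> = 1"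
  shows "lin (nn * m * W) z s w \<in> K"
proof -
  have len: "length z = n" "length w = n" "0 < z ! 0" using K_dest[OF z] L_dest[OF w(1)] by auto
  have c: "1 \<le> nn * m * W" using mult_mono[OF nm W_ge_1] nm by simp
  have "0 \<le> nn * m * W * dot r z + s * dot r w" if r: "r \<in> H" for r
  proof (cases "dot r z = 0")
    case True
    then have "dot r w = 0" using L_dest(3)[OF w(1)] r by (auto simp: tight_def)
    then show ?thesis using True by simp
  next
    case False
    then have "1 \<le> dot r z" using K_dest(3)[OF z r] by simp
    then have "nn * m * W * 1 \<le> nn * m * W * dot r z" using c by (intro mult_left_mono) auto
    moreover have "\<bar>s * dot r w\<bar> \<le> nn * m * W" using row_le[OF r len(2) w(2)] s by (simp add: abs_mult)
    ultimately show ?thesis by linarith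
  qed
  moreover have "0 < nn * m * W * z ! 0" using c len(3) by simp
  ultimately show ?thesis using len n L_dest(2)[OF w(1)] by (simp add: K_def dot_lin')
qed

section \<open>Triangular systems of equations\<close>

fun tri :: "(nat \<times> int list) list \<Rightarrow> bool" where
  "tri [] = True"
| "tri (e # ps) \<longleftrightarrow> length (snd e) = n \<and> fst e < n \<and> snd e ! fst e \<noteq> 0 \<and> (\<forall>i<n. \<bar>snd e ! i\<bar> \<le> G) \<and>
    (\<forall>e'\<in>set ps. snd e ! fst e' = 0) \<and> tri ps"

definition orth :: "(nat \<times> int list) list \<Rightarrow> int list \<Rightarrow> bool" where
  "orth ps w \<longleftrightarrow> (\<forall>e\<in>set ps. dot (snd e) w = 0)"

lemma tri_mem: "tri ps \<Longrightarrow> e \<in> set ps \<Longrightarrow> length (snd e) = n \<and> fst e < n \<and> snd e ! fst e \<noteq> 0 \<and> (\<forall>i<n. \<bar>snd e ! i\<bar> \<le> G)"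
  by (induction ps) auto

lemma tri_distinct: "tri ps \<Longrightarrow> distinct (map fst ps)"
  by (induction ps) (force)+

text \<open>\<open>qs\<close> are the equations still to be treated. Since \<open>u\<close> is 0 at
  their pivots, each correction of a pivot coordinate is a plain assignment.\<close>

lemma back_substitution_partial:
  assumes "tri (ps @ qs)" "k < n" "k \<notin> fst ` set (ps @ qs)"
  defines "u \<equiv> fold (\<lambda>e u. back_step I e u) ps (unit_list I k)"
  shows "length u = n \<and> u ! k \<noteq> 0 \<and> orth ps u \<and> (\<forall>e\<in>set qs. u ! fst e = 0) \<and> (\<forall>i<n. \<bar>u ! i\<bar> \<le> (nn * G) ^ length ps)"
  using assms(1,3) unfolding u_def
proof (induction ps arbitrary: qs rule: rev_induct)
  case Nil
  then show ?case using assms(2) tri_mem[of qs] by (auto simp: orth_def)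
next
  case (snoc e ps)
  define u where "u = fold (\<lambda>e u. back_step I e u) ps (unit_list I k)"
  let ?j = "fst e" and ?p = "snd e"
  have tri: "tri (ps @ e # qs)" using snoc.prems by simp
  have IH: "length u = n" "u ! k \<noteq> 0" "orth ps u" "\<forall>e\<in>set (e # qs). u ! fst e = 0"
    "\<forall>i<n. \<bar>u ! i\<bar> \<le> (nn * G) ^ length ps"
    using snoc.IH[of "e # qs"] snoc.prems unfolding u_def by auto
  have e: "length ?p = n" "?j < n" "?p ! ?j \<noteq> 0" "\<And>i. i < n \<Longrightarrow> \<bar>?p ! i\<bar> \<le> G"
    using tri_mem[OF tri, of e] by auto
  define u' where "u' = back_step I e u"
  have u': "u' = lin (?p ! ?j) u (- dot ?p u) (unit_list I ?j)" using e by (simp add: u'_def back_step_def)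
  have fold: "fold (\<lambda>e u. back_step I e u) (ps @ [e]) (unit_list I k) = u'" by (simp add: u_def u'_def)
  have len: "length u' = n" using IH by (simp add: u')
  have nth: "u' ! i = (if i = ?j then - dot ?p u else ?p ! ?j * u ! i)" if "i < n" for i
    using that IH by (simp add: u')
  have "dot ?p u' = 0"
    unfolding u' using IH(1) e dot_unit_list[of ?p n ?j] by (simp add: dot_lin')
  moreover have "dot (snd e') u' = 0" if e': "e' \<in> set ps" for e'
  proof -
    have "snd e' ! ?j = 0" using tri e' by (induction ps) auto
    moreover have "length (snd e') = n" using tri_mem[OF tri, of e'] e' by auto
    ultimately show ?thesis
      unfolding u' using IH(1,3) e' e dot_unit_list[of "snd e'" n ?j] by (simp add: dot_lin' orth_def)
  qed
  ultimately have orth: "orth (ps @ [e]) u'" by (auto simp: orth_def)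
  have zero: "u' ! fst e' = 0" if e': "e' \<in> set qs" for e'
  proof -
    have "fst e' < n" using tri_mem[OF tri, of e'] e' by auto
    moreover have "?j \<notin> fst ` set qs" using tri_distinct[OF tri] by simp
    then have "fst e' \<noteq> ?j" using e' by (metis imageI)
    ultimately show ?thesis using nth IH(4) e' by simp
  qed
  have "\<bar>u' ! i\<bar> \<le> (nn * G) ^ length (ps @ [e])" if i: "i < n" for i
  proof -
    let ?X = "(nn * G) ^ length ps"
    have X: "0 \<le> ?X" using nG by simp
    have "\<bar>dot ?p u\<bar> \<le> G * asum u" by (rule abs_dot_le[OF e(1) IH(1) e(4)])
    also have "\<dots> \<le> G * (nn * ?X)" using G_ge_1 IH by (intro mult_left_mono asum_le) auto
    finally have 1: "\<bar>dot ?p u\<bar> \<le> nn * G * ?X" by (simp add: ac_simps)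
    have "\<bar>?p ! ?j * u ! i\<bar> \<le> (1 * G) * ?X"
      unfolding abs_mult using e(2,4) IH(5) i X G_ge_1 by (intro mult_mono) auto
    also have "\<dots> \<le> (nn * G) * ?X" using n X G_ge_1 by (intro mult_right_mono) auto
    finally show ?thesis using 1 nth[OF i] by simp
  qed
  moreover have "u' ! k \<noteq> 0" using nth[OF assms(2)] IH(2) e(3) snoc.prems by auto
  ultimately show ?case unfolding fold using len orth zero by blast
qed

lemma back_substitution:
  assumes "tri ps" "k < n" "k \<notin> fst ` set ps"
  defines "u \<equiv> back_substitution I ps k"
  shows "length u = n" "u ! k \<noteq> 0" "orth ps u" "\<And>i. i < n \<Longrightarrow> \<bar>u ! i\<bar> \<le> U"
proof -
  have *: "length u = n \<and> u ! k \<noteq> 0 \<and> orth ps u \<and> (\<forall>i<n. \<bar>u ! i\<bar> \<le> (nn * G) ^ length ps)"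
    using back_substitution_partial[of ps "[]" k] assms by (simp add: back_substitution_def)
  then show "length u = n" "u ! k \<noteq> 0" "orth ps u" by auto
  have "length ps \<le> n"
  proof -
    have "set (map fst ps) \<subseteq> {..<n}" using tri_mem[OF assms(1)] by auto
    then have "card (set (map fst ps)) \<le> card {..<n}" by (intro card_mono) auto
    then show ?thesis using distinct_card[OF tri_distinct[OF assms(1)]] by simp
  qed
  then have "(nn * G) ^ length ps \<le> U" unfolding U using nG by (intro power_increasing) auto
  then show "\<And>i. i < n \<Longrightarrow> \<bar>u ! i\<bar> \<le> U" using * order.trans by blast
qed

lemma eliminate:
  assumes "tri ps" "length h = n"
  shows "length (eliminate ps h) = n \<and> (\<forall>e\<in>set ps. eliminate ps h ! fst e = 0) \<and>
    (\<exists>c. c \<noteq> 0 \<and> (\<forall>w. orth ps w \<longrightarrow> dot (eliminate ps h) w = c * dot h w))"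
  using assms(1)
proof (induction ps)
  case Nil
  then show ?case using assms by (auto simp: eliminate_def intro: exI[of _ 1])
next
  case (Cons e ps)
  let ?j = "fst e" and ?p = "snd e"
  define g where "g = eliminate ps h"
  obtain c where c: "length g = n" "\<forall>e\<in>set ps. g ! fst e = 0" "c \<noteq> 0" "\<And>w. orth ps w \<Longrightarrow> dot g w = c * dot h w"
    using Cons unfolding g_def by auto
  have e: "length ?p = n" "?j < n" "?p ! ?j \<noteq> 0" "\<forall>e'\<in>set ps. ?p ! fst e' = 0"
    using Cons.prems by auto
  have eq: "eliminate (e # ps) h = lin (?p ! ?j) g (- g ! ?j) ?p"
    using e c(1) by (simp add: eliminate_def g_def)
  have lt: "fst e' < n" if "e' \<in> set ps" for e' using tri_mem[of ps e'] Cons.prems that by auto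
  have "dot (eliminate (e # ps) h) w = (?p ! ?j * c) * dot h w" if "orth (e # ps) w" for w
    using that c e unfolding eq by (simp add: dot_lin orth_def)
  moreover have "?p ! ?j * c \<noteq> 0" using e c by simp
  ultimately show ?case unfolding eq using c e lt by (intro conjI exI[of _ "?p ! ?j * c"]) (auto simp: eq)
qed

lemma last_index:
  fixes P :: "nat \<Rightarrow> bool"
  assumes "f = fold (\<lambda>i acc. if P i then (True, i) else acc) I (False, 0)"
  shows "fst f \<Longrightarrow> snd f < n \<and> P (snd f)" "\<not> fst f \<Longrightarrow> i < n \<Longrightarrow> \<not> P i" "\<exists>i<n. P i \<Longrightarrow> fst f"
  using fold_last[of P I "(False, 0)"] assms by fastforce+

lemma grid_fuel: "3 * (2 * n * Suc n * floorlog 2 (nat G)) \<le> length (grid_fuel I m)"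
proof -
  have "length (grid_fuel I m) = Suc n * (Suc n * (floorlog 2 (nat G) * 6))"
    unfolding grid_fuel_def next_list length_concat_const bits_def by (simp add: algebra_simps)
  moreover have "3 * (2 * n * Suc n * floorlog 2 (nat G)) = n * (Suc n * (floorlog 2 (nat G) * 6))" by (simp add: algebra_simps)
  ultimately show ?thesis by simp
qed

text \<open>A functional \<open>h\<close> that separates \<open>T z + u\<close> from the cone is, relative to its size, almost
  zero on the small vectors of \<open>L z\<close>. Rounding it by simultaneous Diophantine approximation therefore
  yields an equation that they satisfy exactly.\<close>

lemma new_equation:
  assumes z: "z \<in> K" and ps: "tri ps" "\<And>w. w \<in> L z \<Longrightarrow> \<forall>i<n. \<bar>w ! i\<bar> \<le> W \<Longrightarrow> orth ps w"
    and u: "length u = n" "orth ps u" "\<And>i. i < n \<Longrightarrow> \<bar>u ! i\<bar> \<le> U"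
    and h: "length h = n" "\<And>y. y \<in> K \<Longrightarrow> 0 < dot h y" and s: "\<bar>s\<bar> = 1" and hu: "dot h (lin T z s u) \<le> 0"
  defines "e \<equiv> new_equation I m ps h"
  shows "tri (e # ps)" "\<And>w. w \<in> L z \<Longrightarrow> \<forall>i<n. \<bar>w ! i\<bar> \<le> W \<Longrightarrow> orth (e # ps) w"
proof -
  define g where "g = eliminate ps h"
  obtain c where g: "length g = n" "\<forall>e\<in>set ps. g ! fst e = 0" "c \<noteq> 0" "\<And>w. orth ps w \<Longrightarrow> dot g w = c * dot h w"
    using eliminate[OF ps(1) h(1)] unfolding g_def by auto
  define \<gamma> where "\<gamma> = asum g"
  define \<beta> where "\<beta> = map (\<lambda>x. (G * x) div \<gamma>) g"
  define qp where "qp = dioph I [0..<Suc n] (grid_fuel I m) G \<beta>"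
  define q where "q = fst qp"
  define p where "p = snd qp"
  have lz: "length z = n" using K_dest[OF z] by simp
  have T1: "1 \<le> nn * m * W" using mult_mono[OF nm W_ge_1] nm by simp
  have hz: "0 < dot h z" using h(2)[OF z] .
  \<comment> \<open>\<open>h\<close> is positive at \<open>z\<close> but not at
    \<open>T z + s u\<close>, so its value on \<open>u\<close> must outweigh \<open>T\<close> times
    its value at \<open>z\<close>.\<close>
  have hu': "T * dot h z \<le> \<bar>dot h u\<bar>"
  proof -
    have "T * dot h z \<le> - (s * dot h u)" using hu lz u(1) by (simp add: dot_lin')
    also have "\<dots> \<le> \<bar>s * dot h u\<bar>" by simp
    finally show ?thesis using s by (simp add: abs_mult)
  qed
  have gu: "\<bar>dot g u\<bar> \<le> \<gamma> * U"
    using abs_dot_le[OF u(1) g(1) u(3)] by (simp add: dot_commute[of g] \<gamma>_def mult.commute)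
  have "0 < T"
    unfolding T using T1 U_ge(1) G_ge_1 by simp
  then have "0 < T * dot h z" using hz by simp
  then have "dot h u \<noteq> 0" using hu' by auto
  then have gu0: "dot g u \<noteq> 0" using g(3,4) u(2) by simp
  have \<gamma>: "0 < \<gamma>"
    using gu gu0 U_ge(1) asum_nonneg[of g] unfolding \<gamma>_def by (cases "asum g = 0") auto
  \<comment> \<open>Both shifts by \<open>w\<close> remain in the cone, so
    \<open>\<bar>dot h w\<bar>\<close> is at most \<open>n m W\<close> times \<open>dot h z\<close>.
    Comparing this with \<open>hu'\<close>, in which \<open>T\<close> carries the additional factor
    \<open>U G\<close>, shows that \<open>g\<close> is on \<open>w\<close> smaller than
    \<open>\<gamma>\<close> by the factor \<open>G\<close>.\<close>
  have gw: "\<bar>dot g w\<bar> * G \<le> \<gamma>" if w: "w \<in> L z" "\<forall>i<n. \<bar>w ! i\<bar> \<le> W" for w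
  proof -
    have lw: "length w = n" using L_dest[OF w(1)] by simp
    have "0 < dot h (lin (nn * m * W) z t w)" if "\<bar>t\<bar> = 1" for t
      using shift_in_K[OF z w(1) _ that] w(2) h(2) by blast
    from this[of 1] this[of "- 1"] have "\<bar>dot h w\<bar> \<le> nn * m * W * dot h z"
      using lz lw by (simp add: dot_lin')
    then have "\<bar>dot h w\<bar> * (U * G) \<le> nn * m * W * dot h z * (U * G)"
      using U_ge(1) G_ge_1 by (intro mult_right_mono) auto
    also have "\<dots> = T * dot h z" by (simp add: T ac_simps)
    finally have "\<bar>dot h w\<bar> * (U * G) \<le> \<bar>dot h u\<bar>" using hu' by simp
    then have "\<bar>c\<bar> * (\<bar>dot h w\<bar> * (U * G)) \<le> \<bar>c\<bar> * \<bar>dot h u\<bar>" by (intro mult_left_mono) auto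
    then have "\<bar>dot g w\<bar> * G * U \<le> \<bar>dot g u\<bar>"
      using g(4)[OF ps(2)[OF w]] g(4)[OF u(2)] by (simp add: abs_mult ac_simps)
    then have "\<bar>dot g w\<bar> * G * U \<le> \<gamma> * U" using gu by simp
    then show ?thesis using U_ge(1) by simp
  qed
  have \<beta>: "length \<beta> = n" "\<And>i. i < n \<Longrightarrow> \<gamma> * \<beta> ! i \<le> G * g ! i" "\<And>i. i < n \<Longrightarrow> G * g ! i < \<gamma> * \<beta> ! i + \<gamma>"
  proof -
    show "length \<beta> = n" by (simp add: \<beta>_def g)
    fix i assume "i < n"
    then have b: "\<beta> ! i = (G * g ! i) div \<gamma>" by (simp add: \<beta>_def g)
    have "\<gamma> * \<beta> ! i + (G * g ! i) mod \<gamma> = G * g ! i" unfolding b by simp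
    then show "\<gamma> * \<beta> ! i \<le> G * g ! i" "G * g ! i < \<gamma> * \<beta> ! i + \<gamma>"
      using pos_mod_sign[OF \<gamma>, of "G * g ! i"] pos_mod_bound[OF \<gamma>, of "G * g ! i"] by linarith+
  qed
  have \<beta>G: "\<bar>\<beta> ! i\<bar> \<le> G" if "i < n" for i
  proof -
    have g\<gamma>: "\<bar>g ! i\<bar> \<le> \<gamma>" using abs_nth_le_asum[of i g] g(1) that by (simp add: \<gamma>_def)
    have 1: "G * g ! i \<le> G * \<gamma>" "G * (- \<gamma>) \<le> G * g ! i"
      using g\<gamma> G_ge_1 by (intro mult_left_mono; simp)+
    have 2: "\<gamma> * G = G * \<gamma>" "\<gamma> * (- G) = G * (- \<gamma>)" "\<gamma> * (\<beta> ! i + 1) = \<gamma> * \<beta> ! i + \<gamma>"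
      by (simp_all add: algebra_simps)
    have "\<gamma> * \<beta> ! i \<le> \<gamma> * G" "\<gamma> * (- G) < \<gamma> * (\<beta> ! i + 1)"
      using \<beta>(2,3)[OF that] 1 2 by linarith+
    then have "\<beta> ! i \<le> G" "- G < \<beta> ! i + 1"
      using \<gamma> by (simp_all only: mult_le_cancel_left_pos mult_less_cancel_left_pos)
    then show ?thesis by simp
  qed
  interpret D: dioph_lattice n G \<beta> by standard (use n G_ge_1 \<beta>(1) in auto)
  have "0 < E" using E by simp
  have GE: "2 ^ (Suc n * Suc n) * E ^ Suc n \<le> G" by (simp add: G)
  have qp': "dioph I [0..<Suc n] (grid_fuel I m) G \<beta> = (q, p)" by (simp add: q_def p_def qp_def)
  note D = D.dioph_approximation[OF \<open>0 < E\<close> GE grid_fuel qp']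
  define x where "x i = q * \<beta> ! i - G * p ! i" for i
  have x: "\<bar>x i\<bar> * E < G" if "i < n" for i using D(4)[OF that] by (simp add: x_def)
  \<comment> \<open>A nonzero numerator would cause an error of at least \<open>G\<close> here.
    Hence zeros of \<open>g\<close>, in particular those at the old pivots, are preserved
    exactly.\<close>
  have ps0: "p ! i = 0" if "i < n" "\<beta> ! i = 0" for i
  proof (rule ccontr)
    assume "p ! i \<noteq> 0"
    then have "G * 1 \<le> \<bar>x i\<bar>" using that(2) G_ge_1 by (simp add: x_def abs_mult)
    also have "\<bar>x i\<bar> * 1 \<le> \<bar>x i\<bar> * E" using E(3) by (intro mult_left_mono) auto
    finally show False using x[OF that(1)] by simp
  qed
  have old: "\<forall>e'\<in>set ps. p ! fst e' = 0"
  proof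
    fix e' assume e': "e' \<in> set ps"
    then have "fst e' < n" "g ! fst e' = 0" using tri_mem[OF ps(1) e'] g(2) by auto
    then show "p ! fst e' = 0" using g(1) by (intro ps0) (auto simp: \<beta>_def)
  qed
  have pG: "\<bar>p ! i\<bar> \<le> G" if i: "i < n" for i
  proof -
    have "G * \<bar>p ! i\<bar> = \<bar>q * \<beta> ! i - x i\<bar>" using G_ge_1 by (simp add: x_def abs_mult)
    also have "\<dots> \<le> \<bar>q\<bar> * \<bar>\<beta> ! i\<bar> + \<bar>x i\<bar>" by (metis abs_mult abs_triangle_ineq4)
    also have "\<dots> \<le> \<bar>q\<bar> * G + \<bar>x i\<bar>" using \<beta>G[OF i] by (intro add_right_mono mult_left_mono) auto
    finally have "G * \<bar>p ! i\<bar> * E \<le> (\<bar>q\<bar> * G + \<bar>x i\<bar>) * E" using E(3) by (intro mult_right_mono) auto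
    also have "\<dots> = (\<bar>q\<bar> * E) * G + \<bar>x i\<bar> * E" by (simp add: algebra_simps)
    also have "\<dots> \<le> G * G + G * 1"
      using D(3) x[OF i] G_ge_1 by (intro add_mono mult_right_mono) auto
    also have "\<dots> \<le> G * (G * 2)" using G_ge_1 by (simp add: algebra_simps)
    also have "\<dots> \<le> G * (G * E)" using E(3) G_ge_1 by (intro mult_left_mono) auto
    finally have "G * E * \<bar>p ! i\<bar> \<le> G * E * G" by (simp add: ac_simps)
    then show ?thesis using G_ge_1 E(3) by simp
  qed
  \<comment> \<open>Some coefficient of \<open>g\<close> is at least \<open>\<gamma> / n\<close> in
    absolute value. Its grid value is about \<open>G / n\<close> or more, too large to be
    approximated by 0 with precision \<open>E \<ge> 2 n\<close>.\<close>
  have "\<exists>i<n. p ! i \<noteq> 0"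
  proof -
    have "\<exists>i<n. \<gamma> \<le> nn * \<bar>g ! i\<bar>"
    proof (rule ccontr)
      assume "\<not> ?thesis"
      then have lt: "\<And>i. i < n \<Longrightarrow> nn * \<bar>g ! i\<bar> < \<gamma>" by auto
      have "nn * \<gamma> = (\<Sum>i<n. nn * \<bar>g ! i\<bar>)" by (simp add: \<gamma>_def asum_sum g(1) sum_distrib_left)
      also have "\<dots> < (\<Sum>i<n. \<gamma>)" using lt n by (intro sum_strict_mono) (auto simp: lessThan_empty_iff)
      finally show False by simp
    qed
    then obtain i where i: "i < n" "\<gamma> \<le> nn * \<bar>g ! i\<bar>" by blast
    have "p ! i \<noteq> 0"
    proof
      assume p0: "p ! i = 0"
      have "G * \<gamma> \<le> G * (nn * \<bar>g ! i\<bar>)" using i(2) G_ge_1 by (intro mult_left_mono) auto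
      also have "\<dots> = nn * \<bar>G * g ! i\<bar>" using G_ge_1 by (simp add: abs_mult)
      also have "\<dots> \<le> nn * (\<gamma> * (\<bar>\<beta> ! i\<bar> + 1))"
      proof (intro mult_left_mono)
        have "\<bar>G * g ! i\<bar> \<le> \<bar>\<gamma> * \<beta> ! i\<bar> + \<gamma>" using \<beta>(2,3)[OF i(1)] by linarith
        then show "\<bar>G * g ! i\<bar> \<le> \<gamma> * (\<bar>\<beta> ! i\<bar> + 1)" using \<gamma> by (simp add: abs_mult algebra_simps)
      qed simp
      finally have "\<gamma> * G \<le> \<gamma> * (nn * (\<bar>\<beta> ! i\<bar> + 1))" by (simp add: ac_simps)
      then have G1: "G \<le> nn * (\<bar>\<beta> ! i\<bar> + 1)" using \<gamma> by simp
      have "1 \<le> \<bar>q\<bar>" using D(1) by simp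
      then have "1 * \<bar>\<beta> ! i\<bar> \<le> \<bar>q\<bar> * \<bar>\<beta> ! i\<bar>" by (intro mult_right_mono) auto
      then have "\<bar>\<beta> ! i\<bar> * E \<le> \<bar>x i\<bar> * E" using p0 E(3) by (intro mult_right_mono) (auto simp: x_def abs_mult)
      then have "\<bar>\<beta> ! i\<bar> * (2 * nn) < G" using x[OF i(1)] mult_left_mono[OF E(2), of "\<bar>\<beta> ! i\<bar>"] by simp
      then have "2 * G < G + 2 * nn" using G1 by (simp add: algebra_simps)
      then show False using E(2) E_le_G by linarith
    qed
    then show ?thesis using i(1) by blast
  qed
  moreover have lp: "length p = n" by (rule D(2))
  ultimately have ex: "\<exists>i<n. nth_default 0 p i \<noteq> 0" by auto
  note ni = last_index[OF nonzero_index_def[of I p]]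
  have e: "e = (snd (nonzero_index I p), p)"
    by (simp add: e_def new_equation_def Let_def g_def[symmetric] \<gamma>_def[symmetric] \<beta>_def[symmetric] next_list qp_def[symmetric] p_def[symmetric] del: upt_Suc)
  have "snd (nonzero_index I p) < n" "p ! snd (nonzero_index I p) \<noteq> 0"
    using ni(1)[OF ni(3)[OF ex]] lp by auto
  then show "tri (e # ps)" using lp pG old ps(1) by (simp add: e)
  fix w assume w: "w \<in> L z" "\<forall>i<n. \<bar>w ! i\<bar> \<le> W"
  have lw: "length w = n" using L_dest[OF w(1)] by simp
  have "\<bar>dot \<beta> w\<bar> \<le> 1 + nn * W"
  proof -
    have "\<gamma> * \<bar>dot \<beta> w\<bar> = \<bar>\<Sum>i<n. \<gamma> * \<beta> ! i * w ! i\<bar>"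
      using \<gamma> \<beta>(1) lw by (simp add: dot_sum sum_distrib_left[symmetric] mult.assoc abs_mult)
    also have "(\<Sum>i<n. \<gamma> * \<beta> ! i * w ! i) = G * dot g w - (\<Sum>i<n. (G * g ! i - \<gamma> * \<beta> ! i) * w ! i)"
      using g(1) lw by (simp add: dot_sum sum_distrib_left sum_subtractf[symmetric] algebra_simps)
    also have "\<bar>\<dots>\<bar> \<le> \<bar>G * dot g w\<bar> + (\<Sum>i<n. \<bar>(G * g ! i - \<gamma> * \<beta> ! i) * w ! i\<bar>)"
      using sum_abs[of "\<lambda>i. (G * g ! i - \<gamma> * \<beta> ! i) * w ! i" "{..<n}"] by linarith
    also have "\<dots> \<le> \<gamma> + (\<Sum>i<n. \<gamma> * W)"
    proof (intro add_mono sum_mono)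
      show "\<bar>G * dot g w\<bar> \<le> \<gamma>" using gw[OF w] G_ge_1 by (simp add: abs_mult mult.commute)
      fix i assume "i \<in> {..<n}"
      then show "\<bar>(G * g ! i - \<gamma> * \<beta> ! i) * w ! i\<bar> \<le> \<gamma> * W"
        unfolding abs_mult using \<beta>(2,3)[of i] w(2) \<gamma> by (intro mult_mono) auto
    qed
    also have "\<dots> = \<gamma> * (1 + nn * W)" by (simp add: algebra_simps)
    finally show ?thesis using \<gamma> by simp
  qed
  note bw = this
  \<comment> \<open>\<open>dot \<beta> w\<close> is small by \<open>bw\<close>, and the
    approximation errors \<open>x\<close> contribute at most \<open>n W\<close> times their bound.
    By the choice of \<open>E\<close> the integer \<open>dot p w\<close> is less than 1 in absolute
    value, hence 0.\<close>
  have "\<bar>dot p w\<bar> < 1"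
  proof -
    have "G * dot p w = q * dot \<beta> w - (\<Sum>i<n. x i * w ! i)"
      using lp lw \<beta>(1) by (simp add: dot_sum x_def sum_distrib_left sum_subtractf[symmetric] algebra_simps)
    then have "G * \<bar>dot p w\<bar> \<le> \<bar>q\<bar> * \<bar>dot \<beta> w\<bar> + \<bar>\<Sum>i<n. x i * w ! i\<bar>"
      using G_ge_1 by (metis abs_mult abs_of_nonneg abs_triangle_ineq4 order.trans zero_le_one)
    also have "\<dots> \<le> \<bar>q\<bar> * (1 + nn * W) + (\<Sum>i<n. \<bar>x i\<bar> * W)"
      using bw w(2) by (intro add_mono mult_left_mono order.trans[OF sum_abs] sum_mono) (auto simp: abs_mult intro!: mult_left_mono)
    finally have "G * \<bar>dot p w\<bar> * E \<le> (\<bar>q\<bar> * (1 + nn * W) + (\<Sum>i<n. \<bar>x i\<bar> * W)) * E"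
      using E(3) by (intro mult_right_mono) auto
    also have "\<dots> = (\<bar>q\<bar> * E) * (1 + nn * W) + (\<Sum>i<n. (\<bar>x i\<bar> * E) * W)"
      by (simp add: algebra_simps sum_distrib_left)
    also have "\<dots> < G * (1 + nn * W) + (\<Sum>i<n. G * W)"
    proof (rule add_less_le_mono)
      have "0 < 1 + nn * W" using W_ge_1 by (simp add: add_pos_nonneg)
      then show "\<bar>q\<bar> * E * (1 + nn * W) < G * (1 + nn * W)" using D(3) by (intro mult_strict_right_mono)
      show "(\<Sum>i<n. \<bar>x i\<bar> * E * W) \<le> (\<Sum>i<n. G * W)"
        using x W_ge_1 by (intro sum_mono mult_right_mono) (auto simp: less_imp_le)
    qed
    also have "\<dots> = G * (1 + 2 * nn * W)" by (simp add: algebra_simps)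
    also have "\<dots> \<le> G * E" using E(1) G_ge_1 by (intro mult_left_mono) auto
    finally have "(G * E) * \<bar>dot p w\<bar> < (G * E) * 1" by (simp add: ac_simps)
    moreover have "0 < G * E" using G_ge_1 E(3) by simp
    ultimately show ?thesis by (simp only: mult_less_cancel_left_pos)
  qed
  then show "orth (e # ps) w" using ps(2)[OF w] by (simp add: orth_def e)
qed

end

text \<open>\<open>no_line\<close> stands for pointedness and \<open>integral\<close> for
  decomposability. The latter is stated through the functionals \<open>dot r\<close>, which evaluate
  sums of lists of vectors without forming them.\<close>

locale cone_oracle = cone +
  assumes mem: "length z = n \<Longrightarrow> 0 < z ! 0 \<Longrightarrow> mem z \<longleftrightarrow> z \<in> K"
    and sep: "length z = n \<Longrightarrow> 0 < z ! 0 \<Longrightarrow> z \<notin> K \<Longrightarrow>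
      length (sep z) = n \<and> dot (sep z) z \<le> 0 \<and> (\<forall>y\<in>K. 0 < dot (sep z) y)"
    and no_line: "length u = n \<Longrightarrow> u ! 0 = 0 \<Longrightarrow> (\<And>r. r \<in> H \<Longrightarrow> dot r u = 0) \<Longrightarrow> i < n \<Longrightarrow> u ! i = 0"
    and integral: "z \<in> K \<Longrightarrow> \<exists>xs. length xs = nat (z ! 0) \<and> (\<forall>x\<in>set xs. x \<in> K \<and> x ! 0 = 1) \<and>
      (\<forall>r. length r = n \<longrightarrow> dot r z = sum_list (map (dot r) xs))"
begin

section \<open>Finding a direction of the minimal face\<close>

lemma tri_full:
  assumes "tri ps" "orth ps w" "length w = n" "\<And>i. i < n \<Longrightarrow> i \<notin> fst ` set ps \<Longrightarrow> w ! i = 0" "i < n"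
  shows "w ! i = 0"
  using assms(1,2,4)
proof (induction ps)
  case Nil
  then show ?case using assms(5) by simp
next
  case (Cons e ps)
  let ?j = "fst e" and ?p = "snd e"
  have e: "length ?p = n" "?j < n" "?p ! ?j \<noteq> 0" "\<forall>e'\<in>set ps. ?p ! fst e' = 0" using Cons.prems by auto
  \<comment> \<open>The newest equation vanishes at the older pivots, and \<open>w\<close> at
    indices that are no pivots; only the newest pivot contributes.\<close>
  have "?p ! i * w ! i = 0" if "i < n" "i \<noteq> ?j" for i
    using that e(4) Cons.prems(3)[of i] by (cases "i \<in> fst ` set ps") auto
  then have "(\<Sum>i\<in>{..<n} - {?j}. ?p ! i * w ! i) = 0" by (intro sum.neutral) auto
  then have "dot ?p w = ?p ! ?j * w ! ?j"
    using e(1,2) assms(3) by (simp add: dot_sum sum.remove[of "{..<n}" ?j])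
  then have wj: "w ! ?j = 0" using Cons.prems(2) e(3) by (simp add: orth_def)
  show ?case
  proof (rule Cons.IH)
    show "tri ps" "orth ps w" using Cons.prems by (auto simp: orth_def)
    show "w ! i = 0" if "i < n" "i \<notin> fst ` set ps" for i
      using that wj Cons.prems(3)[of i] by (cases "i = ?j") auto
  qed
qed

text \<open>The equations are known only for short vectors of \<open>L z\<close>. By
  \<open>small_L\<close> this is enough to recognize a face of positive dimension.\<close>

definition face_inv :: "int list \<Rightarrow> (nat \<times> int list) list \<times> int list \<Rightarrow> bool" where
  "face_inv z s \<longleftrightarrow> tri (fst s) \<and> (0, unit_list I 0) \<in> set (fst s) \<and>
    (\<forall>w\<in>L z. (\<forall>i<n. \<bar>w ! i\<bar> \<le> W) \<longrightarrow> orth (fst s) w) \<and>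
    (snd s \<noteq> [] \<longrightarrow> snd s \<in> L z \<and> (\<exists>i<n. snd s ! i \<noteq> 0) \<and> (\<forall>i<n. \<bar>snd s ! i\<bar> \<le> U))"

lemma face_inv_init: "face_inv z ([(0, unit_list I 0)], [])"
proof -
  have "dot (unit_list I 0) w = 0" if "w \<in> L z" for w
    using dot_unit_list[of w n 0] L_dest[OF that] n by (simp add: dot_commute)
  then show ?thesis using n G_ge_1 by (auto simp: face_inv_def orth_def)
qed

lemma free_index_cases:
  "fst (free_index I ps) \<Longrightarrow> snd (free_index I ps) < n \<and> snd (free_index I ps) \<notin> fst ` set ps"
  "\<not> fst (free_index I ps) \<Longrightarrow> i < n \<Longrightarrow> i \<in> fst ` set ps"
  using last_index(1,2)[OF free_index_def[of I ps]] by (auto simp: filter_empty_conv)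

lemma T_ge_1: "1 \<le> T"
proof -
  have "1 \<le> nn * m * W" using mult_mono[OF nm W_ge_1] nm by simp
  then have "1 * 1 \<le> (nn * m * W) * (U * G)" using U_ge(1) G_ge_1 mult_mono[of 1 U 1 G] by (intro mult_mono) auto
  then show ?thesis by (simp add: T ac_simps)
qed

lemma face_step:
  assumes z: "z \<in> K" and inv: "face_inv z s"
  shows "face_inv z (face_step mem sep I m z s)"
    "snd (face_step mem sep I m z s) \<noteq> [] \<or> \<not> fst (free_index I (fst (face_step mem sep I m z s))) \<or>
     length (fst (face_step mem sep I m z s)) = Suc (length (fst s))"
proof -
  have "face_inv z (face_step mem sep I m z s) \<and> (snd (face_step mem sep I m z s) \<noteq> [] \<or> \<not> fst (free_index I (fst (face_step mem sep I m z s))) \<or>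
     length (fst (face_step mem sep I m z s)) = Suc (length (fst s)))"
  proof (cases "snd s \<noteq> [] \<or> \<not> fst (free_index I (fst s))")
    case True
    then show ?thesis using inv by (auto simp: face_step_def)
  next
    case False
    define k where "k = snd (free_index I (fst s))"
    define u where "u = back_substitution I (fst s) k"
    have tri: "tri (fst s)" and e0: "(0, unit_list I 0) \<in> set (fst s)"
      and orth: "\<And>w. w \<in> L z \<Longrightarrow> \<forall>i<n. \<bar>w ! i\<bar> \<le> W \<Longrightarrow> orth (fst s) w"
      using inv by (auto simp: face_inv_def)
    have "k < n" "k \<notin> fst ` set (fst s)" using free_index_cases(1)[of "fst s"] False by (auto simp: k_def)
    note u = back_substitution[OF tri this, folded u_def]
    have "dot (unit_list I 0) u = 0" using u(3) e0 by (auto simp: orth_def)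
    then have u0: "u ! 0 = 0" using dot_unit_list[of u n 0] u(1) n by (simp add: dot_commute)
    have z': "length z = n" "0 < z ! 0" using K_dest[OF z] by auto
    define x where "x t = lin T z t u" for t
    have x: "length (x t) = n" "0 < x t ! 0" for t
      using z' u(1) n u0 T_ge_1 by (auto simp: x_def)
    have new: "face_inv z (new_equation I m (fst s) (sep (x t)) # fst s, [])" if t: "\<bar>t\<bar> = 1" "x t \<notin> K" for t
    proof -
      have h: "length (sep (x t)) = n" "dot (sep (x t)) (x t) \<le> 0" "\<And>y. y \<in> K \<Longrightarrow> 0 < dot (sep (x t)) y"
        using sep[OF x t(2)] by auto
      have "dot (sep (x t)) (lin T z t u) \<le> 0" using h(2) by (simp only: x_def)
      note ne = new_equation[OF z tri orth u(1,3,4) h(1,3) t(1) this]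
      show ?thesis
        using ne e0 by (auto simp: face_inv_def x_def)
    qed
    have mem': "mem (x t) \<longleftrightarrow> x t \<in> K" for t using mem[OF x] .
    \<comment> \<open>A row tight at \<open>z\<close> takes opposite values at \<open>x 1\<close>
      and \<open>x (- 1)\<close>, both nonnegative, so it vanishes on \<open>u\<close>.\<close>
    have found: "u \<in> L z" if "x 1 \<in> K" "x (- 1) \<in> K"
    proof -
      have "dot r u = 0" if r: "r \<in> tight z" for r
      proof -
        have rH: "r \<in> H" "dot r z = 0" using r by (auto simp: tight_def)
        have "0 \<le> dot r (x 1)" "0 \<le> dot r (x (- 1))" using K_dest(3)[OF \<open>x 1 \<in> K\<close> rH(1)] K_dest(3)[OF \<open>x (- 1) \<in> K\<close> rH(1)] by auto
        then show ?thesis using rH z' u(1) by (simp add: x_def dot_lin')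
      qed
      then show ?thesis using u(1) u0 by (simp add: L_def)
    qed
    have une: "u \<noteq> []" using u(1) n by auto
    have eq: "face_step mem sep I m z s = (if \<not> mem (x 1) then (new_equation I m (fst s) (sep (x 1)) # fst s, [])
      else if \<not> mem (x (- 1)) then (new_equation I m (fst s) (sep (x (- 1))) # fst s, []) else (fst s, u))"
      using False by (simp add: face_step_def Let_def x_def u_def k_def)
    show ?thesis
      unfolding eq mem' using new[of 1] new[of "- 1"] found inv une u(2,4) \<open>k < n\<close>
      by (auto simp: face_inv_def)
  qed
  then show "face_inv z (face_step mem sep I m z s)"
    "snd (face_step mem sep I m z s) \<noteq> [] \<or> \<not> fst (free_index I (fst (face_step mem sep I m z s))) \<or>
     length (fst (face_step mem sep I m z s)) = Suc (length (fst s))" by auto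
qed

lemma face_partial:
  fixes js :: "nat list"
  assumes z: "z \<in> K"
  defines "s \<equiv> fold (\<lambda>_ s. face_step mem sep I m z s) js ([(0, unit_list I 0)], [])"
  shows "face_inv z s \<and> (snd s \<noteq> [] \<or> \<not> fst (free_index I (fst s)) \<or> length (fst s) = Suc (length js))"
  unfolding s_def
proof (induction js rule: rev_induct)
  case Nil
  then show ?case using face_inv_init by simp
next
  case (snoc x js)
  define s where "s = fold (\<lambda>_ s. face_step mem sep I m z s) js ([(0, unit_list I 0)], [])"
  have IH: "face_inv z s" "snd s \<noteq> [] \<or> \<not> fst (free_index I (fst s)) \<or> length (fst s) = Suc (length js)"
    using snoc unfolding s_def by auto
  have "face_step mem sep I m z s = s" if "snd s \<noteq> [] \<or> \<not> fst (free_index I (fst s))"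
    using that by (auto simp: face_step_def)
  then show ?case using face_step[OF z IH(1)] IH(2) by (auto simp: s_def[symmetric])
qed

lemma tri_length: "tri ps \<Longrightarrow> length ps \<le> n"
proof -
  assume tri: "tri ps"
  have "set (map fst ps) \<subseteq> {..<n}" using tri_mem[OF tri] by auto
  then have "card (set (map fst ps)) \<le> card {..<n}" by (intro card_mono) auto
  then show ?thesis using distinct_card[OF tri_distinct[OF tri]] by simp
qed

text \<open>Without a direction all indices have become pivots. A nontrivial face would contain a
  short nonzero vector satisfying all these equations, contradicting
  \<open>tri_full\<close>.\<close>

lemma face:
  assumes z: "z \<in> K"
  shows "face mem sep I m z = [] \<Longrightarrow> trivial z"
    "face mem sep I m z \<noteq> [] \<Longrightarrow> face mem sep I m z \<in> L z \<and> (\<exists>i<n. face mem sep I m z ! i \<noteq> 0) \<and>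
      (\<forall>i<n. \<bar>face mem sep I m z ! i\<bar> \<le> U)"
proof -
  define s where "s = fold (\<lambda>_ s. face_step mem sep I m z s) I ([(0, unit_list I 0)], [])"
  have f: "face mem sep I m z = snd s" by (simp add: face_def s_def)
  have s: "face_inv z s" "snd s \<noteq> [] \<or> \<not> fst (free_index I (fst s)) \<or> length (fst s) = Suc n"
    using face_partial[OF z, of I] unfolding s_def by auto
  show "face mem sep I m z \<noteq> [] \<Longrightarrow> face mem sep I m z \<in> L z \<and> (\<exists>i<n. face mem sep I m z ! i \<noteq> 0) \<and>
      (\<forall>i<n. \<bar>face mem sep I m z ! i\<bar> \<le> U)"
    using s(1) unfolding f face_inv_def by blast
  assume "face mem sep I m z = []"
  then have no: "\<not> fst (free_index I (fst s))"
    using s tri_length[of "fst s"] by (auto simp: f face_inv_def)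
  show "trivial z"
  proof (rule ccontr)
    assume "\<not> trivial z"
    then obtain w where w: "w \<in> L z" "\<exists>i<n. w ! i \<noteq> 0" "\<forall>i<n. \<bar>w ! i\<bar> \<le> W" using small_L by blast
    have "tri (fst s)" "orth (fst s) w" using s(1) w by (auto simp: face_inv_def)
    then have "w ! i = 0" if "i < n" for i
      using tri_full[of "fst s" w i] L_dest(1)[OF w(1)] free_index_cases(2)[OF no] that by blast
    then show False using w(2) by blast
  qed
qed

text \<open>The bisection maintains bounds for the real number \<open>N / s\<close>.\<close>

lemma bisect:
  fixes fuel :: "int list"
  assumes test: "\<And>j. 0 \<le> j \<Longrightarrow> j < J \<Longrightarrow> mem (lin c z j u) \<longleftrightarrow> j * s \<le> N"
    and s: "0 < s" and N: "0 \<le> N" "N < J * s"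
  defines "b \<equiv> fold (\<lambda>_ b. bisect_step mem c z u b) fuel (0, J)"
  shows "0 \<le> fst b \<and> snd b \<le> J \<and> fst b < snd b \<and> fst b * s \<le> N \<and> N < snd b * s \<and>
    (snd b - fst b = 1 \<or> (snd b - fst b) * 2 ^ length fuel \<le> J + 2 ^ length fuel)"
proof -
  have J: "0 < J"
  proof (rule ccontr)
    assume "\<not> 0 < J"
    then have "J * s \<le> 0" using s by (simp add: mult_le_0_iff)
    then show False using N by simp
  qed
  show ?thesis unfolding b_def
  proof (induction fuel rule: rev_induct)
    case Nil
    then show ?case using N J by simp
  next
    case (snoc x fuel)
    define b where "b = fold (\<lambda>_ b. bisect_step mem c z u b) fuel (0, J)"
    have IH: "0 \<le> fst b" "snd b \<le> J" "fst b < snd b" "fst b * s \<le> N" "N < snd b * s"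
      "snd b - fst b = 1 \<or> (snd b - fst b) * 2 ^ length fuel \<le> J + 2 ^ length fuel"
      using snoc unfolding b_def by auto
    define k where "k = (fst b + snd b) div 2"
    have step: "fold (\<lambda>_ b. bisect_step mem c z u b) (fuel @ [x]) (0, J) = bisect_step mem c z u b"
      by (simp add: b_def)
    show ?case
    proof (cases "snd b - fst b \<le> 1")
      case True
      then have "bisect_step mem c z u b = b" by (simp add: bisect_step_def)
      then show ?thesis unfolding step using IH True by simp
    next
      case False
      then have k: "fst b < k" "k < snd b" "2 * k \<le> fst b + snd b" "fst b + snd b \<le> 2 * k + 1"
        unfolding k_def by linarith+
      have t: "mem (lin c z k u) \<longleftrightarrow> k * s \<le> N" using k IH by (intro test) auto
      have eq: "bisect_step mem c z u b = (if k * s \<le> N then (k, snd b) else (fst b, k))"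
        using False t by (simp add: bisect_step_def k_def)
      have w: "(snd b - fst b) * 2 ^ length fuel \<le> J + 2 ^ length fuel" using IH(6) False by auto
      have small: "d * 2 ^ length (fuel @ [x]) \<le> J + 2 ^ length (fuel @ [x])" if "2 * d \<le> snd b - fst b + 1" for d
      proof -
        have "(2 * d) * 2 ^ length fuel \<le> (snd b - fst b + 1) * 2 ^ length fuel"
          using that by (intro mult_right_mono) auto
        also have "\<dots> \<le> J + 2 ^ length fuel + 2 ^ length fuel" using w by (simp add: algebra_simps)
        finally show ?thesis by (simp add: algebra_simps)
      qed
      show ?thesis unfolding step eq using IH k small by auto
    qed
  qed
qed

lemma bits_length: "J < 2 ^ length (bits J)"
proof (cases "0 \<le> J")
  case True
  have "nat J < 2 ^ floorlog 2 (nat J)" by (rule less_floorlog)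
  then show ?thesis using True by (simp add: bits_def nat_less_iff)
next
  case False
  then show ?thesis by (meson less_trans not_less zero_less_numeral zero_less_power)
qed

section \<open>Exact step lengths\<close>

lemma line_fuel: "3 * (2 * 1 * Suc 1 * floorlog 2 (nat G1)) \<le> length (line_fuel I m)"
  unfolding line_fuel_def length_concat_const bits_def by simp

text \<open>The step is limited by the row \<open>r0\<close> with the least ratio, so its length is
  \<open>N / s\<close> with \<open>s\<close> at most half of \<open>E1\<close>. Such a fraction is
  determined by its position on a grid of order \<open>E1^2\<close>.\<close>

lemma line_search:
  assumes z: "z \<in> K" and u: "length u = n" "\<And>i. i < n \<Longrightarrow> \<bar>u ! i\<bar> \<le> U" and t: "0 < t"
    and u0: "0 \<le> z ! 0 + t * u ! 0" and out: "r1 \<in> H" "dot r1 z + t * dot r1 u < 0"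
    and r: "line_search mem I m z u t = (q, p)"
  shows "0 < q" "q \<le> 16 * E1" "0 \<le> p" "p \<le> t * q" "lin q z p u \<in> K" "\<exists>r\<in>H. dot r u < 0 \<and> dot r (lin q z p u) = 0"
proof -
  have z': "length z = n" "0 < z ! 0" using K_dest[OF z] by auto
  define S where "S = {r \<in> H. dot r u < 0}"
  define ratio where "ratio r = real_of_int (dot r z) / real_of_int (- dot r u)" for r
  have fin: "finite S" unfolding S_def using finite_H by simp
  have "dot r1 u < 0"
    using out(2) K_dest(3)[OF z out(1)] t by (smt (verit) mult_nonneg_nonneg)
  then have r1: "r1 \<in> S" using out(1) by (simp add: S_def)
  obtain r0 where r0: "r0 \<in> S" "\<And>r. r \<in> S \<Longrightarrow> ratio r0 \<le> ratio r"
    using arg_min_if_finite(1)[OF fin, of ratio] arg_min_least[OF fin, of _ ratio] r1 by blast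
  define N where "N = dot r0 z"
  define s where "s = - dot r0 u"
  have s: "0 < s" and r0H: "r0 \<in> H" using r0(1) by (auto simp: s_def S_def)
  have N: "0 \<le> N" using K_dest(3)[OF z r0H] by (simp add: N_def)
  have min: "N * (- dot r u) \<le> dot r z * s" if "r \<in> H" "dot r u < 0" for r
  proof -
    have "r \<in> S" using that by (simp add: S_def)
    then have "real_of_int N / real_of_int s \<le> real_of_int (dot r z) / real_of_int (- dot r u)"
      using r0(2)[of r] by (simp add: ratio_def N_def s_def)
    then have "real_of_int N * real_of_int (- dot r u) \<le> real_of_int (dot r z) * real_of_int s"
      using s that by (simp add: divide_simps split: if_splits)
    then show ?thesis by (metis of_int_le_iff of_int_mult)
  qed
  have Nts: "N < t * s"
  proof -
    have "N * (- dot r1 u) \<le> dot r1 z * s" using min[OF out(1) \<open>dot r1 u < 0\<close>] .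
    also have "\<dots> < (t * (- dot r1 u)) * s" using out(2) s by (intro mult_strict_right_mono) auto
    finally have "(- dot r1 u) * N < (- dot r1 u) * (t * s)" by (simp add: ac_simps)
    then show ?thesis using \<open>dot r1 u < 0\<close> by (simp only: mult_less_cancel_left_pos neg_0_less_iff_less)
  qed
  have sE: "2 * s \<le> E1"
  proof -
    have "\<bar>dot r0 u\<bar> \<le> nn * m * U" by (rule row_le[OF r0H u])
    then have "s \<le> nn * m * U" unfolding s_def by linarith
    then show ?thesis by (simp add: E1 mult.assoc)
  qed
  \<comment> \<open>The height is affine along the line, positive at \<open>z\<close> and
    nonnegative at the end \<open>t\<close>, hence positive before the end. Only such points may be
    queried.\<close>
  have hd: "0 < a * z ! 0 + j * u ! 0" if "0 < a" "0 \<le> j" "j < a * t" for a j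
  proof (cases "0 \<le> u ! 0")
    case True
    then show ?thesis using that z' by (simp add: add_pos_nonneg)
  next
    case False
    have "0 \<le> a * (z ! 0 + t * u ! 0)" using that u0 by simp
    moreover have "(a * t) * u ! 0 < j * u ! 0" using False that by (intro mult_strict_right_mono_neg) auto
    ultimately show ?thesis by (simp add: algebra_simps)
  qed
  have inK: "lin a z j u \<in> K \<longleftrightarrow> j * s \<le> a * N" if a: "0 < a" "0 \<le> j" "j < a * t" for a j
  proof
    assume "lin a z j u \<in> K"
    then have "0 \<le> dot r0 (lin a z j u)" using K_dest(3) r0H by blast
    then show "j * s \<le> a * N" using z' u by (simp add: dot_lin' N_def s_def)
  next
    assume le: "j * s \<le> a * N"
    have "0 \<le> a * dot r z + j * dot r u" if r: "r \<in> H" for r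
    proof (cases "dot r u < 0")
      case True
      have "s * (j * (- dot r u)) = (j * s) * (- dot r u)" by simp
      also have "\<dots> \<le> (a * N) * (- dot r u)" using le True by (intro mult_right_mono) auto
      also have "\<dots> = a * (N * (- dot r u))" by simp
      also have "\<dots> \<le> a * (dot r z * s)" using min[OF r True] a by (intro mult_left_mono) auto
      finally have "s * (j * (- dot r u)) \<le> s * (a * dot r z)" by (simp add: ac_simps)
      then have "j * (- dot r u) \<le> a * dot r z" using s by (simp only: mult_le_cancel_left_pos)
      then show ?thesis by simp
    next
      case False
      then show ?thesis using a K_dest(3)[OF z r] by simp
    qed
    then show "lin a z j u \<in> K" using z' u n hd[OF a] by (simp add: K_def dot_lin')
  qed
  define J where "J = t * G1"
  have G1p: "0 < G1" using G1_ge by simp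
  have test: "mem (lin G1 z j u) \<longleftrightarrow> j * s \<le> G1 * N" if "0 \<le> j" "j < J" for j
  proof -
    have j: "0 < G1" "0 \<le> j" "j < G1 * t" using that G1p by (simp_all add: J_def mult.commute)
    have "mem (lin G1 z j u) \<longleftrightarrow> lin G1 z j u \<in> K"
      using z' u n hd[OF j] by (intro mem) auto
    then show ?thesis using inK[OF j] by simp
  qed
  have NJ: "0 \<le> G1 * N" "G1 * N < J * s" using N Nts G1p by (simp_all add: J_def)
  define b where "b = fold (\<lambda>_ b. bisect_step mem G1 z u b) (bits J) (0, J)"
  have b: "0 \<le> fst b" "snd b \<le> J" "fst b < snd b" "fst b * s \<le> G1 * N" "G1 * N < snd b * s"
    "snd b - fst b = 1 \<or> (snd b - fst b) * 2 ^ length (bits J) \<le> J + 2 ^ length (bits J)"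
    using bisect[OF test s NJ, of "bits J"] unfolding b_def by auto
  have b1: "snd b = fst b + 1"
  proof (rule ccontr)
    assume "\<not> ?thesis"
    then have "2 \<le> snd b - fst b" using b(3) by simp
    then have "2 * 2 ^ length (bits J) \<le> (snd b - fst b) * 2 ^ length (bits J)" by (intro mult_right_mono) auto
    then show False using b(6) bits_length[of J] \<open>2 \<le> snd b - fst b\<close> by linarith
  qed
  define j where "j = fst b"
  define d where "d = dioph [0] [0, 1] (line_fuel I m) G1 [j]"
  interpret D: dioph_lattice 1 G1 "[j]" by standard (use G1p in auto)
  have "0 < E1" using E1_ge by simp
  have GE: "2 ^ (Suc 1 * Suc 1) * E1 ^ Suc 1 \<le> G1" by (simp add: G1 power2_eq_square)
  have "dioph [0..<1] [0..<Suc 1] (line_fuel I m) G1 [j] = (fst d, snd d)"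
    by (simp add: d_def upt_rec)
  note D = D.dioph_approximation[OF \<open>0 < E1\<close> GE line_fuel this]
  define p0 where "p0 = snd d ! 0"
  have qp: "q = \<bar>fst d\<bar>" "p = (if fst d < 0 then - p0 else p0)"
    using r D(2) unfolding line_search_def J_def[symmetric] b_def[symmetric] j_def[symmetric] d_def[symmetric] Let_def p0_def
    by (auto split: if_splits)
  have D4: "\<bar>fst d * j - G1 * p0\<bar> * E1 < G1" using D(4)[of 0] by (simp add: p0_def)
  have q: "0 < q" "q * E1 < G1" using D(1,3) by (simp_all add: qp)
  then show "0 < q" by simp
  have "q * E1 < (16 * E1) * E1" using q(2) by (simp add: G1)
  then show "q \<le> 16 * E1" using \<open>0 < E1\<close> by (simp only: mult_less_cancel_right_pos less_imp_le)
  have dj: "\<bar>q * j - G1 * p\<bar> * E1 < G1" using D4 by (auto simp: qp abs_minus_commute)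
  \<comment> \<open>\<open>G1 X\<close> is split into the bisection error, at most
    \<open>q s\<close>, and the approximation error times \<open>s\<close>. Both are less than
    \<open>s G1 / E1\<close>, and \<open>2 s \<le> E1\<close>, so the integer \<open>X\<close> is
    0.\<close>
  have eq: "q * N = p * s"
  proof -
    define X where "X = q * N - p * s"
    have "G1 * X = q * (G1 * N - j * s) + s * (q * j - G1 * p)" by (simp add: X_def algebra_simps)
    then have "\<bar>G1 * X\<bar> \<le> \<bar>q * (G1 * N - j * s)\<bar> + \<bar>s * (q * j - G1 * p)\<bar>" by (metis abs_triangle_ineq)
    also have "\<dots> = q * \<bar>G1 * N - j * s\<bar> + s * \<bar>q * j - G1 * p\<bar>" using q s by (simp add: abs_mult)
    also have "\<dots> \<le> q * s + s * \<bar>q * j - G1 * p\<bar>"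
      using b(4,5) b1 q(1) by (intro add_right_mono mult_left_mono) (auto simp: j_def algebra_simps)
    finally have "\<bar>G1 * X\<bar> * E1 \<le> (q * s + s * \<bar>q * j - G1 * p\<bar>) * E1" using \<open>0 < E1\<close> by (intro mult_right_mono) auto
    also have "\<dots> = s * (q * E1) + s * (\<bar>q * j - G1 * p\<bar> * E1)" by (simp add: algebra_simps)
    also have "\<dots> < s * G1 + s * G1" using q(2) dj s by (intro add_strict_mono mult_strict_left_mono) auto
    also have "\<dots> = G1 * (2 * s)" by simp
    also have "\<dots> \<le> G1 * E1" using sE G1p by (intro mult_left_mono) auto
    finally have "(G1 * E1) * \<bar>X\<bar> < (G1 * E1) * 1" using G1p by (simp add: abs_mult ac_simps)
    moreover have "0 < G1 * E1" using G1p \<open>0 < E1\<close> by simp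
    ultimately have "\<bar>X\<bar> < 1" by (simp only: mult_less_cancel_left_pos)
    then show ?thesis by (simp add: X_def)
  qed
  have "0 \<le> p * s" unfolding eq[symmetric] using q N by simp
  then show p: "0 \<le> p" using s by (simp add: zero_le_mult_iff)
  have "s * p < s * (q * t)"
  proof -
    have "s * p = q * N" using eq by (simp add: mult.commute)
    also have "\<dots> < q * (t * s)" using Nts q by (intro mult_strict_left_mono)
    finally show ?thesis by (simp add: ac_simps)
  qed
  then have pt: "p < q * t" using s by (simp only: mult_less_cancel_left_pos)
  then show "p \<le> t * q" by (simp add: mult.commute)
  have "p * s \<le> q * N" using eq by simp
  then show "lin q z p u \<in> K" using inK[OF q(1) p pt] by simp
  have "dot r0 (lin q z p u) = 0" using eq z' u by (simp add: dot_lin' N_def s_def)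
  then show "\<exists>r\<in>H. dot r u < 0 \<and> dot r (lin q z p u) = 0" using r0H s by (auto simp: s_def)
qed

text \<open>Along a walk through faces of decreasing dimension there is a triangular system of rows and
  directions, so the walk is short.\<close>

definition chain :: "nat \<Rightarrow> int list \<Rightarrow> bool" where
  "chain k z \<longleftrightarrow> (\<exists>a u. (\<forall>t<k. a t \<in> tight z \<and> length (u t) = n \<and> dot (a t) (u t) \<noteq> 0) \<and>
    (\<forall>s<k. \<forall>t<s. dot (a t) (u s) = 0))"

lemma chain_0: "chain 0 z"
  by (simp add: chain_def)

lemma chain_le:
  assumes "chain k z"
  shows "k \<le> n"
proof -
  obtain a u where au: "\<And>t. t < k \<Longrightarrow> a t \<in> tight z \<and> length (u t) = n \<and> dot (a t) (u t) \<noteq> 0"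
    "\<And>s t. s < k \<Longrightarrow> t < s \<Longrightarrow> dot (a t) (u s) = 0" using assms unfolding chain_def by blast
  have "length (a t) = n" if "t < k" for t using au(1)[OF that] H(1) unfolding tight_def by blast
  then show ?thesis using au by (intro triangular_length_le[of k a n u]) auto
qed

text \<open>The direction \<open>v\<close> is annihilated by all earlier rows of the chain, since
  these are tight at \<open>z\<close>, while the new row does not vanish on it; so the system stays
  triangular.\<close>

lemma chain_Suc:
  assumes "chain k z" "length v = n" "\<And>r. r \<in> tight z \<Longrightarrow> dot r v = 0" "tight z \<subseteq> tight z'"
    "r \<in> tight z'" "dot r v \<noteq> 0"
  shows "chain (Suc k) z'"
proof -
  obtain a u where au: "\<And>t. t < k \<Longrightarrow> a t \<in> tight z \<and> length (u t) = n \<and> dot (a t) (u t) \<noteq> 0"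
    "\<And>s t. s < k \<Longrightarrow> t < s \<Longrightarrow> dot (a t) (u s) = 0" using assms(1) unfolding chain_def by blast
  show ?thesis unfolding chain_def
  proof (intro exI conjI allI impI)
    fix t assume "t < Suc k"
    then show "(a(k := r)) t \<in> tight z'" "length ((u(k := v)) t) = n" "dot ((a(k := r)) t) ((u(k := v)) t) \<noteq> 0"
      using au(1)[of t] assms by (auto simp: less_Suc_eq)
  next
    fix s t assume "s < Suc k" "t < s"
    then show "dot ((a(k := r)) t) ((u(k := v)) s) = 0"
      using au(1)[of t] au(2)[of s t] assms(3)[of "a t"] by (cases "s = k") auto
  qed
qed

section \<open>Walks to a vertex\<close>

lemma advance:
  assumes z: "z \<in> K" and u: "u \<in> L z" "\<And>i. i < n \<Longrightarrow> \<bar>u ! i\<bar> \<le> U"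
    and out: "r1 \<in> H" "dot r1 u < 0"
  defines "z' \<equiv> advance mem I m z u"
  shows "z' \<in> K" "tight z \<subseteq> tight z'" "\<exists>r\<in>tight z'. dot r u \<noteq> 0"
    "\<And>i. i < n \<Longrightarrow> \<bar>z' ! i\<bar> \<le> 16 * E1 * (1 + (nn * m + 1) * U) * (asum z + 1)"
proof -
  define t where "t = m * asum z + 1"
  define q where "q = fst (line_search mem I m z u t)"
  define p where "p = snd (line_search mem I m z u t)"
  have len: "length u = n" "length z = n" using L_dest[OF u(1)] K_dest[OF z] by auto
  have t: "0 < t" using m asum_nonneg[of z] by (simp add: t_def add_nonneg_pos)
  have u0: "0 \<le> z ! 0 + t * u ! 0" using L_dest[OF u(1)] K_dest[OF z] by simp
  have "\<bar>dot r1 z\<bar> \<le> m * asum z" using abs_dot_le[OF H(1)[OF out(1)] len(2) H(2)[OF out(1)]] .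
  moreover have "t * dot r1 u \<le> t * (- 1)" using out(2) t by (intro mult_left_mono) auto
  ultimately have o: "dot r1 z + t * dot r1 u < 0" by (simp add: t_def)
  have qp: "line_search mem I m z u t = (q, p)" by (simp add: q_def p_def)
  note ls = line_search[OF z len(1) u(2) t u0 out(1) o qp]
  have z': "z' = lin q z p u" by (simp add: z'_def advance_def t_def[symmetric] q_def p_def Let_def)
  show "z' \<in> K" using ls(5) z' by simp
  show sub: "tight z \<subseteq> tight z'"
    using L_dest(3)[OF u(1)] len by (auto simp: tight_def z' dot_lin')
  show "\<exists>r\<in>tight z'. dot r u \<noteq> 0" using ls(6) by (auto simp: tight_def z')
  show "\<bar>z' ! i\<bar> \<le> 16 * E1 * (1 + (nn * m + 1) * U) * (asum z + 1)" if i: "i < n" for i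
  proof -
    have a: "0 \<le> asum z" by (rule asum_nonneg)
    have tle: "t \<le> (nn * m + 1) * (asum z + 1)"
    proof -
      have "1 * (m * asum z) \<le> nn * (m * asum z)" using n m a by (intro mult_right_mono) auto
      moreover have "0 \<le> nn * m" using m by simp
      ultimately show ?thesis using a by (simp add: t_def algebra_simps)
    qed
    have "\<bar>z' ! i\<bar> \<le> q * \<bar>z ! i\<bar> + p * \<bar>u ! i\<bar>"
      using i len ls(1,3) abs_triangle_ineq[of "q * z ! i" "p * u ! i"] by (simp add: z' abs_mult)
    also have "\<dots> \<le> q * (asum z + 1) + (t * q) * U"
      using abs_nth_le_asum[of i z] i len ls u(2)[OF i] t by (intro add_mono mult_mono) auto
    also have "\<dots> = q * (asum z + 1 + t * U)" by (simp add: algebra_simps)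
    also have "\<dots> \<le> (16 * E1) * (asum z + 1 + ((nn * m + 1) * (asum z + 1)) * U)"
      using ls(2) E1_ge tle U_ge(1) a t by (intro mult_mono add_left_mono mult_right_mono) auto
    also have "\<dots> = 16 * E1 * (1 + (nn * m + 1) * U) * (asum z + 1)" by (simp add: algebra_simps)
    finally show ?thesis .
  qed
qed

lemma L_uminus: "u \<in> L z \<Longrightarrow> map uminus u \<in> L z"
  using n by (auto simp: L_def dot_uminus)

lemma walk_step:
  assumes z: "z \<in> K"
  defines "z' \<equiv> walk_step mem sep I m z"
  shows "z' \<in> K" "tight z \<subseteq> tight z'" "trivial z \<Longrightarrow> trivial z'" "trivial z' \<or> (chain k z \<longrightarrow> chain (Suc k) z')"
    "\<And>i. i < n \<Longrightarrow> \<bar>z' ! i\<bar> \<le> 16 * E1 * (1 + (nn * m + 1) * U) * (asum z + 1)"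
proof -
  have bound: "\<bar>z ! i\<bar> \<le> 16 * E1 * (1 + (nn * m + 1) * U) * (asum z + 1)" if "i < n" for i
  proof -
    have "1 * 1 \<le> 16 * E1 * (1 + (nn * m + 1) * U)"
    proof (rule mult_mono)
      have "0 \<le> (nn * m + 1) * U" using U_ge(1) m by simp
      then show "1 \<le> 1 + (nn * m + 1) * U" by simp
    qed (use E1_ge in auto)
    then have "1 * (asum z + 1) \<le> 16 * E1 * (1 + (nn * m + 1) * U) * (asum z + 1)"
      using asum_nonneg[of z] by (intro mult_right_mono) auto
    then show ?thesis using abs_nth_le_asum[of i z] that K_dest(1)[OF z] by simp
  qed
  have "z' \<in> K \<and> tight z \<subseteq> tight z' \<and> (trivial z \<longrightarrow> trivial z') \<and> (trivial z' \<or> (chain k z \<longrightarrow> chain (Suc k) z')) \<and>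
    (\<forall>i<n. \<bar>z' ! i\<bar> \<le> 16 * E1 * (1 + (nn * m + 1) * U) * (asum z + 1))"
  proof (cases "face mem sep I m z = []")
    case True
    then show ?thesis using z face(1)[OF z] bound by (simp add: z'_def walk_step_def)
  next
    case False
    define u where "u = face mem sep I m z"
    have u: "u \<in> L z" "\<exists>i<n. u ! i \<noteq> 0" "\<And>i. i < n \<Longrightarrow> \<bar>u ! i\<bar> \<le> U"
      using face(2)[OF z False] by (auto simp: u_def)
    have len: "length u = n" "length z = n" "0 < z ! 0" "u ! 0 = 0" using L_dest[OF u(1)] K_dest[OF z] by auto
    have nt: "\<not> trivial z" using u by (auto simp: trivial_def)
    let ?t = "m * asum z + 1"
    have t: "0 < ?t" using m asum_nonneg[of z] by (simp add: add_nonneg_pos)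
    have memt: "mem (lin 1 z ?t u) \<longleftrightarrow> lin 1 z ?t u \<in> K"
      using len n by (intro mem) auto
    define v where "v = (if mem (lin 1 z ?t u) then map uminus u else u)"
    have z': "z' = advance mem I m z v"
      using False by (simp add: z'_def walk_step_def u_def[symmetric] Let_def v_def)
    have v: "v \<in> L z" using u L_uminus by (simp add: v_def)
    have vU: "\<bar>v ! i\<bar> \<le> U" if "i < n" for i using u(3)[OF that] that len by (simp add: v_def)
    have "\<exists>r\<in>H. dot r v < 0"
    proof (cases "lin 1 z ?t u \<in> K")
      case True
      have ge: "0 \<le> dot r u" if r: "r \<in> H" for r
      proof (rule ccontr)
        assume "\<not> 0 \<le> dot r u"
        then have "?t * dot r u \<le> ?t * (- 1)" using t by (intro mult_left_mono) auto
        moreover have "\<bar>dot r z\<bar> \<le> m * asum z" using abs_dot_le[OF H(1)[OF r] len(2) H(2)[OF r]] .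
        moreover have "0 \<le> dot r z + ?t * dot r u" using K_dest(3)[OF True r] len by (simp add: dot_lin')
        ultimately show False by simp
      qed
      have "\<exists>r\<in>H. dot r u \<noteq> 0" using no_line[OF len(1,4)] u(2) by blast
      then show ?thesis using ge True memt by (force simp: v_def dot_uminus)
    next
      case False
      then have "\<exists>r\<in>H. dot r (lin 1 z ?t u) < 0" using len n by (auto simp: K_def not_le)
      then obtain r where r: "r \<in> H" "dot r z + ?t * dot r u < 0" using len by (auto simp: dot_lin')
      have "dot r u < 0" using r K_dest(3)[OF z r(1)] t by (smt (verit) mult_nonneg_nonneg)
      then show ?thesis using False memt r by (auto simp: v_def)
    qed
    then obtain r1 where r1: "r1 \<in> H" "dot r1 v < 0" by blast
    note adv = advance[OF z v vU r1, folded z']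
    obtain r where r: "r \<in> tight z'" "dot r v \<noteq> 0" using adv(3) by blast
    have "chain (Suc k) z'" if "chain k z"
      using chain_Suc[OF that L_dest(1)[OF v] L_dest(3)[OF v] adv(2) r] .
    then show ?thesis using adv nt by blast
  qed
  then show "z' \<in> K" "tight z \<subseteq> tight z'" "trivial z \<Longrightarrow> trivial z'" "trivial z' \<or> (chain k z \<longrightarrow> chain (Suc k) z')"
    "\<And>i. i < n \<Longrightarrow> \<bar>z' ! i\<bar> \<le> 16 * E1 * (1 + (nn * m + 1) * U) * (asum z + 1)"
    by blast+
qed

lemma walk_partial:
  fixes js :: "nat list"
  assumes z: "z \<in> K"
  defines "y \<equiv> fold (\<lambda>_ y. walk_step mem sep I m y) js z"
  shows "y \<in> K \<and> tight z \<subseteq> tight y \<and> (trivial y \<or> chain (length js) y)"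
  unfolding y_def
proof (induction js rule: rev_induct)
  case Nil
  then show ?case using z chain_0 by simp
next
  case (snoc x js)
  define y where "y = fold (\<lambda>_ y. walk_step mem sep I m y) js z"
  have y: "y \<in> K" "tight z \<subseteq> tight y" "trivial y \<or> chain (length js) y" using snoc by (auto simp: y_def)
  show ?case using walk_step(1-3)[OF y(1)] walk_step(4)[OF y(1), of "length js"] y by (auto simp: y_def[symmetric])
qed

text \<open>A chain has at most \<open>n\<close> members, so after \<open>n + 1\<close> steps
  \<open>y\<close> is trivial. A row tight at \<open>y\<close> is nonnegative on every summand of an
  integral decomposition of \<open>y\<close>, hence tight there; so each summand is the vertex that
  \<open>y\<close> represents.\<close>

lemma vertex_near:
  assumes z: "z \<in> K"
  defines "v \<equiv> vertex_near mem sep I m z"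
  shows "v \<in> K" "v ! 0 = 1" "tight z \<subseteq> tight v" "\<And>i. i < n \<Longrightarrow> \<bar>v ! i\<bar> \<le> W"
proof -
  define y where "y = fold (\<lambda>_ y. walk_step mem sep I m y) (next_list I) z"
  have y: "y \<in> K" "tight z \<subseteq> tight y" "trivial y \<or> chain (Suc n) y"
    using walk_partial[OF z, of "next_list I"] unfolding y_def next_list by auto
  have triv: "trivial y" using y(3) chain_le by fastforce
  have ly: "length y = n" "0 < y ! 0" using K_dest[OF y(1)] by auto
  obtain xs where xs: "length xs = nat (y ! 0)" "\<And>x. x \<in> set xs \<Longrightarrow> x \<in> K \<and> x ! 0 = 1"
    "\<And>r. length r = n \<Longrightarrow> dot r y = sum_list (map (dot r) xs)" using integral[OF y(1)] by blast
  have "xs \<noteq> []" using xs(1) ly by auto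
  then obtain x where x: "x \<in> set xs" by (cases xs) auto
  have xK: "x \<in> K" "x ! 0 = 1" "length x = n" using xs(2)[OF x] K_dest by auto
  have tx: "dot r x = 0" if "r \<in> tight y" for r
  proof -
    have r: "r \<in> H" "dot r y = 0" using that by (auto simp: tight_def)
    have "sum_list (map (dot r) xs) = 0" using xs(3)[OF H(1)[OF r(1)]] r(2) by simp
    moreover have "\<forall>c\<in>set (map (dot r) xs). 0 \<le> c" using xs(2) K_dest(3) r(1) by auto
    ultimately have "\<forall>c\<in>set (map (dot r) xs). c = 0"
      by (metis (no_types, lifting) sum_list_nonneg_eq_0_iff)
    then show ?thesis using x by simp
  qed
  have "lin (y ! 0) x (- 1) y \<in> L y"
    using xK ly n tx by (auto simp: L_def dot_lin' tight_def)
  then have "lin (y ! 0) x (- 1) y ! i = 0" if "i < n" for i using triv that by (auto simp: trivial_def)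
  then have eq: "y ! i = y ! 0 * x ! i" if "i < n" for i using that xK ly by force
  have v: "v = x"
  proof (rule nth_equalityI)
    show "length v = length x" using ly xK by (simp add: v_def vertex_near_def Let_def y_def[symmetric])
    fix i assume "i < length v"
    then have i: "i < n" using ly by (simp add: v_def vertex_near_def Let_def y_def[symmetric])
    then have "v ! i = y ! i div y ! 0" using ly n by (simp add: v_def vertex_near_def Let_def y_def[symmetric])
    then show "v ! i = x ! i" using eq[OF i] ly by simp
  qed
  show "v \<in> K" "v ! 0 = 1" using xK v by auto
  show "tight z \<subseteq> tight v" using y(2) tx v by (auto simp: tight_def)
  show "\<And>i. i < n \<Longrightarrow> \<bar>v ! i\<bar> \<le> W" using vertex_small[OF y(1) triv xK(3) eq] v by simp
qed

end

section \<open>Peeling off vertices\<close>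

definition comb :: "(int \<times> int list) list \<Rightarrow> nat \<Rightarrow> int" where
  "comb ps i = sum_list (map (\<lambda>e. fst e * (1 # snd e) ! i) ps)"

context cone_oracle
begin

text \<open>The vector \<open>M r - z\<close> is \<open>M\<close> times the sum of the fractional parts split off so far.\<close>

definition peel_inv :: "int list \<Rightarrow> nat \<Rightarrow> peel_state \<Rightarrow> bool" where
  "peel_inv a t s \<longleftrightarrow> (case s of (d, M, z, r, ps) \<Rightarrow>
    0 < M \<and> z \<in> K \<and> length r = n \<and> (\<forall>i<n. a ! i = r ! i + comb ps i) \<and>
    (\<forall>e\<in>set ps. 0 \<le> fst e \<and> 1 # snd e \<in> K) \<and>
    (if d then r \<in> K \<and> r ! 0 \<le> int t
     else (\<forall>x\<in>H. 0 \<le> M * dot x r - dot x z) \<and> 0 \<le> M * r ! 0 - z ! 0 \<and> M * r ! 0 - z ! 0 \<le> int t * M \<and> chain t z))"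

text \<open>Besides preserving the invariant, one round enlarges the data by controlled factors,
  from which the lengths over all rounds are estimated later.\<close>

lemma peel:
  assumes inv: "peel_inv a t (False, M, z, r, ps)" and v: "v \<in> K" "v ! 0 = 1" "tight z \<subseteq> tight v" "\<And>i. i < n \<Longrightarrow> \<bar>v ! i\<bar> \<le> W"
  defines "s' \<equiv> peel mem I m v M z r ps"
  shows "peel_inv a (Suc t) s' \<and> length (snd (snd (snd (snd s')))) = Suc (length ps) \<and>
    fst (snd s') \<le> 16 * E1 * M \<and> (\<forall>i<n. \<bar>fst (snd (snd s')) ! i\<bar> \<le> 16 * E1 * (1 + W) * (asum z + 1)) \<and>
    (\<forall>e\<in>set (snd (snd (snd (snd s')))). e \<in> set ps \<or> fst e \<le> 16 * E1 * (asum z + 1) \<and> snd e = tl v) \<and>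
    (\<forall>i<n. \<bar>fst (snd (snd (snd s'))) ! i\<bar> \<le> \<bar>r ! i\<bar> + 16 * E1 * (asum z + 1) * W)"
proof -
  have i: "0 < M" "z \<in> K" "length r = n" "\<And>i. i < n \<Longrightarrow> a ! i = r ! i + comb ps i"
    "\<forall>e\<in>set ps. 0 \<le> fst e \<and> 1 # snd e \<in> K" "\<And>x. x \<in> H \<Longrightarrow> 0 \<le> M * dot x r - dot x z"
    "0 \<le> M * r ! 0 - z ! 0" "M * r ! 0 - z ! 0 \<le> int t * M" "chain t z"
    using inv by (auto simp: peel_inv_def)
  have len: "length z = n" "0 < z ! 0" "length v = n" using K_dest i(2) v(1) by auto
  have tlv: "1 # tl v = v" using len n v(2) by (cases v) auto
  have z0: "z ! 0 \<le> asum z" using abs_nth_le_asum[of 0 z] len n by simp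
  have az: "0 \<le> asum z" by (rule asum_nonneg)
  have zd: "nth_default 0 z 0 = z ! 0" using len n by simp
  define w where "w = lin 1 z (- z ! 0) v"
  define c where "c = m * asum v + 1"
  have c: "0 < c" using m asum_nonneg[of v] by (simp add: c_def add_nonneg_pos)
  have w: "length w = n" "w ! 0 = 0" "\<And>x. dot x w = dot x z - z ! 0 * dot x v"
    using len n v(2) by (auto simp: w_def dot_lin')
  have mem_vw: "mem (lin 1 v c w) \<longleftrightarrow> lin 1 v c w \<in> K"
    using len n w v(2) by (intro mem) auto
  have b1: "1 \<le> 16 * E1" using E1_ge by simp
  have zb: "\<bar>z ! i\<bar> \<le> 16 * E1 * (1 + W) * (asum z + 1)" if "i < n" for i
  proof -
    have "1 * 1 \<le> (16 * E1) * (1 + W)" using b1 W_ge_1 by (intro mult_mono) auto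
    then have "1 * (asum z + 1) \<le> 16 * E1 * (1 + W) * (asum z + 1)" using az by (intro mult_right_mono) auto
    then show ?thesis using abs_nth_le_asum[of i z] that len by simp
  qed
  have r': "\<bar>lin 1 r (- k) v ! i\<bar> \<le> \<bar>r ! i\<bar> + 16 * E1 * (asum z + 1) * W"
    if "i < n" "0 \<le> k" "k \<le> 16 * E1 * (asum z + 1)" for i k
  proof -
    have "\<bar>r ! i - k * v ! i\<bar> \<le> \<bar>r ! i\<bar> + \<bar>k\<bar> * \<bar>v ! i\<bar>" by (metis abs_mult abs_triangle_ineq4)
    also have "\<bar>k\<bar> * \<bar>v ! i\<bar> \<le> 16 * E1 * (asum z + 1) * W" using that v(4)[OF that(1)] az b1 by (intro mult_mono mult_nonneg_nonneg) auto
    finally show ?thesis using that len i(3) by simp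
  qed
  have comb': "a ! i = lin 1 r (- k) v ! i + comb ((k, tl v) # ps) i" if "i < n" for i k
    using that i(3,4) len by (simp add: comb_def tlv)
  show ?thesis
  proof (cases "lin 1 v c w \<in> K")
    case True
    \<comment> \<open>With \<open>z ! 0 - 1\<close> instead of \<open>z ! 0\<close> the weight left
      on \<open>v\<close> lies between 1 and \<open>M\<close>, so that the remainder has positive
      height.\<close>
    define k where "k = (z ! 0 - 1) div M"
    have s': "s' = (True, M, z, lin 1 r (- k) v, (k, tl v) # ps)"
      using True mem_vw unfolding s'_def peel_def zd w_def[symmetric] c_def[symmetric] k_def by (simp add: Let_def)
    \<comment> \<open>A row negative on \<open>w\<close> is at most \<open>-1\<close> there, and the
      factor \<open>c\<close> exceeds the value of any row at \<open>v\<close>; so the membership of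
      one far point settles all rows.\<close>
    have dw: "0 \<le> dot x w" if x: "x \<in> H" for x
    proof (rule ccontr)
      assume "\<not> 0 \<le> dot x w"
      then have "c * dot x w \<le> c * (- 1)" using c by (intro mult_left_mono) auto
      moreover have "\<bar>dot x v\<bar> \<le> m * asum v" using abs_dot_le[OF H(1)[OF x] len(3) H(2)[OF x]] .
      moreover have "0 \<le> dot x v + c * dot x w" using K_dest(3)[OF True x] len w by (simp add: dot_lin')
      ultimately show False by (simp add: c_def)
    qed
    have k0: "0 \<le> k" using len(2) i(1) by (simp add: k_def pos_imp_zdiv_nonneg_iff)
    have "M * k + (z ! 0 - 1) mod M = z ! 0 - 1" by (simp add: k_def)
    then have fr: "1 \<le> z ! 0 - M * k" "z ! 0 - M * k \<le> M"
      using pos_mod_sign[OF i(1), of "z ! 0 - 1"] pos_mod_bound[OF i(1), of "z ! 0 - 1"] by linarith+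
    have kb: "k \<le> 16 * E1 * (asum z + 1)"
    proof -
      have "k \<le> \<bar>z ! 0 - 1\<bar>" unfolding k_def using abs_div_le[of "z ! 0 - 1" M] by linarith
      then have "k \<le> 1 * (asum z + 1)" using z0 len(2) by simp
      also have "\<dots> \<le> 16 * E1 * (asum z + 1)" using b1 az by (intro mult_right_mono) auto
      finally show ?thesis .
    qed
    have nonneg: "0 \<le> dot x (lin 1 r (- k) v)" if x: "x \<in> H" for x
    proof -
      have "M * dot x (lin 1 r (- k) v) = (M * dot x r - dot x z) + dot x w + (z ! 0 - M * k) * dot x v"
        using i(3) len w(3) by (simp add: dot_lin' algebra_simps)
      also have "0 \<le> \<dots>" using i(6)[OF x] dw[OF x] fr K_dest(3)[OF v(1) x] by simp
      finally show ?thesis using i(1) by (simp add: zero_le_mult_iff)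
    qed
    have hd: "M * (lin 1 r (- k) v ! 0) = (M * r ! 0 - z ! 0) + (z ! 0 - M * k)"
      using i(3) len n v(2) by (simp add: algebra_simps)
    have "0 < M * (lin 1 r (- k) v ! 0)" using hd i(7) fr by linarith
    then have h1: "0 < lin 1 r (- k) v ! 0" using i(1) by (simp add: zero_less_mult_iff)
    have "M * (lin 1 r (- k) v ! 0) \<le> M * int (Suc t)" using hd i(8) fr by (simp add: algebra_simps)
    then have h2: "lin 1 r (- k) v ! 0 \<le> int (Suc t)" using i(1) by (simp only: mult_le_cancel_left_pos)
    have "lin 1 r (- k) v \<in> K" using h1 nonneg i(3) len by (simp add: K_def)
    then have "peel_inv a (Suc t) s'"
      using i h2 k0 v(1) tlv comb'[of _ k] len unfolding s' peel_inv_def by simp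
    moreover have "M \<le> 16 * E1 * M" using mult_right_mono[OF b1, of M] i(1) by simp
    ultimately show ?thesis using zb kb r'[of _ k] k0 by (simp add: s')
  next
    case False
    have "\<exists>x\<in>H. dot x (lin 1 v c w) < 0" using False len n w v(2) by (auto simp: K_def not_le)
    then obtain x where x: "x \<in> H" "dot x v + c * dot x w < 0" using len w by (auto simp: dot_lin')
    have xw: "dot x w < 0"
      using x(2) K_dest(3)[OF v(1) x(1)] c by (smt (verit) mult_nonneg_nonneg)
    define l where "l = line_search mem I m z (map uminus v) (z ! 0)"
    define q where "q = fst l"
    define p where "p = snd l"
    have l: "line_search mem I m z (map uminus v) (z ! 0) = (q, p)" by (simp add: q_def p_def l_def)
    \<comment> \<open>At step length \<open>z ! 0\<close> only \<open>w\<close> remains: its height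
      is exactly 0, and the row \<open>x\<close> is negative on it, as the line search
      requires.\<close>
    note ls = line_search[OF i(2) _ _ len(2) _ x(1) _ l]
    have vU: "\<bar>map uminus v ! i\<bar> \<le> U" if "i < n" for i using v(4)[OF that] U_ge(2) that len by simp
    have ls: "0 < q" "q \<le> 16 * E1" "0 \<le> p" "p \<le> z ! 0 * q" "lin q z p (map uminus v) \<in> K"
      "\<exists>r\<in>H. dot r (map uminus v) < 0 \<and> dot r (lin q z p (map uminus v)) = 0"
      using ls len vU n v(2) xw w(3) by (simp_all add: dot_uminus)
    define k where "k = p div (q * M)"
    define z' where "z' = lin q z p (map uminus v)"
    have s': "s' = (False, q * M, z', lin 1 r (- k) v, (k, tl v) # ps)"
      using False mem_vw unfolding s'_def peel_def zd w_def[symmetric] c_def[symmetric] k_def l_def[symmetric] q_def p_def z'_def Let_def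
      by simp
    have qM: "0 < q * M" using ls(1) i(1) by simp
    have k0: "0 \<le> k" using ls(3) qM by (simp add: k_def pos_imp_zdiv_nonneg_iff)
    have "q * M * k + p mod (q * M) = p" by (simp add: k_def)
    then have fr: "0 \<le> p - q * M * k" "p - q * M * k \<le> q * M"
      using pos_mod_sign[OF qM, of p] pos_mod_bound[OF qM, of p] by linarith+
    have pb: "p \<le> 16 * E1 * (asum z + 1)"
    proof -
      have "p \<le> z ! 0 * q" by (rule ls(4))
      also have "\<dots> \<le> (asum z + 1) * (16 * E1)" using z0 len(2) ls by (intro mult_mono) auto
      finally show ?thesis by (simp add: mult.commute)
    qed
    have kb: "k \<le> 16 * E1 * (asum z + 1)"
      using abs_div_le[of p "q * M"] pb ls(3) by (simp add: k_def)
    have z'b: "\<bar>z' ! i\<bar> \<le> 16 * E1 * (1 + W) * (asum z + 1)" if "i < n" for i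
    proof -
      have "\<bar>z' ! i\<bar> \<le> q * \<bar>z ! i\<bar> + p * \<bar>v ! i\<bar>"
        using that len ls(1,3) abs_triangle_ineq4[of "q * z ! i" "p * v ! i"] by (simp add: z'_def abs_mult)
      also have "\<dots> \<le> (16 * E1) * (asum z + 1) + (16 * E1 * (asum z + 1)) * W"
        using abs_nth_le_asum[of i z] that len ls pb v(4)[OF that] E1_ge az by (intro add_mono mult_mono) auto
      finally show ?thesis by (simp add: algebra_simps)
    qed
    have dz': "dot x z' = q * dot x z - p * dot x v" for x
      using len by (simp add: z'_def dot_lin' dot_uminus)
    have nonneg: "0 \<le> q * M * dot x (lin 1 r (- k) v) - dot x z'" if x: "x \<in> H" for x
    proof -
      have "q * M * dot x (lin 1 r (- k) v) - dot x z' = q * (M * dot x r - dot x z) + (p - q * M * k) * dot x v"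
        using i(3) len by (simp add: dz' dot_lin' algebra_simps)
      also have "0 \<le> \<dots>" using i(6)[OF x] fr K_dest(3)[OF v(1) x] ls(1) by simp
      finally show ?thesis .
    qed
    have hd: "q * M * (lin 1 r (- k) v ! 0) - z' ! 0 = q * (M * r ! 0 - z ! 0) + (p - q * M * k)"
      using i(3) len n v(2) by (simp add: z'_def algebra_simps)
    have h1: "0 \<le> q * M * (lin 1 r (- k) v ! 0) - z' ! 0"
      unfolding hd using i(7) fr ls(1) by simp
    have h2: "q * M * (lin 1 r (- k) v ! 0) - z' ! 0 \<le> int (Suc t) * (q * M)"
    proof -
      have "q * (M * r ! 0 - z ! 0) \<le> q * (int t * M)" using i(8) ls(1) by (intro mult_left_mono) auto
      then show ?thesis unfolding hd using fr by (simp add: algebra_simps)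
    qed
    have sub: "tight z \<subseteq> tight z'" using v(3) by (auto simp: tight_def dz')
    obtain x' where "x' \<in> H" "dot x' v \<noteq> 0" "dot x' z' = 0" using ls(6) by (auto simp: dot_uminus z'_def)
    then have "chain (Suc t) z'"
      using v(3) by (intro chain_Suc[OF i(9) len(3) _ sub]) (auto simp: tight_def)
    then have "peel_inv a (Suc t) s'"
      using i qM ls(5) k0 v(1) tlv comb'[of _ k] len h1 h2 nonneg unfolding s' peel_inv_def by (simp add: z'_def)
    moreover have "q * M \<le> 16 * E1 * M" using ls(2) i(1) by (intro mult_right_mono) auto
    ultimately show ?thesis using z'b kb r'[of _ k] k0 by (simp add: s')
  qed
qed

lemma peel_inv_mono: "peel_inv a t (True, s) \<Longrightarrow> peel_inv a (Suc t) (True, s)"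
  by (auto simp: peel_inv_def)

lemma peel_step:
  assumes "peel_inv a t s"
  shows "peel_inv a (Suc t) (peel_step mem sep I m s)"
proof (cases "fst s")
  case True
  then show ?thesis using assms peel_inv_mono[of a t "snd s"] by (cases s) (auto simp: peel_step_def)
next
  case False
  obtain M z r ps where s: "s = (False, M, z, r, ps)" using False by (cases s) auto
  have z: "z \<in> K" using assms by (simp add: s peel_inv_def)
  show ?thesis
    using peel[OF assms[unfolded s] vertex_near[OF z]] by (simp add: s peel_step_def)
qed

lemma peel_partial:
  assumes a: "a \<in> K"
  shows "peel_inv a (length (js :: nat list)) (fold (\<lambda>_ s. peel_step mem sep I m s) js (False, 1, a, a, []))"
proof (induction js rule: rev_induct)
  case Nil
  then show ?case using a K_dest(1)[OF a] by (simp add: peel_inv_def chain_0 comb_def)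
next
  case (snoc x js)
  then show ?case using peel_step by simp
qed

text \<open>A process unfinished after \<open>n + 1\<close> rounds would produce a chain longer than
  \<open>n\<close>. Each round adds at most 1 to the height of the remainder.\<close>

lemma peel_all:
  assumes a: "a \<in> K" and r: "peel_all mem sep I m a = (d, M, z, r, ps)"
  shows "r \<in> K" "r ! 0 \<le> int (Suc n)" "\<And>i. i < n \<Longrightarrow> a ! i = r ! i + comb ps i"
    "\<And>e. e \<in> set ps \<Longrightarrow> 0 \<le> fst e \<and> 1 # snd e \<in> K"
proof -
  have inv: "peel_inv a (Suc n) (d, M, z, r, ps)"
    using peel_partial[OF a, of "next_list I"] r unfolding peel_all_def next_list by simp
  have d
  proof (rule ccontr)
    assume "\<not> d"
    then have "chain (Suc n) z" using inv by (simp add: peel_inv_def)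
    then show False using chain_le by fastforce
  qed
  then show "r \<in> K" "r ! 0 \<le> int (Suc n)" "\<And>i. i < n \<Longrightarrow> a ! i = r ! i + comb ps i"
    "\<And>e. e \<in> set ps \<Longrightarrow> 0 \<le> fst e \<and> 1 # snd e \<in> K"
    using inv by (auto simp: peel_inv_def)
qed

section \<open>Bisection for a multiple in the cone\<close>

lemma small_multiple:
  assumes a: "Suc (length a) = n" and k: "k # a \<in> K"
  shows "\<exists>k. k # a \<in> K \<and> k \<le> m * asum a + 1"
proof -
  have k0: "0 < k" using k by (simp add: K_def)
  \<comment> \<open>For the least multiple \<open>i > 1\<close> some row excludes
    \<open>i - 1\<close> but not \<open>i\<close>. Its first coefficient is then at least 1, while
    the rest contributes at most \<open>m * asum a\<close> in absolute value, which bounds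
    \<open>i\<close>.\<close>
  have "\<exists>i. int i # a \<in> K" using k k0 by (intro exI[of _ "nat k"]) simp
  then obtain i where i: "int i # a \<in> K" "\<And>j. j < i \<Longrightarrow> int j # a \<notin> K"
    using exists_least_iff[of "\<lambda>i. int i # a \<in> K"] by blast
  have i0: "0 < i" using i(1) by (simp add: K_def)
  have ma: "0 \<le> m * asum a" using m asum_nonneg[of a] by simp
  show ?thesis
  proof (cases "i = 1")
    case True
    then show ?thesis using i(1) ma by (intro exI[of _ 1]) auto
  next
    case False
    then have "int (i - 1) # a \<notin> K" "0 < int (i - 1)" using i(2)[of "i - 1"] i0 by auto
    then obtain r where r: "r \<in> H" "dot r (int (i - 1) # a) < 0" using a by (auto simp: K_def not_le)
    obtain r0 rt where rr: "r = r0 # rt" using H(1)[OF r(1)] n by (cases r) auto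
    have "0 \<le> dot r (int i # a)" using K_dest(3)[OF i(1) r(1)] .
    then have 1: "0 \<le> r0 * int i + dot rt a" "r0 * (int i - 1) + dot rt a < 0"
      using r(2) i0 by (simp_all add: rr of_nat_diff)
    then have r0: "1 \<le> r0" by (simp add: algebra_simps)
    have "\<bar>dot rt a\<bar> \<le> m * asum a"
      using H[OF r(1)] a by (intro abs_dot_le[of _ "length a"]) (force simp: rr)+
    moreover have "1 * (int i - 1) \<le> r0 * (int i - 1)" using r0 i0 by (intro mult_right_mono) auto
    ultimately have "int i - 1 \<le> r0 * (int i - 1)" "- dot rt a \<le> m * asum a" using abs_le_D2 by auto
    then have "int i - 1 + dot rt a < 0" "int i - 1 \<le> - dot rt a" using 1(2) by auto
    then have "int i \<le> m * asum a + 1" using \<open>- dot rt a \<le> m * asum a\<close> by (simp only: field_simps)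
    then show ?thesis using i(1) by blast
  qed
qed

definition find_inv :: "int list \<Rightarrow> nat \<Rightarrow> int \<times> int \<times> int \<Rightarrow> bool" where
  "find_inv a t s \<longleftrightarrow> (case s of (lo, hi, k) \<Rightarrow> 1 \<le> lo \<and> lo \<le> m * asum a + 2 \<and> hi \<le> m * asum a + 1 \<and> 0 \<le> hi \<and>
    (k \<noteq> 0 \<longrightarrow> k # a \<in> K \<and> k \<le> m * asum a + 1) \<and>
    (k = 0 \<longrightarrow> (\<forall>j. j # a \<in> K \<longrightarrow> j \<le> m * asum a + 1 \<longrightarrow> lo \<le> j \<and> j \<le> hi) \<and>
      (hi < lo \<or> (hi - lo + 1) * 2 ^ t \<le> m * asum a + 1)))"

lemma find_step:
  assumes a: "Suc (length a) = n" and inv: "find_inv a t s"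
  shows "find_inv a (Suc t) (find_step mem sep a s)"
proof -
  obtain lo hi k where s: "s = (lo, hi, k)" by (cases s) auto
  show ?thesis
  proof (cases "k \<noteq> 0 \<or> hi < lo")
    case True
    then show ?thesis using inv by (auto simp: s find_step_def find_inv_def)
  next
    case False
    define j where "j = (lo + hi) div 2"
    have i: "1 \<le> lo" "lo \<le> m * asum a + 2" "hi \<le> m * asum a + 1" "\<And>j. j # a \<in> K \<Longrightarrow> j \<le> m * asum a + 1 \<Longrightarrow> lo \<le> j \<and> j \<le> hi"
      "(hi - lo + 1) * 2 ^ t \<le> m * asum a + 1"
      using inv False by (auto simp: s find_inv_def)
    have j: "lo \<le> j" "j \<le> hi" "2 * j \<le> lo + hi" "lo + hi \<le> 2 * j + 1"
      using False unfolding j_def by linarith+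
    have mem_j: "mem (j # a) \<longleftrightarrow> j # a \<in> K" using a i j by (intro mem) auto
    define c where "c = nth_default 0 (sep (j # a)) 0"
    have step: "find_step mem sep a s = (if mem (j # a) then (lo, hi, j) else
      if 0 < c then (j + 1, hi, 0) else if c < 0 then (lo, j - 1, 0) else (lo, lo - 1, 0))"
      using False by (simp add: s find_step_def j_def c_def Let_def)
    have half: "d * 2 ^ Suc t \<le> m * asum a + 1" if "2 * d \<le> hi - lo + 1" for d
    proof -
      have "(2 * d) * 2 ^ t \<le> (hi - lo + 1) * 2 ^ t" using that by (intro mult_right_mono) auto
      then show ?thesis using i(5) by (simp add: algebra_simps)
    qed
    show ?thesis
    proof (cases "j # a \<in> K")
      case True
      then show ?thesis using i j by (simp add: step mem_j find_inv_def)
    next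
      case nK: False
      have h: "length (sep (j # a)) = n" "dot (sep (j # a)) (j # a) \<le> 0" "\<And>y. y \<in> K \<Longrightarrow> 0 < dot (sep (j # a)) y"
        using sep[of "j # a"] nK a i j by auto
      obtain c' hh where hh: "sep (j # a) = c' # hh" using h(1) n by (cases "sep (j # a)") auto
      then have c: "c' = c" by (simp add: c_def)
      \<comment> \<open>The functional is positive at \<open>j' # a\<close> and not positive at
        \<open>j # a\<close>; the difference of the two values is
        \<open>(j' - j) * c\<close>.\<close>
      have dir: "0 < (j' - j) * c" if "j' # a \<in> K" for j'
        using h(3)[OF that] h(2) by (simp add: hh c algebra_simps)
      consider "0 < c" | "c < 0" | "c = 0" by linarith
      then show ?thesis
      proof cases
        case 1
        then have "j < j'" if "j' # a \<in> K" for j' using dir[OF that] by (simp add: zero_less_mult_iff)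
        then have "\<forall>j'. j' # a \<in> K \<longrightarrow> j' \<le> m * asum a + 1 \<longrightarrow> j + 1 \<le> j' \<and> j' \<le> hi" using i(4) by fastforce
        then show ?thesis using 1 nK i j half[of "hi - (j + 1) + 1"] by (simp add: step mem_j find_inv_def)
      next
        case 2
        then have "j' < j" if "j' # a \<in> K" for j' using dir[OF that] by (simp add: zero_less_mult_iff)
        then have "\<forall>j'. j' # a \<in> K \<longrightarrow> j' \<le> m * asum a + 1 \<longrightarrow> lo \<le> j' \<and> j' \<le> j - 1" using i(4) by fastforce
        then show ?thesis using 2 nK i j half[of "j - 1 - lo + 1"] by (simp add: step mem_j find_inv_def)
      next
        case 3
        then have "j' # a \<notin> K" for j' using dir[of j'] by auto
        then show ?thesis using 3 nK i by (simp add: step mem_j find_inv_def)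
      qed
    qed
  qed
qed

lemma find_partial:
  assumes a: "Suc (length a) = n"
  shows "find_inv a (length (js :: int list)) (fold (\<lambda>_ s. find_step mem sep a s) js (1, m * asum a + 1, 0))"
proof (induction js rule: rev_induct)
  case Nil
  have "0 \<le> m * asum a" using m asum_nonneg[of a] by simp
  moreover have "1 \<le> j" if "j # a \<in> K" for j using that by (simp add: K_def)
  ultimately show ?case by (simp add: find_inv_def)
next
  case (snoc x js)
  then show ?case using find_step[OF a] by simp
qed

lemma find_multiple:
  assumes a: "Suc (length a) = n"
  defines "k \<equiv> find_multiple mem sep m a"
  shows "k \<noteq> 0 \<Longrightarrow> k # a \<in> K" "k = 0 \<Longrightarrow> j # a \<notin> K" "0 \<le> k"
proof -
  let ?c = "m * asum a + 1"
  obtain lo hi where s: "fold (\<lambda>_ s. find_step mem sep a s) (0 # bits ?c) (1, ?c, 0) = (lo, hi, k)"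
    unfolding k_def find_multiple_def by (metis prod.collapse)
  have inv: "find_inv a (length (0 # bits ?c)) (lo, hi, k)"
    using find_partial[OF a, of "0 # bits ?c"] unfolding s .
  then show "k \<noteq> 0 \<Longrightarrow> k # a \<in> K" by (simp add: find_inv_def)
  then show "0 \<le> k" by (cases "k = 0") (auto simp: K_def)
  assume k0: "k = 0"
  have "hi < lo"
  proof (rule ccontr)
    assume "\<not> hi < lo"
    then have "(hi - lo + 1) * 2 ^ length (0 # bits ?c) \<le> ?c" "1 \<le> hi - lo + 1" using inv k0 by (auto simp: find_inv_def)
    moreover have "1 * 2 ^ length (0 # bits ?c) \<le> (hi - lo + 1) * 2 ^ length (0 # bits ?c)"
      using \<open>1 \<le> hi - lo + 1\<close> by (intro mult_right_mono) auto
    moreover have "?c < 2 ^ length (0 # bits ?c)"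
      using bits_length[of ?c] by (rule order.strict_trans2) simp
    ultimately show False by linarith
  qed
  show "j # a \<notin> K"
  proof
    assume "j # a \<in> K"
    from small_multiple[OF a this] obtain j' where "j' # a \<in> K" "j' \<le> ?c" by blast
    then have "lo \<le> j' \<and> j' \<le> hi" using inv k0 unfolding find_inv_def by blast
    then show False using \<open>hi < lo\<close> by simp
  qed
qed

end

subsection \<open>Running time: the face of a point\<close>

lemma esz_int_mono: "\<bar>x\<bar> \<le> \<bar>y\<bar> \<Longrightarrow> esz (x :: int) \<le> esz (y :: int)"
  using vsize_IntV_mono by (simp add: enc_int_def del: vsize.simps)

lemma esz_vec_le: "length v = n \<Longrightarrow> (\<And>i. i < n \<Longrightarrow> \<bar>v ! i\<bar> \<le> c) \<Longrightarrow> esz v \<le> 1 + n * esz (c :: int)"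
  using esz_list_le[of v "esz c"] by (force simp: in_set_conv_nth intro: esz_int_mono)

lemma esz_nat_less: "i < n \<Longrightarrow> esz (i :: nat) \<le> 1 + n"
proof -
  assume "i < n"
  then have "\<bar>int i\<bar> < 2 ^ n" using less_exp[of n] by (simp add: nat_less_real_le flip: of_nat_less_iff)
  then show ?thesis using esz_int_le[of "int i" n] by (simp add: enc_nat_def enc_int_def)
qed

lemma esz_Nil: "esz [] = 1"
  by (simp add: enc_list_def)

lemma FP_at_fst: "FP D f \<Longrightarrow> (\<And>e z. D' e z \<Longrightarrow> D e (fst z)) \<Longrightarrow> FP D' (\<lambda>e z. f e (fst z))"
  by (rule FP_comp[where g = "\<lambda>e z. fst z", OF _ FP_fst[OF FP_id]])

lemma FP_asum [fp]:
  assumes "FP D f"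
  shows "FP D (\<lambda>e x. asum (f e x))"
  unfolding asum_def by (intro fp assms)

lemma FP_next_list [fp]:
  assumes "FP D I"
  shows "FP D (\<lambda>e x. next_list (I e x))"
  unfolding next_list_def by (intro fp assms)

lemma FP_size_of [fp]:
  assumes "FP D I"
  shows "FP D (\<lambda>e x. size_of (I e x))"
  unfolding size_of_def by (intro fp assms)

lemma FP_unit_list [fp]:
  assumes "FP D I" "FP D k"
  shows "FP D (\<lambda>e x. unit_list (I e x) (k e x))"
  unfolding unit_list_def
  by (intro fp FP_at_fst[OF assms(2)] assms) simp

lemma FP_prod_const:
  assumes "FP D I" "FP D f"
  shows "FP D (\<lambda>e x. prod_list (map (\<lambda>_. f e x) (I e x)) :: int)"
  by (intro fp FP_at_fst[OF assms(2)] assms) simp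

lemma FP_kernel_bound [fp]: "FP D I \<Longrightarrow> FP D m \<Longrightarrow> FP D (\<lambda>e x. kernel_bound (I e x) (m e x))"
  unfolding kernel_bound_def by (intro FP_prod_const fp)

lemma FP_quality [fp]: "FP D I \<Longrightarrow> FP D m \<Longrightarrow> FP D (\<lambda>e x. quality (I e x) (m e x))"
  unfolding quality_def by (intro fp)

lemma FP_grid [fp]: "FP D I \<Longrightarrow> FP D m \<Longrightarrow> FP D (\<lambda>e x. grid (I e x) (m e x))"
  unfolding grid_def by (intro FP_prod_const FP_times FP_quality FP_next_list FP_const)

lemma FP_direction_bound [fp]: "FP D I \<Longrightarrow> FP D m \<Longrightarrow> FP D (\<lambda>e x. direction_bound (I e x) (m e x))"
  unfolding direction_bound_def by (intro FP_prod_const fp)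

lemma FP_zoom [fp]: "FP D I \<Longrightarrow> FP D m \<Longrightarrow> FP D (\<lambda>e x. zoom (I e x) (m e x))"
  unfolding zoom_def by (intro fp)

lemma FP_grid_fuel [fp]: "FP D I \<Longrightarrow> FP D m \<Longrightarrow> FP D (\<lambda>e x. grid_fuel (I e x) (m e x))"
  unfolding grid_fuel_def by (intro FP_iteration_list fp)

lemma FP_line_quality [fp]: "FP D I \<Longrightarrow> FP D m \<Longrightarrow> FP D (\<lambda>e x. line_quality (I e x) (m e x))"
  unfolding line_quality_def by (intro fp)

lemma FP_line_grid [fp]: "FP D I \<Longrightarrow> FP D m \<Longrightarrow> FP D (\<lambda>e x. line_grid (I e x) (m e x))"
  unfolding line_grid_def by (intro fp)

lemma FP_line_fuel [fp]: "FP D I \<Longrightarrow> FP D m \<Longrightarrow> FP D (\<lambda>e x. line_fuel (I e x) (m e x))"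
  unfolding line_fuel_def by (intro FP_iteration_list fp)

lemma FP_last_index:
  assumes I: "FP D I" and P: "FP (\<lambda>e z. D e (fst z)) (\<lambda>e z. P e (fst z) (snd z))"
  shows "FP D (\<lambda>e x. fold (\<lambda>i acc. if P e x i then (True, i) else acc) (I e x) (False, 0 :: nat))"
proof (rule FP_fold[where D' = "\<lambda>e z. D e (fst z)"
      and I = "\<lambda>e x k s. snd s = 0 \<or> snd s \<in> set (I e x)" and B = "\<lambda>e x. 10 + esz (I e x)"])
  show "pbd D (\<lambda>e x. 10 + esz (I e x))"
    by (intro pbd_add pbd_const pbd_FP I)
  show "esz s \<le> 10 + esz (I e x)" if "snd s = 0 \<or> snd s \<in> set (I e x)" for e x and s :: "bool \<times> nat"
    using that esz_prod[of "fst s" "snd s"] esz_mem[of "snd s" "I e x"]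
    by (auto simp: enc_bool_def bool_val_def enc_nat_def floorlog_small split: if_splits)
  have "FP (\<lambda>e z. D e (fst z)) (\<lambda>e z. P e (fst z) (fst (snd z)))"
    by (rule FP_comp[OF P, where g = "\<lambda>e z. (fst z, fst (snd z))", simplified]) (intro fp)
  then show "FP (\<lambda>e z. D e (fst z)) (\<lambda>e z. if P e (fst z) (fst (snd z)) then (True, fst (snd z)) else snd (snd z))"
    by (intro fp)
qed (auto intro!: fp I)

lemma FP_free_index [fp]:
  assumes "FP D I" "FP D ps"
  shows "FP D (\<lambda>e x. free_index (I e x) (ps e x))"
  unfolding free_index_def
  by (intro FP_last_index fp assms FP_filter[where F = "\<lambda>e x p. fst p = snd x" and D' = "\<lambda>_ _. True"] FP_at_fst[OF assms(2)]) auto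

lemma FP_nonzero_index [fp]:
  assumes "FP D I" "FP D p"
  shows "FP D (\<lambda>e x. nonzero_index (I e x) (p e x))"
  unfolding nonzero_index_def
  by (intro FP_last_index fp assms FP_at_fst[OF assms(2)])

lemma FP_back_step [fp]:
  assumes "FP D I" "FP D p" "FP D u"
  shows "FP D (\<lambda>e x. back_step (I e x) (p e x) (u e x))"
  unfolding back_step_def by (intro fp assms)

context cone
begin

lemma back_substitution_size:
  assumes "tri ps" "k < n" "k \<notin> fst ` set ps"
  shows "esz (fold (\<lambda>e u. back_step I e u) (take j ps) (unit_list I k)) \<le> 1 + n * esz U"
proof -
  have ps: "ps = take j ps @ drop j ps" by simp
  have "length (take j ps) \<le> n"
  proof -
    have "card (set (map fst ps)) \<le> card {..<n}" using tri_mem[OF assms(1)] by (intro card_mono) auto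
    then have "length ps \<le> n" using distinct_card[OF tri_distinct[OF assms(1)]] by simp
    then show ?thesis by simp
  qed
  then have "(nn * G) ^ length (take j ps) \<le> U" unfolding U using nG by (intro power_increasing)
  then show ?thesis
    using back_substitution_partial[of "take j ps" "drop j ps" k] assms ps by (intro esz_vec_le) fastforce+
qed

lemma eliminate_size:
  assumes "tri ps" "length h = n" "j \<le> length ps"
  defines "g \<equiv> fold (\<lambda>e g. lin (nth_default 0 (snd e) (fst e)) g (- nth_default 0 g (fst e)) (snd e)) (take j (rev ps)) h"
  shows "length g = n \<and> (\<forall>i<n. \<bar>g ! i\<bar> \<le> (2 * G) ^ j * asum h)"
  using assms(3) unfolding g_def
proof (induction j)
  case 0
  then show ?case using assms(2) abs_nth_le_asum[of _ h] by simp
next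
  case (Suc j)
  define e where "e = rev ps ! j"
  define g where "g = fold (\<lambda>e g. lin (nth_default 0 (snd e) (fst e)) g (- nth_default 0 g (fst e)) (snd e)) (take j (rev ps)) h"
  have g: "length g = n" "\<And>i. i < n \<Longrightarrow> \<bar>g ! i\<bar> \<le> (2 * G) ^ j * asum h" using Suc by (auto simp: g_def)
  have "e \<in> set ps" using Suc.prems by (metis Suc_le_lessD e_def length_rev nth_mem set_rev)
  then have e: "length (snd e) = n" "fst e < n" "\<And>i. i < n \<Longrightarrow> \<bar>snd e ! i\<bar> \<le> G" using tri_mem[OF assms(1)] by auto
  have "\<bar>lin (snd e ! fst e) g (- g ! fst e) (snd e) ! i\<bar> \<le> (2 * G) ^ Suc j * asum h" if i: "i < n" for i
  proof -
    have "\<bar>lin (snd e ! fst e) g (- g ! fst e) (snd e) ! i\<bar> \<le> \<bar>snd e ! fst e\<bar> * \<bar>g ! i\<bar> + \<bar>g ! fst e\<bar> * \<bar>snd e ! i\<bar>"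
      using i e g abs_triangle_ineq[of "snd e ! fst e * g ! i" "- g ! fst e * snd e ! i"] by (simp add: abs_mult)
    also have "\<dots> \<le> G * ((2 * G) ^ j * asum h) + ((2 * G) ^ j * asum h) * G"
      using e g i G_ge_1 asum_nonneg[of h] by (intro add_mono mult_mono) auto
    finally show ?thesis by (simp add: algebra_simps)
  qed
  then show ?case
    using Suc.prems e g nth_default_nth[of "fst e" "snd e" 0] nth_default_nth[of "fst e" g 0]
    by (simp add: take_Suc_conv_app_nth g_def[symmetric] e_def[symmetric])
qed

end

context cone_oracle
begin

lemma tri_size: "tri ps \<Longrightarrow> esz ps \<le> 1 + n * (3 + n + n * esz G)"
proof -
  assume tri: "tri ps"
  have "esz e \<le> 3 + n + n * esz G" if "e \<in> set ps" for e
  proof -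
    have "esz (fst e) \<le> 1 + n" using tri_mem[OF tri that] by (intro esz_nat_less) simp
    moreover have "esz (snd e) \<le> 1 + n * esz G" using tri_mem[OF tri that] by (intro esz_vec_le) blast+
    ultimately show ?thesis using esz_prod[of "fst e" "snd e"] by simp
  qed
  then have "esz ps \<le> 1 + length ps * (3 + n + n * esz G)" by (rule esz_list_le)
  also have "\<dots> \<le> 1 + n * (3 + n + n * esz G)" using tri_length[OF tri] by (intro add_left_mono mult_right_mono) auto
  finally show ?thesis .
qed

lemma face_size: "face_inv z s \<Longrightarrow> esz s \<le> 5 + n * (3 + n + n * esz G) + n * esz U"
proof -
  assume inv: "face_inv z s"
  have "esz (snd s) \<le> 1 + n * esz U"
  proof (cases "snd s = []")
    case False
    then show ?thesis using inv L_dest(1)[of "snd s" z] unfolding face_inv_def by (intro esz_vec_le) blast+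
  qed (simp add: esz_Nil)
  then show ?thesis using tri_size[of "fst s"] inv esz_prod[of "fst s" "snd s"] by (auto simp: face_inv_def)
qed

lemma face_query:
  assumes z: "z \<in> K" and inv: "face_inv z s" and free: "fst (free_index I (fst s))"
  defines "k \<equiv> snd (free_index I (fst s))"
  defines "u \<equiv> back_substitution I (fst s) k"
  shows "tri (fst s)" "k < n" "k \<notin> fst ` set (fst s)" "length (lin T z t u) = n" "0 < lin T z t u ! 0"
    "\<not> mem (lin T z t u) \<Longrightarrow> length (sep (lin T z t u)) = n"
proof -
  show tri: "tri (fst s)" using inv by (simp add: face_inv_def)
  show k: "k < n" "k \<notin> fst ` set (fst s)" using free_index_cases(1)[of "fst s"] free by (auto simp: k_def)
  note u = back_substitution[OF tri this, folded u_def]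
  have "dot (unit_list I 0) u = 0" using u(3) inv by (auto simp: orth_def face_inv_def)
  then have "u ! 0 = 0" using dot_unit_list[of u n 0] u(1) n by (simp add: dot_commute)
  then show x: "length (lin T z t u) = n" "0 < lin T z t u ! 0" using K_dest[OF z] u(1) n T_ge_1 by auto
  show "\<not> mem (lin T z t u) \<Longrightarrow> length (sep (lin T z t u)) = n" using sep[OF x] mem[OF x] by simp
qed

end

text \<open>One cone per environment. The oracles are required to be polynomial only on admissible
  queries, for separation only outside the cone.\<close>

locale oracle_family =
  fixes V :: "env \<Rightarrow> bool" and nv :: "env \<Rightarrow> nat" and mv :: "env \<Rightarrow> int" and Hv :: "env \<Rightarrow> int list set"
    and memv :: "env \<Rightarrow> int list \<Rightarrow> bool" and sepv :: "env \<Rightarrow> int list \<Rightarrow> int list"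
  assumes V: "V e \<Longrightarrow> cone_oracle (nv e) (mv e) (Hv e) (memv e) (sepv e)"
    and FP_mem_z: "FP (\<lambda>e z. V e \<and> length z = nv e \<and> 0 < z ! 0) memv"
    and FP_sep_z: "FP (\<lambda>e z. V e \<and> length z = nv e \<and> 0 < z ! 0 \<and> \<not> memv e z) sepv"
begin

lemma FP_mem: "FP D z \<Longrightarrow> (\<And>e x. D e x \<Longrightarrow> V e \<and> length (z e x) = nv e \<and> 0 < z e x ! 0) \<Longrightarrow> FP D (\<lambda>e x. memv e (z e x))"
  by (rule FP_comp[OF FP_mem_z])

lemma FP_sep: "FP D z \<Longrightarrow> (\<And>e x. D e x \<Longrightarrow> V e \<and> length (z e x) = nv e \<and> 0 < z e x ! 0 \<and> \<not> memv e (z e x)) \<Longrightarrow>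
    FP D (\<lambda>e x. sepv e (z e x))"
  by (rule FP_comp[OF FP_sep_z])

lemma V_cone: "V e \<Longrightarrow> cone (nv e) (mv e) (Hv e)"
  using V by (simp add: cone_oracle_def)

text \<open>The numbers \<open>nv e\<close> and \<open>mv e\<close> belong to the environment, which
  programs cannot read. Programs work with computed data \<open>I\<close> and \<open>m\<close>, and
  this predicate ties the two together.\<close>

definition param :: "(env \<Rightarrow> 'a :: enc \<Rightarrow> bool) \<Rightarrow> (env \<Rightarrow> 'a \<Rightarrow> nat list) \<Rightarrow> (env \<Rightarrow> 'a \<Rightarrow> int) \<Rightarrow> bool" where
  "param D I m \<longleftrightarrow> FP D I \<and> FP D m \<and> (\<forall>e x. D e x \<longrightarrow> V e \<and> I e x = [0..<nv e] \<and> m e x = mv e)"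

lemma paramD:
  assumes "param D I m"
  shows "FP D I" "FP D m" "D e x \<Longrightarrow> V e" "D e x \<Longrightarrow> I e x = [0..<nv e]" "D e x \<Longrightarrow> m e x = mv e"
  using assms by (auto simp: param_def)

lemma param_fst: "param D I m \<Longrightarrow> (\<And>e z. D' e z \<Longrightarrow> D e (fst z)) \<Longrightarrow> param D' (\<lambda>e z. I e (fst z)) (\<lambda>e z. m e (fst z))"
  unfolding param_def using FP_at_fst[of D I D'] FP_at_fst[of D m D'] by blast

lemma param_weaken: "param D I m \<Longrightarrow> (\<And>e z. D' e z \<Longrightarrow> D e z) \<Longrightarrow> param D' I m"
  unfolding param_def by (intro conjI FP_weaken[of D I D'] FP_weaken[of D m D']) auto

lemma nv_le_esz: "param D I m \<Longrightarrow> D e x \<Longrightarrow> nv e \<le> esz (I e x)"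
  using length_le_esz[of "I e x"] paramD(4)[of D I m e x] by simp

lemma FP_back_substitution:
  assumes p: "param D I m" and ps: "FP D ps" and k: "FP D k"
    and D: "\<And>e x. D e x \<Longrightarrow> cone.tri (nv e) (mv e) (ps e x) \<and> k e x < nv e \<and> k e x \<notin> fst ` set (ps e x)"
  shows "FP D (\<lambda>e x. back_substitution (I e x) (ps e x) (k e x))"
  unfolding back_substitution_def
proof (rule FP_fold[where D' = "\<lambda>e z. D e (fst z)"
      and I = "\<lambda>e x j s. s = fold (\<lambda>q u. back_step (I e x) q u) (take j (ps e x)) (unit_list (I e x) (k e x))"
      and B = "\<lambda>e x. 1 + esz (I e x) * esz (direction_bound (I e x) (m e x))"])
  show "FP (\<lambda>e z. D e (fst z)) (\<lambda>e z. back_step (I e (fst z)) (fst (snd z)) (snd (snd z)))"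
    by (intro fp FP_at_fst[OF paramD(1)[OF p]])
  show "pbd D (\<lambda>e x. 1 + esz (I e x) * esz (direction_bound (I e x) (m e x)))"
    by (intro fp paramD[OF p])
  fix e x j s
  assume x: "D e x" and s: "s = fold (\<lambda>q u. back_step (I e x) q u) (take j (ps e x)) (unit_list (I e x) (k e x))"
  have "esz s \<le> 1 + nv e * esz (direction_bound (I e x) (m e x))"
    using cone.back_substitution_size[OF V_cone[OF paramD(3)[OF p x]]] D[OF x] paramD(4,5)[OF p x] s by simp
  also have "\<dots> \<le> 1 + esz (I e x) * esz (direction_bound (I e x) (m e x))"
    using nv_le_esz[OF p x] by (intro add_left_mono mult_right_mono) auto
  finally show "esz s \<le> 1 + esz (I e x) * esz (direction_bound (I e x) (m e x))" .
qed (auto intro!: fp ps k paramD[OF p] simp: take_Suc_conv_app_nth)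

lemma FP_eliminate:
  assumes p: "param D I m" and ps: "FP D ps" and h: "FP D h"
    and D: "\<And>e x. D e x \<Longrightarrow> cone.tri (nv e) (mv e) (ps e x) \<and> length (h e x) = nv e"
  shows "FP D (\<lambda>e x. eliminate (ps e x) (h e x))"
  unfolding eliminate_def
proof (rule FP_fold[where D' = "\<lambda>e z. D e (fst z)"
      and I = "\<lambda>e x j s. s = fold (\<lambda>q g. lin (nth_default 0 (snd q) (fst q)) g (- nth_default 0 g (fst q)) (snd q)) (take j (rev (ps e x))) (h e x)"
      and B = "\<lambda>e x. 1 + esz (I e x) * esz (prod_list (map (\<lambda>_. 2 * grid (I e x) (m e x)) (I e x)) * asum (h e x))"])
  show "FP (\<lambda>e z. D e (fst z)) (\<lambda>e (z :: 'a \<times> (nat \<times> int list) \<times> int list). lin (nth_default 0 (snd (fst (snd z))) (fst (fst (snd z)))) (snd (snd z))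
      (- nth_default 0 (snd (snd z)) (fst (fst (snd z)))) (snd (fst (snd z))))"
    by (intro fp)
  show "pbd D (\<lambda>e x. 1 + esz (I e x) * esz (prod_list (map (\<lambda>_. 2 * grid (I e x) (m e x)) (I e x)) * asum (h e x)))"
    by (intro pbd_add pbd_mult pbd_const pbd_FP FP_times FP_prod_const FP_grid FP_const FP_asum h paramD[OF p])
  fix e x j s
  assume x: "D e x" and j: "j \<le> length (rev (ps e x))"
    and s: "s = fold (\<lambda>q g. lin (nth_default 0 (snd q) (fst q)) g (- nth_default 0 g (fst q)) (snd q)) (take j (rev (ps e x))) (h e x)"
  interpret cone_oracle "nv e" "mv e" "Hv e" "memv e" "sepv e" by (rule V[OF paramD(3)[OF p x]])
  have tri: "tri (ps e x)" and len: "length (h e x) = nv e" using D[OF x] by auto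
  let ?c = "prod_list (map (\<lambda>_. 2 * grid (I e x) (m e x)) (I e x)) * asum (h e x)"
  have "j \<le> nv e" using j tri_length[OF tri] by simp
  then have "(2 * G) ^ j \<le> (2 * G) ^ nv e" using G_ge_1 by (intro power_increasing) auto
  then have "(2 * G) ^ j * asum (h e x) \<le> ?c"
    using asum_nonneg[of "h e x"] by (simp add: prod_list_const paramD(4,5)[OF p x] mult_right_mono)
  then have "esz s \<le> 1 + nv e * esz ?c"
    using eliminate_size[OF tri len, of j] j s by (intro esz_vec_le) force+
  also have "\<dots> \<le> 1 + esz (I e x) * esz ?c"
    using nv_le_esz[OF p x] by (intro add_left_mono mult_right_mono) auto
  finally show "esz s \<le> 1 + esz (I e x) * esz ?c" .
qed (auto intro!: fp ps h paramD[OF p] simp: take_Suc_conv_app_nth)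

lemma FP_new_equation:
  assumes p: "param D I m" and ps: "FP D ps" and h: "FP D h"
    and D: "\<And>e x. D e x \<Longrightarrow> cone.tri (nv e) (mv e) (ps e x) \<and> length (h e x) = nv e"
  shows "FP D (\<lambda>e x. new_equation (I e x) (m e x) (ps e x) (h e x))"
  unfolding new_equation_def
proof (rule FP_Let, rule FP_eliminate[OF p ps h D], assumption)
  let ?D = "\<lambda>e z. D e (fst z) \<and> snd z = eliminate (ps e (fst z)) (h e (fst z))"
  have p': "param ?D (\<lambda>e z. I e (fst z)) (\<lambda>e z. m e (fst z))" by (rule param_fst[OF p]) simp
  note P = paramD[OF p']
  have b: "FP ?D (\<lambda>e z. map (\<lambda>y. (grid (I e (fst z)) (m e (fst z)) * y) div asum (snd z)) (snd z))"
    by (intro fp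
        FP_at_fst[where f = "\<lambda>e z. I e (fst z)", OF P(1)] FP_at_fst[where f = "\<lambda>e z. m e (fst z)", OF P(2)]) auto
  have d: "FP ?D (\<lambda>e z. dioph (I e (fst z)) (next_list (I e (fst z))) (grid_fuel (I e (fst z)) (m e (fst z))) (grid (I e (fst z)) (m e (fst z)))
     (map (\<lambda>y. (grid (I e (fst z)) (m e (fst z)) * y) div asum (snd z)) (snd z)))"
  proof (intro FP_dioph b fp P(1,2))
    fix e z assume z: "?D e z"
    interpret cone_oracle "nv e" "mv e" "Hv e" "memv e" "sepv e" by (rule V[OF P(3)[OF z]])
    show "\<exists>n>0. I e (fst z) = [0..<n] \<and> next_list (I e (fst z)) = [0..<Suc n] \<and> 0 < grid (I e (fst z)) (m e (fst z)) \<and>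
        length (map (\<lambda>y. (grid (I e (fst z)) (m e (fst z)) * y) div asum (snd z)) (snd z)) = n"
      using z n G_ge_1 next_list P(4,5)[OF z] eliminate[of "ps e (fst z)" "h e (fst z)"] D[of e "fst z"]
      by (intro exI[of _ "nv e"]) (simp del: upt_Suc)
  qed
  show "FP ?D (\<lambda>e z. let c = asum (snd z); q = snd (dioph (I e (fst z)) (next_list (I e (fst z))) (grid_fuel (I e (fst z)) (m e (fst z)))
      (grid (I e (fst z)) (m e (fst z))) (map (\<lambda>y. (grid (I e (fst z)) (m e (fst z)) * y) div c) (snd z))) in
      (snd (nonzero_index (I e (fst z)) q), q))"
    unfolding Let_def by (intro fp d P(1))
qed

text \<open>Every query must be admissible: positive height for membership, and a preceding negative
  answer for separation. The fact collection \<open>facts\<close> derives this from the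
  invariant.\<close>

lemma FP_face_step:
  assumes p: "param D I m" and z: "FP D z" and s: "FP D s"
    and D: "\<And>e x. D e x \<Longrightarrow> z e x \<in> cone.K (nv e) (Hv e) \<and> cone_oracle.face_inv (nv e) (mv e) (Hv e) (z e x) (s e x)"
  shows "FP D (\<lambda>e x. face_step (memv e) (sepv e) (I e x) (m e x) (z e x) (s e x))"
  unfolding face_step_def
proof (rule FP_If)
  note P = paramD[OF p]
  show "FP D (\<lambda>e x. snd (s e x) \<noteq> [] \<or> \<not> fst (free_index (I e x) (fst (s e x))))"
    by (intro fp s P)
  show "FP (\<lambda>e x. D e x \<and> (snd (s e x) \<noteq> [] \<or> \<not> fst (free_index (I e x) (fst (s e x))))) s"
    by (rule FP_weaken[OF s]) simp
  let ?D = "\<lambda>e x. D e x \<and> \<not> (snd (s e x) \<noteq> [] \<or> \<not> fst (free_index (I e x) (fst (s e x))))"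
  have p': "param ?D I m" by (rule param_weaken[OF p]) simp
  have z': "FP ?D z" and s': "FP ?D s" by (rule FP_weaken[OF z], simp, rule FP_weaken[OF s], simp)
  let ?u = "\<lambda>e x. back_substitution (I e x) (fst (s e x)) (snd (free_index (I e x) (fst (s e x))))"
  let ?x = "\<lambda>t e x. lin (zoom (I e x) (m e x)) (z e x) t (?u e x)"
  have facts: "cone.tri (nv e) (mv e) (fst (s e x)) \<and> snd (free_index (I e x) (fst (s e x))) < nv e \<and>
      snd (free_index (I e x) (fst (s e x))) \<notin> fst ` set (fst (s e x)) \<and> V e \<and> length (?x t e x) = nv e \<and> 0 < ?x t e x ! 0 \<and>
      (\<not> memv e (?x t e x) \<longrightarrow> length (sepv e (?x t e x)) = nv e)" if x: "?D e x" for e x t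
  proof -
    have x': "D e x" "fst (free_index [0..<nv e] (fst (s e x)))" using x P(4) by auto
    note * = cone_oracle.face_query[OF V[OF P(3)[OF x'(1)]] conjunct1[OF D[OF x'(1)]] conjunct2[OF D[OF x'(1)]] x'(2)]
    show ?thesis unfolding P(4,5)[OF x'(1)] using * P(3)[OF x'(1)] by blast
  qed
  have u: "FP ?D ?u"
    by (intro FP_back_substitution[OF p'] fp s' paramD(1)[OF p']) (use facts in blast)
  have x: "FP ?D (?x t)" for t
    by (intro fp z' u paramD(1,2)[OF p'])
  have mem: "FP ?D (\<lambda>e y. memv e (?x t e y))" for t
    by (intro FP_mem x) (use facts in blast)
  have new: "FP (\<lambda>e y. ?D e y \<and> \<not> memv e (?x t e y)) (\<lambda>e y. new_equation (I e y) (m e y) (fst (s e y)) (sepv e (?x t e y)))" for t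
  proof (rule FP_new_equation)
    show "param (\<lambda>e y. ?D e y \<and> \<not> memv e (?x t e y)) I m" by (rule param_weaken[OF p]) simp
    show "FP (\<lambda>e y. ?D e y \<and> \<not> memv e (?x t e y)) (\<lambda>e x. fst (s e x))" by (rule FP_weaken[OF FP_fst[OF s']]) simp
    show "FP (\<lambda>e y. ?D e y \<and> \<not> memv e (?x t e y)) (\<lambda>e y. sepv e (?x t e y))"
      by (rule FP_sep, rule FP_weaken[OF x], simp) (use facts in blast)
  qed (use facts in blast)
  have "FP ?D (\<lambda>e y. if \<not> memv e (?x 1 e y) then (new_equation (I e y) (m e y) (fst (s e y)) (sepv e (?x 1 e y)) # fst (s e y), [])
      else if \<not> memv e (?x (- 1) e y) then (new_equation (I e y) (m e y) (fst (s e y)) (sepv e (?x (- 1) e y)) # fst (s e y), [])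
      else (fst (s e y), ?u e y))"
    by (intro FP_If FP_Pair FP_Cons FP_const FP_fst FP_not FP_weaken[OF mem] FP_weaken[OF new] FP_weaken[OF s] FP_weaken[OF u]) auto
  then show "FP ?D (\<lambda>e x. let u = ?u e x in
      if \<not> memv e (lin (zoom (I e x) (m e x)) (z e x) 1 u) then (new_equation (I e x) (m e x) (fst (s e x)) (sepv e (lin (zoom (I e x) (m e x)) (z e x) 1 u)) # fst (s e x), [])
      else if \<not> memv e (lin (zoom (I e x) (m e x)) (z e x) (- 1) u) then (new_equation (I e x) (m e x) (fst (s e x)) (sepv e (lin (zoom (I e x) (m e x)) (z e x) (- 1) u)) # fst (s e x), [])
      else (fst (s e x), u))"
    unfolding Let_def .
qed

lemma FP_face:
  assumes p: "param D I m" and z: "FP D z" and D: "\<And>e x. D e x \<Longrightarrow> z e x \<in> cone.K (nv e) (Hv e)"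
  shows "FP D (\<lambda>e x. face (memv e) (sepv e) (I e x) (m e x) (z e x))"
  unfolding face_def
proof (rule FP_snd, rule FP_fold[where D' = "\<lambda>e y. D e (fst y) \<and> cone_oracle.face_inv (nv e) (mv e) (Hv e) (z e (fst y)) (snd (snd y))"
      and I = "\<lambda>e x j s. cone_oracle.face_inv (nv e) (mv e) (Hv e) (z e x) s"
      and B = "\<lambda>e x. 5 + esz (I e x) * (3 + esz (I e x) + esz (I e x) * esz (grid (I e x) (m e x))) + esz (I e x) * esz (direction_bound (I e x) (m e x))"])
  let ?D = "\<lambda>e y. D e (fst y) \<and> cone_oracle.face_inv (nv e) (mv e) (Hv e) (z e (fst y)) (snd (snd y))"
  show "FP ?D (\<lambda>e (y :: 'a \<times> nat \<times> ((nat \<times> int list) list \<times> int list)). face_step (memv e) (sepv e) (I e (fst y)) (m e (fst y)) (z e (fst y)) (snd (snd y)))"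
    by (intro FP_face_step param_fst[OF p] FP_at_fst[OF z] fp) (auto simp: D)
  show "FP D I" by (rule paramD[OF p])
  show "FP D (\<lambda>e x. ([(0, unit_list (I e x) 0)], []))" by (intro fp paramD[OF p])
  show "pbd D (\<lambda>e x. 5 + esz (I e x) * (3 + esz (I e x) + esz (I e x) * esz (grid (I e x) (m e x))) + esz (I e x) * esz (direction_bound (I e x) (m e x)))"
    by (intro fp paramD[OF p])
  fix e x assume x: "D e x"
  note P = paramD(3-5)[OF p x]
  interpret cone_oracle "nv e" "mv e" "Hv e" "memv e" "sepv e" by (rule V[OF P(1)])
  show "face_inv (z e x) ([(0, unit_list (I e x) 0)], [])" using face_inv_init P by simp
  fix j s assume s: "face_inv (z e x) s"
  show "face_inv (z e x) (face_step (memv e) (sepv e) (I e x) (m e x) (z e x) s)"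
    using face_step(1)[OF D[OF x] s] P by simp
  show "?D e (x, (I e x ! j, s))" using x s by simp
  have "esz s \<le> 5 + nv e * (3 + nv e + nv e * esz G) + nv e * esz U" by (rule face_size[OF s])
  also have "\<dots> \<le> 5 + esz (I e x) * (3 + esz (I e x) + esz (I e x) * esz G) + esz (I e x) * esz U"
    using nv_le_esz[OF p x] by (intro add_mono mult_mono) auto
  finally show "esz s \<le> 5 + esz (I e x) * (3 + esz (I e x) + esz (I e x) * esz (grid (I e x) (m e x))) + esz (I e x) * esz (direction_bound (I e x) (m e x))"
    using P by simp
qed

end

subsection \<open>Running time: line search, walk and decomposition\<close>

text \<open>The factor by which \<open>asum z + 1\<close> may grow in one step of a walk. It has
  polynomial length, and so has its power over all \<open>n + 1\<close> steps.\<close>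

definition walk_growth :: "nat list \<Rightarrow> int \<Rightarrow> int" where
  "walk_growth I m = size_of I * (16 * line_quality I m * (1 + (size_of I * m + 1) * direction_bound I m)) + 1"

text \<open>One factor that covers the growth of the scale, the point, the remainder and the
  coefficients in a round of peeling.\<close>

definition peel_growth :: "nat list \<Rightarrow> int \<Rightarrow> int" where
  "peel_growth I m = 32 * line_quality I m * (1 + kernel_bound I m) * (size_of I + 1)"

lemma FP_walk_growth [fp]: "FP D I \<Longrightarrow> FP D m \<Longrightarrow> FP D (\<lambda>e x. walk_growth (I e x) (m e x))"
  unfolding walk_growth_def by (intro fp)

lemma FP_peel_growth [fp]: "FP D I \<Longrightarrow> FP D m \<Longrightarrow> FP D (\<lambda>e x. peel_growth (I e x) (m e x))"
  unfolding peel_growth_def by (intro fp)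

lemma esz_vec_le': "length v \<le> n \<Longrightarrow> (\<And>x. x \<in> set v \<Longrightarrow> \<bar>x\<bar> \<le> c) \<Longrightarrow> esz v \<le> 1 + n * esz (c :: int)"
proof -
  assume *: "length v \<le> n" "\<And>x. x \<in> set v \<Longrightarrow> \<bar>x\<bar> \<le> c"
  have "esz v \<le> 1 + length v * esz c" using *(2) by (intro esz_list_le esz_int_mono) force
  also have "\<dots> \<le> 1 + n * esz c" using *(1) by (intro add_left_mono mult_right_mono) auto
  finally show ?thesis .
qed

lemma esz_bool_le: "esz (b :: bool) \<le> 2"
  by (simp add: enc_bool_def bool_val_def floorlog_small)

context cone_oracle
begin

text \<open>The height is affine in \<open>j\<close>, positive at 0 and nonnegative at the end of
  the interval; so every point tried by the bisection is an admissible query.\<close>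

lemma line_query:
  assumes "z \<in> K" "length u = n" "0 \<le> z ! 0 + t * u ! 0" "0 < t" "0 \<le> j" "j < t * G1"
  shows "length (lin G1 z j u) = n" "0 < lin G1 z j u ! 0"
proof -
  show "length (lin G1 z j u) = n" using assms K_dest by auto
  have z: "length z = n" "0 < z ! 0" using assms K_dest by auto
  have "0 < G1 * z ! 0 + j * u ! 0"
  proof (cases "u ! 0 < 0")
    case True
    have "0 \<le> G1 * (z ! 0 + t * u ! 0)" using assms(3) G1_ge by simp
    moreover have "(t * G1) * u ! 0 < j * u ! 0" using assms(6) True by (simp add: mult_strict_right_mono_neg)
    ultimately show ?thesis by (simp add: algebra_simps)
  next
    case False
    have "0 < G1 * z ! 0" using z G1_ge by simp
    moreover have "0 \<le> j * u ! 0" using False assms(5) by simp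
    ultimately show ?thesis by simp
  qed
  then show "0 < lin G1 z j u ! 0" using z assms(2) n by auto
qed

lemma walk_growth: "walk_growth I m = nn * (16 * E1 * (1 + (nn * m + 1) * U)) + 1"
  by (simp add: walk_growth_def size_of)

lemma peel_growth: "peel_growth I m = 32 * E1 * (1 + W) * (nn + 1)"
  by (simp add: peel_growth_def size_of)

lemma walk_growth_ge_1: "1 \<le> walk_growth I m"
proof -
  have "0 \<le> (nn * m + 1) * U" using U_ge(1) m by simp
  then have "0 \<le> 16 * E1 * (1 + (nn * m + 1) * U)" using E1_ge by simp
  then show ?thesis by (simp add: walk_growth)
qed

lemma walk_size:
  assumes z: "z \<in> K"
  shows "asum (walk_step mem sep I m z) + 1 \<le> walk_growth I m * (asum z + 1)"
proof -
  let ?z = "walk_step mem sep I m z"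
  have "asum ?z \<le> nn * (16 * E1 * (1 + (nn * m + 1) * U) * (asum z + 1))"
    using walk_step(1,5)[OF z] K_dest(1)[of ?z] by (intro asum_le) auto
  then show ?thesis using asum_nonneg[of z] by (simp add: walk_growth algebra_simps)
qed

definition peel_small :: "int \<Rightarrow> nat \<Rightarrow> peel_state \<Rightarrow> bool" where
  "peel_small c t s \<longleftrightarrow> (case s of (d, M, z, r, ps) \<Rightarrow>
    0 < c \<and> \<bar>M\<bar> \<le> c \<and> asum z + 1 \<le> c \<and> (\<forall>i<n. \<bar>r ! i\<bar> \<le> c) \<and> length ps \<le> t \<and>
    (\<forall>e\<in>set ps. \<bar>fst e\<bar> \<le> c \<and> length (snd e) \<le> n \<and> (\<forall>x\<in>set (snd e). \<bar>x\<bar> \<le> c)))"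

lemma peel_small_mono: "peel_small c t s \<Longrightarrow> c \<le> c' \<Longrightarrow> peel_small c' (Suc t) s"
  by (fastforce simp: peel_small_def)

lemma peel_growth_ge:
  "1 \<le> peel_growth I m" "1 + W \<le> peel_growth I m" "16 * E1 \<le> peel_growth I m"
  "nn * (16 * E1 * (1 + W)) + 1 \<le> peel_growth I m" "1 + 16 * E1 * W \<le> peel_growth I m"
proof -
  define p where "p = 16 * E1 * (1 + W)"
  have *: "16 * E1 \<le> p" using mult_left_mono[of 1 "1 + W" "16 * E1"] W_ge_1 E1_ge by (simp add: p_def)
  have **: "1 + W \<le> p" using mult_right_mono[of 1 "16 * E1" "1 + W"] W_ge_1 E1_ge by (simp add: p_def)
  have g: "peel_growth I m = 2 * (nn * p) + 2 * p" by (simp add: peel_growth p_def algebra_simps)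
  have p: "1 \<le> p" using * E1_ge by simp
  then have np: "0 \<le> nn * p" by simp
  show "1 \<le> peel_growth I m" "1 + W \<le> peel_growth I m" "16 * E1 \<le> peel_growth I m" using * ** p np unfolding g by linarith+
  show "nn * (16 * E1 * (1 + W)) + 1 \<le> peel_growth I m" using p np unfolding g p_def[symmetric] by linarith
  have "p = 16 * E1 + 16 * E1 * W" by (simp add: p_def algebra_simps)
  then show "1 + 16 * E1 * W \<le> peel_growth I m" using p np E1_ge unfolding g by linarith
qed

lemma peel_small_step:
  assumes inv: "peel_inv a t s" and small: "peel_small c t s"
  shows "peel_small (peel_growth I m * c) (Suc t) (peel_step mem sep I m s)"
proof -
  obtain d M z r ps where s: "s = (d, M, z, r, ps)" by (cases s) auto
  have c: "0 < c" "\<bar>M\<bar> \<le> c" "asum z + 1 \<le> c" "\<And>i. i < n \<Longrightarrow> \<bar>r ! i\<bar> \<le> c" "length ps \<le> t"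
    "\<And>e. e \<in> set ps \<Longrightarrow> \<bar>fst e\<bar> \<le> c \<and> length (snd e) \<le> n \<and> (\<forall>x\<in>set (snd e). \<bar>x\<bar> \<le> c)"
    using small by (auto simp: peel_small_def s)
  have gc: "k * c \<le> peel_growth I m * c" if "k \<le> peel_growth I m" for k
    using that c(1) by (intro mult_right_mono) auto
  have cc: "c \<le> peel_growth I m * c" using gc[OF peel_growth_ge(1)] by simp
  show ?thesis
  proof (cases d)
    case True
    then show ?thesis using peel_small_mono[OF small cc] by (simp add: peel_step_def s)
  next
    case False
    have zM: "z \<in> K" "0 < M" "length r = n" using inv by (auto simp: peel_inv_def s)
    define v where "v = vertex_near mem sep I m z"
    note v = vertex_near[OF zM(1), folded v_def]
    obtain d' M' z' r' ps' where s': "peel mem I m v M z r ps = (d', M', z', r', ps')" using prod_cases5 by blast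
    have step: "peel_step mem sep I m s = (d', M', z', r', ps')" using False s' by (simp add: peel_step_def s v_def)
    have inv': "peel_inv a t (False, M, z, r, ps)" using inv False s by simp
    have p: "length ps' = Suc (length ps)" "M' \<le> 16 * E1 * M" "\<And>i. i < n \<Longrightarrow> \<bar>z' ! i\<bar> \<le> 16 * E1 * (1 + W) * (asum z + 1)"
      "\<And>e. e \<in> set ps' \<Longrightarrow> e \<in> set ps \<or> fst e \<le> 16 * E1 * (asum z + 1) \<and> snd e = tl v"
      "\<And>i. i < n \<Longrightarrow> \<bar>r' ! i\<bar> \<le> \<bar>r ! i\<bar> + 16 * E1 * (asum z + 1) * W"
      "peel_inv a (Suc t) (d', M', z', r', ps')"
      using peel[OF inv' v] unfolding s' by auto
    have i': "0 < M'" "z' \<in> K" "\<And>e. e \<in> set ps' \<Longrightarrow> 0 \<le> fst e" using p(6) by (auto simp: peel_inv_def)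
    have Ec: "16 * E1 * (asum z + 1) \<le> 16 * E1 * c" using c(3) E1_ge by (intro mult_left_mono) auto
    have "16 * E1 * M \<le> 16 * E1 * c" using c(2) E1_ge by (intro mult_left_mono) auto
    then have "\<bar>M'\<bar> \<le> peel_growth I m * c" using p(2) i'(1) gc[OF peel_growth_ge(3)] by linarith
    moreover have "asum z' + 1 \<le> peel_growth I m * c"
    proof -
      have "16 * E1 * (1 + W) * (asum z + 1) \<le> 16 * E1 * (1 + W) * c" using c(3) E1_ge W_ge_1 by (intro mult_left_mono) auto
      then have "asum z' \<le> nn * (16 * E1 * (1 + W) * c)"
        using p(3) K_dest(1)[OF i'(2)] by (intro asum_le) force+
      then have "asum z' + 1 \<le> (nn * (16 * E1 * (1 + W)) + 1) * c" using c(1) by (simp add: algebra_simps)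
      then show ?thesis using gc[OF peel_growth_ge(4)] by linarith
    qed
    moreover have "\<bar>r' ! i\<bar> \<le> peel_growth I m * c" if i: "i < n" for i
    proof -
      have "16 * E1 * (asum z + 1) * W \<le> 16 * E1 * c * W" using Ec W_ge_1 by (intro mult_right_mono) auto
      then have "\<bar>r' ! i\<bar> \<le> (1 + 16 * E1 * W) * c" using p(5)[OF i] c(4)[OF i] by (simp add: algebra_simps)
      then show ?thesis using gc[OF peel_growth_ge(5)] by linarith
    qed
    moreover have "\<bar>fst e\<bar> \<le> peel_growth I m * c \<and> length (snd e) \<le> n \<and> (\<forall>x\<in>set (snd e). \<bar>x\<bar> \<le> peel_growth I m * c)"
      if e: "e \<in> set ps'" for e
    proof (cases "e \<in> set ps")
      case True
      then show ?thesis using c(6)[OF True] cc by fastforce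
    next
      case False
      then have e': "fst e \<le> 16 * E1 * (asum z + 1)" "snd e = tl v" using p(4)[OF e] by auto
      have "\<bar>x\<bar> \<le> W" if "x \<in> set (tl v)" for x
        using v(4) K_dest(1)[OF v(1)] list.set_sel(2)[OF _ that] that by (metis in_set_conv_nth list.sel(2))
      moreover have "W \<le> peel_growth I m * c"
      proof -
        have "W \<le> (1 + W) * 1" by simp
        also have "\<dots> \<le> (1 + W) * c" using c(1) W_ge_1 by (intro mult_left_mono) auto
        also have "\<dots> \<le> peel_growth I m * c" by (rule gc[OF peel_growth_ge(2)])
        finally show ?thesis .
      qed
      moreover have "\<bar>fst e\<bar> \<le> peel_growth I m * c" using e'(1) i'(3)[OF e] Ec gc[OF peel_growth_ge(3)] by linarith
      ultimately show ?thesis using K_dest(1)[OF v(1)] unfolding e'(2) by fastforce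
    qed
    ultimately show ?thesis using c(1,5) cc p(1) unfolding step peel_small_def by simp
  qed
qed

lemma peel_small_size:
  assumes "peel_inv a t s" "peel_small c t s"
  shows "esz s \<le> 10 + esz c + (1 + n * esz c) + (1 + n * esz c) + (1 + t * (2 + esz c + n * esz c))"
proof -
  obtain d M z r ps where s: "s = (d, M, z, r, ps)" by (cases s) auto
  have c: "\<bar>M\<bar> \<le> c" "asum z + 1 \<le> c" "\<And>i. i < n \<Longrightarrow> \<bar>r ! i\<bar> \<le> c" "length ps \<le> t"
    "\<And>e. e \<in> set ps \<Longrightarrow> \<bar>fst e\<bar> \<le> c \<and> length (snd e) \<le> n \<and> (\<forall>x\<in>set (snd e). \<bar>x\<bar> \<le> c)"
    using assms(2) by (auto simp: peel_small_def s)
  have zr: "z \<in> K" "length r = n" using assms(1) by (auto simp: peel_inv_def s)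
  have "esz M \<le> esz c" using c(1) by (intro esz_int_mono) auto
  moreover have "esz z \<le> 1 + n * esz c"
    using abs_nth_le_asum[of _ z] K_dest(1)[OF zr(1)] c(2) by (intro esz_vec_le) fastforce+
  moreover have "esz r \<le> 1 + n * esz c" by (intro esz_vec_le zr c)
  moreover have "esz ps \<le> 1 + t * (2 + esz c + n * esz c)"
  proof -
    have "esz e \<le> 2 + esz c + n * esz c" if e: "e \<in> set ps" for e
    proof -
      have "esz (fst e) \<le> esz c" using c(5)[OF e] by (intro esz_int_mono) auto
      moreover have "esz (snd e) \<le> 1 + n * esz c" using c(5)[OF e] by (intro esz_vec_le') auto
      ultimately show ?thesis using esz_prod[of "fst e" "snd e"] by simp
    qed
    then have "esz ps \<le> 1 + length ps * (2 + esz c + n * esz c)" by (rule esz_list_le)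
    also have "\<dots> \<le> 1 + t * (2 + esz c + n * esz c)" using c(4) by (intro add_left_mono mult_right_mono) auto
    finally show ?thesis .
  qed
  moreover have "esz s = 4 + esz d + esz M + esz z + esz r + esz ps"
    unfolding s esz_prod by simp
  ultimately show ?thesis using esz_bool_le[of d] by linarith
qed

end

context oracle_family
begin

lemma K_length: "V e \<Longrightarrow> z \<in> cone.K (nv e) (Hv e) \<Longrightarrow> length z = nv e \<and> 0 < z ! 0 \<and> 1 \<le> nv e"
  using cone.K_dest(1,2)[OF V_cone] cone.n[OF V_cone] by blast

lemma FP_bisect_step:
  assumes c: "FP D c" and z: "FP D z" and u: "FP D u" and s: "FP D s"
    and D: "\<And>e x. D e x \<Longrightarrow> V e \<and> 0 \<le> fst (s e x) \<and>
      (\<forall>j. 0 \<le> j \<longrightarrow> j < snd (s e x) \<longrightarrow> length (lin (c e x) (z e x) j (u e x)) = nv e \<and> 0 < lin (c e x) (z e x) j (u e x) ! 0)"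
  shows "FP D (\<lambda>e x. bisect_step (memv e) (c e x) (z e x) (u e x) (s e x))"
  unfolding bisect_step_def
proof (rule FP_If)
  let ?D = "\<lambda>e x. D e x \<and> \<not> snd (s e x) - fst (s e x) \<le> 1"
  have s': "FP ?D s" by (rule FP_weaken[OF s]) simp
  have q: "FP ?D (\<lambda>e x. lin (c e x) (z e x) ((fst (s e x) + snd (s e x)) div 2) (u e x))"
    by (intro fp s' FP_weaken[OF c] FP_weaken[OF z] FP_weaken[OF u]) auto
  have mem: "FP ?D (\<lambda>e x. memv e (lin (c e x) (z e x) ((fst (s e x) + snd (s e x)) div 2) (u e x)))"
  proof (rule FP_mem[OF q])
    fix e x assume x: "?D e x"
    have "0 \<le> (fst (s e x) + snd (s e x)) div 2" "(fst (s e x) + snd (s e x)) div 2 < snd (s e x)"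
      using x D[of e x] by auto
    then show "V e \<and> length (lin (c e x) (z e x) ((fst (s e x) + snd (s e x)) div 2) (u e x)) = nv e \<and>
       0 < lin (c e x) (z e x) ((fst (s e x) + snd (s e x)) div 2) (u e x) ! 0"
      using x D[of e x] by blast
  qed
  show "FP ?D (\<lambda>e x. if memv e (lin (c e x) (z e x) ((fst (s e x) + snd (s e x)) div 2) (u e x))
      then ((fst (s e x) + snd (s e x)) div 2, snd (s e x)) else (fst (s e x), (fst (s e x) + snd (s e x)) div 2))"
    by (intro FP_if mem fp s')
qed (auto intro!: fp s intro: FP_weaken[OF s])

lemma FP_line_search:
  assumes p: "param D I m" and z: "FP D z" and u: "FP D u" and t: "FP D t"
    and D: "\<And>e x. D e x \<Longrightarrow> z e x \<in> cone.K (nv e) (Hv e) \<and> length (u e x) = nv e \<and> 0 < t e x \<and> 0 \<le> z e x ! 0 + t e x * u e x ! 0"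
  shows "FP D (\<lambda>e x. line_search (memv e) (I e x) (m e x) (z e x) (u e x) (t e x))"
proof -
  note P = paramD[OF p]
  let ?G = "\<lambda>e x. line_grid (I e x) (m e x)"
  let ?s = "\<lambda>e x. fold (\<lambda>_ s. bisect_step (memv e) (?G e x) (z e x) (u e x) s) (bits (t e x * ?G e x)) (0, t e x * ?G e x)"
  have G: "1 \<le> ?G e x" if "D e x" for e x
    using cone.G1_ge[OF V_cone[OF P(3)[OF that]]] P(4,5)[OF that] by simp
  have "FP D (\<lambda>e x. fold (\<lambda>_ s. bisect_step (memv e) (?G e x) (z e x) (u e x) s) (bits (t e x * ?G e x)) (0, t e x * ?G e x))"
  proof (rule FP_fold[where D' = "\<lambda>e y. D e (fst y) \<and> 0 \<le> fst (snd (snd y)) \<and> snd (snd (snd y)) \<le> t e (fst y) * ?G e (fst y)"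
        and I = "\<lambda>e x j s. 0 \<le> fst s \<and> fst s \<le> snd s \<and> snd s \<le> t e x * ?G e x"
        and B = "\<lambda>e x. 1 + esz (t e x * ?G e x) + esz (t e x * ?G e x)"])
    let ?D = "\<lambda>e y. D e (fst y) \<and> 0 \<le> fst (snd (snd y)) \<and> snd (snd (snd y)) \<le> t e (fst y) * ?G e (fst y)"
    show "FP ?D (\<lambda>e (y :: 'a \<times> int \<times> int \<times> int). bisect_step (memv e) (?G e (fst y)) (z e (fst y)) (u e (fst y)) (snd (snd y)))"
    proof (rule FP_bisect_step)
      fix e and y :: "'a \<times> int \<times> int \<times> int"
      assume y: "?D e y"
      let ?x = "fst y"
      have x: "D e ?x" using y by simp
      note * = cone_oracle.line_query[OF V[OF P(3)[OF x]], where t = "t e ?x", of "z e ?x" "u e ?x", folded P(4,5)[OF x]]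
      show "V e \<and> 0 \<le> fst (snd (snd y)) \<and> (\<forall>j\<ge>0. j < snd (snd (snd y)) \<longrightarrow>
         length (lin (?G e ?x) (z e ?x) j (u e ?x)) = nv e \<and> 0 < lin (?G e ?x) (z e ?x) j (u e ?x) ! 0)"
        using y P(3)[OF x] D[OF x] * by fastforce
    qed ((intro fp FP_at_fst[OF P(1)] FP_at_fst[OF P(2)] FP_at_fst[OF z] FP_at_fst[OF u] | simp)+)
    show "pbd D (\<lambda>e x. 1 + esz (t e x * ?G e x) + esz (t e x * ?G e x))"
      by (intro fp t P)
    fix e x assume x: "D e x"
    show "0 \<le> fst (0 :: int, t e x * ?G e x) \<and> fst (0 :: int, t e x * ?G e x) \<le> snd (0 :: int, t e x * ?G e x) \<and> snd (0 :: int, t e x * ?G e x) \<le> t e x * ?G e x"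
      using D[OF x] G[OF x] by simp
    fix s :: "int \<times> int" assume s: "0 \<le> fst s \<and> fst s \<le> snd s \<and> snd s \<le> t e x * ?G e x"
    show "0 \<le> fst (bisect_step (memv e) (?G e x) (z e x) (u e x) s) \<and>
         fst (bisect_step (memv e) (?G e x) (z e x) (u e x) s) \<le> snd (bisect_step (memv e) (?G e x) (z e x) (u e x) s) \<and>
         snd (bisect_step (memv e) (?G e x) (z e x) (u e x) s) \<le> t e x * ?G e x"
      using s by (auto simp: bisect_step_def)
    have "esz (fst s) \<le> esz (t e x * ?G e x)" "esz (snd s) \<le> esz (t e x * ?G e x)" using s by (intro esz_int_mono; simp)+
    then show "esz s \<le> 1 + esz (t e x * ?G e x) + esz (t e x * ?G e x)" using esz_prod[of "fst s" "snd s"] by simp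
  qed (auto intro!: fp t P)
  then have s: "FP D ?s" .
  have d: "FP D (\<lambda>e x. dioph [0] [0, 1] (line_fuel (I e x) (m e x)) (?G e x) [fst (?s e x)])"
  proof (rule FP_dioph)
    show "FP D (\<lambda>e x. [fst (?s e x)])" by (intro FP_Cons FP_fst s FP_const)
    fix e x assume "D e x"
    then show "\<exists>n>0. [0] = [0..<n] \<and> [0, 1] = [0..<Suc n] \<and> 0 < ?G e x \<and> length [fst (?s e x)] = n"
      using G[of e x] by (intro exI[of _ 1]) (simp add: upt_rec)
  qed (intro fp P)+
  show ?thesis unfolding line_search_def Let_def
    by (intro FP_if fp d)
qed

lemma FP_advance:
  assumes p: "param D I m" and z: "FP D z" and u: "FP D u"
    and D: "\<And>e x. D e x \<Longrightarrow> z e x \<in> cone.K (nv e) (Hv e) \<and> length (u e x) = nv e \<and> u e x ! 0 = 0"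
  shows "FP D (\<lambda>e x. advance (memv e) (I e x) (m e x) (z e x) (u e x))"
proof -
  have "FP D (\<lambda>e x. line_search (memv e) (I e x) (m e x) (z e x) (u e x) (m e x * asum (z e x) + 1))"
  proof (rule FP_line_search[OF p z u])
    show "FP D (\<lambda>e x. m e x * asum (z e x) + 1)" by (intro fp z paramD[OF p])
    fix e x assume x: "D e x"
    have "0 \<le> m e x * asum (z e x)" using cone.m[OF V_cone[OF paramD(3)[OF p x]]] paramD(5)[OF p x] asum_nonneg[of "z e x"] by simp
    then show "z e x \<in> cone.K (nv e) (Hv e) \<and> length (u e x) = nv e \<and> 0 < m e x * asum (z e x) + 1 \<and>
        0 \<le> z e x ! 0 + (m e x * asum (z e x) + 1) * u e x ! 0"
      using D[OF x] K_length[OF paramD(3)[OF p x], of "z e x"] by simp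
  qed
  then show ?thesis unfolding advance_def Let_def by (intro fp z u)
qed

lemma FP_walk_step:
  assumes p: "param D I m" and z: "FP D z" and D: "\<And>e x. D e x \<Longrightarrow> z e x \<in> cone.K (nv e) (Hv e)"
  shows "FP D (\<lambda>e x. walk_step (memv e) (sepv e) (I e x) (m e x) (z e x))"
proof -
  let ?u = "\<lambda>e x. face (memv e) (sepv e) (I e x) (m e x) (z e x)"
  let ?q = "\<lambda>e x. lin 1 (z e x) (m e x * asum (z e x) + 1) (?u e x)"
  let ?D = "\<lambda>e x. D e x \<and> ?u e x \<noteq> []"
  have u: "FP D ?u" by (rule FP_face[OF p z D])
  have zD: "FP ?D z" and uD: "FP ?D ?u" by (rule FP_weaken[OF z], simp, rule FP_weaken[OF u], simp)
  have p': "param ?D I m" by (rule param_weaken[OF p]) simp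
  have uL: "length (?u e x) = nv e \<and> ?u e x ! 0 = 0 \<and> length (z e x) = nv e \<and> 0 < z e x ! 0 \<and> V e \<and> 1 \<le> nv e" if x: "?D e x" for e x
  proof -
    interpret cone_oracle "nv e" "mv e" "Hv e" "memv e" "sepv e" using V paramD(3)[OF p] x by blast
    have "?u e x \<in> L (z e x)" using face(2)[OF D] x paramD(4,5)[OF p, of e x] by simp
    then show ?thesis using L_dest(1,2) K_length[OF _ D] paramD(3)[OF p] x by blast
  qed
  have mem: "FP ?D (\<lambda>e x. memv e (?q e x))"
  proof (rule FP_mem)
    show "FP ?D ?q" by (intro fp zD uD paramD[OF p'])
    fix e x assume "?D e x"
    then show "V e \<and> length (?q e x) = nv e \<and> 0 < ?q e x ! 0"
      using uL[of e x] by auto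
  qed
  have a: "FP ?D (\<lambda>e x. advance (memv e) (I e x) (m e x) (z e x) (map uminus (?u e x)))"
    by (intro FP_advance p' zD fp uD) (use uL D in force)
  have b: "FP ?D (\<lambda>e x. advance (memv e) (I e x) (m e x) (z e x) (?u e x))"
    by (intro FP_advance p' zD uD) (use uL D in force)
  show ?thesis unfolding walk_step_def Let_def
    by (rule FP_If) ((intro FP_null u FP_weaken[OF z] FP_if mem a b | simp)+)
qed

lemma FP_vertex_near:
  assumes p: "param D I m" and z: "FP D z" and D: "\<And>e x. D e x \<Longrightarrow> z e x \<in> cone.K (nv e) (Hv e)"
  shows "FP D (\<lambda>e x. vertex_near (memv e) (sepv e) (I e x) (m e x) (z e x))"
proof -
  note P = paramD[OF p]
  let ?c = "\<lambda>e x. prod_list (map (\<lambda>_. walk_growth (I e x) (m e x)) (next_list (I e x))) * (asum (z e x) + 1)"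
  let ?y = "\<lambda>e x. fold (\<lambda>_ y. walk_step (memv e) (sepv e) (I e x) (m e x) y) (next_list (I e x)) (z e x)"
  have y: "FP D ?y"
  proof (rule FP_fold[where D' = "\<lambda>e y. D e (fst y) \<and> snd (snd y) \<in> cone.K (nv e) (Hv e)"
        and I = "\<lambda>e x j y. y \<in> cone.K (nv e) (Hv e) \<and> asum y + 1 \<le> walk_growth (I e x) (m e x) ^ j * (asum (z e x) + 1)"
        and B = "\<lambda>e x. 1 + esz (I e x) * esz (?c e x)"])
    show "FP (\<lambda>e y. D e (fst y) \<and> snd (snd y) \<in> cone.K (nv e) (Hv e))
        (\<lambda>e (y :: 'a \<times> nat \<times> int list). walk_step (memv e) (sepv e) (I e (fst y)) (m e (fst y)) (snd (snd y)))"
      by (intro FP_walk_step param_fst[OF p] fp) auto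
    show "pbd D (\<lambda>e x. 1 + esz (I e x) * esz (?c e x))"
      by (intro pbd_add pbd_mult pbd_const pbd_FP FP_times FP_plus FP_const FP_prod_const FP_walk_growth FP_asum z P FP_next_list)
    fix e x j y assume x: "D e x"
    interpret cone_oracle "nv e" "mv e" "Hv e" "memv e" "sepv e" by (rule V[OF P(3)[OF x]])
    note Px = P(4,5)[OF x]
    assume y: "y \<in> cone.K (nv e) (Hv e) \<and> asum y + 1 \<le> walk_growth (I e x) (m e x) ^ j * (asum (z e x) + 1)"
    then have "walk_growth (I e x) (m e x) * (asum y + 1) \<le> walk_growth (I e x) (m e x) * (walk_growth (I e x) (m e x) ^ j * (asum (z e x) + 1))"
      using walk_growth_ge_1 Px by (intro mult_left_mono) auto
    then show "walk_step (memv e) (sepv e) (I e x) (m e x) y \<in> cone.K (nv e) (Hv e) \<and>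
      asum (walk_step (memv e) (sepv e) (I e x) (m e x) y) + 1 \<le> walk_growth (I e x) (m e x) ^ Suc j * (asum (z e x) + 1)"
      using walk_step(1)[of y] walk_size[of y] y Px by (simp add: mult.assoc)
    assume j: "j \<le> length (next_list (I e x))"
    have "walk_growth (I e x) (m e x) ^ j \<le> walk_growth (I e x) (m e x) ^ length (next_list (I e x))"
      using walk_growth_ge_1 Px j by (intro power_increasing) auto
    then have "walk_growth (I e x) (m e x) ^ j * (asum (z e x) + 1) \<le> ?c e x"
      unfolding prod_list_const using asum_nonneg[of "z e x"] by (intro mult_right_mono) auto
    then have "asum y \<le> ?c e x" using y by linarith
    then have "esz y \<le> 1 + nv e * esz (?c e x)"
      using y K_dest(1)[of y] abs_nth_le_asum[of _ y] by (intro esz_vec_le) force+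
    also have "\<dots> \<le> 1 + esz (I e x) * esz (?c e x)"
      using nv_le_esz[OF p x] by (intro add_left_mono mult_right_mono) auto
    finally show "esz y \<le> 1 + esz (I e x) * esz (?c e x)" .
  qed (auto intro!: fp z P simp: D)
  show ?thesis unfolding vertex_near_def Let_def
    by (intro y fp FP_at_fst[OF y]) auto
qed

lemma FP_peel:
  assumes p: "param D I m" and v: "FP D v" and M: "FP D M" and z: "FP D z" and r: "FP D r" and ps: "FP D ps"
    and D: "\<And>e x. D e x \<Longrightarrow> z e x \<in> cone.K (nv e) (Hv e) \<and> v e x \<in> cone.K (nv e) (Hv e) \<and> v e x ! 0 = 1"
  shows "FP D (\<lambda>e x. peel (memv e) (I e x) (m e x) (v e x) (M e x) (z e x) (r e x) (ps e x))"
proof -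
  note P = paramD[OF p]
  have len: "length (z e x) = nv e \<and> 0 < z e x ! 0 \<and> length (v e x) = nv e \<and> nth_default 0 (z e x) 0 = z e x ! 0 \<and> 1 \<le> nv e" if "D e x" for e x
    using K_length[OF P(3)[OF that], of "z e x"] K_length[OF P(3)[OF that], of "v e x"] D[OF that]
    by (auto simp: nth_default_nth)
  let ?q = "\<lambda>e x. lin 1 (v e x) (m e x * asum (v e x) + 1) (lin 1 (z e x) (- nth_default 0 (z e x) 0) (v e x))"
  have mem: "FP D (\<lambda>e x. memv e (?q e x))"
  proof (rule FP_mem)
    show "FP D ?q" by (intro fp v z P)
    fix e x assume "D e x"
    then show "V e \<and> length (?q e x) = nv e \<and> 0 < ?q e x ! 0" using len[of e x] D[of e x] P(3)[of e x] by auto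
  qed
  have ls: "FP D (\<lambda>e x. line_search (memv e) (I e x) (m e x) (z e x) (map uminus (v e x)) (nth_default 0 (z e x) 0))"
  proof (rule FP_line_search[OF p z])
    show "FP D (\<lambda>e x. map uminus (v e x))" by (intro fp v)
    show "FP D (\<lambda>e x. nth_default 0 (z e x) 0)" by (intro fp z)
    fix e x assume "D e x"
    then show "z e x \<in> cone.K (nv e) (Hv e) \<and> length (map uminus (v e x)) = nv e \<and> 0 < nth_default 0 (z e x) 0 \<and>
        0 \<le> z e x ! 0 + nth_default 0 (z e x) 0 * map uminus (v e x) ! 0"
      using len[of e x] D[of e x] by (auto simp: nth_map)
  qed
  show ?thesis unfolding peel_def Let_def
    by (intro FP_if mem fp ls v M z r ps)
qed

lemma FP_peel_step:
  assumes p: "param D I m" and s: "FP D s"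
    and D: "\<And>e x. D e x \<Longrightarrow> \<exists>a t. cone_oracle.peel_inv (nv e) (Hv e) a t (s e x)"
  shows "FP D (\<lambda>e x. peel_step (memv e) (sepv e) (I e x) (m e x) (s e x))"
  unfolding peel_step_def
proof (rule FP_If)
  let ?D = "\<lambda>e x. D e x \<and> \<not> fst (s e x)"
  have p': "param ?D I m" and s': "FP ?D s" by (rule param_weaken[OF p], simp, rule FP_weaken[OF s], simp)
  have z: "fst (snd (snd (s e x))) \<in> cone.K (nv e) (Hv e)" if "?D e x" for e x
  proof -
    interpret cone_oracle "nv e" "mv e" "Hv e" "memv e" "sepv e" using V paramD(3)[OF p] that by blast
    obtain a t where "peel_inv a t (s e x)" using D[of e x] \<open>?D e x\<close> by blast
    then show ?thesis using \<open>?D e x\<close> by (cases "s e x") (auto simp: peel_inv_def)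
  qed
  have v: "FP ?D (\<lambda>e x. vertex_near (memv e) (sepv e) (I e x) (m e x) (fst (snd (snd (s e x)))))"
    by (intro FP_vertex_near[OF p'] fp s' z)
  show "FP ?D (\<lambda>e x. peel (memv e) (I e x) (m e x) (vertex_near (memv e) (sepv e) (I e x) (m e x) (fst (snd (snd (s e x)))))
      (fst (snd (s e x))) (fst (snd (snd (s e x)))) (fst (snd (snd (snd (s e x))))) (snd (snd (snd (snd (s e x))))))"
  proof (intro FP_peel[OF p' v] fp s')
    fix e x assume x: "?D e x"
    show "fst (snd (snd (s e x))) \<in> cone.K (nv e) (Hv e) \<and> vertex_near (memv e) (sepv e) (I e x) (m e x) (fst (snd (snd (s e x)))) \<in> cone.K (nv e) (Hv e) \<and>
        vertex_near (memv e) (sepv e) (I e x) (m e x) (fst (snd (snd (s e x)))) ! 0 = 1"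
      using cone_oracle.vertex_near(1,2)[OF V[OF paramD(3)[OF p]] z[OF x]] z[OF x] x paramD(4,5)[OF p, of e x] by auto
  qed
  show "FP (\<lambda>e x. D e x \<and> fst (s e x)) s" by (rule FP_weaken[OF s]) simp
qed (intro fp s)

lemma FP_peel_all:
  assumes p: "param D I m" and a: "FP D a" and D: "\<And>e x. D e x \<Longrightarrow> a e x \<in> cone.K (nv e) (Hv e)"
  shows "FP D (\<lambda>e x. peel_all (memv e) (sepv e) (I e x) (m e x) (a e x))"
proof -
  note P = paramD[OF p]
  let ?g = "\<lambda>e x. peel_growth (I e x) (m e x)"
  let ?c = "\<lambda>e x. prod_list (map (\<lambda>_. ?g e x) (next_list (I e x))) * (asum (a e x) + 1)"
  let ?N = "\<lambda>e x. Suc (esz (I e x))"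
  let ?B = "\<lambda>e x. 10 + esz (?c e x) + (1 + ?N e x * esz (?c e x)) + (1 + ?N e x * esz (?c e x)) + (1 + ?N e x * (2 + esz (?c e x) + ?N e x * esz (?c e x)))"
  show ?thesis unfolding peel_all_def
  proof (rule FP_fold[where D' = "\<lambda>e y. D e (fst y) \<and> (\<exists>a t. cone_oracle.peel_inv (nv e) (Hv e) a t (snd (snd y)))"
        and I = "\<lambda>e x j s. cone_oracle.peel_inv (nv e) (Hv e) (a e x) j s \<and> cone_oracle.peel_small (nv e) (?g e x ^ j * (asum (a e x) + 1)) j s"
        and B = ?B])
    show "FP (\<lambda>e y. D e (fst y) \<and> (\<exists>a t. cone_oracle.peel_inv (nv e) (Hv e) a t (snd (snd y))))
        (\<lambda>e (y :: 'a \<times> nat \<times> peel_state). peel_step (memv e) (sepv e) (I e (fst y)) (m e (fst y)) (snd (snd y)))"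
      by (intro FP_peel_step param_fst[OF p] fp) auto
    have c: "FP D ?c" by (intro FP_times FP_plus FP_const FP_prod_const FP_peel_growth FP_asum a P FP_next_list)
    have N: "pbd D ?N" using pbd_add[OF pbd_const[of D 1] pbd_FP[OF P(1)]] by simp
    show "pbd D ?B" by (intro pbd_add pbd_mult pbd_const pbd_FP[OF c] N)
    show "FP D (\<lambda>e x. next_list (I e x))" by (intro fp P)
    show "FP D (\<lambda>e x. (False, 1, a e x, a e x, []))" by (intro FP_Pair FP_const a)
    fix e x assume x: "D e x"
    interpret cone_oracle "nv e" "mv e" "Hv e" "memv e" "sepv e" by (rule V[OF P(3)[OF x]])
    note Px = P(4,5)[OF x]
    note aK = D[OF x]
    have "\<bar>a e x ! i\<bar> \<le> asum (a e x) + 1" if "i < nv e" for i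
      using abs_nth_le_asum[of i "a e x"] K_dest(1)[OF aK] that by simp
    then have "peel_small (asum (a e x) + 1) 0 (False, 1, a e x, a e x, [])"
      using asum_nonneg[of "a e x"] by (simp add: peel_small_def)
    then show "peel_inv (a e x) 0 (False, 1, a e x, a e x, []) \<and> peel_small (?g e x ^ 0 * (asum (a e x) + 1)) 0 (False, 1, a e x, a e x, [])"
      using peel_partial[OF aK, of "[]"] by simp
    fix j s assume s: "peel_inv (a e x) j s \<and> peel_small (?g e x ^ j * (asum (a e x) + 1)) j s"
    show "peel_inv (a e x) (Suc j) (peel_step (memv e) (sepv e) (I e x) (m e x) s) \<and>
      peel_small (?g e x ^ Suc j * (asum (a e x) + 1)) (Suc j) (peel_step (memv e) (sepv e) (I e x) (m e x) s)"
      using s peel_step[of "a e x" j s] peel_small_step[of "a e x" j s] Px by (simp add: mult.assoc)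
    show "D e (fst (x, (next_list (I e x) ! j, s))) \<and> (\<exists>a t. peel_inv a t (snd (snd (x, (next_list (I e x) ! j, s)))))"
      using x s by auto
    assume j: "j \<le> length (next_list (I e x))"
    have "?g e x ^ j \<le> ?g e x ^ length (next_list (I e x))"
      using peel_growth_ge(1) Px j by (intro power_increasing) auto
    then have "?g e x ^ j * (asum (a e x) + 1) \<le> ?c e x"
      unfolding prod_list_const using asum_nonneg[of "a e x"] by (intro mult_right_mono) auto
    moreover have "0 \<le> ?g e x ^ j * (asum (a e x) + 1)"
      using peel_growth_ge(1) Px asum_nonneg[of "a e x"] by simp
    ultimately have c: "esz (?g e x ^ j * (asum (a e x) + 1)) \<le> esz (?c e x)" by (intro esz_int_mono) linarith
    have jN: "j \<le> ?N e x" "nv e \<le> ?N e x" using j next_list Px nv_le_esz[OF p x] by (auto simp del: upt_Suc)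
    let ?k = "esz (?g e x ^ j * (asum (a e x) + 1))"
    have "esz s \<le> 10 + ?k + (1 + nv e * ?k) + (1 + nv e * ?k) + (1 + j * (2 + ?k + nv e * ?k))"
      using s by (intro peel_small_size) auto
    also have "\<dots> \<le> ?B e x" using c jN by (intro add_mono mult_mono order.refl) auto
    finally show "esz s \<le> ?B e x" .
  qed
qed

lemma FP_find_step:
  assumes a: "FP D a" and s: "FP D s"
    and D: "\<And>e x. D e x \<Longrightarrow> V e \<and> Suc (length (a e x)) = nv e \<and> 1 \<le> fst (s e x)"
  shows "FP D (\<lambda>e x. find_step (memv e) (sepv e) (a e x) (s e x))"
  unfolding find_step_def
proof (rule FP_If)
  let ?D = "\<lambda>e x. D e x \<and> \<not> (snd (snd (s e x)) \<noteq> 0 \<or> fst (snd (s e x)) < fst (s e x))"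
  let ?k = "\<lambda>e x. (fst (s e x) + fst (snd (s e x))) div 2"
  let ?D' = "\<lambda>e x. ?D e x \<and> \<not> memv e (?k e x # a e x)"
  have s': "FP ?D s" and s'': "FP ?D' s" by (rule FP_weaken[OF s], simp)+
  have q: "FP ?D (\<lambda>e x. ?k e x # a e x)" by (intro fp s' FP_weaken[OF a]) auto
  have k: "V e \<and> length (?k e x # a e x) = nv e \<and> 0 < (?k e x # a e x) ! 0" if "?D e x" for e x
    using D[of e x] that by (auto simp: pos_imp_zdiv_pos_iff)
  have mem: "FP ?D (\<lambda>e x. memv e (?k e x # a e x))" by (rule FP_mem[OF q k])
  have sep: "FP ?D' (\<lambda>e x. sepv e (?k e x # a e x))"
    by (rule FP_sep[OF FP_weaken[OF q]]) (use k in blast)+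
  show "FP ?D (\<lambda>e x. let k = ?k e x in if memv e (k # a e x) then (fst (s e x), fst (snd (s e x)), k)
      else let c = nth_default 0 (sepv e (k # a e x)) 0 in
        if 0 < c then (k + 1, fst (snd (s e x)), 0) else if c < 0 then (fst (s e x), k - 1, 0) else (fst (s e x), fst (s e x) - 1, 0))"
    unfolding Let_def
  proof (rule FP_If[OF mem])
    show "FP (\<lambda>e x. ?D e x \<and> memv e (?k e x # a e x)) (\<lambda>e x. (fst (s e x), fst (snd (s e x)), ?k e x))"
      by (rule FP_weaken[of ?D], intro fp s') simp
  qed (intro FP_if fp sep s'')
  show "FP (\<lambda>e x. D e x \<and> (snd (snd (s e x)) \<noteq> 0 \<or> fst (snd (s e x)) < fst (s e x))) s"
    by (rule FP_weaken[OF s]) simp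
qed (intro fp s)

lemma FP_find_multiple:
  assumes p: "param D I m" and a: "FP D a" and D: "\<And>e x. D e x \<Longrightarrow> Suc (length (a e x)) = nv e"
  shows "FP D (\<lambda>e x. find_multiple (memv e) (sepv e) (m e x) (a e x))"
proof -
  note P = paramD[OF p]
  let ?c = "\<lambda>e x. m e x * asum (a e x) + 1"
  have c: "FP D ?c" by (intro fp a P)
  have b: "FP D (\<lambda>e x. m e x * asum (a e x) + 2)" by (intro fp a P)
  have "FP D (\<lambda>e x. fold (\<lambda>_ s. find_step (memv e) (sepv e) (a e x) s) (0 # bits (?c e x)) (1, ?c e x, 0))"
  proof (rule FP_fold[where D' = "\<lambda>e y. D e (fst y) \<and> 1 \<le> fst (snd (snd y))"
        and I = "\<lambda>e x j s. cone_oracle.find_inv (nv e) (mv e) (Hv e) (a e x) j s"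
        and B = "\<lambda>e x. 2 + esz (m e x * asum (a e x) + 2) + esz (m e x * asum (a e x) + 2) + esz (m e x * asum (a e x) + 2)"])
    show "FP (\<lambda>e y. D e (fst y) \<and> 1 \<le> fst (snd (snd y)))
        (\<lambda>e (y :: 'a \<times> int \<times> int \<times> int \<times> int). find_step (memv e) (sepv e) (a e (fst y)) (snd (snd y)))"
      by (intro FP_find_step fp FP_at_fst[OF a]) (auto simp: D P(3))
    show "FP D (\<lambda>e x. 0 # bits (?c e x))" by (intro fp c)
    show "FP D (\<lambda>e x. (1, ?c e x, 0))" by (intro FP_Pair c FP_const)
    show "pbd D (\<lambda>e x. 2 + esz (m e x * asum (a e x) + 2) + esz (m e x * asum (a e x) + 2) + esz (m e x * asum (a e x) + 2))"
      by (intro pbd_add pbd_const pbd_FP[OF b])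
    fix e x assume x: "D e x"
    interpret cone_oracle "nv e" "mv e" "Hv e" "memv e" "sepv e" by (rule V[OF P(3)[OF x]])
    note Px = P(4,5)[OF x]
    show "find_inv (a e x) 0 (1, ?c e x, 0)" using find_partial[OF D[OF x], of "[]"] Px by simp
    fix j s assume s: "find_inv (a e x) j s"
    show "find_inv (a e x) (Suc j) (find_step (memv e) (sepv e) (a e x) s)" using find_step[OF D[OF x] s] .
    show "D e (fst (x, ((0 # bits (?c e x)) ! j, s))) \<and> 1 \<le> fst (snd (snd (x, ((0 # bits (?c e x)) ! j, s))))"
      using x s by (auto simp: find_inv_def split: prod.splits)
    obtain lo hi k where s': "s = (lo, hi, k)" by (cases s) auto
    have "0 \<le> lo" "lo \<le> m e x * asum (a e x) + 2" "0 \<le> hi" "hi \<le> m e x * asum (a e x) + 2" "0 \<le> k" "k \<le> m e x * asum (a e x) + 2"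
    proof -
      have "0 < k" if "k \<noteq> 0" using s that by (auto simp: find_inv_def s' K_def)
      then show "0 \<le> lo" "lo \<le> m e x * asum (a e x) + 2" "0 \<le> hi" "hi \<le> m e x * asum (a e x) + 2" "0 \<le> k" "k \<le> m e x * asum (a e x) + 2"
        using s Px by (auto simp: find_inv_def s')
    qed
    then have "esz lo \<le> esz (m e x * asum (a e x) + 2)" "esz hi \<le> esz (m e x * asum (a e x) + 2)" "esz k \<le> esz (m e x * asum (a e x) + 2)"
      by (intro esz_int_mono; linarith)+
    then show "esz s \<le> 2 + esz (m e x * asum (a e x) + 2) + esz (m e x * asum (a e x) + 2) + esz (m e x * asum (a e x) + 2)"
      unfolding s' esz_prod by linarith
  qed
  then show ?thesis unfolding find_multiple_def by (intro fp)
qed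

end

section \<open>Polyhedra as cones\<close>

definition point :: "nat \<Rightarrow> int list \<Rightarrow> real vec" where
  "point d z = vec d (\<lambda>j. real_of_int (z ! Suc j) / real_of_int (z ! 0))"

text \<open>The inequalities as a set of rows with signs chosen such that feasibility means
  \<open>dot r z \<ge> 0\<close> for homogeneous vectors \<open>z\<close>.\<close>

definition describes :: "nat \<Rightarrow> nat \<Rightarrow> real vec set \<Rightarrow> int list set \<Rightarrow> bool" where
  "describes d \<Delta> P H \<longleftrightarrow> (\<forall>r\<in>H. length r = Suc d \<and> (\<forall>i<Suc d. \<bar>r ! i\<bar> \<le> int \<Delta>)) \<and>
    P = {x \<in> carrier_vec d. \<forall>r\<in>H. 0 \<le> real_of_int (r ! 0) + (\<Sum>j<d. real_of_int (r ! Suc j) * x $ j)}"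

lemma describable_mono: "describable d \<Delta> P \<Longrightarrow> \<Delta> \<le> \<Delta>' \<Longrightarrow> describable d \<Delta>' P"
  unfolding describable_def by (meson int_ops(1) of_nat_le_iff order_trans)

lemma describable_describes:
  assumes "describable d \<Delta> P"
  shows "\<exists>H. describes d \<Delta> P H"
proof -
  obtain m A b where A: "A \<in> carrier_mat m d" "b \<in> carrier_vec m"
    "\<And>i j. i < m \<Longrightarrow> j < d \<Longrightarrow> \<bar>A $$ (i, j)\<bar> \<le> int \<Delta>" "\<And>i. i < m \<Longrightarrow> \<bar>b $ i\<bar> \<le> int \<Delta>"
    "P = {x \<in> carrier_vec d. map_mat real_of_int A *\<^sub>v x \<le> real_vec b}"
    using assms unfolding describable_def by blast
  define row where "row i = b $ i # map (\<lambda>j. - A $$ (i, j)) [0..<d]" for i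
  have "\<bar>row i ! j\<bar> \<le> int \<Delta>" if "i < m" "j < Suc d" for i j
    using that A(3,4) by (cases j) (auto simp: row_def)
  moreover have "(map_mat real_of_int A *\<^sub>v x \<le> real_vec b) \<longleftrightarrow>
      (\<forall>i<m. 0 \<le> real_of_int (row i ! 0) + (\<Sum>j<d. real_of_int (row i ! Suc j) * x $ j))" if x: "x \<in> carrier_vec d" for x
  proof -
    have "(map_mat real_of_int A *\<^sub>v x) $ i = - (\<Sum>j<d. real_of_int (row i ! Suc j) * x $ j)" if "i < m" for i
      using that A(1) x by (simp add: row_def scalar_prod_def sum_negf lessThan_atLeast0)
    then show ?thesis using A(1,2) by (auto simp: less_eq_vec_def row_def)
  qed
  ultimately have "describes d \<Delta> P (row ` {..<m})"
    using A(5) by (auto simp: describes_def row_def)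
  then show ?thesis by blast
qed

lemma description_complexity_describable:
  assumes "rational_polyhedron d P"
  shows "0 < description_complexity d P \<and> describable d (description_complexity d P) P"
proof -
  obtain \<Delta> where "describable d \<Delta> P" using assms by (auto simp: rational_polyhedron_def)
  then have "0 < Suc \<Delta> \<and> describable d (Suc \<Delta>) P" using describable_mono[of d \<Delta> P "Suc \<Delta>"] by simp
  then show ?thesis unfolding description_complexity_def by (rule LeastI)
qed

lemma dot_point:
  assumes "length r = Suc d" "length z = Suc d" "0 < z ! 0"
  shows "real_of_int (dot r z) = real_of_int (z ! 0) * (real_of_int (r ! 0) + (\<Sum>j<d. real_of_int (r ! Suc j) * point d z $ j))"
proof -
  have "real_of_int (dot r z) = real_of_int (r ! 0) * real_of_int (z ! 0) + (\<Sum>j<d. real_of_int (r ! Suc j) * real_of_int (z ! Suc j))"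
    using assms by (simp add: dot_sum sum.lessThan_Suc_shift del: sum.lessThan_Suc)
  also have "(\<Sum>j<d. real_of_int (r ! Suc j) * real_of_int (z ! Suc j)) =
      real_of_int (z ! 0) * (\<Sum>j<d. real_of_int (r ! Suc j) * point d z $ j)"
    unfolding sum_distrib_left using assms(3) by (intro sum.cong) (auto simp: point_def)
  finally show ?thesis by (simp add: algebra_simps)
qed

lemma vsum_carrier: "set xs \<subseteq> carrier_vec d \<Longrightarrow> vsum d xs \<in> carrier_vec d"
  by (induction xs) (auto simp: vsum_def)

lemma vsum_index: "set xs \<subseteq> carrier_vec d \<Longrightarrow> j < d \<Longrightarrow> vsum d xs $ j = sum_list (map (\<lambda>x. x $ j) xs)"
proof (induction xs)
  case (Cons x xs)
  then show ?case using vsum_carrier[of xs d] by (simp add: vsum_def)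
qed (simp add: vsum_def)

text \<open>The height serves as common denominator; the encoding of rationals admits fractions that
  are not reduced.\<close>

definition query :: "int list \<Rightarrow> (int \<times> int) list" where
  "query z = map (\<lambda>c. (c, nth_default 0 z 0)) (tl z)"

text \<open>On admissible queries a positive answer is an integer and a separating functional is a
  list, so testing the kind of value suffices.\<close>

definition member :: "env \<Rightarrow> int list \<Rightarrow> bool" where
  "member e z \<longleftrightarrow> (case env_oracle e Separation (enc (query z)) of IntV _ \<Rightarrow> True | ListV _ \<Rightarrow> False)"

definition pairs_of :: "val \<Rightarrow> (int \<times> int) list" where
  "pairs_of w = map (\<lambda>v. (int_of (hd (list_of v)), int_of (hd (tl (list_of v))))) (list_of w)"

text \<open>The product of all denominators is a common multiple whose length is at most linear in
  the length of the answer.\<close>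

definition clear_denominators :: "(int \<times> int) list \<Rightarrow> int list" where
  "clear_denominators hs = map (\<lambda>e. fst e * (prod_list (map snd hs) div snd e)) hs"

text \<open>The homogeneous form of \<open>h \<bullet> x_z - h \<bullet> x_y\<close>, as a function
  of \<open>y\<close>: clearing both heights gives
  \<open>y_0 (h \<bullet> z') - z_0 (h \<bullet> y')\<close>, where primes denote tails. It vanishes
  at \<open>z\<close> itself.\<close>

definition functional :: "int list \<Rightarrow> int list \<Rightarrow> int list" where
  "functional h z = dot h (tl z) # map (\<lambda>c. - nth_default 0 z 0 * c) h"

definition separator :: "env \<Rightarrow> int list \<Rightarrow> int list" where
  "separator e z = functional (clear_denominators (pairs_of (env_oracle e Separation (enc (query z))))) z"

text \<open>Some description within the known complexity bound. It exists for the analysis only; no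
  program computes it.\<close>

definition rows :: "env \<Rightarrow> int list set" where
  "rows e = (SOME H. describes (env_dim e) (env_complexity e) (env_polyhedron e) H)"

lemma pairs_of_enc: "pairs_of (enc ps) = ps"
  by (induction ps) (auto simp: pairs_of_def enc_defs)

lemma encodes_vec_query:
  assumes "length z = Suc d" "0 < z ! 0"
  shows "encodes_vec (enc (query z)) (point d z)"
proof -
  have "nth_default 0 z 0 = z ! 0" using assms by (simp add: nth_default_nth)
  then have "list_all2 encodes_rat (map enc (query z)) (list_of_vec (point d z))"
    using assms
    by (auto simp: list_all2_conv_all_nth query_def encodes_rat_def enc_defs point_def list_of_vec_index nth_tl intro!: exI)
  then show ?thesis by (auto simp: encodes_vec_def enc_list_def)
qed

lemma encodes_vec_dest:
  assumes "encodes_vec w h"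
  shows "\<exists>ps. w = enc ps \<and> length ps = dim_vec h \<and> (\<forall>i<dim_vec h. 0 < snd (ps ! i) \<and> h $ i = real_of_int (fst (ps ! i)) / real_of_int (snd (ps ! i)))"
proof -
  obtain vs where vs: "w = ListV vs" "list_all2 encodes_rat vs (list_of_vec h)"
    using assms by (auto simp: encodes_vec_def)
  have len: "length vs = dim_vec h" using vs(2) by (auto dest: list_all2_lengthD)
  have "\<exists>e. 0 < snd e \<and> vs ! i = enc e \<and> h $ i = real_of_int (fst e) / real_of_int (snd e)" if "i < dim_vec h" for i
  proof -
    have "encodes_rat (vs ! i) (h $ i)"
      using list_all2_nthD[OF vs(2), of i] that len by (simp add: list_of_vec_index)
    then obtain p q where "0 < q" "vs ! i = ListV [IntV p, IntV q]" "h $ i = real_of_int p / real_of_int q"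
      by (auto simp: encodes_rat_def)
    then show ?thesis by (intro exI[of _ "(p, q)"]) (simp add: enc_defs)
  qed
  then obtain f where f: "\<And>i. i < dim_vec h \<Longrightarrow> 0 < snd (f i) \<and> vs ! i = enc (f i) \<and> h $ i = real_of_int (fst (f i)) / real_of_int (snd (f i))"
    by metis
  have "vs = map enc (map f [0..<dim_vec h])" using len f by (intro nth_equalityI) auto
  then show ?thesis using vs(1) f by (intro exI[of _ "map f [0..<dim_vec h]"]) (auto simp: enc_list_def)
qed

lemma clear_denominators:
  assumes "\<And>i. i < length ps \<Longrightarrow> 0 < snd (ps ! i)"
  shows "\<exists>Q>0. \<forall>i<length ps. real_of_int (clear_denominators ps ! i) = Q * (real_of_int (fst (ps ! i)) / real_of_int (snd (ps ! i)))"
proof (intro exI conjI allI impI)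
  have pos: "0 < snd e" if "e \<in> set ps" for e using assms that by (metis in_set_conv_nth)
  then have "0 < prod_list (map snd ps)" by (induction ps) auto
  then show "0 < real_of_int (prod_list (map snd ps))" by simp
  fix i assume i: "i < length ps"
  have dvd: "snd e dvd prod_list (map snd ps)" if "e \<in> set ps" for e
    using that by (induction ps) (auto intro: dvd_mult)
  have "snd (ps ! i) dvd prod_list (map snd ps)" using i dvd by simp
  then show "real_of_int (clear_denominators ps ! i) =
      real_of_int (prod_list (map snd ps)) * (real_of_int (fst (ps ! i)) / real_of_int (snd (ps ! i)))"
    using i assms[OF i] by (simp add: clear_denominators_def real_of_int_div)
qed

lemma point_carrier [simp]: "point d z \<in> carrier_vec d"
  by (simp add: point_def)

section \<open>The cone of an admissible polyhedron\<close>

locale valid_env =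
  fixes e :: env
  assumes valid_axioms: "rational_polyhedron (env_dim e) (env_polyhedron e) \<and> pointed (env_dim e) (env_polyhedron e) \<and>
    decomposable (env_dim e) (env_polyhedron e) \<and>
    description_complexity (env_dim e) (env_polyhedron e) \<le> env_complexity e \<and>
    separation_oracle (env_dim e) (env_polyhedron e) (env_oracle e Separation) \<and>
    decomposition_oracle (env_dim e) (env_polyhedron e) (env_oracle e Decomposition) \<and>
    bounded_answers (answer_bound e) (env_dim e) (env_complexity e) (env_polyhedron e) (env_oracle e)"
begin

lemmas valid = valid_env_axioms

abbreviation "d \<equiv> env_dim e"
abbreviation "P \<equiv> env_polyhedron e"

lemma rows: "describes d (env_complexity e) P (rows e)"
proof -
  have "describable d (env_complexity e) P"
    using description_complexity_describable[of d P] describable_mono[of d "description_complexity d P" P] valid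
    unfolding valid_env_def by blast
  then show ?thesis unfolding rows_def by (intro someI_ex[OF describable_describes])
qed

lemma complexity_pos: "1 \<le> env_complexity e"
  using description_complexity_describable[of d P] valid unfolding valid_env_def by linarith

lemma row_length: "r \<in> rows e \<Longrightarrow> length r = Suc d"
  using rows by (simp add: describes_def)

lemma in_P: "x \<in> P \<longleftrightarrow> x \<in> carrier_vec d \<and> (\<forall>r\<in>rows e. 0 \<le> real_of_int (r ! 0) + (\<Sum>j<d. real_of_int (r ! Suc j) * x $ j))"
  using rows unfolding describes_def by blast

lemma cone_env: "cone (Suc d) (int (env_complexity e)) (rows e)"
  using rows complexity_pos by unfold_locales (auto simp: describes_def)

abbreviation "KK \<equiv> cone.K (Suc d) (rows e)"

lemma in_K: "z \<in> KK \<longleftrightarrow> length z = Suc d \<and> 0 < z ! 0 \<and> (\<forall>r\<in>rows e. 0 \<le> dot r z)"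
  using cone.K_def[OF cone_env] by simp

lemma K_point: "length z = Suc d \<Longrightarrow> 0 < z ! 0 \<Longrightarrow> z \<in> KK \<longleftrightarrow> point d z \<in> P"
proof -
  assume z: "length z = Suc d" "0 < z ! 0"
  have "0 \<le> dot r z \<longleftrightarrow> 0 \<le> real_of_int (r ! 0) + (\<Sum>j<d. real_of_int (r ! Suc j) * point d z $ j)" if "r \<in> rows e" for r
  proof -
    have "0 \<le> dot r z \<longleftrightarrow> 0 \<le> real_of_int (dot r z)" by simp
    then show ?thesis unfolding dot_point[OF row_length[OF that] z] using z(2) by (simp add: zero_le_mult_iff)
  qed
  then show ?thesis using z by (simp add: in_K in_P)
qed

lemma oracle_answer:
  assumes "length z = Suc d" "0 < z ! 0"
  shows "(env_oracle e Separation (enc (query z)) = IntV 1 \<and> point d z \<in> P) \<or>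
    (\<exists>ps h. env_oracle e Separation (enc (query z)) = enc (ps :: (int \<times> int) list) \<and> length ps = d \<and> h \<in> carrier_vec d \<and>
      (\<forall>i<d. 0 < snd (ps ! i) \<and> h $ i = real_of_int (fst (ps ! i)) / real_of_int (snd (ps ! i))) \<and>
      (\<forall>y\<in>P. h \<bullet> y < h \<bullet> point d z))"
proof -
  have "separation_oracle d P (env_oracle e Separation)" using valid by (simp add: valid_env_def)
  then have "(env_oracle e Separation (enc (query z)) = IntV 1 \<and> point d z \<in> P) \<or>
      (\<exists>h \<in> carrier_vec d. encodes_vec (env_oracle e Separation (enc (query z))) h \<and> (\<forall>y \<in> P. h \<bullet> y < h \<bullet> point d z))"
    using encodes_vec_query[OF assms] point_carrier unfolding separation_oracle_def by blast
  then show ?thesis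
  proof
    assume "\<exists>h \<in> carrier_vec d. encodes_vec (env_oracle e Separation (enc (query z))) h \<and> (\<forall>y \<in> P. h \<bullet> y < h \<bullet> point d z)"
    then obtain h where h: "h \<in> carrier_vec d" "encodes_vec (env_oracle e Separation (enc (query z))) h" "\<forall>y \<in> P. h \<bullet> y < h \<bullet> point d z"
      by blast
    from encodes_vec_dest[OF h(2)] obtain ps :: "(int \<times> int) list" where
      "env_oracle e Separation (enc (query z)) = enc ps" "length ps = dim_vec h"
      "\<forall>i<dim_vec h. 0 < snd (ps ! i) \<and> h $ i = real_of_int (fst (ps ! i)) / real_of_int (snd (ps ! i))" by blast
    then show ?thesis using h(1,3) by (intro disjI2 exI[of _ ps] exI[of _ h]) simp
  qed simp
qed

lemma mem_env: "length z = Suc d \<Longrightarrow> 0 < z ! 0 \<Longrightarrow> member e z \<longleftrightarrow> z \<in> KK"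
proof -
  assume z: "length z = Suc d" "0 < z ! 0"
  show ?thesis using oracle_answer[OF z]
  proof (elim disjE conjE exE)
    assume "env_oracle e Separation (enc (query z)) = IntV 1" "point d z \<in> P"
    then show ?thesis using K_point[OF z] by (simp add: member_def)
  next
    fix ps :: "(int \<times> int) list" and h
    assume "env_oracle e Separation (enc (query z)) = enc ps" "\<forall>y\<in>P. h \<bullet> y < h \<bullet> point d z"
    then show ?thesis using K_point[OF z] by (auto simp: member_def enc_list_def)
  qed
qed

lemma sep_env:
  assumes z: "length z = Suc d" "0 < z ! 0" "z \<notin> KK"
  shows "length (separator e z) = Suc d \<and> dot (separator e z) z \<le> 0 \<and> (\<forall>y\<in>KK. 0 < dot (separator e z) y)"
proof -
  obtain ps h where ps: "env_oracle e Separation (enc (query z)) = enc (ps :: (int \<times> int) list)" "length ps = d" "h \<in> carrier_vec d"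
      "\<And>i. i < d \<Longrightarrow> 0 < snd (ps ! i) \<and> h $ i = real_of_int (fst (ps ! i)) / real_of_int (snd (ps ! i))"
      "\<And>y. y \<in> P \<Longrightarrow> h \<bullet> y < h \<bullet> point d z"
    using oracle_answer[OF z(1,2)] K_point[OF z(1,2)] z(3) by blast
  obtain Q where Q: "0 < Q" "\<And>i. i < d \<Longrightarrow> real_of_int (clear_denominators ps ! i) = Q * h $ i"
    using clear_denominators[of ps] ps(2,4) by auto
  define g where "g = clear_denominators ps"
  have g: "length g = d" using ps(2) by (simp add: g_def clear_denominators_def)
  have sep: "separator e z = dot g (tl z) # map (\<lambda>c. - (z ! 0) * c) g"
    using z by (simp add: separator_def functional_def ps(1) pairs_of_enc g_def nth_default_nth)
  have gdot: "real_of_int (dot g (tl y)) = Q * real_of_int (y ! 0) * (h \<bullet> point d y)" if y: "length y = Suc d" "0 < y ! 0" for y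
  proof -
    have "real_of_int (dot g (tl y)) = (\<Sum>i<d. (Q * h $ i) * real_of_int (y ! Suc i))"
      using y g Q(2) by (simp add: dot_sum nth_tl g_def)
    also have "\<dots> = (\<Sum>i<d. (Q * real_of_int (y ! 0)) * (h $ i * point d y $ i))"
      using y by (intro sum.cong) (auto simp: point_def)
    also have "\<dots> = Q * real_of_int (y ! 0) * (\<Sum>i<d. h $ i * point d y $ i)" by (simp only: sum_distrib_left)
    also have "(\<Sum>i<d. h $ i * point d y $ i) = h \<bullet> point d y"
      by (simp add: scalar_prod_def lessThan_atLeast0 point_def)
    finally show ?thesis .
  qed
  have dot_map: "dot (map (\<lambda>c. k * c) g) u = k * dot g u" if "length u = d" for k u
    using that g by (simp add: dot_sum sum_distrib_left mult.assoc)
  have sdot: "dot (separator e z) y = y ! 0 * dot g (tl z) - z ! 0 * dot g (tl y)" if y: "length y = Suc d" for y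
  proof -
    obtain y0 yt where "y = y0 # yt" using y by (cases y) auto
    then show ?thesis using y dot_map[of yt "- (z ! 0)"] by (simp add: sep)
  qed
  show ?thesis
  proof (intro conjI ballI)
    show "length (separator e z) = Suc d" using g by (simp add: sep)
    show "dot (separator e z) z \<le> 0" using sdot[OF z(1)] by simp
    fix y assume yK: "y \<in> KK"
    then have y: "length y = Suc d" "0 < y ! 0" by (auto simp: in_K)
    have "h \<bullet> point d y < h \<bullet> point d z" using ps(5) K_point[OF y] yK by simp
    then have "0 < Q * real_of_int (y ! 0) * real_of_int (z ! 0) * (h \<bullet> point d z - h \<bullet> point d y)"
      using Q(1) y(2) z(2) by simp
    also have "\<dots> = real_of_int (dot (separator e z) y)"
      unfolding sdot[OF y(1)] by (simp add: gdot[OF y] gdot[OF z(1,2)] algebra_simps)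
    finally show "0 < dot (separator e z) y" by simp
  qed
qed

text \<open>On a line through a vertex, the functional maximized only there would have to decrease
  strictly in both directions.\<close>

lemma no_line_env:
  assumes u: "length u = Suc d" "u ! 0 = 0" "\<And>r. r \<in> rows e \<Longrightarrow> dot r u = 0" and i: "i < Suc d"
  shows "u ! i = 0"
proof (rule ccontr)
  assume "u ! i \<noteq> 0"
  with u(2) obtain j where j: "i = Suc j" by (cases i) auto
  obtain x c where x: "x \<in> P" "c \<in> carrier_vec d" "\<And>y. y \<in> P \<Longrightarrow> y \<noteq> x \<Longrightarrow> c \<bullet> y < c \<bullet> x"
    using valid unfolding valid_env_def pointed_def vertex_def by blast
  define w where "w = vec d (\<lambda>j. real_of_int (u ! Suc j))"
  have w: "w \<in> carrier_vec d" by (simp add: w_def)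
  have xc: "x \<in> carrier_vec d" using x(1) by (simp add: in_P)
  have shift: "x + s \<cdot>\<^sub>v w \<in> P" for s
  proof -
    have "(\<Sum>k<d. real_of_int (r ! Suc k) * (x + s \<cdot>\<^sub>v w) $ k) = (\<Sum>k<d. real_of_int (r ! Suc k) * x $ k)" if r: "r \<in> rows e" for r
    proof -
      have "real_of_int (dot r u) = (\<Sum>k<d. real_of_int (r ! Suc k) * w $ k)"
        using u(1,2) row_length[OF r] by (simp add: dot_sum sum.lessThan_Suc_shift w_def del: sum.lessThan_Suc)
      then have 0: "(\<Sum>k<d. real_of_int (r ! Suc k) * w $ k) = 0" using u(3)[OF r] by simp
      have "(\<Sum>k<d. real_of_int (r ! Suc k) * (x + s \<cdot>\<^sub>v w) $ k) =
          (\<Sum>k<d. real_of_int (r ! Suc k) * x $ k) + s * (\<Sum>k<d. real_of_int (r ! Suc k) * w $ k)"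
        unfolding sum_distrib_left sum.distrib[symmetric] using xc w by (intro sum.cong) (auto simp: algebra_simps)
      then show ?thesis by (simp add: 0)
    qed
    then show ?thesis using x(1) xc w by (simp add: in_P)
  qed
  have ne: "x + s \<cdot>\<^sub>v w \<noteq> x" if "s \<noteq> 0" for s
  proof
    assume "x + s \<cdot>\<^sub>v w = x"
    then have "(x + s \<cdot>\<^sub>v w) $ j = x $ j" by simp
    then show False using j i xc w \<open>u ! i \<noteq> 0\<close> \<open>s \<noteq> 0\<close> by (simp add: w_def)
  qed
  have "c \<bullet> (x + s \<cdot>\<^sub>v w) = c \<bullet> x + s * (c \<bullet> w)" for s
    using x(2) xc w by (simp add: scalar_prod_add_distrib[of _ d])
  then have "s * (c \<bullet> w) < 0" if "s \<noteq> 0" for s using x(3)[OF shift ne[OF that]] by simp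
  from this[of 1] this[of "- 1"] show False by simp
qed

text \<open>The height becomes the dilation factor, which links points of the cone to
  decomposability and to queries of the decomposition oracle.\<close>

lemma lattice_dilate:
  assumes z: "z \<in> KK"
  shows "vec_of_list (tl z) \<in> lattice_points d (dilate (nat (z ! 0)) P)"
proof -
  have z': "length z = Suc d" "0 < z ! 0" using z by (auto simp: in_K)
  have "point d z \<in> P" using z K_point[OF z'] by simp
  moreover have "real_vec (vec_of_list (tl z)) = real (nat (z ! 0)) \<cdot>\<^sub>v point d z"
  proof (rule eq_vecI)
    have n: "real (nat (z ! 0)) = real_of_int (z ! 0)" using z'(2) by simp
    fix j assume "j < dim_vec (real (nat (z ! 0)) \<cdot>\<^sub>v point d z)"
    then have j: "j < d" by (simp add: point_def)
    have "vec_of_list (tl z) $ j = z ! Suc j" using j z'(1) by (simp add: vec_of_list_index nth_tl)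
    then show "real_vec (vec_of_list (tl z)) $ j = (real (nat (z ! 0)) \<cdot>\<^sub>v point d z) $ j"
      unfolding n using j z' by (simp add: point_def)
  qed (use z'(1) in \<open>simp add: point_def\<close>)
  ultimately have "real_vec (vec_of_list (tl z)) \<in> dilate (nat (z ! 0)) P" unfolding dilate_def by auto
  moreover have "vec_of_list (tl z) \<in> carrier_vec d" by (rule carrier_vecI) (simp add: z'(1))
  ultimately show ?thesis by (simp add: lattice_points_def)
qed

lemma lattice_point_K: "v \<in> lattice_points d P \<longleftrightarrow> v \<in> carrier_vec d \<and> 1 # list_of_vec v \<in> KK"
proof (cases "v \<in> carrier_vec d")
  case True
  then have l: "length (1 # list_of_vec v) = Suc d" "0 < (1 # list_of_vec v) ! 0" by auto
  have "point d (1 # list_of_vec v) = real_vec v"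
    using True by (intro eq_vecI) (auto simp: point_def list_of_vec_index)
  then show ?thesis using K_point[OF l] True by (simp add: lattice_points_def)
qed (simp add: lattice_points_def)

lemma dot_sum_list:
  assumes "set xs \<subseteq> carrier_vec d" "length r = Suc d" "length z = Suc d" "z ! 0 = int (length xs)" "vec_of_list (tl z) = vsum d xs"
  shows "dot r z = sum_list (map (\<lambda>v. dot r (1 # list_of_vec v)) xs)"
proof -
  have tl: "z ! Suc j = sum_list (map (\<lambda>v. v $ j) xs)" if "j < d" for j
    using arg_cong[OF assms(5), of "\<lambda>v. v $ j"] vsum_index[OF assms(1) that] that assms(3)
    by (simp add: vec_of_list_index nth_tl)
  have "dot r (1 # list_of_vec v) = r ! 0 + (\<Sum>j<d. r ! Suc j * v $ j)" if "v \<in> set xs" for v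
    using that assms(1,2) by (subst dot_sum) (auto simp: sum.lessThan_Suc_shift list_of_vec_index simp del: sum.lessThan_Suc)
  then have "sum_list (map (\<lambda>v. dot r (1 # list_of_vec v)) xs) = sum_list (map (\<lambda>v. r ! 0 + (\<Sum>j<d. r ! Suc j * v $ j)) xs)"
    by (intro arg_cong[of _ _ sum_list] map_cong) auto
  also have "\<dots> = r ! 0 * int (length xs) + (\<Sum>j<d. r ! Suc j * sum_list (map (\<lambda>v. v $ j) xs))"
    by (induction xs) (simp_all add: sum.distrib algebra_simps)
  also have "\<dots> = dot r z"
    using assms(2,3,4) tl by (simp add: dot_sum sum.lessThan_Suc_shift del: sum.lessThan_Suc)
  finally show ?thesis by simp
qed

lemma integral_env:
  assumes z: "z \<in> KK"
  shows "\<exists>xs. length xs = nat (z ! 0) \<and> (\<forall>x\<in>set xs. x \<in> KK \<and> x ! 0 = 1) \<and>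
      (\<forall>r. length r = Suc d \<longrightarrow> dot r z = sum_list (map (dot r) xs))"
proof -
  have z': "length z = Suc d" "0 < z ! 0" using z by (auto simp: in_K)
  have "1 \<le> nat (z ! 0)" using z'(2) by simp
  then obtain xs where xs: "length xs = nat (z ! 0)" "set xs \<subseteq> lattice_points d P" "vec_of_list (tl z) = vsum d xs"
    using valid lattice_dilate[OF z] unfolding valid_env_def decomposable_def by blast
  have c: "set xs \<subseteq> carrier_vec d" using xs(2) by (auto simp: lattice_points_def)
  show ?thesis
  proof (intro exI[of _ "map (\<lambda>v. 1 # list_of_vec v) xs"] conjI allI impI)
    show "length (map (\<lambda>v. 1 # list_of_vec v) xs) = nat (z ! 0)" using xs(1) by simp
    show "\<forall>x\<in>set (map (\<lambda>v. 1 # list_of_vec v) xs). x \<in> KK \<and> x ! 0 = 1"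
      using xs(2) lattice_point_K by auto
    fix r :: "int list" assume "length r = Suc d"
    then show "dot r z = sum_list (map (dot r) (map (\<lambda>v. 1 # list_of_vec v) xs))"
      using dot_sum_list[OF c _ z'(1) _ xs(3)] xs(1) z'(2) by (simp add: comp_def)
  qed
qed

lemma cone_oracle_env: "cone_oracle (Suc d) (int (env_complexity e)) (rows e) (member e) (separator e)"
  unfolding cone_oracle_def cone_oracle_axioms_def
  using cone_env mem_env sep_env no_line_env integral_env by blast

end

section \<open>The main program\<close>

text \<open>The answer bound is fixed before the polynomial is chosen, so it may be composed with
  other polynomial bounds.\<close>

lemma pbd_answer:
  assumes "pbd D g"
  shows "pbd D (\<lambda>e x. poly (answer_bound e) (g e x))"
  unfolding pbd_def
proof
  fix q
  obtain p where p: "\<And>e x. answer_bound e = q \<Longrightarrow> D e x \<Longrightarrow> g e x \<le> poly p (isz e x)"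
    using assms unfolding pbd_def by blast
  show "\<exists>p. \<forall>e x. answer_bound e = q \<longrightarrow> D e x \<longrightarrow> poly (answer_bound e) (g e x) \<le> poly p (isz e x)"
    using p by (intro exI[of _ "pcompose q p"]) (auto simp: poly_pcompose intro!: poly_nat_mono)
qed

lemma FP_query:
  assumes "FP D z"
  shows "FP D (\<lambda>e x. query (z e x))"
  unfolding query_def
  by (intro fp assms FP_at_fst[OF assms]) simp

abbreviation valid_query :: "env \<Rightarrow> int list \<Rightarrow> bool" where
  "valid_query e z \<equiv> valid_env e \<and> length z = Suc (env_dim e) \<and> 0 < z ! 0"

lemma FP_separation: "FP valid_query (\<lambda>e z. env_oracle e Separation (enc (query z)))"
proof (rule FP_Ask[OF FP_query[OF FP_id]])
  show "pbd valid_query (\<lambda>e z. poly (answer_bound e) (esz (query z) + env_size e))"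
    by (intro pbd_answer pbd_add pbd_FP FP_query FP_id pbd_env_size)
  fix e z assume "valid_query e z"
  then have "vsize (env_oracle e Separation (enc (query z))) \<le>
      poly (answer_bound e) (esz (query z) + env_dim e + floorlog 2 (env_complexity e))"
    using encodes_vec_query[of z "env_dim e"] point_carrier[of "env_dim e" z]
    unfolding valid_env_def bounded_answers_def by blast
  then show "vsize (env_oracle e Separation (enc (query z))) \<le> poly (answer_bound e) (esz (query z) + env_size e)"
    by (simp add: env_size_def add.assoc)
qed

lemma FP_member: "FP valid_query member"
  unfolding member_def by (intro FP_Is_int FP_separation)

lemma FP_clear_denominators:
  assumes "FP D f"
  shows "FP D (\<lambda>e x. clear_denominators (f e x))"
  unfolding clear_denominators_def by (intro fp assms FP_at_fst[OF assms]) simp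

lemma FP_functional:
  assumes "FP D h" "FP D z"
  shows "FP D (\<lambda>e x. functional (h e x) (z e x))"
  unfolding functional_def
  by (intro fp assms FP_at_fst[OF assms(2)]) simp

text \<open>For a separating answer, reading it as a list of pairs leaves its code unchanged, so
  only clearing denominators and homogenizing has to be computed.\<close>

lemma FP_separator: "FP (\<lambda>e z. valid_query e z \<and> \<not> member e z) separator"
proof -
  let ?D = "\<lambda>e z. valid_query e z \<and> \<not> member e z"
  have "FP ?D (\<lambda>e z. pairs_of (env_oracle e Separation (enc (query z))))"
  proof (rule FP_cong_enc[OF FP_separation])
    fix e z assume z: "?D e z"
    then show "valid_query e z" by simp
    have "env_oracle e Separation (enc (query z)) \<noteq> IntV 1" using z by (auto simp: member_def)
    then obtain ps where "env_oracle e Separation (enc (query z)) = enc (ps :: (int \<times> int) list)"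
      using valid_env.oracle_answer[of e z] z by blast
    then show "enc (pairs_of (env_oracle e Separation (enc (query z)))) = enc (env_oracle e Separation (enc (query z)))"
      by (simp add: pairs_of_enc enc_val_def)
  qed
  then show ?thesis unfolding separator_def by (intro FP_functional FP_clear_denominators FP_id)
qed

lemma oracle_family: "oracle_family valid_env (\<lambda>e. Suc (env_dim e)) (\<lambda>e. int (env_complexity e)) rows member separator"
  by (intro oracle_family.intro valid_env.cone_oracle_env FP_member FP_weaken[OF FP_separator]) auto

text \<open>The dimension is given in binary; the length of the vector \<open>a\<close> provides it
  in unary, and the homogenizing coordinate adds 1.\<close>

definition index_list :: "int list \<Rightarrow> nat list" where
  "index_list a = fold (\<lambda>_ I. next_list I) a [0]"

lemma next_list_upt: "next_list [0..<k] = [0..<Suc k]"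
  by (simp add: next_list_def map_Suc_upt upt_conv_Cons del: upt_Suc)

lemma index_list_partial: "fold (\<lambda>_ I. next_list I) a [0..<k] = [0..<length a + k]"
  by (induction a arbitrary: k) (simp_all add: next_list_upt del: upt_Suc)

lemma index_list: "index_list a = [0..<Suc (length a)]"
  using index_list_partial[of a 1] by (simp add: index_list_def del: upt_Suc) simp

lemma FP_index_list:
  assumes "FP D a"
  shows "FP D (\<lambda>e x. index_list (a e x))"
  unfolding index_list_def
proof (rule FP_fold[where D' = "\<lambda>_ _. True"
      and I = "\<lambda>e x k I. I = [0..<Suc k]" and B = "\<lambda>e x. 1 + (1 + esz (a e x)) * (2 + esz (a e x))"])
  show "pbd D (\<lambda>e x. 1 + (1 + esz (a e x)) * (2 + esz (a e x)))"
    by (intro pbd_add pbd_mult pbd_const pbd_FP assms)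
  show "[0] = [0..<Suc 0]" by simp
  fix e x k I assume k: "k \<le> length (a e x)" and I: "I = [0..<Suc k]"
  have l: "length (a e x) \<le> esz (a e x)" by (rule length_le_esz)
  have "esz i \<le> 2 + k" if "i \<in> set I" for i using that esz_nat_less[of i "Suc k"] by (auto simp: I)
  then have "esz I \<le> 1 + length I * (2 + k)" by (rule esz_list_le)
  also have "\<dots> \<le> 1 + (1 + esz (a e x)) * (2 + esz (a e x))"
    using k l by (intro add_left_mono mult_mono) (auto simp: I)
  finally show "esz I \<le> 1 + (1 + esz (a e x)) * (2 + esz (a e x))" .
qed (auto intro!: assms fp simp: next_list_upt simp del: upt_Suc)

text \<open>Selects as many indices as the number \<open>c\<close> says. The supply suffices because
  the remainder of the peeling has height at most the length of \<open>next_list I\<close>.\<close>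

definition unary :: "nat list \<Rightarrow> int \<Rightarrow> int list" where
  "unary I c = map (\<lambda>_. 1) (filter (\<lambda>i. int i < c) (next_list I))"

definition last_query :: "nat list \<Rightarrow> peel_state \<Rightarrow> int list \<times> int list" where
  "last_query I s = (let r = fst (snd (snd (snd s))) in (unary I (nth_default 0 r 0), tl r))"

text \<open>The zero vector is treated apart: its empty decomposition always exists, whether or not
  some \<open>k # a\<close> lies in the cone. Otherwise the peeled vertices and the oracle's
  decomposition of the remainder, with coefficients 1, are joined.\<close>

definition solve :: "env \<Rightarrow> int \<Rightarrow> int list \<Rightarrow> val" where
  "solve e m a =
    (if asum a = 0 then ListV [] else
      if find_multiple (member e) (separator e) m a = 0 then IntV 0 else
      let s = peel_all (member e) (separator e) (index_list a) m (find_multiple (member e) (separator e) m a # a) in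
      enc (map enc (snd (snd (snd (snd s)))) @
        map (\<lambda>v. enc (1 :: int, v)) (list_of (env_oracle e Decomposition (enc (last_query (index_list a) s))))))"

lemma unary: "0 \<le> c \<Longrightarrow> c \<le> int (Suc k) \<Longrightarrow> unary [0..<k] c = replicate (nat c) 1"
proof -
  assume c: "0 \<le> c" "c \<le> int (Suc k)"
  have "[0..<Suc k] = [0..<nat c] @ [nat c..<Suc k]"
    using upt_add_eq_append[of 0 "nat c" "Suc k - nat c"] c by simp
  moreover have "filter (\<lambda>i. int i < c) [0..<nat c] = [0..<nat c]" by (intro filter_True) auto
  moreover have "filter (\<lambda>i. int i < c) [nat c..<Suc k] = []" by (auto simp: filter_empty_conv simp del: upt_Suc)
  ultimately have "filter (\<lambda>i. int i < c) [0..<Suc k] = [0..<nat c]" by (metis append_Nil2 filter_append)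
  then show ?thesis unfolding unary_def next_list_upt by (simp add: map_replicate_const)
qed

lemma last_query:
  assumes "length r = Suc k" "0 \<le> r ! 0" "r ! 0 \<le> int (Suc (Suc k))"
  shows "enc (last_query [0..<Suc k] (b, M, z, r, ps)) = decomposition_query (nat (r ! 0)) (vec_of_list (tl r))"
proof -
  have "nth_default 0 r 0 = r ! 0" using assms by (simp add: nth_default_nth)
  then show ?thesis
    using assms unary[of "r ! 0" "Suc k"]
    by (simp add: last_query_def enc_defs decomposition_query_def int_vec_val_def list_vec del: upt_Suc)
qed

context
  fixes e :: env and a :: "int list"
  assumes valid: "valid_env e" and a: "length a = env_dim e"
    and k: "find_multiple (member e) (separator e) (int (env_complexity e)) a \<noteq> 0"
begin

abbreviation "result \<equiv> peel_all (member e) (separator e) (index_list a) (int (env_complexity e))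
  (find_multiple (member e) (separator e) (int (env_complexity e)) a # a)"

lemma multiple_in_K: "find_multiple (member e) (separator e) (int (env_complexity e)) a # a \<in> cone.K (Suc (env_dim e)) (rows e)"
  using cone_oracle.find_multiple(1)[OF valid_env.cone_oracle_env[OF valid]] a k by simp

lemma last_answer:
  assumes s: "result = (b, M, z, r, ps)"
  shows "enc (last_query (index_list a) result) = decomposition_query (nat (r ! 0)) (vec_of_list (tl r))"
    "1 \<le> nat (r ! 0)" "vec_of_list (tl r) \<in> lattice_points (env_dim e) (dilate (nat (r ! 0)) (env_polyhedron e))"
    "\<exists>xs. env_oracle e Decomposition (enc (last_query (index_list a) result)) = ListV (map int_vec_val xs) \<and>
      length xs = nat (r ! 0) \<and> set xs \<subseteq> lattice_points (env_dim e) (env_polyhedron e) \<and> vec_of_list (tl r) = vsum (env_dim e) xs"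
proof -
  note I = index_list[of a, unfolded a]
  note p = cone_oracle.peel_all[OF valid_env.cone_oracle_env[OF valid] multiple_in_K s[unfolded I]]
  have r: "length r = Suc (env_dim e)" "0 < r ! 0" using p(1) valid_env.in_K[OF valid] by auto
  then show q: "enc (last_query (index_list a) result) = decomposition_query (nat (r ! 0)) (vec_of_list (tl r))"
    using p(2) unfolding s unfolding I by (intro last_query) auto
  show n: "1 \<le> nat (r ! 0)" using r(2) by simp
  show l: "vec_of_list (tl r) \<in> lattice_points (env_dim e) (dilate (nat (r ! 0)) (env_polyhedron e))"
    by (rule valid_env.lattice_dilate[OF valid p(1)])
  show "\<exists>xs. env_oracle e Decomposition (enc (last_query (index_list a) result)) = ListV (map int_vec_val xs) \<and>
      length xs = nat (r ! 0) \<and> set xs \<subseteq> lattice_points (env_dim e) (env_polyhedron e) \<and> vec_of_list (tl r) = vsum (env_dim e) xs"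
    using valid n l unfolding q valid_env_def decomposition_oracle_def by blast
qed

end

lemma FP_solve:
  "FP (\<lambda>e x. valid_env e \<and> fst x = int (env_complexity e) \<and> length (snd x) = env_dim e) (\<lambda>e x. solve e (fst x) (snd x))"
proof -
  let ?D = "\<lambda>e x. valid_env e \<and> fst x = int (env_complexity e) \<and> length (snd x) = env_dim e"
  let ?k = "\<lambda>e x. find_multiple (member e) (separator e) (fst x) (snd x)"
  let ?s = "\<lambda>e x. peel_all (member e) (separator e) (index_list (snd x)) (fst x) (?k e x # snd x)"
  let ?D2 = "\<lambda>e x. ?D e x \<and> ?k e x \<noteq> 0"
  let ?q = "\<lambda>e x. last_query (index_list (snd x)) (?s e x)"
  have I: "FP D (\<lambda>e (x :: int \<times> int list). index_list (snd x))" for D by (intro FP_index_list fp)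
  have par: "oracle_family.param valid_env (\<lambda>e. Suc (env_dim e)) (\<lambda>e. int (env_complexity e)) ?D (\<lambda>e x. index_list (snd x)) (\<lambda>e x. fst x)"
    unfolding oracle_family.param_def[OF oracle_family] using I by (auto intro: fp simp: index_list simp del: upt_Suc)
  have k: "FP ?D ?k"
    by (rule oracle_family.FP_find_multiple[OF oracle_family par]) (auto intro: fp)
  have s: "FP ?D2 ?s"
  proof (rule oracle_family.FP_peel_all[OF oracle_family])
    show "oracle_family.param valid_env (\<lambda>e. Suc (env_dim e)) (\<lambda>e. int (env_complexity e)) ?D2 (\<lambda>e x. index_list (snd x)) (\<lambda>e x. fst x)"
      by (rule oracle_family.param_weaken[OF oracle_family par]) simp
    show "FP ?D2 (\<lambda>e x. ?k e x # snd x)"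
      by (intro fp FP_weaken[OF k]) simp
    show "?k e x # snd x \<in> cone.K (Suc (env_dim e)) (rows e)" if "?D2 e x" for e x
      using multiple_in_K[of e "snd x"] that by auto
  qed
  have q: "FP ?D2 ?q"
    unfolding last_query_def unary_def Let_def
    by (intro fp s I FP_filter[where F = "\<lambda>e x i. int i < nth_default 0 (fst (snd (snd (snd (?s e x))))) 0" and D' = "\<lambda>e z. ?D2 e (fst z)"]
        FP_at_fst[OF s] FP_id) auto
  have dec: "FP ?D2 (\<lambda>e x. env_oracle e Decomposition (enc (?q e x)))"
  proof (rule FP_Ask[OF q])
    show "pbd ?D2 (\<lambda>e x. poly (answer_bound e) (esz (?q e x) + env_size e))"
      by (intro pbd_answer pbd_add pbd_FP q pbd_env_size)
    fix e and x :: "int \<times> int list" assume x: "?D2 e x"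
    obtain b M z r ps where s: "?s e x = (b, M, z, r, ps)" using prod_cases5 by blast
    note last_answer(1-3)[of e "snd x" b M z r ps]
    then have "enc (?q e x) = decomposition_query (nat (r ! 0)) (vec_of_list (tl r))" "1 \<le> nat (r ! 0)"
      "vec_of_list (tl r) \<in> lattice_points (env_dim e) (dilate (nat (r ! 0)) (env_polyhedron e))"
      using x s by auto
    then have "vsize (env_oracle e Decomposition (enc (?q e x))) \<le>
        poly (answer_bound e) (esz (?q e x) + env_dim e + floorlog 2 (env_complexity e))"
      using x unfolding valid_env_def bounded_answers_def by metis
    then show "vsize (env_oracle e Decomposition (enc (?q e x))) \<le> poly (answer_bound e) (esz (?q e x) + env_size e)"
      by (simp add: env_size_def add.assoc)
  qed
  have dec': "FP ?D2 (\<lambda>e x. list_of (env_oracle e Decomposition (enc (?q e x))))"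
  proof (rule FP_cong_enc[OF dec])
    fix e and x :: "int \<times> int list" assume x: "?D2 e x"
    obtain b M z r ps where s: "?s e x = (b, M, z, r, ps)" using prod_cases5 by blast
    have "\<exists>xs. env_oracle e Decomposition (enc (?q e x)) = ListV (map int_vec_val xs)"
      using last_answer(4)[of e "snd x" b M z r ps] x s by auto
    then show "enc (list_of (env_oracle e Decomposition (enc (?q e x)))) = enc (env_oracle e Decomposition (enc (?q e x)))"
      by (auto simp: enc_list_def enc_val_def)
  qed auto
  have out: "FP ?D2 (\<lambda>e x. enc (map enc (snd (snd (snd (snd (?s e x))))) @ map (\<lambda>v. enc (1 :: int, v)) (list_of (env_oracle e Decomposition (enc (?q e x))))))"
    by (intro fp s dec')
  let ?D1 = "\<lambda>e x. ?D e x \<and> asum (snd x) \<noteq> 0"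
  show ?thesis unfolding solve_def Let_def
  proof (rule FP_If)
    show "FP ?D (\<lambda>e x. asum (snd x) = 0)" by (intro fp)
    show "FP ?D1 (\<lambda>e x. if ?k e x = 0 then IntV 0 else
        enc (map enc (snd (snd (snd (snd (?s e x))))) @ map (\<lambda>v. enc (1 :: int, v)) (list_of (env_oracle e Decomposition (enc (?q e x))))))"
    proof (rule FP_If)
      show "FP ?D1 (\<lambda>e x. ?k e x = 0)" by (rule FP_weaken[of ?D], intro FP_eq k FP_const) simp
    qed (rule FP_const, rule FP_weaken[OF out], blast)
  qed (rule FP_const)
qed

subsection \<open>Correctness\<close>

lemma combination_index:
  assumes "snd ` set ps \<subseteq> carrier_vec d" "j < d"
  shows "combination d ps $ j = sum_list (map (\<lambda>p. int (fst p) * snd p $ j) ps)"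
proof -
  have "set (map (\<lambda>(l, x). int l \<cdot>\<^sub>v x) ps) \<subseteq> carrier_vec d" using assms(1) by auto
  then have "combination d ps $ j = sum_list (map (\<lambda>p. (case p of (l, x) \<Rightarrow> int l \<cdot>\<^sub>v x) $ j) ps)"
    using assms(2) by (simp add: combination_def vsum_index comp_def)
  also have "\<dots> = sum_list (map (\<lambda>p. int (fst p) * snd p $ j) ps)"
    using assms by (intro arg_cong[of _ _ sum_list] map_cong) auto
  finally show ?thesis .
qed

lemma combination_carrier: "snd ` set ps \<subseteq> carrier_vec d \<Longrightarrow> combination d ps \<in> carrier_vec d"
  unfolding combination_def by (intro vsum_carrier) auto

lemma asum_eq_0: "asum v = 0 \<longleftrightarrow> (\<forall>x\<in>set v. x = 0)"
  unfolding asum_def by (subst sum_list_nonneg_eq_0_iff) auto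

lemma dot_Cons_list_of_vec:
  assumes "length r = Suc d" "v \<in> carrier_vec d"
  shows "dot r (c # list_of_vec v) = r ! 0 * c + (\<Sum>j<d. r ! Suc j * v $ j)"
  using assms by (subst dot_sum) (auto simp: sum.lessThan_Suc_shift list_of_vec_index simp del: sum.lessThan_Suc)

lemma dot_combination:
  assumes "snd ` set ps \<subseteq> carrier_vec d" "length r = Suc d"
  shows "dot r (sum_list (map (\<lambda>p. int (fst p)) ps) # list_of_vec (combination d ps)) =
    sum_list (map (\<lambda>p. int (fst p) * dot r (1 # list_of_vec (snd p))) ps)"
proof -
  have "sum_list (map (\<lambda>p. int (fst p) * dot r (1 # list_of_vec (snd p))) ps) =
      sum_list (map (\<lambda>p. int (fst p) * (r ! 0 + (\<Sum>j<d. r ! Suc j * snd p $ j))) ps)"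
    using assms by (intro arg_cong[of _ _ sum_list] map_cong) (auto simp: dot_Cons_list_of_vec)
  also have "\<dots> = r ! 0 * sum_list (map (\<lambda>p. int (fst p)) ps) + (\<Sum>j<d. r ! Suc j * sum_list (map (\<lambda>p. int (fst p) * snd p $ j) ps))"
    by (induction ps) (simp_all add: sum.distrib sum_distrib_left algebra_simps)
  also have "\<dots> = dot r (sum_list (map (\<lambda>p. int (fst p)) ps) # list_of_vec (combination d ps))"
    using dot_Cons_list_of_vec[OF assms(2) combination_carrier[OF assms(1)]] combination_index[OF assms(1)] by simp
  finally show ?thesis by simp
qed

lemma solve_correct:
  assumes valid: "valid_env e" and a: "a \<in> carrier_vec (env_dim e)"
  shows "solves_monoid_decomposition (env_dim e) (lattice_points (env_dim e) (env_polyhedron e)) a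
    (solve e (int (env_complexity e)) (list_of_vec a))"
proof -
  let ?d = "env_dim e" and ?P = "env_polyhedron e" and ?S = "lattice_points (env_dim e) (env_polyhedron e)"
  let ?a = "list_of_vec a" and ?out = "solve e (int (env_complexity e)) (list_of_vec a)"
  have len: "length ?a = ?d" using a by simp
  have S: "?S \<subseteq> carrier_vec ?d" by (auto simp: lattice_points_def)
  let ?k = "find_multiple (member e) (separator e) (int (env_complexity e)) ?a"
  have yes: ?thesis if "?out = decomposition_val ps" "snd ` set ps \<subseteq> ?S" "a = combination ?d ps" for ps
  proof -
    have "a \<in> mon ?d ?S" using that(2,3) by (auto simp: mon_def)
    then show ?thesis using that by (auto simp: solves_monoid_decomposition_def)
  qed
  show ?thesis
  proof (cases "asum ?a = 0")
    case True
    have "a $ j = 0" if "j < ?d" for j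
      using True that a nth_mem[of j ?a] by (simp add: asum_eq_0 list_of_vec_index)
    then have "a = combination ?d []" using a by (intro eq_vecI) (auto simp: combination_def vsum_def)
    then show ?thesis using True by (intro yes[of "[]"]) (simp_all add: solve_def decomposition_val_def)
  next
    case nz: False
    show ?thesis
    proof (cases "?k = 0")
      case True
      have "a \<notin> mon ?d ?S"
      proof
        assume "a \<in> mon ?d ?S"
        then obtain ps where ps: "a = combination ?d ps" "snd ` set ps \<subseteq> ?S" by (auto simp: mon_def)
        have c: "snd ` set ps \<subseteq> carrier_vec ?d" using ps(2) S by blast
        \<comment> \<open>The sum of the coefficients is the height at which \<open>a\<close> occurs
          in the cone. It is positive because \<open>a\<close> is nonzero, so the search could not
          have failed.\<close>
        let ?N = "sum_list (map (\<lambda>p. int (fst p)) ps)"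
        have "?N \<noteq> 0"
        proof
          assume "?N = 0"
          then have 0: "fst p = 0" if "p \<in> set ps" for p using that by (subst (asm) sum_list_nonneg_eq_0_iff) auto
          have "a $ j = 0" if "j < ?d" for j
          proof -
            have "map (\<lambda>p. int (fst p) * snd p $ j) ps = map (\<lambda>_. 0) ps" using 0 by simp
            then show ?thesis unfolding ps(1) combination_index[OF c that] by (simp only: sum_list_0)
          qed
          then have "asum ?a = 0" using a by (auto simp: asum_eq_0 in_set_conv_nth list_of_vec_index)
          then show False using nz by simp
        qed
        moreover have "0 \<le> ?N" by (intro sum_list_nonneg) auto
        ultimately have N: "0 < ?N" by simp
        have "0 \<le> dot r (?N # ?a)" if r: "r \<in> rows e" for r
        proof -
          have "0 \<le> dot r (1 # list_of_vec (snd p))" if "p \<in> set ps" for p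
            using ps(2) that r valid_env.lattice_point_K[OF valid, of "snd p"] valid_env.in_K[OF valid] by blast
          then have "0 \<le> sum_list (map (\<lambda>p. int (fst p) * dot r (1 # list_of_vec (snd p))) ps)"
            by (intro sum_list_nonneg) auto
          then show ?thesis using dot_combination[OF c valid_env.row_length[OF valid r]] ps(1) by simp
        qed
        then have "?N # ?a \<in> cone.K (Suc ?d) (rows e)" using N len by (simp add: valid_env.in_K[OF valid])
        then show False
          using cone_oracle.find_multiple(2)[OF valid_env.cone_oracle_env[OF valid], of ?a] len True by simp
      qed
      then show ?thesis using True nz by (simp add: solve_def solves_monoid_decomposition_def)
    next
      case False
      let ?s = "peel_all (member e) (separator e) (index_list ?a) (int (env_complexity e)) (?k # ?a)"
      obtain b M z r ps where s: "?s = (b, M, z, r, ps)" using prod_cases5 by blast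
      note I = index_list[of ?a, unfolded len]
      note p = cone_oracle.peel_all[OF valid_env.cone_oracle_env[OF valid] multiple_in_K[OF valid len False] s[unfolded I]]
      obtain xs where xs: "env_oracle e Decomposition (enc (last_query (index_list ?a) ?s)) = ListV (map int_vec_val xs)"
        "set xs \<subseteq> ?S" "vec_of_list (tl r) = vsum ?d xs"
        using last_answer(4)[OF valid len False s] by blast
      define qs where "qs = map (\<lambda>p. (nat (fst p), vec_of_list (snd p))) ps @ map (\<lambda>x. (1, x)) xs"
      have psK: "0 \<le> fst p" "length (snd p) = ?d" "vec_of_list (snd p) \<in> ?S" if "p \<in> set ps" for p
      proof -
        have *: "0 \<le> fst p" "1 # snd p \<in> cone.K (Suc ?d) (rows e)" using p(4)[OF that] by auto
        then show "0 \<le> fst p" "length (snd p) = ?d" by (auto simp: valid_env.in_K[OF valid])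
        then show "vec_of_list (snd p) \<in> ?S"
          using *(2) by (auto simp: valid_env.lattice_point_K[OF valid] list_vec intro: carrier_vecI)
      qed
      show ?thesis
      proof (rule yes[of qs])
        have "map enc ps = map (\<lambda>p. ListV [IntV (int (nat (fst p))), int_vec_val (vec_of_list (snd p))]) ps"
          using psK(1) by (intro map_cong) (auto simp: enc_defs int_vec_val_def list_vec)
        then show "?out = decomposition_val qs"
          using nz False xs(1) unfolding solve_def Let_def s
          by (simp add: decomposition_val_def qs_def enc_list_def enc_prod_def enc_int_def enc_val_def comp_def)
        show qS: "snd ` set qs \<subseteq> ?S" using psK(3) xs(2) by (auto simp: qs_def)
        then have qc: "snd ` set qs \<subseteq> carrier_vec ?d" using S by blast
        have xc: "set xs \<subseteq> carrier_vec ?d" using xs(2) S by blast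
        have rl: "length r = Suc ?d" using p(1) by (simp add: valid_env.in_K[OF valid])
        show "a = combination ?d qs"
        proof (rule eq_vecI)
          show "dim_vec a = dim_vec (combination ?d qs)" using a combination_carrier[OF qc] by simp
          fix j assume "j < dim_vec (combination ?d qs)"
          then have j: "j < ?d" using combination_carrier[OF qc] by simp
          have "combination ?d qs $ j = sum_list (map (\<lambda>p. int (nat (fst p)) * vec_of_list (snd p) $ j) ps) + sum_list (map (\<lambda>x. x $ j) xs)"
            unfolding combination_index[OF qc j] by (simp add: qs_def comp_def)
          also have "sum_list (map (\<lambda>x. x $ j) xs) = r ! Suc j"
            using vsum_index[OF xc j] arg_cong[OF xs(3), of "\<lambda>v. v $ j"] rl j by (simp add: vec_of_list_index nth_tl)
          also have "sum_list (map (\<lambda>p. int (nat (fst p)) * vec_of_list (snd p) $ j) ps) = comb ps (Suc j)"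
            unfolding comb_def using psK(1,2) j by (intro arg_cong[of _ _ sum_list] map_cong) (auto simp: vec_of_list_index)
          also have "comb ps (Suc j) + r ! Suc j = a $ j" using p(3)[of "Suc j"] j a by (simp add: list_of_vec_index)
          finally show "a $ j = combination ?d qs $ j" by simp
        qed
      qed
    qed
  qed
qed

text \<open>Typed as a list of raw values since the three entries are of different kinds; its code
  is then literally the initial content of register 0.\<close>

definition input :: "env \<Rightarrow> val list \<Rightarrow> bool" where
  "input e x \<longleftrightarrow> valid_env e \<and>
    (\<exists>a \<in> carrier_vec (env_dim e). x = [IntV (int (env_dim e)), IntV (int (env_complexity e)), int_vec_val a])"

lemma FP_main: "FP input (\<lambda>e x. solve e (int_of (nth_default (IntV 0) x 1)) (map int_of (list_of (nth_default (IntV 0) x 2))))"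
proof -
  have v: "FP input (\<lambda>e x. nth_default (IntV 0) x i)" for i by (intro fp)
  have 1: "FP input (\<lambda>e x. int_of (nth_default (IntV 0) x 1))"
    by (rule FP_cong_enc[OF v[of 1]]) (auto simp: input_def enc_defs nth_default_def)
  have 2: "FP input (\<lambda>e x. map int_of (list_of (nth_default (IntV 0) x 2)))"
    by (rule FP_cong_enc[OF v[of 2]]) (auto simp: input_def enc_defs nth_default_def int_vec_val_def comp_def)
  have "valid_env e \<and> int_of (nth_default (IntV 0) x 1) = int (env_complexity e) \<and>
      length (map int_of (list_of (nth_default (IntV 0) x 2))) = env_dim e" if "input e x" for e x
    using that by (auto simp: input_def nth_default_def int_vec_val_def)
  with FP_comp2[OF FP_solve 1 2] show ?thesis by simp
qed

theorem theorem2p4: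
  shows "\<exists>prog :: com. \<forall>q :: nat poly. \<exists>p :: nat poly.
    \<forall>(d :: nat) (\<Delta> :: nat) (P :: real vec set) (orc :: oracle_name \<Rightarrow> val \<Rightarrow> val) (a :: int vec).
      rational_polyhedron d P \<longrightarrow> pointed d P \<longrightarrow> decomposable d P \<longrightarrow>
      description_complexity d P \<le> \<Delta> \<longrightarrow>
      separation_oracle d P (orc Separation) \<longrightarrow>
      decomposition_oracle d P (orc Decomposition) \<longrightarrow>
      bounded_answers q d \<Delta> P orc \<longrightarrow>
      a \<in> carrier_vec d \<longrightarrow>
      (\<exists>s t. exec orc prog (initial_state d \<Delta> a) s t \<and>
        t \<le> poly p (d + floorlog 2 \<Delta> + vsize (int_vec_val a)) \<and>
        solves_monoid_decomposition d (lattice_points d P) a (s 0))"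
    (is "\<exists>prog. \<forall>q. \<exists>p. ?P prog q p")
proof -
  obtain c T where T: "pbd input T" and c: "computes c input
      (\<lambda>e x. solve e (int_of (nth_default (IntV 0) x 1)) (map int_of (list_of (nth_default (IntV 0) x 2)))) T"
    using FP_main unfolding FP_def by blast
  show ?thesis
  proof (intro exI[of _ c] allI)
    fix q
    obtain p where p: "\<And>e x. answer_bound e = q \<Longrightarrow> input e x \<Longrightarrow> T e x \<le> poly p (isz e x)"
      using T unfolding pbd_def by blast
    show "\<exists>p. ?P c q p"
    \<comment> \<open>The input length counts the dimension once more in binary, the length of
      \<open>\<Delta>\<close> twice, and three units for the list and the signs;
      \<open>3 + 2 x\<close> covers this.\<close>
    proof (intro exI[of _ "pcompose p [:3, 2:]"] allI impI)
      fix d \<Delta> P and orc :: "oracle_name \<Rightarrow> val \<Rightarrow> val" and a :: "int vec"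
      assume *: "rational_polyhedron d P" "pointed d P" "decomposable d P" "description_complexity d P \<le> \<Delta>"
        "separation_oracle d P (orc Separation)" "decomposition_oracle d P (orc Decomposition)" "bounded_answers q d \<Delta> P orc"
        and a: "a \<in> carrier_vec d"
      define e where "e = Env q d \<Delta> P orc"
      have valid: "valid_env e" using * by (simp add: valid_env_def e_def)
      define x where "x = [IntV (int d), IntV (int \<Delta>), int_vec_val a]"
      have x: "input e x" using valid a by (auto simp: input_def x_def e_def)
      have "initial_state d \<Delta> a 0 = enc x" by (simp add: initial_state_def x_def enc_defs)
      then obtain s where s: "runs orc c (initial_state d \<Delta> a) s (T e x)"
        "s 0 = enc (solve e (int_of (nth_default (IntV 0) x 1)) (map int_of (list_of (nth_default (IntV 0) x 2))))"
        using computesD[OF c x] by (auto simp: e_def)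
      have "s 0 = solve e (int (env_complexity e)) (list_of_vec a)"
        by (simp add: s(2) x_def nth_default_def int_vec_val_def comp_def enc_val_def e_def)
      then have correct: "solves_monoid_decomposition d (lattice_points d P) a (s 0)"
        using solve_correct[OF valid, of a] a by (simp add: e_def)
      obtain t where t: "exec orc c (initial_state d \<Delta> a) s t" "t \<le> T e x"
        using s(1) by (auto simp: runs_def)
      note t(2)
      also have "T e x \<le> poly p (isz e x)" using p[OF _ x] by (simp add: e_def)
      also have "\<dots> \<le> poly p (3 + 2 * (d + floorlog 2 \<Delta> + vsize (int_vec_val a)))"
      proof (rule poly_nat_mono)
        have "floorlog 2 d \<le> d" by (rule floorlog_le) (rule less_exp)
        then show "isz e x \<le> 3 + 2 * (d + floorlog 2 \<Delta> + vsize (int_vec_val a))"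
          by (simp add: isz_def env_size_def e_def x_def enc_defs)
      qed
      also have "\<dots> = poly (pcompose p [:3, 2:]) (d + floorlog 2 \<Delta> + vsize (int_vec_val a))"
        by (simp add: poly_pcompose algebra_simps)
      finally show "\<exists>s t. exec orc c (initial_state d \<Delta> a) s t \<and>
        t \<le> poly (pcompose p [:3, 2:]) (d + floorlog 2 \<Delta> + vsize (int_vec_val a)) \<and>
        solves_monoid_decomposition d (lattice_points d P) a (s 0)"
        using t(1) correct by blast
    qed
  qed
qed

end
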